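(* Let $0<s<t<1$, let $\Omega\subset\mathbb{R}^n$, $n\ge1$, be a bounded Lipschitz domain, $\Omega_e=\mathbb{R}^n\setminus\overline\Omega$, let $b,q\in L^\infty(\Omega)$, and suppose that $\mathscr{L}_{b,q}=(-\Delta)^t+(-\Delta)^{s/2}_\Omega\,b\,(-\Delta)^{s/2}_\Omega+q$ satisfies the eigenvalue condition: the only $\varphi\in H^t(\mathbb{R}^n)$ with $\mathscr{L}_{b,q}\varphi=0$ in $\Omega$ and $\varphi=0$ in $\Omega_e$ is $\varphi=0$. Let $\mathcal{O}\Subset\Omega$ be a non-empty open set with Lipschitz boundary, compactly contained in $\Omega$, and let $W$ be a non-empty open bounded subset of $\Omega_e$. For $f\in C_c^\infty(W)$ let $v_f\in H^t(\mathbb{R}^n)$ denote the solution of $\mathscr{L}_{b,q}v_f=0$ in $\Omega$, $v_f=f$ in $\Omega_e$, and set $$X=\{((-\Delta)^{s/2}_\Omega v_f)|_{\mathcal{O}}:\ f\in C_c^\infty(W)\},\qquad Y=\{v_f|_\Omega:\ f\in C_c^\infty(W)\}.$$ Then: (1) for any $F\in L^2(\mathcal{O})$ and any $\epsilon>0$ there exists $u\in X$ such that $\|F-u\|_{L^2(\mathcal{O})}<\epsilon$; (2) the set $Y$ is dense in $L^2(\Omega)$.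
   Context: All functions are real valued. $H^r(\mathbb{R}^n)$ is the $L^2$-based Sobolev space; for an open set $U$ with Lipschitz boundary, $H^r(U)$ is the space of restrictions to $U$ of elements of $H^r(\mathbb{R}^n)$ and $\widetilde H^r(U)$ is the closure of $C_c^\infty(U)$ in $H^r(\mathbb{R}^n)$. $(-\Delta)^t$ is the Fourier multiplier $|\xi|^{2t}$ on $\mathbb{R}^n$. For $0<a<1$, $C_{n,a}>0$ is the constant with $(-\Delta)^a u(x)=C_{n,a}\,\mathrm{p.v.}\int_{\mathbb{R}^n}\frac{u(x)-u(y)}{|x-y|^{n+2a}}dy$ for Schwartz $u$. The regional fractional Laplacian is $(-\Delta)^a_\Omega u(x)=C_{n,a}\,\mathrm{p.v.}\int_\Omega\frac{u(x)-u(y)}{|x-y|^{n+2a}}dy$, extended to $u\in H^a(\Omega)$ weakly by $\langle(-\Delta)^a_\Omega u,v\rangle=\frac{C_{n,a}}{2}\int_\Omega\int_\Omega\frac{(u(x)-u(y))(v(x)-v(y))}{|x-y|^{n+2a}}dy\,dx$; applied to functions on $\mathbb{R}^n$ it acts on their restriction to $\Omega$. For $f\in\widetilde H^t(\Omega_e)$, $u\in H^t(\mathbb{R}^n)$ solves $\mathscr{L}_{b,q}u=0$ in $\Omega$, $u=f$ in $\Omega_e$, if $u=f$ in $\Omega_e$ and for all $\varphi\in C_c^\infty(\Omega)$, $$\int_{\mathbb{R}^n}(-\Delta)^{t/2}u\,(-\Delta)^{t/2}\varphi\,dx+\int_\Omega b\,(-\Delta)^{s/2}_\Omega u\,(-\Delta)^{s/2}_\Omega\varphi\,dx+\int_\Omega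 q\,u\,\varphi\,dx=0.$$ (Here $u|_\Omega=(u-f)|_\Omega$ with $u-f\in\widetilde H^t(\Omega)$, and $(-\Delta)^{s/2}_\Omega u\in L^2(\Omega)$.) Under the eigenvalue condition the solution exists and is unique. *)

theory Defs
  imports "HOL-Analysis.Analysis"
begin

section \<open>Smooth functions and Lipschitz domains\<close>

fun iter_partial :: "'a::euclidean_space list \<Rightarrow> ('a \<Rightarrow> real) \<Rightarrow> 'a \<Rightarrow> real" where
  "iter_partial [] u = u"
| "iter_partial (e # es) u = (\<lambda>x. frechet_derivative (iter_partial es u) (at x) e)"

text \<open>Differentiability of every iterated partial derivative already forces their continuity,
  so this is the usual class of infinitely differentiable functions.\<close>

definition smooth :: "('a::euclidean_space \<Rightarrow> real) \<Rightarrow> bool" where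
  "smooth u \<longleftrightarrow> (\<forall>es \<in> lists Basis. iter_partial es u differentiable_on UNIV)"

definition schwartz :: "('a::euclidean_space \<Rightarrow> real) set" where
  "schwartz = {u. smooth u \<and>
     (\<forall>es \<in> lists Basis. \<forall>k::nat. bounded (range (\<lambda>x. norm x ^ k * iter_partial es u x)))}"

definition test_functions :: "'a::euclidean_space set \<Rightarrow> ('a \<Rightarrow> real) set" where
  "test_functions U = {u. smooth u \<and> compact (closure {x. u x \<noteq> 0}) \<and> closure {x. u x \<noteq> 0} \<subseteq> U}"

text \<open>Near each boundary point, \<open>U\<close> is the region below the graph of a Lipschitz function over
  the hyperplane orthogonal to some unit vector \<open>e\<close>.\<close>

definition lipschitz_boundary :: "'a::euclidean_space set \<Rightarrow> bool" where
  "lipschitz_boundary U \<longleftrightarrow> (\<forall>p \<in> frontier U. \<exists>e r L g. norm e = 1 \<and> 0 < r \<and>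
     L-lipschitz_on {z. z \<bullet> e = 0} g \<and>
     (\<forall>x \<in> ball p r. x \<in> U \<longleftrightarrow> x \<bullet> e < (g (x - (x \<bullet> e) *\<^sub>R e) :: real)))"

definition bounded_lipschitz_domain :: "'a::euclidean_space set \<Rightarrow> bool" where
  "bounded_lipschitz_domain U \<longleftrightarrow>
     open U \<and> connected U \<and> U \<noteq> {} \<and> bounded U \<and> lipschitz_boundary U"

section \<open>Lebesgue spaces\<close>

text \<open>Elements of the Lebesgue and Sobolev spaces are represented by functions on the whole
  space; only the values on \<open>A\<close>, up to null sets, are relevant.\<close>

definition L2 :: "'a::euclidean_space set \<Rightarrow> ('a \<Rightarrow> 'b::{banach, second_countable_topology}) set" where
  "L2 A = {u. set_borel_measurable lebesgue A u \<and>
              set_integrable lebesgue A (\<lambda>x. (norm (u x))\<^sup>2)}"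

definition L2_norm :: "'a::euclidean_space set \<Rightarrow> ('a \<Rightarrow> 'b::{banach, second_countable_topology}) \<Rightarrow> real"
  where "L2_norm A u = sqrt (LINT x:A|lebesgue. (norm (u x))\<^sup>2)"

definition L2_dense :: "'a::euclidean_space set \<Rightarrow> ('a \<Rightarrow> real) set \<Rightarrow> bool" where
  "L2_dense A Y \<longleftrightarrow> Y \<subseteq> L2 A \<and>
     (\<forall>F \<in> L2 A. \<forall>\<epsilon>>0. \<exists>u\<in>Y. L2_norm A (\<lambda>x. F x - u x) < \<epsilon>)"

definition Linfty :: "'a::euclidean_space set \<Rightarrow> ('a \<Rightarrow> real) set" where
  "Linfty A = {u. set_borel_measurable lebesgue A u \<and>
                  (\<exists>M. AE x in lebesgue. x \<in> A \<longrightarrow> \<bar>u x\<bar> \<le> M)}"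

section \<open>Fourier transform, Sobolev spaces and the fractional Laplacian\<close>

text \<open>The Plancherel transform, as a limit in mean of the (absolutely convergent) Fourier
  integrals over growing balls. For \<open>u \<in> L2 UNIV\<close> these truncated transforms are themselves in
  \<open>L2 UNIV\<close>.\<close>

definition truncated_fourier :: "real \<Rightarrow> ('a::euclidean_space \<Rightarrow> complex) \<Rightarrow> 'a \<Rightarrow> complex" where
  "truncated_fourier R u \<xi> = (LINT x:cball 0 R|lebesgue. exp (- \<i> * of_real (x \<bullet> \<xi>)) * u x)"

definition has_fourier :: "('a::euclidean_space \<Rightarrow> complex) \<Rightarrow> ('a \<Rightarrow> complex) \<Rightarrow> bool" where
  "has_fourier u v \<longleftrightarrow> u \<in> L2 UNIV \<and> v \<in> L2 UNIV \<and>
     ((\<lambda>R. L2_norm UNIV (\<lambda>\<xi>. v \<xi> - truncated_fourier R u \<xi>)) \<longlongrightarrow> 0) at_top"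

text \<open>The space \<open>H\<^sup>r\<close> for \<open>r \<ge> 0\<close>, the only range needed here.\<close>

definition sobolev :: "real \<Rightarrow> ('a::euclidean_space \<Rightarrow> real) set" where
  "sobolev r = {u. \<exists>v. has_fourier (\<lambda>x. of_real (u x)) v \<and>
     (\<lambda>\<xi>. of_real ((1 + (norm \<xi>)\<^sup>2) powr (r / 2)) * v \<xi>) \<in> L2 UNIV}"

definition sobolev_on :: "real \<Rightarrow> 'a::euclidean_space set \<Rightarrow> ('a \<Rightarrow> real) set" where
  "sobolev_on r U = {u. \<exists>v \<in> sobolev r. \<forall>x\<in>U. u x = v x}"

text \<open>The Fourier multiplier \<open>\<bar>\<xi>\<bar>\<^sup>2\<^sup>a\<close>; for \<open>u \<in> sobolev (2 * a)\<close> with \<open>a \<ge> 0\<close> the chosen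
  function is determined up to null sets.\<close>

definition frac_laplacian :: "real \<Rightarrow> ('a::euclidean_space \<Rightarrow> real) \<Rightarrow> 'a \<Rightarrow> real" where
  "frac_laplacian a u = (SOME w. \<exists>v. has_fourier (\<lambda>x. of_real (u x)) v \<and>
     has_fourier (\<lambda>x. of_real (w x)) (\<lambda>\<xi>. of_real (norm \<xi> powr (2 * a)) * v \<xi>))"

text \<open>The constant \<open>C\<^sub>n\<^sub>,\<^sub>a\<close>, for \<open>0 < a < 1\<close> and \<open>n = DIM('a)\<close>, which makes the principal value
  formula for the fractional Laplacian hold on Schwartz functions. The formula is required almost
  everywhere because \<open>frac_laplacian\<close> is only determined up to null sets.\<close>

definition frac_const :: "'a::euclidean_space itself \<Rightarrow> real \<Rightarrow> real" where
  "frac_const _ a = (THE C. 0 < C \<and> (\<forall>u \<in> (schwartz :: ('a \<Rightarrow> real) set).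
     AE x in lebesgue.
       ((\<lambda>\<epsilon>. C * (LINT y:- ball x \<epsilon>|lebesgue.
                    (u x - u y) / norm (x - y) powr (real DIM('a) + 2 * a)))
         \<longlongrightarrow> frac_laplacian a u x) (at_right 0)))"

section \<open>The regional fractional Laplacian and the exterior value problem\<close>

definition regional_form ::
    "real \<Rightarrow> 'a::euclidean_space set \<Rightarrow> ('a \<Rightarrow> real) \<Rightarrow> ('a \<Rightarrow> real) \<Rightarrow> real" where
  "regional_form a U u v = frac_const TYPE('a) a / 2 *
     (LINT x:U|lebesgue. (LINT y:U|lebesgue.
        (u x - u y) * (v x - v y) / norm (x - y) powr (real DIM('a) + 2 * a)))"

text \<open>The weak regional fractional Laplacian, where it is represented by an \<open>L2\<close> function, which
  is then determined almost everywhere on \<open>U\<close>.\<close>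

definition regional_frac_laplacian ::
    "real \<Rightarrow> 'a::euclidean_space set \<Rightarrow> ('a \<Rightarrow> real) \<Rightarrow> 'a \<Rightarrow> real" where
  "regional_frac_laplacian a U u = (SOME w. w \<in> L2 U \<and>
     (\<forall>v \<in> sobolev_on a U. (LINT x:U|lebesgue. w x * v x) = regional_form a U u v))"

definition weak_solution :: "real \<Rightarrow> real \<Rightarrow> 'a::euclidean_space set \<Rightarrow> ('a \<Rightarrow> real) \<Rightarrow> ('a \<Rightarrow> real)
    \<Rightarrow> ('a \<Rightarrow> real) \<Rightarrow> ('a \<Rightarrow> real) \<Rightarrow> bool" where
  "weak_solution s t \<Omega> b q f u \<longleftrightarrow>
     u \<in> sobolev t \<and>
     (AE x in lebesgue. x \<in> - closure \<Omega> \<longrightarrow> u x = f x) \<and>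
     (\<forall>\<phi> \<in> test_functions \<Omega>.
        (LINT x|lebesgue. frac_laplacian (t / 2) u x * frac_laplacian (t / 2) \<phi> x)
      + (LINT x:\<Omega>|lebesgue. b x * regional_frac_laplacian (s / 2) \<Omega> u x
                               * regional_frac_laplacian (s / 2) \<Omega> \<phi> x)
      + (LINT x:\<Omega>|lebesgue. q x * u x * \<phi> x) = 0)"

definition eigenvalue_condition ::
    "real \<Rightarrow> real \<Rightarrow> 'a::euclidean_space set \<Rightarrow> ('a \<Rightarrow> real) \<Rightarrow> ('a \<Rightarrow> real) \<Rightarrow> bool" where
  "eigenvalue_condition s t \<Omega> b q \<longleftrightarrow>
     (\<forall>\<phi>. weak_solution s t \<Omega> b q (\<lambda>_. 0) \<phi> \<longrightarrow> (AE x in lebesgue. \<phi> x = 0))"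

end

theory Submission imports Defs "HOL-Probability.Probability" begin

text \<open>Both density claims are Hahn--Banach arguments: a subspace of a Hilbert space approximates a
vector as soon as everything orthogonal to the subspace is orthogonal to the vector. Let \<open>L\<close> be the
bilinear form of the equation. If \<open>l\<close> is a functional that annihilates all solutions (and the
exterior data), solve the adjoint problem \<open>L(\<phi>, \<psi>) = l(\<psi>)\<close> for all \<open>\<psi>\<close> supported in \<open>\<Omega>\<close>; the form
is symmetric, so this is the same equation. Writing a solution as \<open>f + w\<close> with \<open>w\<close> supported in \<open>\<Omega>\<close>
turns \<open>l(f + w) = 0\<close> into \<open>((-\<Delta>)\<^sup>t f, \<phi>) = 0\<close> for every datum \<open>f\<close>, the lower order terms seeing only
\<open>\<Omega>\<close>, where \<open>f\<close> vanishes. Hence \<open>\<phi>\<close> and \<open>(-\<Delta>)\<^sup>t \<phi>\<close> both vanish on \<open>W\<close>, unique continuation gives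
\<open>\<phi> = 0\<close>, and so \<open>l = 0\<close> on functions supported in \<open>\<Omega>\<close> (\<open>functional_vanishes\<close>).

For the density of the solutions themselves this ends the proof, since test functions separate
\<open>L\<^sup>2(\<Omega>)\<close>. For the regional Laplacian of the solutions, orthogonality to \<open>G\<close> supported in \<open>\<O>\<close> now says
that \<open>(-\<Delta>)\<^sup>s\<^sup>/\<^sup>2 G\<close> vanishes on the open set \<open>\<Omega> - closure \<O>\<close>, where \<open>G\<close> itself vanishes, and a second
unique continuation gives \<open>G = 0\<close>.

Unique continuation is elementary here, because both times the function has compact support \<open>K\<close> and
the potential \<open>\<integral>G(y)|x - y|\<^sup>-\<^sup>p dy\<close>, with \<open>p\<close> larger than the dimension, vanishes on an open set away
from \<open>K\<close>: its derivatives give, at one point \<open>x\<close>, that all moments of \<open>G(y)|x - y|\<^sup>-\<^sup>p\<close> in the inverted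
variable \<open>(x - y)/|x - y|\<^sup>2\<close> are zero, and polynomials in that variable are dense in \<open>C(K)\<close> by
Stone--Weierstrass (\<open>riesz_potential_unique_continuation\<close>).

Solvability is Fredholm theory for a symmetric form that is coercive modulo finitely many
functionals (\<open>coercive_modulo_finite_rank_solvable\<close>), the eigenvalue condition being injectivity. The
energy space consists of the pairs (function, difference quotient
\<open>(u(x) - u(y))|x - y|\<^sup>-\<^sup>n\<^sup>/\<^sup>2\<^sup>-\<^sup>t\<close>) in \<open>L\<^sup>2 \<times> L\<^sup>2\<close>. Coercivity comes from a Poincare inequality on a
grid of small cubes (\<open>fractional_poincare_modulo_finite_rank\<close>) and from the fact that the regional
Laplacian has lower order (\<open>Rop_interpolation\<close>). The link with the Fourier side is Plancherel's theorem
applied to difference quotients: the Gagliardo energy of \<open>u\<close> is a constant times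
\<open>\<integral>|\<xi>|\<^sup>2\<^sup>t|F u|\<^sup>2\<close> (\<open>gagliardo_fourier\<close>). The same constant determines the normalisation \<open>C\<^sub>n\<^sub>,\<^sub>a\<close> of the
regional Laplacian, which enters only through \<open>C\<^sub>n\<^sub>,\<^sub>a \<noteq> 0\<close> (\<open>frac_const_eq\<close>).\<close>

notation LIMSEQ (infix "---->" 60)

abbreviation Borel :: "('a::topological_space => 'b::topological_space) set" where
 "Borel \<equiv> borel_measurable borel"

abbreviation lborel_nn_integral :: "('a::euclidean_space => ennreal) => ennreal" (binder "\<integral>+" 10) where
 "lborel_nn_integral f \<equiv> nn_integral lborel f"

lemmas bochner_bound = Bochner_Integration.integrable_bound
 and bochner_cong = Bochner_Integration.integral_cong
 and bochner_add = Bochner_Integration.integral_add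
 and bochner_diff = Bochner_Integration.integral_diff
 and bochner_integrable_diff = Bochner_Integration.integrable_diff

section \<open>Hilbert spaces and symmetric forms coercive modulo finite rank\<close>

class hilbert = real_inner + complete_space

lemma hilbert_projection:
 fixes S :: "'h::hilbert set"
 assumes S: "subspace S" and cl: "closed S"
 obtains p where "p \<in> S" "!!y. y \<in> S ==> (x - p) \<bullet> y = 0"
proof -
 define d where "d = (INF y\<in>S. (norm (x - y))^2)"
 have S0: "0 \<in> S" using S subspace_0 by blast
 have bdd: "bdd_below ((\<lambda>y. (norm (x - y))^2) ` S)" by (rule bdd_belowI[of _ 0]) auto
 have dle: "d <= (norm (x - y))^2" if "y \<in> S" for y
  unfolding d_def by (rule cINF_lower[OF bdd that])
 have ex: "\<exists>y\<in>S. (norm (x - y))^2 < d + e" if "e > 0" for e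
 proof -
  have "(INF y\<in>S. (norm (x - y))^2) < d + e" using that d_def by simp
  then show ?thesis using cINF_less_iff[OF _ bdd, of "d + e"] S0 by auto
 qed
 have "\<forall>n::nat. \<exists>y\<in>S. (norm (x - y))^2 < d + 1 / real (Suc n)"
  using ex by auto
 then obtain Y where Y: "!!n::nat. Y n \<in> S" "!!n. (norm (x - Y n))^2 < d + 1 / real (Suc n)"
  by metis
 have par: "(norm (y - z))^2 <= 2 * (norm (x - y))^2 + 2 * (norm (x - z))^2 - 4 * d"
  if "y \<in> S" "z \<in> S" for y z
 proof -
  have "(1/2) *\<^sub>R (y + z) \<in> S" using S that by (simp add: subspace_add subspace_scale)
  from dle[OF this] have "4 * d <= 4 * (norm (x - (1/2) *\<^sub>R (y + z)))^2" by simp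
  also have "... = 2 * (norm (x - y))^2 + 2 * (norm (x - z))^2 - (norm (y - z))^2"
   by (simp add: power2_norm_eq_inner inner_simps inner_commute algebra_simps)
  finally show ?thesis by simp
 qed
 have "Cauchy Y"
 proof (rule CauchyI)
  fix e :: real assume "e > 0"
  then obtain N :: nat where N: "inverse (real (Suc N)) < e^2 / 4"
   using reals_Archimedean[of "e^2 / 4"] by auto
  show "\<exists>M. \<forall>m\<ge>M. \<forall>n\<ge>M. norm (Y m - Y n) < e"
  proof (intro exI[of _ N] allI impI)
   fix m n assume mn: "m >= N" "n >= N"
   have "1 / real (Suc m) <= 1 / real (Suc N)" "1 / real (Suc n) <= 1 / real (Suc N)"
    using mn by (auto intro!: divide_left_mono)
   then have "(norm (Y m - Y n))^2 < e^2"
    using par[OF Y(1)[of m] Y(1)[of n]] Y(2)[of m] Y(2)[of n] N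
    by (simp add: inverse_eq_divide)
   then show "norm (Y m - Y n) < e"
    using \<open>e > 0\<close> by (simp add: power2_less_imp_less)
  qed
 qed
 then obtain p where p: "Y ----> p" using Cauchy_convergent convergent_def by blast
 have pS: "p \<in> S" using closed_sequentially[OF cl _ p] Y(1) by auto
 have "(\<lambda>n. (norm (x - Y n))^2) ----> (norm (x - p))^2"
  by (intro tendsto_intros p)
 moreover have "(\<lambda>n. d + 1 / real (Suc n)) ----> d + 0"
  by (intro tendsto_intros LIMSEQ_Suc[OF lim_1_over_n])
 ultimately have pd: "(norm (x - p))^2 <= d"
  using LIMSEQ_le[of "\<lambda>n. (norm (x - Y n))^2" _ "\<lambda>n. d + 1 / real (Suc n)" "d + 0"] Y(2)
  by (auto intro: less_imp_le)
 show ?thesis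
 proof (rule that[OF pS])
  fix y assume y: "y \<in> S"
  show "(x - p) \<bullet> y = 0"
  proof (cases "y = 0")
   case False
   define c where "c = ((x - p) \<bullet> y) / (y \<bullet> y)"
   have yy: "y \<bullet> y > 0" using False by simp
   have expand: "(norm (a - c *\<^sub>R y))^2 = (norm a)^2 - 2 * c * (a \<bullet> y) + c^2 * (y \<bullet> y)" for a
    unfolding power2_norm_eq_inner
    by (simp add: inner_diff_left inner_diff_right inner_commute algebra_simps power2_eq_square)
   have "p + c *\<^sub>R y \<in> S" using S pS y by (simp add: subspace_add subspace_scale)
   from dle[OF this] pd have "(norm (x - p))^2 <= (norm ((x - p) - c *\<^sub>R y))^2"
    unfolding diff_diff_eq by (rule order_trans[rotated])
   also have "... = (norm (x - p))^2 - 2 * c * ((x - p) \<bullet> y) + c^2 * (y \<bullet> y)"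
    by (rule expand)
   also have "... = (norm (x - p))^2 - ((x - p) \<bullet> y)^2 / (y \<bullet> y)"
    using yy by (simp add: c_def power2_eq_square field_simps)
   finally have "((x - p) \<bullet> y)^2 / (y \<bullet> y) <= 0" by simp
   then have "((x - p) \<bullet> y)^2 <= 0" using yy by (simp add: divide_le_0_iff)
   then show ?thesis by simp
  qed simp
 qed
qed

lemma closure_subspace:
 fixes S :: "'a::real_normed_vector set"
 assumes S: "subspace S"
 shows "subspace (closure S)"
 unfolding subspace_def
proof (intro conjI ballI allI)
 show "0 \<in> closure S" using S closure_subset subspace_0 by blast
next
 fix x y assume "x \<in> closure S" "y \<in> closure S"
 then obtain X Y where X: "!!n::nat. X n \<in> S" "X ----> x" and Y: "!!n::nat. Y n \<in> S" "Y ----> y"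
  unfolding closure_sequential by blast
 have "!!n. X n + Y n \<in> S" "(\<lambda>n. X n + Y n) ----> x + y"
  using X Y S by (auto intro: tendsto_add simp: subspace_add)
 then show "x + y \<in> closure S" unfolding closure_sequential by (intro exI[of _ "\<lambda>n. X n + Y n"]) auto
next
 fix c :: real and x assume "x \<in> closure S"
 then obtain X where X: "!!n::nat. X n \<in> S" "X ----> x" unfolding closure_sequential by blast
 have "!!n. c *\<^sub>R X n \<in> S" "(\<lambda>n. c *\<^sub>R X n) ----> c *\<^sub>R x"
  using X S by (auto intro: tendsto_scaleR simp: subspace_scale)
 then show "c *\<^sub>R x \<in> closure S" unfolding closure_sequential by (intro exI[of _ "\<lambda>n. c *\<^sub>R X n"]) auto
qed

lemma hilbert_dense_if_orthogonal_trivial: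
 fixes S :: "'h::hilbert set"
 assumes S: "subspace S" and orth: "!!z. (!!y. y \<in> S ==> z \<bullet> y = 0) ==> z \<bullet> x = 0"
 shows "x \<in> closure S"
proof -
 obtain p where p: "p \<in> closure S" "!!y. y \<in> closure S ==> (x - p) \<bullet> y = 0"
  using hilbert_projection[OF closure_subspace[OF S] closed_closure, of x] by blast
 have "(x - p) \<bullet> x = 0" using orth p(2) closure_subset by blast
 then have "(x - p) \<bullet> (x - p) = 0" using p by (simp add: inner_diff_right)
 then show ?thesis using p(1) by simp
qed

lemma hilbert_riesz:
 fixes S :: "'h::hilbert set" and l :: "'h => real"
 assumes S: "subspace S" "closed S" and l: "bounded_linear l"
 obtains u where "u \<in> S" "!!y. y \<in> S ==> u \<bullet> y = l y"
proof (cases "\<forall>y\<in>S. l y = 0")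
 case True
 then show ?thesis using that[of 0] S subspace_0 by auto
next
 case False
 interpret l: bounded_linear l by fact
 obtain x where x: "x \<in> S" "l x ~= 0" using False by auto
 define K where "K = S \<inter> {y. l y = 0}"
 have K: "subspace K" using S by (auto simp: K_def subspace_def l.add l.scaleR l.zero)
 have "closed {y. l y = 0}"
  by (intro closed_Collect_eq continuous_intros l.continuous_on)
 then have "closed K" using S by (auto simp: K_def)
 then obtain p where p: "p \<in> K" "!!y. y \<in> K ==> (x - p) \<bullet> y = 0"
  using hilbert_projection[OF K] by metis
 define z where "z = x - p"
 have zS: "z \<in> S" using p(1) x(1) S by (auto simp: z_def K_def subspace_diff)
 have lz: "l z = l x" using p(1) by (simp add: z_def l.diff K_def)
 then have z0: "z ~= 0" using x(2) l.zero by auto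
 show ?thesis
 proof (rule that[of "(l z / (z \<bullet> z)) *\<^sub>R z"])
  show "(l z / (z \<bullet> z)) *\<^sub>R z \<in> S" using zS S by (simp add: subspace_scale)
  fix y assume y: "y \<in> S"
  have "y - (l y / l z) *\<^sub>R z \<in> K"
   using y zS S lz x by (auto simp: K_def subspace_diff subspace_scale l.diff l.scaleR)
  then have "z \<bullet> (y - (l y / l z) *\<^sub>R z) = 0" using p(2) z_def by blast
  then have "z \<bullet> y = (l y / l z) * (z \<bullet> z)" by (simp add: inner_diff_right)
  then show "(l z / (z \<bullet> z)) *\<^sub>R z \<bullet> y = l y"
   using z0 lz x(2) by (simp add: field_simps)
 qed
qed

text \<open>Bolzano--Weierstrass for finitely many bounded sequences at once, by induction on the index set.\<close>

lemma finite_family_convergent_subsequence: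
 fixes x :: "nat => 'i => real"
 assumes "finite J" "!!j. j \<in> J ==> bounded (range (\<lambda>k. x k j))"
 obtains r :: "nat => nat" where "strict_mono r" "!!j. j \<in> J ==> convergent (\<lambda>k. x (r k) j)"
 using assms
proof (induction J arbitrary: thesis rule: finite_induct)
 case empty
 then show ?case using strict_mono_id by blast
next
 case (insert j J)
 then obtain r where r: "strict_mono r" "!!i. i \<in> J ==> convergent (\<lambda>k. x (r k) i)"
  by (metis insertCI)
 have "bounded (range (\<lambda>k. x (r k) j))"
  using insert.prems(2)[of j] by (rule bounded_subset) auto
 from bounded_imp_convergent_subsequence[OF this] obtain l s where
  s: "strict_mono (s :: nat => nat)" "((\<lambda>k. x (r k) j) \<circ> s) ----> l" by auto
 show ?case
 proof (rule insert.prems(1)[of "r \<circ> s"])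
  show "strict_mono (r \<circ> s)" using r s by (simp add: strict_mono_o)
  fix i assume "i \<in> insert j J"
  then show "convergent (\<lambda>k. x ((r \<circ> s) k) i)"
  proof
   assume "i = j" then show ?thesis using s(2) by (auto simp: convergent_def o_def)
  next
   assume "i \<in> J"
   from r(2)[OF this] obtain l where "(\<lambda>k. x (r k) i) ----> l" by (auto simp: convergent_def)
   from LIMSEQ_subseq_LIMSEQ[OF this s(1)] show ?thesis by (auto simp: convergent_def o_def)
  qed
 qed
qed

text \<open>Fredholm alternative. Let \<open>A\<close> represent \<open>B\<close> on \<open>S\<close>. A unit sequence with \<open>A u \<longlonglongrightarrow> 0\<close> would, after
passing to a subsequence along which the finitely many functionals converge, be Cauchy by coercivity, and
its limit would contradict injectivity. So \<open>A\<close> is bounded below, its range is closed, and by symmetry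
and injectivity the range is all of \<open>S\<close>.\<close>

lemma coercive_modulo_finite_rank_solvable:
 fixes S :: "'h::hilbert set" and B :: "'h => 'h => real" and ev :: "'i => 'h => real"
 assumes S: "subspace S" "closed S"
  and B: "bounded_bilinear B" and sym: "!!u v. B u v = B v u"
  and J: "finite J" "!!j. j \<in> J ==> bounded_linear (ev j)"
  and c: "c > 0" and coercive: "!!u. u \<in> S ==> c * (norm u)^2 <= B u u + K * (\<Sum>j\<in>J. (ev j u)^2)"
  and inj: "!!u. u \<in> S ==> (!!v. v \<in> S ==> B u v = 0) ==> u = 0"
  and l: "bounded_linear l"
 obtains u where "u \<in> S" "!!v. v \<in> S ==> B u v = l v"
proof -
 interpret B: bounded_bilinear B by fact
 have "\<forall>u. \<exists>a. a \<in> S & (\<forall>v\<in>S. a \<bullet> v = B u v)"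
  using hilbert_riesz[OF S B.bounded_linear_right] by metis
 then obtain A where AS: "!!u. A u \<in> S" and A: "!!u v. v \<in> S ==> A u \<bullet> v = B u v" by metis
 have eqI: "a = b" if "a \<in> S" "b \<in> S" "!!v. v \<in> S ==> a \<bullet> v = b \<bullet> v" for a b
 proof -
  have "(a - b) \<bullet> (a - b) = 0"
   using that(3)[of "a - b"] that S by (simp add: subspace_diff inner_diff_left)
  then show ?thesis by simp
 qed
 have Aadd: "A (u + w) = A u + A w" for u w
  by (rule eqI) (auto simp: AS S subspace_add A inner_add_left B.add_left)
 have Asc: "A (r *\<^sub>R u) = r *\<^sub>R A u" for r u
  by (rule eqI) (auto simp: AS S subspace_scale A B.scaleR_left)
 have Adiff: "A (u - w) = A u - A w" for u w
  by (rule eqI) (auto simp: AS S subspace_diff A inner_diff_left B.diff_left)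
 have Bu: "\<bar>B u w\<bar> <= norm (A u) * norm w" if "w \<in> S" for u w
  using A[OF that, of u] Cauchy_Schwarz_ineq2[of "A u" w] by simp
 obtain M where M: "!!u w. norm (B u w) <= norm u * norm w * M" and M0: "M >= 0"
  using B.nonneg_bounded by blast
 have Abd: "norm (A u) <= M * norm u" for u
 proof (cases "A u = 0")
  case False
  have "norm (A u) * norm (A u) = B u (A u)"
   using A[OF AS, of u u] by (simp add: power2_norm_eq_inner[symmetric] power2_eq_square)
  also have "... <= norm u * norm (A u) * M" using M[of u "A u"] by simp
  finally show ?thesis using False by (simp add: mult.commute mult.left_commute)
 qed (use M0 in simp)
 have below: "\<exists>m>0. \<forall>u\<in>S. m * norm u <= norm (A u)"
 proof (rule ccontr)
  assume "\<not> ?thesis"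
  then have "\<forall>k::nat. \<exists>u\<in>S. norm (A u) < inverse (real (Suc k)) * norm u"
   by (metis inverse_positive_iff_positive not_le of_nat_0_less_iff zero_less_Suc)
  then obtain u' where u': "!!k. u' k \<in> S" "!!k. norm (A (u' k)) < inverse (real (Suc k)) * norm (u' k)"
   by metis
  define u where "u k = (1 / norm (u' k)) *\<^sub>R u' k" for k
  have nz: "norm (u' k) > 0" for k
   using u'(2)[of k] by (metis mult_zero_right norm_not_less_zero zero_less_norm_iff norm_zero)
  have uS: "u k \<in> S" for k using u' S by (simp add: u_def subspace_scale)
  have nu: "norm (u k) = 1" for k using nz[of k] by (simp add: u_def)
  have Au: "norm (A (u k)) < inverse (real (Suc k))" for k
   using u'(2)[of k] nz[of k] by (simp add: u_def Asc field_simps)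
  have Au0: "(\<lambda>k. A (u k)) ----> 0"
   by (rule Lim_null_comparison[OF _ LIMSEQ_inverse_real_of_nat])
     (use Au less_imp_le in \<open>auto intro!: always_eventually\<close>)
  have bdd: "bounded (range (\<lambda>k. ev j (u k)))" if "j \<in> J" for j
  proof -
   interpret bounded_linear "ev j" using J that by auto
   obtain C where "!!x. norm (ev j x) <= norm x * C" using bounded by auto
   then show ?thesis using nu by (intro boundedI[of _ C]) (metis (mono_tags) mult_1 rangeE)
  qed
  obtain r where r: "strict_mono r" "!!j. j \<in> J ==> convergent (\<lambda>k. ev j (u (r k)))"
   using finite_family_convergent_subsequence[OF J(1), of "\<lambda>k j. ev j (u k)"] bdd by metis
  define w where "w k = u (r k)" for k
  have wS: "w k \<in> S" and nw: "norm (w k) = 1" for k by (auto simp: w_def uS nu)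
  have Aw0: "(\<lambda>k. A (w k)) ----> 0"
   using LIMSEQ_subseq_LIMSEQ[OF Au0 r(1)] by (simp add: w_def o_def)
  have est: "c * (norm (w k - w n))^2 <= 2 * (norm (A (w k)) + norm (A (w n)))
    + \<bar>K\<bar> * (\<Sum>j\<in>J. (ev j (w k) - ev j (w n))^2)" for k n
  proof -
   have d: "w k - w n \<in> S" using wS S by (simp add: subspace_diff)
   have lin: "ev j (w k - w n) = ev j (w k) - ev j (w n)" if "j \<in> J" for j
    using J(2)[OF that] by (simp add: linear_diff bounded_linear.linear)
   have "B (w k - w n) (w k - w n) <= norm (A (w k) - A (w n)) * norm (w k - w n)"
    using Bu[OF d, of "w k - w n"] by (simp add: Adiff)
   also have "... <= (norm (A (w k)) + norm (A (w n))) * 2"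
    using norm_triangle_ineq4[of "w k" "w n"] nw norm_triangle_ineq4[of "A (w k)" "A (w n)"]
    by (intro mult_mono) auto
   finally have "B (w k - w n) (w k - w n) <= 2 * (norm (A (w k)) + norm (A (w n)))" by simp
   moreover have "K * (\<Sum>j\<in>J. (ev j (w k - w n))^2) <= \<bar>K\<bar> * (\<Sum>j\<in>J. (ev j (w k) - ev j (w n))^2)"
    using lin by (auto intro!: mult_mono sum_nonneg)
   ultimately show ?thesis using coercive[OF d] by linarith
  qed
  have "Cauchy w"
  proof (rule metric_CauchyI)
   fix e :: real assume e: "e > 0"
   define \<delta> where "\<delta> = c * e^2 / 8"
   have \<delta>: "\<delta> > 0" using c e by (simp add: \<delta>_def)
   define \<eta> where "\<eta> = \<delta> / ((\<bar>K\<bar> + 1) * (real (card J) + 1))"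
   have \<eta>: "\<eta> > 0" using \<delta> by (simp add: \<eta>_def)
   have "\<forall>j\<in>J. \<exists>N. \<forall>k\<ge>N. \<forall>n\<ge>N. \<bar>ev j (w k) - ev j (w n)\<bar> < sqrt \<eta>"
   proof
    fix j assume "j \<in> J"
    then have "Cauchy (\<lambda>k. ev j (w k))" using r(2) by (simp add: w_def Cauchy_convergent_iff)
    from CauchyD[OF this, of "sqrt \<eta>"] \<eta> show "\<exists>N. \<forall>k\<ge>N. \<forall>n\<ge>N. \<bar>ev j (w k) - ev j (w n)\<bar> < sqrt \<eta>"
     by auto
   qed
   then obtain N where N: "!!j k n. j \<in> J ==> k >= N j ==> n >= N j ==> \<bar>ev j (w k) - ev j (w n)\<bar> < sqrt \<eta>"
    by metis
   obtain N1 where N1: "!!k. k >= N1 ==> norm (A (w k)) < \<delta>"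
    using LIMSEQ_D[OF Aw0 \<delta>] by auto
   define N2 where "N2 = Max (insert N1 (N ` J))"
   have N2: "N1 <= N2" "!!j. j \<in> J ==> N j <= N2" using J(1) by (auto simp: N2_def)
   show "\<exists>M. \<forall>k\<ge>M. \<forall>n\<ge>M. dist (w k) (w n) < e"
   proof (intro exI[of _ N2] allI impI)
    fix k n assume kn: "k >= N2" "n >= N2"
    have "(\<Sum>j\<in>J. (ev j (w k) - ev j (w n))^2) <= (\<Sum>j\<in>J. \<eta>)"
    proof (rule sum_mono)
     fix j assume j: "j \<in> J"
     have "\<bar>ev j (w k) - ev j (w n)\<bar> <= sqrt \<eta>" using N[OF j, of k n] N2(2)[OF j] kn by simp
     then have "\<bar>ev j (w k) - ev j (w n)\<bar>^2 <= (sqrt \<eta>)^2" by (intro power_mono) auto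
     then show "(ev j (w k) - ev j (w n))^2 <= \<eta>" using \<eta> by simp
    qed
    then have "\<bar>K\<bar> * (\<Sum>j\<in>J. (ev j (w k) - ev j (w n))^2) <= (\<bar>K\<bar> + 1) * ((real (card J) + 1) * \<eta>)"
     using \<eta> by (intro mult_mono) (auto simp: algebra_simps intro!: sum_nonneg)
    also have "... = ((\<bar>K\<bar> + 1) * (real (card J) + 1)) * \<eta>" by simp
    also have "... = \<delta>" unfolding \<eta>_def by (simp add: add_nonneg_eq_0_iff)
    finally have "\<bar>K\<bar> * (\<Sum>j\<in>J. (ev j (w k) - ev j (w n))^2) <= \<delta>" .
    then have "c * (norm (w k - w n))^2 < 8 * \<delta>"
    proof -
     have *: "y < 8 * \<delta>" if "x <= \<delta>" "y <= 2 * (a + b) + x" "a < \<delta>" "b < \<delta>" for x y a b :: real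
      using that \<delta> by argo
     assume "\<bar>K\<bar> * (\<Sum>j\<in>J. (ev j (w k) - ev j (w n))^2) <= \<delta>"
     from *[OF this est N1[OF order_trans[OF N2(1) kn(1)]] N1[OF order_trans[OF N2(1) kn(2)]]]
     show ?thesis .
    qed
    then have "(norm (w k - w n))^2 < e^2" using c by (simp add: \<delta>_def)
    then show "dist (w k) (w n) < e" using e by (simp add: dist_norm power2_less_imp_less)
   qed
  qed
  then obtain w0 where w0: "w ----> w0" using Cauchy_convergent convergent_def by blast
  have w0S: "w0 \<in> S" using closed_sequentially[OF S(2) _ w0] wS by auto
  have "B w0 v = 0" if v: "v \<in> S" for v
  proof -
   have "(\<lambda>k. B (w k) v) ----> B w0 v" by (intro B.tendsto w0 tendsto_const)
   moreover have "(\<lambda>k. A (w k) \<bullet> v) ----> 0 \<bullet> v" by (intro tendsto_intros Aw0)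
   ultimately show ?thesis using A[OF v] LIMSEQ_unique by fastforce
  qed
  then have "w0 = 0" using inj w0S by blast
  moreover have "norm w0 = 1" using tendsto_norm[OF w0] nw by (simp add: LIMSEQ_const_iff)
  ultimately show False by simp
 qed
 then obtain m where m: "m > 0" "!!u. u \<in> S ==> m * norm u <= norm (A u)" by blast
 define T where "T = A ` S"
 have Tsub: "subspace T"
  unfolding subspace_def
 proof (intro conjI ballI allI)
  show "0 \<in> T" using Asc[of 0 0] subspace_0[OF S(1)] unfolding T_def by force
 next
  fix x y assume "x \<in> T" "y \<in> T"
  then show "x + y \<in> T" unfolding T_def using S by (auto simp flip: Aadd simp: subspace_add)
 next
  fix r :: real and x assume "x \<in> T"
  then show "r *\<^sub>R x \<in> T" unfolding T_def using S by (auto simp flip: Asc simp: subspace_scale)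
 qed
 have Tcl: "closed T"
  unfolding closed_sequential_limits
 proof (intro allI impI, elim conjE)
  fix y y0 assume y: "\<forall>n::nat. y n \<in> T" "y ----> y0"
  then have "\<forall>n. \<exists>x. x \<in> S & y n = A x" by (auto simp: T_def)
  then obtain x where x: "!!n. x n \<in> S" "!!n. y n = A (x n)" by metis
  have "Cauchy y" using y(2) LIMSEQ_imp_Cauchy by blast
  have "Cauchy x"
  proof (rule metric_CauchyI)
   fix e :: real assume "e > 0"
   then obtain N where N: "!!k n. k >= N ==> n >= N ==> norm (y k - y n) < m * e"
    using CauchyD[OF \<open>Cauchy y\<close>, of "m * e"] m(1) by auto
   show "\<exists>M. \<forall>k\<ge>M. \<forall>n\<ge>M. dist (x k) (x n) < e"
   proof (intro exI[of _ N] allI impI)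
    fix k n assume "k >= N" "n >= N"
    have "m * norm (x k - x n) <= norm (y k - y n)"
     using m(2)[of "x k - x n"] x S by (simp add: subspace_diff Adiff)
    also have "... < m * e" using N \<open>k >= N\<close> \<open>n >= N\<close> by auto
    finally show "dist (x k) (x n) < e" using m(1) by (simp add: dist_norm)
   qed
  qed
  then obtain x0 where x0: "x ----> x0" using Cauchy_convergent convergent_def by blast
  then have "x0 \<in> S" using closed_sequentially[OF S(2)] x by auto
  have "(\<lambda>n. A (x n)) ----> A x0"
  proof -
   have "bounded_linear A"
    by (rule bounded_linear_intro[of A M]) (auto simp: Aadd Asc Abd mult.commute)
   then show ?thesis using x0 bounded_linear.tendsto by blast
  qed
  moreover have "y = (\<lambda>n. A (x n))" using x(2) by auto
  ultimately have "y0 = A x0" using y(2) LIMSEQ_unique by blast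
  then show "y0 \<in> T" using \<open>x0 \<in> S\<close> by (auto simp: T_def)
 qed
 obtain z where z: "z \<in> S" "!!v. v \<in> S ==> z \<bullet> v = l v" using hilbert_riesz[OF S l] by metis
 obtain p where p: "p \<in> T" "!!y. y \<in> T ==> (z - p) \<bullet> y = 0" using hilbert_projection[OF Tsub Tcl] by metis
 have pS: "p \<in> S" using p(1) AS by (auto simp: T_def)
 have zpS: "z - p \<in> S" using z(1) pS S by (simp add: subspace_diff)
 have "B (z - p) v = 0" if v: "v \<in> S" for v
  using p(2)[of "A v"] v A[OF zpS, of v] sym[of v "z - p"] by (simp add: T_def inner_commute)
 then have "z = p" using inj[OF zpS] by simp
 then obtain u where "u \<in> S" "A u = z" using p(1) by (auto simp: T_def)
 then show ?thesis using that[of u] A[of _ u] z(2) by auto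
qed

section \<open>The Hilbert space of square integrable functions\<close>

lemma mem_L2_UNIV:
 "f \<in> L2 UNIV \<longleftrightarrow> f \<in> borel_measurable lebesgue & integrable lebesgue (\<lambda>x. (norm (f x))^2)"
 by (simp add: L2_def set_borel_measurable_def set_integrable_def)

lemma L2_cong_AE:
 assumes "f \<in> L2 UNIV" "AE x in lebesgue. f x = g x" "g \<in> borel_measurable lebesgue"
 shows "g \<in> L2 UNIV"
proof -
 have "integrable lebesgue (\<lambda>x. (norm (f x))^2) \<longleftrightarrow> integrable lebesgue (\<lambda>x. (norm (g x))^2)"
  using assms by (intro integrable_cong_AE) (auto simp: mem_L2_UNIV)
 then show ?thesis using assms by (simp add: mem_L2_UNIV)
qed

lemma L2_zero [simp]: "(\<lambda>x. 0) \<in> L2 UNIV"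
 by (simp add: mem_L2_UNIV)

lemma norm_add_sq_le: "(norm (a + b :: 'a::real_normed_vector))^2 <= 2 * (norm a)^2 + 2 * (norm b)^2"
proof -
 have "(norm (a + b))^2 <= (norm a + norm b)^2" by (intro power_mono norm_triangle_ineq) auto
 also have "... <= 2 * (norm a)^2 + 2 * (norm b)^2"
  using sum_squares_bound[of "norm a" "norm b"] by (simp add: power2_sum)
 finally show ?thesis .
qed

lemma L2_add [intro]:
 assumes "f \<in> L2 UNIV" "g \<in> L2 UNIV"
 shows "(\<lambda>x. f x + g x) \<in> L2 UNIV"
 unfolding mem_L2_UNIV
proof
 show m: "(\<lambda>x. f x + g x) \<in> borel_measurable lebesgue" using assms by (auto simp: mem_L2_UNIV)
 show "integrable lebesgue (\<lambda>x. (norm (f x + g x))^2)"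
 proof (rule bochner_bound)
  show "integrable lebesgue (\<lambda>x. 2 * (norm (f x))^2 + 2 * (norm (g x))^2)"
   using assms by (auto simp: mem_L2_UNIV)
  show "AE x in lebesgue. norm ((norm (f x + g x))^2) <= norm (2 * (norm (f x))^2 + 2 * (norm (g x))^2)"
   using norm_add_sq_le by (intro AE_I2) auto
 qed (use m in measurable)
qed

lemma L2_scaleR [intro]:
 assumes "f \<in> L2 UNIV" shows "(\<lambda>x. c *\<^sub>R f x) \<in> L2 UNIV"
 using assms by (auto simp: mem_L2_UNIV power_mult_distrib)

lemma L2_uminus [intro]: "f \<in> L2 UNIV ==> (\<lambda>x. - f x) \<in> L2 UNIV"
 by (auto simp: mem_L2_UNIV)

lemma L2_diff [intro]: "f \<in> L2 UNIV ==> g \<in> L2 UNIV ==> (\<lambda>x. f x - g x) \<in> L2 UNIV"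
 using L2_add[of f "\<lambda>x. - g x"] by auto

lemma L2_dominated:
 assumes "f \<in> L2 UNIV" "g \<in> borel_measurable lebesgue" "AE x in lebesgue. norm (g x) <= C * norm (f x)"
 shows "g \<in> L2 UNIV"
 unfolding mem_L2_UNIV
proof
 show "integrable lebesgue (\<lambda>x. (norm (g x))^2)"
 proof (rule bochner_bound)
  show "integrable lebesgue (\<lambda>x. C^2 * (norm (f x))^2)" using assms by (auto simp: mem_L2_UNIV)
  show "AE x in lebesgue. norm ((norm (g x))^2) <= norm (C^2 * (norm (f x))^2)"
   using assms(3)
  proof eventually_elim
   case (elim x)
   have "(norm (g x))^2 <= (C * norm (f x))^2" using elim by (intro power_mono) auto
   then show ?case by (simp add: power_mult_distrib)
  qed
 qed (use assms in measurable)
qed (use assms in auto)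

lemma L2_inner_integrable:
 fixes f g :: "'a::euclidean_space => 'b::euclidean_space"
 assumes "f \<in> L2 UNIV" "g \<in> L2 UNIV"
 shows "integrable lebesgue (\<lambda>x. f x \<bullet> g x)"
proof (rule bochner_bound)
 show "integrable lebesgue (\<lambda>x. (norm (f x))^2 + (norm (g x))^2)"
  using assms by (auto simp: mem_L2_UNIV)
 show "AE x in lebesgue. norm (f x \<bullet> g x) <= norm ((norm (f x))^2 + (norm (g x))^2)"
 proof (rule AE_I2)
  fix x
  have "norm (f x \<bullet> g x) <= norm (f x) * norm (g x)" using Cauchy_Schwarz_ineq2 by simp
  also have "... <= (norm (f x))^2 + (norm (g x))^2"
   using sum_squares_bound[of "norm (f x)" "norm (g x)"] mult_nonneg_nonneg[of "norm (f x)" "norm (g x)"]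
    norm_ge_zero[of "f x"] norm_ge_zero[of "g x"] by linarith
  finally show "norm (f x \<bullet> g x) <= norm ((norm (f x))^2 + (norm (g x))^2)" by simp
 qed
qed (use assms in \<open>auto simp: mem_L2_UNIV\<close>)

text \<open>The quotient by equality almost everywhere turns the set \<open>L2 UNIV\<close> of functions into a type to
which the library of inner product spaces applies.\<close>

definition l2_rel :: "('a::euclidean_space => 'b::euclidean_space) => ('a => 'b) => bool" where
 "l2_rel f g \<longleftrightarrow> f \<in> L2 UNIV & g \<in> L2 UNIV & (AE x in lebesgue. f x = g x)"

quotient_type (overloaded) ('a, 'b) l2 =
 "'a::euclidean_space => 'b::euclidean_space" / partial: l2_rel
proof (rule part_equivpI)
 show "\<exists>f::'a => 'b. l2_rel f f" by (rule exI[of _ "\<lambda>x. 0"]) (simp add: l2_rel_def)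
 show "symp (l2_rel :: ('a => 'b) => _)" by (auto simp: l2_rel_def symp_def elim: AE_mp)
 show "transp (l2_rel :: ('a => 'b) => _)" unfolding l2_rel_def transp_def by (auto elim: AE_mp)
qed

instantiation l2 :: (euclidean_space, euclidean_space) real_vector
begin

lift_definition zero_l2 :: "('a, 'b) l2" is "\<lambda>x. 0" by (simp add: l2_rel_def)

lift_definition plus_l2 :: "('a, 'b) l2 => ('a, 'b) l2 => ('a, 'b) l2" is "\<lambda>f g x. f x + g x"
 by (auto simp: l2_rel_def elim: AE_mp)

lift_definition uminus_l2 :: "('a, 'b) l2 => ('a, 'b) l2" is "\<lambda>f x. - f x"
 by (auto simp: l2_rel_def elim: AE_mp)

lift_definition minus_l2 :: "('a, 'b) l2 => ('a, 'b) l2 => ('a, 'b) l2" is "\<lambda>f g x. f x - g x"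
 by (auto simp: l2_rel_def elim: AE_mp)

lift_definition scaleR_l2 :: "real => ('a, 'b) l2 => ('a, 'b) l2" is "\<lambda>c f x. c *\<^sub>R f x"
 by (auto simp: l2_rel_def elim: AE_mp)

instance
proof
 fix U V W :: "('a, 'b) l2" and r s :: real
 show "U + V + W = U + (V + W)"
  by transfer (auto simp: l2_rel_def add.assoc)
 show "U + V = V + U" by transfer (auto simp: l2_rel_def add.commute)
 show "0 + U = U" by transfer (auto simp: l2_rel_def)
 show "- U + U = 0" by transfer (auto simp: l2_rel_def)
 show "U - V = U + - V" by transfer (auto simp: l2_rel_def)
 show "r *\<^sub>R (U + V) = r *\<^sub>R U + r *\<^sub>R V" by transfer (auto simp: l2_rel_def scaleR_add_right)
 show "(r + s) *\<^sub>R U = r *\<^sub>R U + s *\<^sub>R U" by transfer (auto simp: l2_rel_def scaleR_add_left)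
 show "r *\<^sub>R s *\<^sub>R U = (r * s) *\<^sub>R U" by transfer (auto simp: l2_rel_def)
 show "1 *\<^sub>R U = U" by transfer (auto simp: l2_rel_def)
qed

end

instantiation l2 :: (euclidean_space, euclidean_space) real_inner
begin

lift_definition inner_l2 :: "('a, 'b) l2 => ('a, 'b) l2 => real" is "\<lambda>f g. LINT x|lebesgue. f x \<bullet> g x"
proof -
 fix f f' g g' :: "'a => 'b"
 assume a: "l2_rel f f'" "l2_rel g g'"
 then have "AE x in lebesgue. f x \<bullet> g x = f' x \<bullet> g' x"
  by (auto simp: l2_rel_def elim: AE_mp)
 then show "(LINT x|lebesgue. f x \<bullet> g x) = (LINT x|lebesgue. f' x \<bullet> g' x)"
  using a by (intro integral_cong_AE) (auto simp: l2_rel_def mem_L2_UNIV)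
qed

definition norm_l2 :: "('a, 'b) l2 => real" where "norm_l2 U = sqrt (inner U U)"
definition sgn_l2 :: "('a, 'b) l2 => ('a, 'b) l2" where "sgn_l2 U = U /\<^sub>R norm U"
definition dist_l2 :: "('a, 'b) l2 => ('a, 'b) l2 => real" where "dist_l2 U V = norm (U - V)"
definition uniformity_l2 :: "(('a, 'b) l2 \<times> ('a, 'b) l2) filter" where
 "uniformity_l2 = (INF e\<in>{0 <..}. principal {(x, y). dist x y < e})"
definition open_l2 :: "('a, 'b) l2 set => bool" where
 "open_l2 S \<longleftrightarrow> (\<forall>x\<in>S. \<forall>\<^sub>F (x', y) in uniformity. x' = x --> y \<in> S)"

instance
proof
 fix U V W :: "('a, 'b) l2" and r s :: real
 show "dist U V = norm (U - V)" by (simp add: dist_l2_def)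
 show "sgn U = U /\<^sub>R norm U" by (simp add: sgn_l2_def)
 show "(uniformity :: (('a, 'b) l2 \<times> ('a, 'b) l2) filter) = (INF e\<in>{0 <..}. principal {(x, y). dist x y < e})"
  by (simp add: uniformity_l2_def)
 show "open S \<longleftrightarrow> (\<forall>x\<in>S. \<forall>\<^sub>F (x', y) in uniformity. x' = x --> y \<in> S)" for S :: "('a, 'b) l2 set"
  by (simp add: open_l2_def)
 show "inner U V = inner V U" by transfer (simp add: inner_commute)
 show "inner (U + V) W = inner U W + inner V W"
  by transfer (auto simp: l2_rel_def inner_add_left L2_inner_integrable)
 show "inner (r *\<^sub>R U) V = r * inner U V" by transfer (simp add: l2_rel_def)
 show "0 <= inner U U" by transfer (simp add: l2_rel_def)
 show "inner U U = 0 \<longleftrightarrow> U = 0"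
 proof transfer
  fix f :: "'a => 'b" assume "l2_rel f f"
  then have f: "f \<in> L2 UNIV" by (simp add: l2_rel_def)
  have "(LINT x|lebesgue. f x \<bullet> f x) = 0 \<longleftrightarrow> (AE x in lebesgue. f x \<bullet> f x = 0)"
   by (rule integral_nonneg_eq_0_iff_AE) (use f L2_inner_integrable[OF f f] in auto)
  then show "(LINT x|lebesgue. f x \<bullet> f x) = 0 \<longleftrightarrow> l2_rel f (\<lambda>x. 0)"
   using f by (simp add: l2_rel_def)
 qed
 show "norm U = sqrt (inner U U)" by (simp add: norm_l2_def)
qed

end

definition l2of :: "('a::euclidean_space => 'b::euclidean_space) => ('a, 'b) l2" where
 "l2of f = abs_l2 f"

lemma l2of_eq_iff:
 assumes "f \<in> L2 UNIV" "g \<in> L2 UNIV"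
 shows "l2of f = l2of g \<longleftrightarrow> (AE x in lebesgue. f x = g x)"
 using Quotient3_rel[OF Quotient3_l2, of f g] assms by (auto simp: l2of_def l2_rel_def)

lemma l2of_add: "f \<in> L2 UNIV ==> g \<in> L2 UNIV ==> l2of (\<lambda>x. f x + g x) = l2of f + l2of g"
 unfolding l2of_def by (rule plus_l2.abs_eq[symmetric]) (auto simp: l2_rel_def)

lemma l2of_diff: "f \<in> L2 UNIV ==> g \<in> L2 UNIV ==> l2of (\<lambda>x. f x - g x) = l2of f - l2of g"
 unfolding l2of_def by (rule minus_l2.abs_eq[symmetric]) (auto simp: l2_rel_def)

lemma l2of_scaleR: "f \<in> L2 UNIV ==> l2of (\<lambda>x. c *\<^sub>R f x) = c *\<^sub>R l2of f"
 unfolding l2of_def by (rule scaleR_l2.abs_eq[symmetric]) (auto simp: l2_rel_def)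

lemma l2of_zero: "l2of (\<lambda>x. 0) = 0"
 unfolding l2of_def zero_l2_def ..

lemma inner_l2of: "f \<in> L2 UNIV ==> g \<in> L2 UNIV ==> l2of f \<bullet> l2of g = (LINT x|lebesgue. f x \<bullet> g x)"
 unfolding l2of_def by (rule inner_l2.abs_eq) (auto simp: l2_rel_def)

lemma norm_l2of: "f \<in> L2 UNIV ==> norm (l2of f) = L2_norm UNIV f"
 by (simp add: norm_eq_sqrt_inner inner_l2of L2_norm_def power2_norm_eq_inner set_lebesgue_integral_def)

lemma norm_l2of_sq: "f \<in> L2 UNIV ==> (norm (l2of f))^2 = (LINT x|lebesgue. (norm (f x))^2)"
 by (simp add: power2_norm_eq_inner inner_l2of)

lemma nn_integral_l2of:
 assumes "f \<in> L2 UNIV"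
 shows "(\<integral>\<^sup>+x. ennreal ((norm (f x))^2) \<partial>lebesgue) = ennreal ((norm (l2of f))^2)"
 using assms by (simp add: norm_l2of_sq nn_integral_eq_integral mem_L2_UNIV)

lemma AE_lebesgue_iff_lborel: "(AE x in lebesgue. P x) \<longleftrightarrow> (AE x in lborel. P x)"
 by (rule AE_completion_iff)

text \<open>Borel representatives are measurable for the uncompleted measure \<open>lborel\<close>, for which Tonelli, Fubini
and translation invariance are available.\<close>

lemma lebesgue_measurable_ex_borel:
 fixes f :: "'a::euclidean_space => 'b::euclidean_space"
 assumes "f \<in> borel_measurable lebesgue"
 obtains g where "g \<in> Borel" "AE x in lebesgue. f x = g x"
proof -
 have "\<forall>b. \<exists>g. g \<in> Borel & (AE x in lborel. f x \<bullet> b = g x)"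
 proof
  fix b
  have "(\<lambda>x. f x \<bullet> b) \<in> borel_measurable lebesgue" using assms by measurable
  from completion_ex_borel_measurable_real[OF this]
  show "\<exists>g. g \<in> Borel & (AE x in lborel. f x \<bullet> b = g x)" by auto
 qed
 then obtain g where g: "!!b. g b \<in> Borel" "!!b. AE x in lborel. f x \<bullet> b = g b x" by metis
 show ?thesis
 proof (rule that[of "\<lambda>x. \<Sum>b\<in>Basis. g b x *\<^sub>R b"])
  show "(\<lambda>x. \<Sum>b\<in>Basis. g b x *\<^sub>R b) \<in> Borel" using g(1) by measurable
  have "AE x in lborel. \<forall>b\<in>Basis. f x \<bullet> b = g b x" using g(2) by (intro AE_finite_allI) auto
  then show "AE x in lebesgue. f x = (\<Sum>b\<in>Basis. g b x *\<^sub>R b)"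
   unfolding AE_lebesgue_iff_lborel
  proof eventually_elim
   case (elim x)
   have "(\<Sum>b\<in>Basis. g b x *\<^sub>R b) = (\<Sum>b\<in>Basis. (f x \<bullet> b) *\<^sub>R b)"
    by (rule sum.cong[OF refl]) (simp only: bspec[OF elim])
   also have "... = f x" by (rule euclidean_representation)
   finally show ?case by (rule sym)
  qed
 qed
qed

definition l2fun :: "('a::euclidean_space, 'b::euclidean_space) l2 => 'a => 'b" where
 "l2fun U = (SOME f. f \<in> Borel & f \<in> L2 UNIV & l2of f = U)"

lemma borel_measurable_lebesgueI: "f \<in> Borel ==> f \<in> borel_measurable lebesgue"
 by (rule measurable_completion) simp

lemma l2fun_ex: "\<exists>f. f \<in> Borel & f \<in> L2 UNIV & l2of f = U"
proof -
 obtain f where f: "f \<in> L2 UNIV" "U = l2of f"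
  using Quotient3_rep_reflp[OF Quotient3_l2, of U] Quotient3_abs_rep[OF Quotient3_l2, of U]
  by (metis l2_rel_def l2of_def)
 obtain g where g: "g \<in> Borel" "AE x in lebesgue. f x = g x"
  using lebesgue_measurable_ex_borel f(1) mem_L2_UNIV by metis
 have "g \<in> L2 UNIV" by (rule L2_cong_AE[OF f(1) g(2) borel_measurable_lebesgueI[OF g(1)]])
 moreover have "l2of f = l2of g" using l2of_eq_iff[OF f(1) \<open>g \<in> L2 UNIV\<close>] g(2) by blast
 ultimately show ?thesis using f(2) g(1) by auto
qed

lemma l2fun_measurable [measurable]: "l2fun U \<in> Borel"
 and l2fun_L2 [simp, intro]: "l2fun U \<in> L2 UNIV"
 and l2of_l2fun [simp]: "l2of (l2fun U) = U"
 using someI_ex[OF l2fun_ex[of U]] by (auto simp: l2fun_def)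

lemma l2fun_l2of: "f \<in> L2 UNIV ==> AE x in lebesgue. l2fun (l2of f) x = f x"
 by (rule iffD1[OF l2of_eq_iff]) auto

lemma l2fun_add: "AE x in lebesgue. l2fun (U + V) x = l2fun U x + l2fun V x"
 using l2fun_l2of[of "\<lambda>x. l2fun U x + l2fun V x"] by (simp add: l2of_add L2_add)

lemma l2fun_scaleR: "AE x in lebesgue. l2fun (c *\<^sub>R U) x = c *\<^sub>R l2fun U x"
 using l2fun_l2of[of "\<lambda>x. c *\<^sub>R l2fun U x"] by (simp add: l2of_scaleR L2_scaleR)

lemma inner_l2fun: "U \<bullet> V = (LINT x|lebesgue. l2fun U x \<bullet> l2fun V x)"
 using inner_l2of[of "l2fun U" "l2fun V"] by simp

lemma L2_fatou:
 fixes f :: "nat => 'a::euclidean_space => 'b::euclidean_space"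
 assumes f: "!!k. f k \<in> L2 UNIV" and bd: "!!k. norm (l2of (f k)) <= C"
  and lim: "AE x in lebesgue. (\<lambda>k. f k x) ----> g x" and g: "g \<in> borel_measurable lebesgue"
 shows "g \<in> L2 UNIV" "norm (l2of g) <= C"
proof -
 have C: "C >= 0" using bd[of 0] norm_ge_zero order_trans by blast
 have fm: "!!k. f k \<in> borel_measurable lebesgue" using f by (simp add: mem_L2_UNIV)
 have "(\<integral>\<^sup>+x. ennreal ((norm (g x))^2) \<partial>lebesgue) = (\<integral>\<^sup>+x. liminf (\<lambda>k. ennreal ((norm (f k x))^2)) \<partial>lebesgue)"
 proof (rule nn_integral_cong_AE)
  show "AE x in lebesgue. ennreal ((norm (g x))^2) = liminf (\<lambda>k. ennreal ((norm (f k x))^2))"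
   using lim
  proof eventually_elim
   case (elim x)
   have "(\<lambda>k. ennreal ((norm (f k x))^2)) ----> ennreal ((norm (g x))^2)"
    by (intro tendsto_intros tendsto_ennrealI elim)
   from lim_imp_Liminf[OF _ this] show ?case by simp
  qed
 qed
 also have "... <= liminf (\<lambda>k. \<integral>\<^sup>+x. ennreal ((norm (f k x))^2) \<partial>lebesgue)"
  by (rule nn_integral_liminf) (use fm in measurable)
 also have "... <= liminf (\<lambda>k. ennreal (C^2))"
  using bd f by (intro Liminf_mono always_eventually allI)
   (simp add: nn_integral_l2of ennreal_leI power_mono)
 also have "... = ennreal (C^2)" by (simp add: Liminf_const)
 finally have le: "(\<integral>\<^sup>+x. ennreal ((norm (g x))^2) \<partial>lebesgue) <= ennreal (C^2)" .
 show gL: "g \<in> L2 UNIV"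
  unfolding mem_L2_UNIV using g le
  by (auto intro!: integrableI_nonneg simp: le_less_trans[OF le])
 have "ennreal ((norm (l2of g))^2) <= ennreal (C^2)" using le nn_integral_l2of[OF gL] by simp
 then have "(norm (l2of g))^2 <= C^2" using C by (simp add: ennreal_le_iff)
 then show "norm (l2of g) <= C" by (rule power2_le_imp_le[OF _ C])
qed

text \<open>A fast Cauchy sequence converges almost everywhere: the weights \<open>4 ^ k\<close> are summable against
 the squared increments.\<close>

lemma l2_fast_Cauchy_AE:
 fixes U :: "nat => ('a::euclidean_space, 'b::euclidean_space) l2"
 assumes fast: "!!k. (norm (U (Suc k) - U k))^2 <= (1/8) ^ k"
 shows "AE x in lebesgue. convergent (\<lambda>k. l2fun (U k) x)"
proof -
 define D where "D k x = l2fun (U (Suc k)) x - l2fun (U k) x" for k x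
 have DL: "D k \<in> L2 UNIV" for k unfolding D_def by auto
 have Dm [measurable]: "D k \<in> Borel" for k unfolding D_def by measurable
 have Dn: "(\<integral>+x. ennreal ((norm (D k x))^2)) <= ennreal ((1/8) ^ k)" for k
 proof -
  have "l2of (D k) = U (Suc k) - U k" unfolding D_def by (simp add: l2of_diff)
  then show ?thesis using nn_integral_l2of[OF DL[of k]] fast[of k]
   by (simp add: nn_integral_completion ennreal_leI)
 qed
 have "(\<integral>+x. (\<Sum>k. ennreal (4 ^ k * (norm (D k x))^2)))
   = (\<Sum>k. \<integral>+x. ennreal (4 ^ k * (norm (D k x))^2))"
  by (rule nn_integral_suminf) measurable
 also have "... <= (\<Sum>k. ennreal ((1/2) ^ k))"
 proof (rule suminf_le)
  fix k
  have "(\<integral>+x. ennreal (4 ^ k * (norm (D k x))^2)) = ennreal (4 ^ k) * (\<integral>+x. ennreal ((norm (D k x))^2))"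
   by (simp add: ennreal_mult nn_integral_cmult)
  also have "... <= ennreal (4 ^ k) * ennreal ((1/8) ^ k)" by (intro mult_left_mono Dn) auto
  also have "... = ennreal ((1/2) ^ k)"
   by (simp add: ennreal_mult[symmetric] power_mult_distrib[symmetric])
  finally show "(\<integral>+x. ennreal (4 ^ k * (norm (D k x))^2)) <= ennreal ((1/2) ^ k)" .
 qed auto
 also have "... = ennreal (\<Sum>k. (1/2) ^ k)" by (rule suminf_ennreal2) auto
 finally have "(\<integral>+x. (\<Sum>k. ennreal (4 ^ k * (norm (D k x))^2))) ~= \<infinity>"
  by (metis ennreal_neq_top infinity_ennreal_def neq_top_trans)
 then have "AE x in lborel. (\<Sum>k. ennreal (4 ^ k * (norm (D k x))^2)) ~= \<infinity>"
  by (intro nn_integral_noteq_infinite) auto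
 then show ?thesis unfolding AE_lebesgue_iff_lborel
 proof eventually_elim
  case (elim x)
  then have s: "summable (\<lambda>k. 4 ^ k * (norm (D k x))^2)"
   by (intro summable_suminf_not_top) (auto simp: infinity_ennreal_def)
  define C where "C = (\<Sum>k. 4 ^ k * (norm (D k x))^2)"
  have C0: "C >= 0" unfolding C_def by (intro suminf_nonneg s) auto
  have le: "norm (D k x) <= sqrt C * (1/2) ^ k" for k
  proof -
   have "4 ^ k * (norm (D k x))^2 <= C"
    unfolding C_def using sum_le_suminf[OF s, of "{k}"] by auto
   also have "C = (sqrt C)^2" using C0 by simp
   finally have "4 ^ k * (norm (D k x))^2 <= (sqrt C)^2" .
   moreover have "(2 ^ k * norm (D k x))^2 = (2 ^ k * 2 ^ k) * (norm (D k x))^2"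
    by (simp only: power2_eq_square mult_ac)
   moreover have "(2::real) ^ k * 2 ^ k = 4 ^ k" by (simp flip: power_mult_distrib)
   ultimately have "(2 ^ k * norm (D k x))^2 <= (sqrt C)^2" by simp
   then have "2 ^ k * norm (D k x) <= sqrt C" by (rule power2_le_imp_le) (use C0 in simp)
   then show ?thesis by (simp add: field_simps power_divide)
  qed
  have "summable (\<lambda>k. D k x)"
   by (rule summable_comparison_test'[of "\<lambda>k. sqrt C * (1/2) ^ k" 0]) (use le in \<open>auto intro!: summable_mult\<close>)
  then have "convergent (\<lambda>n. \<Sum>k<n. D k x)" by (simp add: summable_iff_convergent)
  then have "convergent (\<lambda>n. (\<Sum>k<n. D k x) + l2fun (U 0) x)"
   by (intro convergent_add convergent_const)
  moreover have "(\<Sum>k<n. D k x) + l2fun (U 0) x = l2fun (U n) x" for n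
   unfolding D_def using sum_lessThan_telescope[of "\<lambda>k. l2fun (U k) x" n] by simp
  ultimately show ?case by simp
 qed
qed

text \<open>The rate \<open>1/8\<close> of the squared increments beats the weights used in \<open>l2_fast_Cauchy_AE\<close>.\<close>

lemma Cauchy_fast_subsequence:
 fixes X :: "nat => 'a::real_normed_vector"
 assumes "Cauchy X"
 obtains r :: "nat => nat" where "strict_mono r" "!!k. (norm (X (r (Suc k)) - X (r k)))^2 <= (1/8) ^ k"
  "!!k n. n >= r k ==> norm (X n - X (r k)) <= sqrt ((1/8) ^ k)"
proof -
 have "\<forall>k. \<exists>N. \<forall>m\<ge>N. \<forall>n\<ge>N. norm (X m - X n) < sqrt ((1/8) ^ k)"
  using CauchyD[OF assms] by simp
 then obtain N where N: "!!k m n. m >= N k ==> n >= N k ==> norm (X m - X n) < sqrt ((1/8) ^ k)" by metis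
 define r where "r k = (\<Sum>i\<le>k. Suc (N i))" for k
 have r: "strict_mono r" by (rule strict_monoI_Suc) (simp add: r_def)
 have rN: "r k >= N k" for k
 proof -
  have "Suc (N k) <= r k" unfolding r_def by (rule member_le_sum) auto
  then show ?thesis by simp
 qed
 have *: "norm (X n - X (r k)) <= sqrt ((1/8) ^ k)" if "n >= r k" for k n
  using N[of k n "r k"] rN[of k] that by simp
 show ?thesis
 proof (rule that[OF r _ *])
  fix k
  have "norm (X (r (Suc k)) - X (r k)) <= sqrt ((1/8) ^ k)"
   using *[of k "r (Suc k)"] strict_mono_less_eq[OF r] by simp
  then have "(norm (X (r (Suc k)) - X (r k)))^2 <= (sqrt ((1/8) ^ k))^2" by (intro power_mono) auto
  then show "(norm (X (r (Suc k)) - X (r k)))^2 <= (1/8) ^ k" by simp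
 qed
qed

instance l2 :: (euclidean_space, euclidean_space) hilbert
proof
 fix X :: "nat => ('a, 'b) l2" assume X: "Cauchy X"
 obtain r where r: "strict_mono r" "!!k. (norm (X (r (Suc k)) - X (r k)))^2 <= (1/8) ^ k"
  "!!k n. n >= r k ==> norm (X n - X (r k)) <= sqrt ((1/8) ^ k)"
  using Cauchy_fast_subsequence[OF X] by metis
 define g where "g x = lim (\<lambda>k. l2fun (X (r k)) x)" for x
 have gm [measurable]: "g \<in> Borel" unfolding g_def by measurable
 have lim: "AE x in lebesgue. (\<lambda>k. l2fun (X (r k)) x) ----> g x"
  using l2_fast_Cauchy_AE[of "\<lambda>k. X (r k)", OF r(2)]
  by eventually_elim (simp add: g_def convergent_LIMSEQ_iff)
 have est: "(\<lambda>x. g x - l2fun (X (r k)) x) \<in> L2 UNIV &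
   norm (l2of (\<lambda>x. g x - l2fun (X (r k)) x)) <= sqrt ((1/8) ^ k)" for k
 proof -
  let ?f = "\<lambda>j x. l2fun (X (r (j + k))) x - l2fun (X (r k)) x"
  have "l2of (?f j) = X (r (j + k)) - X (r k)" for j by (simp add: l2of_diff)
  then have bd: "norm (l2of (?f j)) <= sqrt ((1/8) ^ k)" for j
   using r(3)[of k "r (j + k)"] strict_mono_less_eq[OF r(1)] by simp
  have l: "AE x in lebesgue. (\<lambda>j. ?f j x) ----> g x - l2fun (X (r k)) x"
   using lim
  proof eventually_elim
   case (elim x)
   show ?case by (intro tendsto_intros LIMSEQ_ignore_initial_segment[OF elim])
  qed
  have m: "(\<lambda>x. g x - l2fun (X (r k)) x) \<in> borel_measurable lebesgue"
   by (rule borel_measurable_lebesgueI) measurable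
  have fL: "?f j \<in> L2 UNIV" for j by auto
  show ?thesis
   by (intro conjI L2_fatou[of ?f, OF fL bd l m])
 qed
 have "(\<lambda>x. (g x - l2fun (X (r 0)) x) + l2fun (X (r 0)) x) \<in> L2 UNIV"
  by (intro L2_add) (use est in auto)
 then have gL: "g \<in> L2 UNIV" by simp
 have ng: "norm (l2of g - X (r k)) <= sqrt ((1/8) ^ k)" for k
  using est[of k] gL by (simp add: l2of_diff)
 have "(\<lambda>k. X (r k)) ----> l2of g"
 proof (rule LIM_zero_cancel, rule Lim_null_comparison)
  show "\<forall>\<^sub>F k in sequentially. norm (X (r k) - l2of g) <= sqrt ((1/8) ^ k)"
   using ng by (subst norm_minus_commute) (rule always_eventually, rule allI)
  have "(\<lambda>k. sqrt ((1/8) ^ k)) ----> sqrt 0"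
   by (intro tendsto_intros LIMSEQ_realpow_zero) auto
  then show "(\<lambda>k. sqrt ((1/8) ^ k)) ----> 0" by simp
 qed
 then have "X ----> l2of g" using Cauchy_converges_subseq[OF X r(1)] unfolding comp_def by blast
 then show "convergent X" by (auto simp: convergent_def)
qed

instance prod :: (hilbert, hilbert) hilbert ..

lemma l2_tendsto_AE_subsequence:
 fixes U :: "nat => ('a::euclidean_space, 'b::euclidean_space) l2"
 assumes "U ----> V"
 obtains r :: "nat => nat" where "strict_mono r" "AE x in lebesgue. (\<lambda>k. l2fun (U (r k)) x) ----> l2fun V x"
proof -
 obtain r where r: "strict_mono r" "!!k. (norm (U (r (Suc k)) - U (r k)))^2 <= (1/8) ^ k"
  using Cauchy_fast_subsequence[OF LIMSEQ_imp_Cauchy[OF assms]] by metis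
 define g where "g x = lim (\<lambda>k. l2fun (U (r k)) x)" for x
 have gm [measurable]: "g \<in> Borel" unfolding g_def by measurable
 have lim: "AE x in lebesgue. (\<lambda>k. l2fun (U (r k)) x) ----> g x"
  using l2_fast_Cauchy_AE[of "\<lambda>k. U (r k)", OF r(2)]
  by eventually_elim (simp add: g_def convergent_LIMSEQ_iff)
 have conv: "(\<lambda>k. U (r k)) ----> V" using LIMSEQ_subseq_LIMSEQ[OF assms r(1)] by (simp add: o_def)
 have "norm (l2of (\<lambda>x. l2fun V x - g x)) <= e & (\<lambda>x. l2fun V x - g x) \<in> L2 UNIV" if e: "e > 0" for e
 proof -
  obtain N where N: "!!k. k >= N ==> norm (U (r k) - V) < e" using LIMSEQ_D[OF conv e] by auto
  let ?f = "\<lambda>j x. l2fun V x - l2fun (U (r (j + N))) x"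
  have bd: "norm (l2of (?f j)) <= e" for j
   using N[of "j + N"] by (simp add: l2of_diff norm_minus_commute)
  have l: "AE x in lebesgue. (\<lambda>j. ?f j x) ----> l2fun V x - g x"
   using lim
  proof eventually_elim
   case (elim x)
   show ?case by (intro tendsto_intros LIMSEQ_ignore_initial_segment[OF elim])
  qed
  have m: "(\<lambda>x. l2fun V x - g x) \<in> borel_measurable lebesgue"
   by (rule borel_measurable_lebesgueI) measurable
  have fL: "?f j \<in> L2 UNIV" for j by auto
  show ?thesis by (intro conjI L2_fatou[of ?f, OF fL bd l m])
 qed
 note * = this
 have L: "(\<lambda>x. l2fun V x - g x) \<in> L2 UNIV" using *[OF zero_less_one] by simp
 have "norm (l2of (\<lambda>x. l2fun V x - g x)) <= 0" by (rule field_le_epsilon) (use * in simp)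
 then have "l2of (\<lambda>x. l2fun V x - g x) = l2of (\<lambda>x. 0)" by (simp add: l2of_zero)
 then have "AE x in lebesgue. l2fun V x - g x = 0" using l2of_eq_iff[OF L L2_zero] by blast
 then have "AE x in lebesgue. (\<lambda>k. l2fun (U (r k)) x) ----> l2fun V x"
  using lim by eventually_elim simp
 then show ?thesis using that r(1) by blast
qed

section \<open>Test functions\<close>

text \<open>The functions \<open>P(1/x) exp(-1/x)\<close>, extended by zero, are closed under differentiation; \<open>flat_deriv\<close> is
the induced operation on \<open>P\<close>, and smoothness of bumps needs no other derivative.\<close>

definition flat :: "real poly => real => real" where
 "flat P x = (if x <= 0 then 0 else poly P (1 / x) * exp (- (1 / x)))"

definition flat_deriv :: "real poly => real poly" where
 "flat_deriv P = [:0, 0, 1:] * (P - pderiv P)"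

lemma poly_times_exp_minus_tendsto_0:
 fixes P :: "real poly"
 shows "((\<lambda>y. poly P y * exp (- y)) \<longlongrightarrow> 0) at_top"
proof -
 have "((\<lambda>y. \<Sum>i\<le>degree P. coeff P i * (y ^ i / exp y)) \<longlongrightarrow> (\<Sum>i\<le>degree P. coeff P i * 0)) at_top"
  by (intro tendsto_intros tendsto_power_div_exp_0)
 moreover have "(\<Sum>i\<le>degree P. coeff P i * (y ^ i / exp y)) = poly P y * exp (- y)" for y
  by (simp add: poly_altdef sum_distrib_right exp_minus divide_inverse mult.assoc)
 ultimately show ?thesis by simp
qed

lemma flat_has_derivative:
 "(flat P has_real_derivative flat (flat_deriv P) x) (at x)"
proof (cases x "0::real" rule: linorder_cases)
 case less
 have "((\<lambda>_. 0) has_real_derivative 0) (at x)" by simp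
 then have "(flat P has_real_derivative 0) (at x)"
  by (rule has_field_derivative_transform_within_open[of _ _ _ "{..<0}"]) (use less in \<open>auto simp: flat_def\<close>)
 then show ?thesis using less by (simp add: flat_def)
next
 case greater
 have "((\<lambda>x. poly P (1 / x) * exp (- (1 / x))) has_real_derivative
   (poly (pderiv P) (1 / x) * (- (1 / x^2))) * exp (- (1 / x)) + poly P (1 / x) * (exp (- (1 / x)) * (1 / x^2))) (at x)"
  using greater by (auto intro!: derivative_eq_intros simp: power2_eq_square)
 then have "(flat P has_real_derivative
   (poly (pderiv P) (1 / x) * (- (1 / x^2))) * exp (- (1 / x)) + poly P (1 / x) * (exp (- (1 / x)) * (1 / x^2))) (at x)"
  by (rule has_field_derivative_transform_within_open[of _ _ _ "{0<..}"]) (use greater in \<open>auto simp: flat_def\<close>)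
 moreover have "(poly (pderiv P) (1 / x) * (- (1 / x^2))) * exp (- (1 / x)) + poly P (1 / x) * (exp (- (1 / x)) * (1 / x^2))
   = flat (flat_deriv P) x"
  using greater by (simp add: flat_def flat_deriv_def power2_eq_square algebra_simps)
 ultimately show ?thesis by simp
next
 case equal
 have "((\<lambda>h. flat P h / h) \<longlongrightarrow> 0) (at_right 0)"
 proof -
  have "((\<lambda>h. poly ([:0, 1:] * P) (inverse h) * exp (- (inverse h))) \<longlongrightarrow> 0) (at_right 0)"
   by (rule filterlim_compose[OF poly_times_exp_minus_tendsto_0 filterlim_inverse_at_top_right])
  moreover have "\<forall>\<^sub>F h in at_right (0::real). poly ([:0, 1:] * P) (inverse h) * exp (- (inverse h)) = flat P h / h"
   unfolding eventually_at_right_field by (rule exI[of _ 1]) (auto simp: flat_def field_simps)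
  ultimately show ?thesis by (rule Lim_transform_eventually)
 qed
 moreover have "((\<lambda>h. flat P h / h) \<longlongrightarrow> 0) (at_left 0)"
 proof -
  have "\<forall>\<^sub>F h in at_left (0::real). 0 = flat P h / h"
   unfolding eventually_at_left_field by (rule exI[of _ "-1"]) (auto simp: flat_def)
  then show ?thesis by (rule Lim_transform_eventually[OF tendsto_const])
 qed
 ultimately have "((\<lambda>h. flat P h / h) \<longlongrightarrow> 0) (at 0)" by (simp add: filterlim_split_at_real)
 then show ?thesis using equal by (simp add: DERIV_def flat_def)
qed

inductive_set bump_algebra :: "('a::euclidean_space => real) set" where
 base: "(\<lambda>x. flat P (x \<bullet> v + c)) \<in> bump_algebra"
| add: "u \<in> bump_algebra ==> w \<in> bump_algebra ==> (\<lambda>x. u x + w x) \<in> bump_algebra"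
| mult: "u \<in> bump_algebra ==> w \<in> bump_algebra ==> (\<lambda>x. u x * w x) \<in> bump_algebra"

text \<open>An algebra of functions closed under all partial derivatives consists of smooth functions, so no
explicit formula for iterated partial derivatives of a bump is required.\<close>

lemma bump_algebra_derivative:
 assumes "u \<in> bump_algebra"
 shows "\<exists>D. (\<forall>x. (u has_derivative D x) (at x)) & (\<forall>e. (\<lambda>x. D x e) \<in> bump_algebra)"
 using assms
proof induction
 case (base P v c)
 let ?D = "\<lambda>x h. (h \<bullet> v) * flat (flat_deriv P) (x \<bullet> v + c)"
 have "((\<lambda>x. flat P (x \<bullet> v + c)) has_derivative ?D x) (at x)" for x
 proof -
  have "(flat P has_derivative (\<lambda>t. t * flat (flat_deriv P) (x \<bullet> v + c))) (at (x \<bullet> v + c))"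
   using flat_has_derivative[of P "x \<bullet> v + c"]
   by (simp add: has_field_derivative_def mult_commute_abs)
  moreover have "((\<lambda>x. x \<bullet> v + c) has_derivative (\<lambda>h. h \<bullet> v)) (at x)"
   by (auto intro!: derivative_eq_intros)
  ultimately show ?thesis
   using has_derivative_compose[of "\<lambda>x. x \<bullet> v + c" "\<lambda>h. h \<bullet> v" x UNIV "flat P"] by simp
 qed
 moreover have "(\<lambda>x. ?D x e) \<in> bump_algebra" for e
 proof -
  have "(\<lambda>x. flat (smult (e \<bullet> v) (flat_deriv P)) (x \<bullet> v + c)) \<in> bump_algebra" by (rule bump_algebra.base)
  moreover have "(\<lambda>x. flat (smult (e \<bullet> v) (flat_deriv P)) (x \<bullet> v + c)) = (\<lambda>x. ?D x e)"
   by (auto simp: flat_def)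
  ultimately show ?thesis by simp
 qed
 ultimately show ?case by (intro exI[of _ ?D]) auto
next
 case (add u w)
 then obtain D E where D: "!!x. (u has_derivative D x) (at x)" "!!e. (\<lambda>x. D x e) \<in> bump_algebra"
  and E: "!!x. (w has_derivative E x) (at x)" "!!e. (\<lambda>x. E x e) \<in> bump_algebra" by blast
 show ?case
  by (rule exI[of _ "\<lambda>x h. D x h + E x h"])
    (auto intro!: has_derivative_add D E bump_algebra.add)
next
 case (mult u w)
 then obtain D E where D: "!!x. (u has_derivative D x) (at x)" "!!e. (\<lambda>x. D x e) \<in> bump_algebra"
  and E: "!!x. (w has_derivative E x) (at x)" "!!e. (\<lambda>x. E x e) \<in> bump_algebra" by blast
 show ?case
  by (rule exI[of _ "\<lambda>x h. u x * E x h + D x h * w x"])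
    (auto intro!: has_derivative_mult D E bump_algebra.add bump_algebra.mult mult)
qed

lemma smooth_bump_algebra:
 assumes "u \<in> bump_algebra" shows "smooth u"
proof -
 have it: "iter_partial es u \<in> bump_algebra" for es
 proof (induction es)
  case (Cons e es)
  obtain D where D: "!!x. (iter_partial es u has_derivative D x) (at x)" "!!e. (\<lambda>x. D x e) \<in> bump_algebra"
   using bump_algebra_derivative[OF Cons] by blast
  have "frechet_derivative (iter_partial es u) (at x) = D x" for x
   using frechet_derivative_at[OF D(1)[of x]] by simp
  then show ?case using D(2)[of e] by simp
 qed (use assms in simp)
 show ?thesis unfolding smooth_def
 proof
  fix es
  obtain D where "!!x. (iter_partial es u has_derivative D x) (at x)"
   using bump_algebra_derivative[OF it] by blast
  then show "iter_partial es u differentiable_on UNIV"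
   by (auto simp: differentiable_on_def differentiable_def)
 qed
qed

definition bump :: "real => 'a => 'a => 'a::euclidean_space => real" where
 "bump k a c x = (\<Prod>b\<in>Basis. flat 1 (k * (x \<bullet> b - a \<bullet> b)) * flat 1 (k * (c \<bullet> b - x \<bullet> b)))"

lemma bump_in_algebra: "bump k a c \<in> (bump_algebra :: ('a::euclidean_space => real) set)"
proof -
 let ?g = "\<lambda>b x. flat 1 (k * (x \<bullet> b - a \<bullet> b)) * flat 1 (k * (c \<bullet> b - x \<bullet> b))"
 have g: "?g b \<in> bump_algebra" for b :: 'a
 proof (rule bump_algebra.mult)
  show "(\<lambda>x. flat 1 (k * (x \<bullet> b - a \<bullet> b))) \<in> bump_algebra"
   using bump_algebra.base[of 1 "k *\<^sub>R b" "- k * (a \<bullet> b)"] by (simp add: algebra_simps)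
  show "(\<lambda>x. flat 1 (k * (c \<bullet> b - x \<bullet> b))) \<in> bump_algebra"
   using bump_algebra.base[of 1 "- k *\<^sub>R b" "k * (c \<bullet> b)"] by (simp add: algebra_simps)
 qed
 have "(\<lambda>x. \<Prod>b\<in>F. ?g b x) \<in> bump_algebra" if "finite F" "F ~= {}" for F :: "'a set"
  using that
 proof (induction F rule: finite_ne_induct)
  case (singleton b) then show ?case using g[of b] by simp
 next
  case (insert b F)
  then show ?case using bump_algebra.mult[OF g[of b] insert.IH] by simp
 qed
 from this[OF finite_Basis] show ?thesis unfolding bump_def[abs_def] by simp
qed

lemma flat_1: "0 <= flat 1 x" "flat 1 x <= 1" "flat 1 x > 0 \<longleftrightarrow> x > 0"
 by (auto simp: flat_def)

lemma bump_nonneg: "0 <= bump k a c x"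
 unfolding bump_def by (intro prod_nonneg) (simp add: flat_1)

lemma bump_le_1: "bump k a c x <= 1"
 unfolding bump_def by (intro prod_le_1) (auto simp: flat_1 mult_le_one)

lemma bump_pos_iff:
 assumes "k > 0" shows "bump k a c x ~= 0 \<longleftrightarrow> x \<in> box a c"
proof -
 have "flat 1 (k * y) ~= 0 \<longleftrightarrow> 0 < y" for y
  using flat_1(1)[of "k * y"] flat_1(3)[of "k * y"] assms zero_less_mult_pos[of k y] mult_pos_pos[of k y]
  by linarith
 then show ?thesis unfolding bump_def by (auto simp: box_def)
qed

text \<open>Increasing \<open>k\<close> steepens the flanks, so the bumps on a fixed box tend to its indicator.\<close>

lemma bump_tendsto_indicator:
 "(\<lambda>n. bump (real (Suc n)) a c x) ----> indicator (box a c) x"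
proof (cases "x \<in> box a c")
 case True
 have l: "(\<lambda>n. flat 1 (real (Suc n) * y)) ----> 1" if "y > 0" for y
 proof -
  have "(\<lambda>n. exp (- ((1 / y) * inverse (real (Suc n))))) ----> exp (- ((1 / y) * 0))"
   by (intro tendsto_intros LIMSEQ_inverse_real_of_nat)
  moreover have "exp (- ((1 / y) * inverse (real (Suc n)))) = flat 1 (real (Suc n) * y)" for n
   using that by (simp add: flat_def mult_le_0_iff inverse_eq_divide del: of_nat_Suc)
  ultimately show ?thesis by simp
 qed
 have "(\<lambda>n. bump (real (Suc n)) a c x) ----> (\<Prod>b\<in>(Basis::'a set). 1 * 1)"
  unfolding bump_def by (intro tendsto_prod tendsto_mult l) (use True in \<open>auto simp: box_def\<close>)
 then show ?thesis using True by simp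
next
 case False
 then have "bump (real (Suc n)) a c x = 0" for n using bump_pos_iff[of "real (Suc n)" a c x] by simp
 then show ?thesis using False by simp
qed

lemma bump_test_function:
 assumes "k > 0" "cbox a c \<subseteq> U"
 shows "bump k a c \<in> test_functions U"
proof -
 have "{x. bump k a c x ~= 0} = box a c" using bump_pos_iff[OF assms(1)] by auto
 moreover have "closure (box a c) \<subseteq> cbox a c" by (simp add: closure_minimal box_subset_cbox closed_cbox)
 moreover have "compact (closure (box a c))" using bounded_box by (simp add: compact_closure)
 ultimately show ?thesis
  using assms(2) smooth_bump_algebra[OF bump_in_algebra] by (auto simp: test_functions_def)
qed

lemma smooth_differentiable: "smooth u ==> u differentiable (at x)"
 unfolding smooth_def differentiable_on_def by (metis UNIV_I iter_partial.simps(1) lists.Nil)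

lemma smooth_continuous: "smooth u ==> continuous_on UNIV u"
 using smooth_differentiable[of u] differentiable_imp_continuous_within
 by (intro continuous_at_imp_continuous_on) blast

lemma smooth_partial_continuous:
 assumes "smooth u" "b \<in> Basis" shows "continuous_on UNIV (iter_partial [b] u)"
proof -
 have "iter_partial [b] u differentiable_on UNIV"
  using assms unfolding smooth_def by (metis lists.simps)
 then show ?thesis by (rule differentiable_imp_continuous_on)
qed

lemma smooth_lipschitz_on_convex:
 fixes u :: "'a::euclidean_space => real"
 assumes u: "smooth u" and S: "convex S" and B: "!!b z. b \<in> Basis ==> z \<in> S ==> \<bar>iter_partial [b] u z\<bar> <= B"
  and xy: "x \<in> S" "y \<in> S"
 shows "\<bar>u x - u y\<bar> <= real DIM('a) * B * norm (x - y)"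
proof -
 let ?D = "\<lambda>z. frechet_derivative u (at z)"
 have D: "(u has_derivative ?D z) (at z)" for z
  using smooth_differentiable[OF u] frechet_derivative_works by blast
 have "onorm (?D z) <= real DIM('a) * B" if z: "z \<in> S" for z
 proof (rule onorm_le)
  fix h :: 'a
  have lin: "linear (?D z)" using D has_derivative_linear by blast
  have "?D z h = ?D z (\<Sum>b\<in>Basis. (h \<bullet> b) *\<^sub>R b)" by (simp add: euclidean_representation)
  also have "... = (\<Sum>b\<in>Basis. (h \<bullet> b) * ?D z b)"
   using lin by (simp add: linear_sum linear_scale)
  finally have "norm (?D z h) <= (\<Sum>b\<in>Basis. \<bar>(h \<bullet> b) * ?D z b\<bar>)"
   by (simp add: sum_abs)
  also have "... <= (\<Sum>b\<in>(Basis::'a set). norm h * B)"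
  proof (rule sum_mono)
   fix b :: 'a assume b: "b \<in> Basis"
   have "\<bar>h \<bullet> b\<bar> <= norm h" using Basis_le_norm[OF b] by simp
   moreover have "\<bar>?D z b\<bar> <= B" using B[OF b z] by simp
   ultimately show "\<bar>(h \<bullet> b) * ?D z b\<bar> <= norm h * B"
    unfolding abs_mult by (intro mult_mono) auto
  qed
  finally show "norm (?D z h) <= real DIM('a) * B * norm h" by (simp add: mult_ac)
 qed
 then show ?thesis
  using differentiable_bound[OF S, of u ?D "real DIM('a) * B" x y] D xy
  by (auto intro: has_derivative_at_withinI)
qed

lemma iter_partial_add:
 assumes "smooth u" "smooth w" "es \<in> lists Basis"
 shows "iter_partial es (\<lambda>x. u x + w x) = (\<lambda>x. iter_partial es u x + iter_partial es w x)"
 using assms(3)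
proof (induction es)
 case (Cons e es)
 have d: "iter_partial es u differentiable (at x)" "iter_partial es w differentiable (at x)" for x
  using assms Cons by (auto simp: smooth_def differentiable_on_def)
 have "frechet_derivative (\<lambda>x. iter_partial es u x + iter_partial es w x) (at x)
   = (\<lambda>h. frechet_derivative (iter_partial es u) (at x) h + frechet_derivative (iter_partial es w) (at x) h)" for x
  using frechet_derivative_at[OF has_derivative_add[OF d[THEN frechet_derivative_works[THEN iffD1]]]] by simp
 then show ?case using Cons by simp
qed simp

lemma iter_partial_scale:
 assumes "smooth u" "es \<in> lists Basis"
 shows "iter_partial es (\<lambda>x. c * u x) = (\<lambda>x. c * iter_partial es u x)"
 using assms(2)
proof (induction es)
 case (Cons e es)
 have d: "iter_partial es u differentiable (at x)" for x
  using assms Cons by (auto simp: smooth_def differentiable_on_def)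
 have "frechet_derivative (\<lambda>x. c * iter_partial es u x) (at x)
   = (\<lambda>h. c * frechet_derivative (iter_partial es u) (at x) h)" for x
  using frechet_derivative_at[OF has_derivative_mult_right[OF d[THEN frechet_derivative_works[THEN iffD1]]]] by simp
 then show ?case using Cons by simp
qed simp

lemma smooth_add: "smooth u ==> smooth w ==> smooth (\<lambda>x. u x + w x)"
 using iter_partial_add[of u w] by (auto simp: smooth_def intro!: differentiable_on_add)

lemma smooth_scale: "smooth u ==> smooth (\<lambda>x. c * u x)"
 using iter_partial_scale[of u] by (auto simp: smooth_def intro!: differentiable_on_mult differentiable_on_const)

lemma test_functions_add:
 assumes "u \<in> test_functions U" "w \<in> test_functions U"
 shows "(\<lambda>x. u x + w x) \<in> test_functions U"
proof -
 let ?S = "closure {x. u x ~= 0} \<union> closure {x. w x ~= 0}"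
 have "{x. u x + w x ~= 0} \<subseteq> ?S"
  using closure_subset[of "{x. u x ~= 0}"] closure_subset[of "{x. w x ~= 0}"] by fastforce
 then have sub: "closure {x. u x + w x ~= 0} \<subseteq> ?S" by (rule closure_minimal) auto
 moreover have "compact ?S" using assms by (auto simp: test_functions_def)
 then have "compact (?S \<inter> closure {x. u x + w x ~= 0})" by (rule compact_Int_closed) simp
 then have "compact (closure {x. u x + w x ~= 0})" using sub by (simp add: Int_absorb1)
 moreover have "closure {x. u x + w x ~= 0} \<subseteq> U" using sub assms by (auto simp: test_functions_def)
 ultimately show ?thesis using assms smooth_add by (auto simp: test_functions_def)
qed

lemma test_functions_scale:
 assumes "u \<in> test_functions U" shows "(\<lambda>x. c * u x) \<in> test_functions U"
proof -
 have sub: "closure {x. c * u x ~= 0} \<subseteq> closure {x. u x ~= 0}" by (intro closure_mono) auto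
 have "compact (closure {x. u x ~= 0} \<inter> closure {x. c * u x ~= 0})"
  using assms by (intro compact_Int_closed) (auto simp: test_functions_def)
 then have "compact (closure {x. c * u x ~= 0})" using sub by (simp add: Int_absorb1)
 then show ?thesis using assms sub smooth_scale by (auto simp: test_functions_def)
qed

lemma test_functions_zero: "(\<lambda>x. 0) \<in> test_functions U"
proof -
 have "iter_partial es (\<lambda>x. 0::real) = (\<lambda>x. 0)" for es :: "'a list" by (induction es) auto
 then show ?thesis by (simp add: test_functions_def smooth_def)
qed

lemma test_function_support:
 assumes "u \<in> test_functions U"
 obtains K where "compact K" "K \<subseteq> U" "!!x. x ~: K ==> u x = 0"
proof (rule that)
 show "compact (closure {x. u x ~= 0})" "closure {x. u x ~= 0} \<subseteq> U" using assms by (auto simp: test_functions_def)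
 show "u x = 0" if "x ~: closure {x. u x ~= 0}" for x using that closure_subset by force
qed

lemma continuous_compact_support_bounded:
 fixes u :: "'a::euclidean_space => 'b::real_normed_vector"
 assumes "continuous_on UNIV u" "compact K" "!!x. x ~: K ==> u x = 0"
 obtains M where "M >= 0" "!!x. norm (u x) <= M"
proof -
 have "compact (u ` K)" using assms by (intro compact_continuous_image continuous_on_subset[OF assms(1)]) auto
 then obtain M where "\<forall>y\<in>u ` K. norm y <= M" using compact_imp_bounded bounded_iff by metis
 then have "norm (u x) <= max 0 M" for x using assms(3)[of x] by (cases "x \<in> K") (auto intro: le_max_iff_disj[THEN iffD2])
 then show ?thesis using that[of "max 0 M"] by auto
qed

lemma continuous_compact_support_L2:
 fixes u :: "'a::euclidean_space => 'b::euclidean_space"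
 assumes "continuous_on UNIV u" "compact K" "!!x. x ~: K ==> u x = 0"
 shows "u \<in> Borel" "u \<in> L2 UNIV" "integrable lborel u"
proof -
 show m: "u \<in> Borel" using assms(1) by (rule borel_measurable_continuous_onI)
 obtain M where M: "M >= 0" "!!x. norm (u x) <= M"
  using continuous_compact_support_bounded[OF assms] by metis
 have ind: "integrable lborel (\<lambda>x. indicator K x * C :: real)" for C
  using emeasure_compact_finite[OF assms(2)] assms(2)
  by (intro integrable_mult_left integrable_real_indicator) (auto simp: borel_compact)
 show "integrable lborel u"
  by (rule bochner_bound[OF ind[of M]])
    (use m M assms(3) in \<open>auto split: split_indicator\<close>)
 have "integrable lborel (\<lambda>x. (norm (u x))^2)"
  by (rule bochner_bound[OF ind[of "M^2"]])
    (use m M assms(3) in \<open>auto split: split_indicator intro!: power_mono\<close>)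
 then show "u \<in> L2 UNIV"
  unfolding mem_L2_UNIV using m borel_measurable_lebesgueI integrable_completion[of "\<lambda>x. (norm (u x))^2" lborel] by auto
qed

lemma test_function_L2:
 assumes "u \<in> test_functions U"
 shows "u \<in> Borel" "u \<in> L2 UNIV" "integrable lborel u" "continuous_on UNIV u"
proof -
 obtain K where K: "compact K" "K \<subseteq> U" "!!x. x ~: K ==> u x = 0" using test_function_support[OF assms] by metis
 show c: "continuous_on UNIV u" using assms smooth_continuous by (auto simp: test_functions_def)
 show "u \<in> Borel" "u \<in> L2 UNIV" "integrable lborel u"
  using continuous_compact_support_L2[OF c K(1,3)] by auto
qed

text \<open>Boxes form an intersection-stable generator of the Borel sets, so the positive and negative parts
define the same measure.\<close>

lemma AE_zero_if_box_integrals_zero: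
 fixes F :: "'a::euclidean_space => real"
 assumes F: "integrable lborel F" and z: "!!a c. (LBINT x. indicator (box a c) x * F x) = 0"
 shows "AE x in lborel. F x = 0"
proof -
 have [measurable]: "F \<in> Borel" using F by (auto dest: borel_measurable_integrable)
 let ?p = "\<lambda>x. max 0 (F x)" and ?n = "\<lambda>x. max 0 (- F x)"
 have ip: "integrable lborel (\<lambda>x. indicator A x * ?p x)" and "in": "integrable lborel (\<lambda>x. indicator A x * ?n x)"
  if "A \<in> sets borel" for A
  using F that by (auto intro!: integrable_real_mult_indicator simp: mult.commute[of "indicator _ _"])
 let ?E = "range (\<lambda>(a, b). box a b::'a set)"
 have em: "emeasure (density lborel (\<lambda>x. ennreal (?p x))) (box a c) = ennreal (LBINT x. indicator (box a c) x * ?p x)"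
    "emeasure (density lborel (\<lambda>x. ennreal (?n x))) (box a c) = ennreal (LBINT x. indicator (box a c) x * ?n x)" for a c
  using ip[of "box a c"] "in"[of "box a c"]
  by (auto simp: emeasure_density nn_integral_eq_integral[symmetric] ennreal_mult' ennreal_indicator mult.commute[of "indicator _ _"]
    intro!: nn_integral_cong split: split_indicator)
 have eq: "(LBINT x. indicator (box a c) x * ?p x) = (LBINT x. indicator (box a c) x * ?n x)" for a c
 proof -
  have "(LBINT x. indicator (box a c) x * ?p x) - (LBINT x. indicator (box a c) x * ?n x)
    = (LBINT x. indicator (box a c) x * ?p x - indicator (box a c) x * ?n x)"
   by (rule bochner_diff[symmetric]) (use ip "in" in auto)
  also have "... = (LBINT x. indicator (box a c) x * F x)"
   by (intro bochner_cong) (auto simp: max_def split: split_indicator)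
  finally show ?thesis using z by simp
 qed
 have "density lborel (\<lambda>x. ennreal (?p x)) = density lborel (\<lambda>x. ennreal (?n x))"
 proof (rule measure_eqI_generator_eq)
  show "Int_stable ?E" by (auto simp: Int_stable_def box_Int_box)
  show "?E \<subseteq> Pow UNIV" "sets (density lborel (\<lambda>x. ennreal (?p x))) = sigma_sets UNIV ?E"
   "sets (density lborel (\<lambda>x. ennreal (?n x))) = sigma_sets UNIV ?E"
   by (simp_all add: borel_eq_box)
  let ?A = "\<lambda>n::nat. box (- (real n *\<^sub>R One)) (real n *\<^sub>R One) :: 'a set"
  show "range ?A \<subseteq> ?E" "(\<Union>i. ?A i) = UNIV" unfolding UN_box_eq_UNIV by auto
  show "emeasure (density lborel (\<lambda>x. ennreal (?p x))) (?A i) ~= \<infinity>" for i unfolding em by simp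
  show "emeasure (density lborel (\<lambda>x. ennreal (?p x))) X = emeasure (density lborel (\<lambda>x. ennreal (?n x))) X" if "X \<in> ?E" for X
   using that em eq by auto
 qed
 then have "AE x in lborel. ennreal (?p x) = ennreal (?n x)"
  by (intro sigma_finite_measure.density_unique[OF sigma_finite_lborel]) auto
 then show ?thesis by eventually_elim (auto simp: max_def split: if_splits)
qed

text \<open>Bumps converge boundedly to indicators of boxes, so the integral over every box inside \<open>\<Omega>\<close> vanishes;
\<open>\<Omega>\<close> is a countable union of such boxes.\<close>

lemma test_functions_separate:
 fixes H :: "'a::euclidean_space => real"
 assumes \<Omega>: "open \<Omega>" and loc: "!!a c. cbox a c \<subseteq> \<Omega> ==> integrable lebesgue (\<lambda>x. indicator (cbox a c) x * H x)"
  and z: "!!\<psi>. \<psi> \<in> test_functions \<Omega> ==> (LINT x|lebesgue. H x * \<psi> x) = 0"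
 shows "AE x in lebesgue. x \<in> \<Omega> --> H x = 0"
proof -
 have box0: "(LINT x|lebesgue. indicator (box a c) x * H x) = 0" if sub: "cbox a c \<subseteq> \<Omega>" for a c
 proof -
  let ?H = "\<lambda>x. indicator (cbox a c) x * H x"
  have "(\<lambda>n. LINT x|lebesgue. bump (real (Suc n)) a c x * ?H x) ----> (LINT x|lebesgue. indicator (box a c) x * ?H x)"
  proof (rule integral_dominated_convergence[where w = "\<lambda>x. norm (?H x)"])
   show "integrable lebesgue (\<lambda>x. norm (?H x))" using loc[OF sub] by (rule integrable_norm)
   have Hm: "?H \<in> borel_measurable lebesgue" using loc[OF sub] by (rule borel_measurable_integrable)
   show "(\<lambda>x. indicator (box a c) x * ?H x) \<in> borel_measurable lebesgue"
    by (intro borel_measurable_times borel_measurable_indicator Hm) auto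
   have "bump (real (Suc n)) a c \<in> borel_measurable lebesgue" for n
    using test_function_L2(1)[OF bump_test_function[of "real (Suc n)" a c UNIV]]
    by (intro borel_measurable_lebesgueI) auto
   then show "(\<lambda>x. bump (real (Suc n)) a c x * ?H x) \<in> borel_measurable lebesgue" for n
    using Hm by (rule borel_measurable_times)
   show "AE x in lebesgue. (\<lambda>n. bump (real (Suc n)) a c x * ?H x) ----> indicator (box a c) x * ?H x"
    by (intro AE_I2 tendsto_mult bump_tendsto_indicator tendsto_const)
   show "AE x in lebesgue. norm (bump (real (Suc n)) a c x * ?H x) <= norm (?H x)" for n
    unfolding norm_mult
    by (intro AE_I2 mult_left_le_one_le) (auto simp: abs_of_nonneg[OF bump_nonneg] bump_le_1 bump_nonneg simp del: of_nat_Suc)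
  qed
  moreover have "(LINT x|lebesgue. bump (real (Suc n)) a c x * ?H x) = 0" for n
  proof -
   have "bump (real (Suc n)) a c x * ?H x = H x * bump (real (Suc n)) a c x" for x
    using bump_pos_iff[of "real (Suc n)" a c x] box_subset_cbox[of a c] by (auto split: split_indicator)
   then show ?thesis using z[OF bump_test_function[OF _ sub, of "real (Suc n)"]] by (simp only: of_nat_0_less_iff zero_less_Suc)
  qed
  ultimately have "(LINT x|lebesgue. indicator (box a c) x * ?H x) = 0"
   by (simp add: LIMSEQ_const_iff)
  moreover have "indicator (box a c) x * ?H x = indicator (box a c) x * H x" for x
   using box_subset_cbox[of a c] by (auto split: split_indicator)
  ultimately show ?thesis by simp
 qed
 have loc0: "AE x in lebesgue. x \<in> cbox a c --> H x = 0" if sub: "cbox a c \<subseteq> \<Omega>" for a c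
 proof -
  let ?H = "\<lambda>x. indicator (cbox a c) x * H x"
  have Hi: "integrable lebesgue ?H" by (rule loc[OF sub])
  obtain F where F: "F \<in> Borel" "AE x in lebesgue. ?H x = F x"
   using lebesgue_measurable_ex_borel[OF borel_measurable_integrable[OF Hi]] by metis
  have Fi: "integrable lebesgue F"
   using integrable_cong_AE[OF borel_measurable_integrable[OF Hi] borel_measurable_lebesgueI[OF F(1)] F(2)] Hi by simp
  then have Fl: "integrable lborel F" using F(1) integrable_completion[of F lborel] by simp
  have "AE x in lborel. F x = 0"
  proof (rule AE_zero_if_box_integrals_zero[OF Fl])
   fix p r
   obtain p' r' where pr: "box p r \<inter> box a c = box p' r'" "cbox p r \<inter> cbox a c = cbox p' r'"
    by (rule that[OF box_Int_box Int_interval])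
   have sub': "cbox p' r' \<subseteq> \<Omega>" using pr sub by auto
   have nb: "AE x in lebesgue. x ~: cbox a c - box a c"
    using negligible_frontier_interval[of a c] unfolding negligible_iff_null_sets by (rule AE_not_in)
   have "(LBINT x. indicator (box p r) x * F x) = (LINT x|lebesgue. indicator (box p r) x * F x)"
    using F(1) by (intro integral_completion[symmetric]) auto
   also have "... = (LINT x|lebesgue. indicator (box p' r') x * H x)"
   proof (rule integral_cong_AE)
    show "(\<lambda>x. indicator (box p r) x * F x) \<in> borel_measurable lebesgue"
     using borel_measurable_lebesgueI[OF F(1)] by (intro borel_measurable_times borel_measurable_indicator) auto
    have "(\<lambda>x. indicator (box p' r') x * ?H x) \<in> borel_measurable lebesgue"
     by (rule borel_measurable_times[OF borel_measurable_indicator borel_measurable_integrable[OF Hi]]) auto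
    moreover have "indicator (box p' r') x * ?H x = indicator (box p' r') x * H x" for x
     using pr(1) box_subset_cbox[of a c] by (auto split: split_indicator)
    ultimately show "(\<lambda>x. indicator (box p' r') x * H x) \<in> borel_measurable lebesgue" by simp
    show "AE x in lebesgue. indicator (box p r) x * F x = indicator (box p' r') x * H x"
     using F(2) nb
    proof eventually_elim
     case (elim x)
     show ?case
     proof (cases "x \<in> cbox a c")
      case True
      then have "x \<in> box a c" "F x = H x" using elim by auto
      then show ?thesis unfolding pr(1)[symmetric] by (simp add: indicator_inter_arith)
     next
      case False
      then have "x ~: box a c" "F x = 0" using elim box_subset_cbox[of a c] by auto
      then show ?thesis unfolding pr(1)[symmetric] by (simp add: indicator_inter_arith)
     qed
    qed
   qed
   also have "... = 0" by (rule box0[OF sub'])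
   finally show "(LBINT x. indicator (box p r) x * F x) = 0" .
  qed
  then have "AE x in lebesgue. F x = 0" by (simp add: AE_lebesgue_iff_lborel)
  then show ?thesis using F(2) by eventually_elim (auto split: split_indicator_asm)
 qed
 obtain \<D> where D: "countable \<D>" "\<D> \<subseteq> Pow \<Omega>" "!!X. X \<in> \<D> ==> \<exists>a b. X = cbox a b" "\<Union>\<D> = \<Omega>"
  using open_countable_Union_open_cbox[OF \<Omega>] by metis
 have "AE x in lebesgue. \<forall>X\<in>\<D>. x \<in> X --> H x = 0"
  unfolding AE_ball_countable[OF D(1)]
 proof
  fix X assume X: "X \<in> \<D>"
  obtain a b where ab: "X = cbox a b" using D(3)[OF X] by blast
  then have "cbox a b \<subseteq> \<Omega>" using X D(2) by auto
  then show "AE x in lebesgue. x \<in> X --> H x = 0" unfolding ab by (rule loc0)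
 qed
 then show ?thesis
 proof eventually_elim
  case (elim x)
  show ?case
  proof
   assume "x \<in> \<Omega>"
   then obtain X where "X \<in> \<D>" "x \<in> X" using D(4) by blast
   then show "H x = 0" using elim by blast
  qed
 qed
qed

lemma L2_indicator:
 fixes A :: "'a::euclidean_space set"
 assumes "A \<in> sets borel" "bounded A"
 shows "(\<lambda>x. indicator A x :: real) \<in> L2 UNIV"
proof -
 have "integrable lborel (\<lambda>x. indicator A x :: real)"
  using assms emeasure_bounded_finite[OF assms(2)] by (intro integrable_real_indicator) auto
 then have "integrable lebesgue (\<lambda>x. indicator A x :: real)"
  using assms(1) integrable_completion[of "\<lambda>x. indicator A x :: real" lborel] by simp
 moreover have "(norm (indicator A x :: real))^2 = indicator A x" for x by (simp split: split_indicator)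
 ultimately show ?thesis unfolding mem_L2_UNIV
  using assms(1) by (auto intro: borel_measurable_lebesgueI)
qed

lemma L2_orthogonal_test_functions:
 fixes u :: "'a::euclidean_space => real"
 assumes \<Omega>: "open \<Omega>" and u: "u \<in> L2 UNIV" and z: "!!\<psi>. \<psi> \<in> test_functions \<Omega> ==> (LINT x|lebesgue. u x * \<psi> x) = 0"
 shows "AE x in lebesgue. x \<in> \<Omega> --> u x = 0"
proof (rule test_functions_separate[OF \<Omega> _ z])
 fix a c
 show "integrable lebesgue (\<lambda>x. indicator (cbox a c) x * u x)"
  using L2_inner_integrable[OF L2_indicator[of "cbox a c"] u] by simp
qed

section \<open>Integrals of powers of the norm\<close>

text \<open>Instead of polar coordinates: on a shell \<open>\<rho> \<le> |z| < 2\<rho>\<close> the power is comparable to \<open>\<rho>\<^sup>p\<close>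
and the volume is at most a multiple of \<open>\<rho>\<^sup>n\<close>.\<close>

lemma nn_integral_dyadic_shells:
 fixes A :: "'a::euclidean_space set" and \<rho> :: "nat => real"
 assumes \<rho>: "!!k. \<rho> k > 0" and A: "A \<in> sets borel"
  and cover: "!!z. z \<in> A ==> z ~= 0 ==> \<exists>k. \<rho> k <= norm z & norm z < 2 * \<rho> k"
 shows "(\<integral>+z. indicator A z * ennreal (norm z powr p))
  <= (\<Sum>k. ennreal (2 powr \<bar>p\<bar> * unit_ball_vol (real DIM('a)) * 2 ^ DIM('a) * \<rho> k powr (p + real DIM('a))))"
proof -
 let ?c = "2 powr \<bar>p\<bar> * unit_ball_vol (real DIM('a)) * 2 ^ DIM('a)"
 define g where "g k z = ennreal (2 powr \<bar>p\<bar> * \<rho> k powr p) * indicator (ball (0::'a) (2 * \<rho> k)) z" for k z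
 have gm [measurable]: "g k \<in> Borel" for k
  unfolding g_def[abs_def] by (intro borel_measurable_times_ennreal borel_measurable_const borel_measurable_indicator) simp
 have pw: "norm z powr p <= 2 powr \<bar>p\<bar> * \<rho> k powr p" if "\<rho> k <= norm z" "norm z < 2 * \<rho> k" for z :: 'a and k
 proof (cases "p >= 0")
  case True
  have "norm z powr p <= (2 * \<rho> k) powr p" using that True by (intro powr_mono2) auto
  then show ?thesis using True \<rho>[of k] by (simp add: powr_mult)
 next
  case False
  have "norm z powr p <= \<rho> k powr p" using that False \<rho>[of k] by (intro powr_mono2') auto
  also have "... <= 2 powr \<bar>p\<bar> * \<rho> k powr p" using ge_one_powr_ge_zero[of 2 "\<bar>p\<bar>"] by (simp add: mult_le_cancel_right1)
  finally show ?thesis .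
 qed
 have "(\<integral>+z. indicator A z * ennreal (norm z powr p)) <= (\<integral>+z. (\<Sum>k. g k z))"
 proof (rule nn_integral_mono)
  fix z :: 'a
  show "indicator A z * ennreal (norm z powr p) <= (\<Sum>k. g k z)"
  proof (cases "z \<in> A & z ~= 0")
   case True
   then obtain k where k: "\<rho> k <= norm z" "norm z < 2 * \<rho> k" using cover by blast
   have "indicator A z * ennreal (norm z powr p) <= g k z"
    using True k pw[OF k] by (auto simp: g_def intro: ennreal_leI)
   also have "g k z <= (\<Sum>k. g k z)"
   proof -
    have le: "h k <= (\<Sum>k. h k)" for h :: "nat => ennreal" using sum_le_suminf[of h "{k}"] by simp
    show ?thesis by (rule le)
   qed
   finally show ?thesis .
  qed auto
 qed
 also have "... = (\<Sum>k. \<integral>+z. g k z)"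
  by (rule nn_integral_suminf) (simp add: gm)
 also have "... = (\<Sum>k. ennreal (?c * \<rho> k powr (p + real DIM('a))))"
 proof (intro suminf_cong)
  fix k
  have "(\<integral>+z. g k z) = ennreal (2 powr \<bar>p\<bar> * \<rho> k powr p) * emeasure lborel (ball (0::'a) (2 * \<rho> k))"
   unfolding g_def by (subst nn_integral_cmult_indicator) auto
  also have "... = ennreal (2 powr \<bar>p\<bar> * \<rho> k powr p) * ennreal (unit_ball_vol (real DIM('a)) * (2 * \<rho> k) ^ DIM('a))"
   using \<rho>[of k] by (subst emeasure_ball) auto
  also have "... = ennreal ((2 powr \<bar>p\<bar> * \<rho> k powr p) * (unit_ball_vol (real DIM('a)) * (2 * \<rho> k) ^ DIM('a)))"
   by (rule ennreal_mult[symmetric]) (use \<rho>[of k] in auto)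
  also have "(2 powr \<bar>p\<bar> * \<rho> k powr p) * (unit_ball_vol (real DIM('a)) * (2 * \<rho> k) ^ DIM('a)) = ?c * \<rho> k powr (p + real DIM('a))"
   using \<rho>[of k] by (simp add: powr_add powr_realpow power_mult_distrib)
  finally show "(\<integral>+z. g k z) = ennreal (?c * \<rho> k powr (p + real DIM('a)))" .
 qed
 finally show ?thesis .
qed

lemma nn_integral_norm_powr_near_0:
 assumes "\<alpha> > 0"
 obtains C where "C >= 0" "!!\<delta>. \<delta> > 0 ==>
  (\<integral>\<^sup>+z. indicator (ball 0 \<delta>) z * ennreal (norm z powr (\<alpha> - real DIM('a))) \<partial>(lborel::'a::euclidean_space measure)) <= ennreal (C * \<delta> powr \<alpha>)"
proof -
 define p where "p = \<alpha> - real DIM('a)"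
 define c where "c = 2 powr \<bar>p\<bar> * unit_ball_vol (real DIM('a)) * 2 ^ DIM('a)"
 define x where "x = (1/2) powr \<alpha>"
 have x: "0 < x" "x < 1" using assms powr_less_mono2[of \<alpha> "1/2" 1] by (auto simp: x_def)
 have c0: "c >= 0" unfolding c_def by auto
 show ?thesis
 proof (rule that[of "c * (1/2) powr \<alpha> * (1 / (1 - x))"])
  show "0 <= c * (1/2) powr \<alpha> * (1 / (1 - x))" using x c0 by auto
  fix \<delta> :: real assume \<delta>: "\<delta> > 0"
  let ?\<rho> = "\<lambda>k. \<delta> * (1/2) ^ Suc k"
  have "(\<integral>\<^sup>+z. indicator (ball 0 \<delta>) z * ennreal (norm z powr p) \<partial>(lborel::'a measure)) <= (\<Sum>k. ennreal (c * ?\<rho> k powr (p + real DIM('a))))"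
   unfolding c_def
  proof (rule nn_integral_dyadic_shells)
   fix z :: 'a assume z: "z \<in> ball 0 \<delta>" "z ~= 0"
   obtain n where n: "(1/2) ^ n < norm z / \<delta>" using real_arch_pow_inv[of "norm z / \<delta>" "1/2"] z \<delta> by auto
   define k where "k = (LEAST k. ?\<rho> k <= norm z)"
   have ex: "?\<rho> n <= norm z"
   proof -
    have "\<delta> * (1/2) ^ Suc n <= \<delta> * (1/2) ^ n" using \<delta> by simp
    also have "... <= norm z" using n \<delta> by (simp add: field_simps)
    finally show ?thesis .
   qed
   have 1: "?\<rho> k <= norm z" unfolding k_def by (rule LeastI[of "\<lambda>k. ?\<rho> k <= norm z", OF ex])
   have 2: "norm z < 2 * ?\<rho> k"
   proof (cases k)
    case 0 then show ?thesis using z by simp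
   next
    case (Suc j)
    then have "\<not> ?\<rho> j <= norm z" using not_less_Least[of j "\<lambda>k. ?\<rho> k <= norm z"] unfolding k_def by simp
    then show ?thesis using Suc by simp
   qed
   show "\<exists>k. ?\<rho> k <= norm z & norm z < 2 * ?\<rho> k" using 1 2 by blast
  qed (use \<delta> in auto)
  also have "(\<lambda>k. c * ?\<rho> k powr (p + real DIM('a))) = (\<lambda>k. c * (1/2) powr \<alpha> * \<delta> powr \<alpha> * x ^ k)"
  proof
   fix k
   have e: "(1/2::real) ^ k = (1/2) powr real k" by (simp add: powr_realpow)
   have "?\<rho> k powr \<alpha> = \<delta> powr \<alpha> * ((1/2) powr \<alpha> * ((1/2) ^ k) powr \<alpha>)"
    using \<delta> by (simp add: powr_mult powr_divide)
   also have "((1/2::real) ^ k) powr \<alpha> = x ^ k"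
    unfolding e x_def by (simp add: powr_powr powr_realpow[symmetric] mult.commute)
   finally show "c * ?\<rho> k powr (p + real DIM('a)) = c * (1/2) powr \<alpha> * \<delta> powr \<alpha> * x ^ k"
    by (simp add: p_def mult_ac)
  qed
  also have "(\<Sum>k. ennreal (c * (1/2) powr \<alpha> * \<delta> powr \<alpha> * x ^ k)) = ennreal (\<Sum>k. c * (1/2) powr \<alpha> * \<delta> powr \<alpha> * x ^ k)"
   using x c0 by (intro suminf_ennreal2 summable_mult summable_geometric) auto
  also have "(\<Sum>k. c * (1/2) powr \<alpha> * \<delta> powr \<alpha> * x ^ k) = c * (1/2) powr \<alpha> * (1 / (1 - x)) * \<delta> powr \<alpha>"
   using x by (subst suminf_mult) (auto simp: suminf_geometric summable_geometric)
  finally show "(\<integral>\<^sup>+z. indicator (ball 0 \<delta>) z * ennreal (norm z powr (\<alpha> - real DIM('a))) \<partial>(lborel::'a measure))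
    <= ennreal (c * (1/2) powr \<alpha> * (1 / (1 - x)) * \<delta> powr \<alpha>)" unfolding p_def .
 qed
qed

lemma nn_integral_norm_powr_far:
 assumes "\<alpha> > 0" "\<delta> > 0"
 shows "(\<integral>\<^sup>+z. indicator (- ball 0 \<delta>) z * ennreal (norm z powr (- \<alpha> - real DIM('a))) \<partial>(lborel::'a::euclidean_space measure)) < \<infinity>"
proof -
 define p where "p = - \<alpha> - real DIM('a)"
 define c where "c = 2 powr \<bar>p\<bar> * unit_ball_vol (real DIM('a)) * 2 ^ DIM('a)"
 define x where "x = 2 powr (- \<alpha>)"
 have x: "0 < x" "x < 1" using assms by (auto simp: x_def powr_minus field_simps)
 have c0: "c >= 0" unfolding c_def by auto
 let ?\<rho> = "\<lambda>k. \<delta> * 2 ^ k"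
 have "(\<integral>\<^sup>+z. indicator (- ball 0 \<delta>) z * ennreal (norm z powr p) \<partial>(lborel::'a measure)) <= (\<Sum>k. ennreal (c * ?\<rho> k powr (p + real DIM('a))))"
  unfolding c_def
 proof (rule nn_integral_dyadic_shells)
  fix z :: 'a assume z: "z \<in> - ball 0 \<delta>" "z ~= 0"
  obtain n where n: "norm z / \<delta> < 2 ^ n" using real_arch_pow[of 2 "norm z / \<delta>"] by auto
  define k where "k = (LEAST k. norm z < 2 * ?\<rho> k)"
  have ex: "norm z < 2 * ?\<rho> n"
  proof -
   have "norm z < \<delta> * 2 ^ n" using n assms by (simp add: field_simps)
   also have "... <= 2 * ?\<rho> n" using assms by simp
   finally show ?thesis .
  qed
  have 1: "norm z < 2 * ?\<rho> k" unfolding k_def by (rule LeastI[of "\<lambda>k. norm z < 2 * ?\<rho> k", OF ex])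
  have 2: "?\<rho> k <= norm z"
  proof (cases k)
   case 0 then show ?thesis using z by simp
  next
   case (Suc j)
   then have "\<not> norm z < 2 * ?\<rho> j" using not_less_Least[of j "\<lambda>k. norm z < 2 * ?\<rho> k"] unfolding k_def by simp
   then show ?thesis using Suc by simp
  qed
  show "\<exists>k. ?\<rho> k <= norm z & norm z < 2 * ?\<rho> k" using 1 2 by blast
 qed (use assms in auto)
 also have "(\<lambda>k. c * ?\<rho> k powr (p + real DIM('a))) = (\<lambda>k. c * \<delta> powr (- \<alpha>) * x ^ k)"
 proof
  fix k
  have e: "(2::real) ^ k = 2 powr real k" by (simp add: powr_realpow)
  have "?\<rho> k powr (- \<alpha>) = \<delta> powr (- \<alpha>) * (2 ^ k) powr (- \<alpha>)"
   using assms by (simp add: powr_mult)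
  also have "((2::real) ^ k) powr (- \<alpha>) = x ^ k"
   unfolding e x_def by (simp add: powr_powr powr_realpow[symmetric] mult.commute)
  finally show "c * ?\<rho> k powr (p + real DIM('a)) = c * \<delta> powr (- \<alpha>) * x ^ k"
   by (simp add: p_def mult_ac)
 qed
 also have "(\<Sum>k. ennreal (c * \<delta> powr (- \<alpha>) * x ^ k)) = ennreal (\<Sum>k. c * \<delta> powr (- \<alpha>) * x ^ k)"
  using x c0 by (intro suminf_ennreal2 summable_mult summable_geometric) auto
 also have "... < \<infinity>" by simp
 finally show ?thesis unfolding p_def .
qed

section \<open>Unique continuation for Riesz potentials\<close>

text \<open>The homogeneous monomials \<open>\<Prod>(w \<bullet> a)\<close> over a list of vectors \<open>a\<close>; basis vectors give all monomials.\<close>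

fun inner_prod :: "'a::euclidean_space list => 'a => real" where
 "inner_prod [] w = 1"
| "inner_prod (a # as) w = (w \<bullet> a) * inner_prod as w"

fun inner_prod_deriv :: "'a::euclidean_space => 'a list => 'a => real" where
 "inner_prod_deriv e [] w = 0"
| "inner_prod_deriv e (a # as) w = (e \<bullet> a) * inner_prod as w + (w \<bullet> a) * inner_prod_deriv e as w"

lemma inner_prod_has_derivative:
 "(inner_prod as has_derivative (\<lambda>e. inner_prod_deriv e as w)) (at w)"
proof (induction as)
 case (Cons a as)
 have "((\<lambda>w. (w \<bullet> a) * inner_prod as w) has_derivative
   (\<lambda>e. (w \<bullet> a) * inner_prod_deriv e as w + (e \<bullet> a) * inner_prod as w)) (at w)"
  by (intro has_derivative_mult Cons has_derivative_inner_left has_derivative_ident)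
 then show ?case by (simp add: add.commute inner_prod.simps[abs_def])
qed simp

lemma inner_prod_continuous [continuous_intros]: "continuous_on S (inner_prod as)"
 by (induction as) (auto intro!: continuous_intros)

lemma inner_prod_deriv_continuous [continuous_intros]: "continuous_on S (inner_prod_deriv e as)"
 by (induction as) (auto intro!: continuous_intros)

lemma inner_prod_append: "inner_prod (as @ bs) w = inner_prod as w * inner_prod bs w"
 by (induction as) auto

lemma inner_prod_scale: "inner_prod as (c *\<^sub>R w) = c ^ length as * inner_prod as w"
 by (induction as) auto

lemma inner_prod_euler:
 "(\<Sum>b\<in>Basis. (w \<bullet> b) * inner_prod_deriv b as w) = real (length as) * inner_prod as w"
proof (induction as)
 case (Cons a as)
 have "(\<Sum>b\<in>Basis. (w \<bullet> b) * (b \<bullet> a)) = w \<bullet> a"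
  by (subst euclidean_inner[of w a]) (simp add: inner_commute)
 then have "(\<Sum>b\<in>Basis. (w \<bullet> b) * ((b \<bullet> a) * inner_prod as w)) = (w \<bullet> a) * inner_prod as w"
  by (simp add: sum_distrib_right[symmetric] mult.assoc[symmetric])
 moreover have "(\<Sum>b\<in>Basis. (w \<bullet> b) * ((w \<bullet> a) * inner_prod_deriv b as w)) = (w \<bullet> a) * (real (length as) * inner_prod as w)"
  unfolding Cons[symmetric] sum_distrib_left by (simp add: mult_ac)
 ultimately show ?case by (simp add: distrib_left sum.distrib distrib_right algebra_simps)
qed simp

text \<open>This family is closed under differentiation up to a shift of \<open>q\<close> by 2 and of the list by one, which
is what allows an induction on the number of derivatives.\<close>

definition riesz_kernel :: "real => 'a::euclidean_space list => 'a => real" where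
 "riesz_kernel q as w = norm w powr (- q) * inner_prod as w"

definition riesz_kernel_deriv :: "'a::euclidean_space => real => 'a list => 'a => real" where
 "riesz_kernel_deriv e q as w = - q * norm w powr (- (q + 2)) * (w \<bullet> e) * inner_prod as w
   + norm w powr (- q) * inner_prod_deriv e as w"

lemma riesz_kernel_has_derivative:
 assumes "w ~= 0"
 shows "(riesz_kernel q as has_derivative (\<lambda>e. riesz_kernel_deriv e q as w)) (at w)"
proof -
 have n: "(norm has_derivative (\<lambda>e. e \<bullet> sgn w)) (at w)" using assms by (rule has_derivative_norm)
 have "((\<lambda>w. norm w powr (- q)) has_derivative (\<lambda>e. (- q * norm w powr (- q - 1)) * (e \<bullet> sgn w))) (at w)"
 proof -
  have "((\<lambda>z. z powr (- q)) has_derivative (*) (- q * norm w powr (- q - 1))) (at (norm w))"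
   using assms by (intro has_real_derivative_powr[unfolded has_field_derivative_def]) simp
  from has_derivative_compose[OF n this] show ?thesis .
 qed
 moreover have "(- q * norm w powr (- q - 1)) * (e \<bullet> sgn w) = - q * norm w powr (- (q + 2)) * (w \<bullet> e)" for e
 proof -
  have "norm w powr (- q - 1) * (e \<bullet> sgn w) = (norm w powr (- q - 1) / norm w) * (w \<bullet> e)"
   by (simp add: sgn_div_norm inner_commute divide_inverse)
  also have "norm w powr (- q - 1) / norm w = norm w powr (- (q + 2))"
   using assms by (simp add: powr_diff[symmetric] powr_minus_divide[symmetric] powr_diff powr_add field_simps power2_eq_square)
  finally show ?thesis by simp
 qed
 ultimately have "((\<lambda>w. norm w powr (- q)) has_derivative (\<lambda>e. - q * norm w powr (- (q + 2)) * (w \<bullet> e))) (at w)"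
  by (simp only:)
 from has_derivative_mult[OF this inner_prod_has_derivative[of as w]]
 show ?thesis unfolding riesz_kernel_def[abs_def] riesz_kernel_deriv_def by (simp add: add.commute)
qed

lemma riesz_kernel_continuous: "0 ~: S ==> continuous_on S (riesz_kernel q as)"
 unfolding riesz_kernel_def[abs_def] by (intro continuous_intros) auto

lemma riesz_kernel_deriv_continuous: "0 ~: S ==> continuous_on S (riesz_kernel_deriv e q as)"
 unfolding riesz_kernel_deriv_def[abs_def] by (intro continuous_intros) auto

lemma inner_prod_measurable [measurable]: "inner_prod as \<in> Borel"
 by (intro borel_measurable_continuous_onI inner_prod_continuous)

lemma inner_prod_deriv_measurable [measurable]: "inner_prod_deriv e as \<in> Borel"
 by (intro borel_measurable_continuous_onI inner_prod_deriv_continuous)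

lemma riesz_kernel_measurable [measurable]: "riesz_kernel q as \<in> Borel"
 unfolding riesz_kernel_def[abs_def] by measurable

lemma riesz_kernel_deriv_measurable [measurable]: "riesz_kernel_deriv e q as \<in> Borel"
 unfolding riesz_kernel_deriv_def[abs_def] by measurable

lemma compact_differences_away_from_0:
 fixes K V :: "'a::euclidean_space set"
 assumes "compact K" "open V" "V \<inter> K = {}" "x \<in> V"
 obtains r C where "r > 0" "cball x r \<subseteq> V" "compact C" "0 ~: C"
  "!!a y. a \<in> cball x r ==> y \<in> K ==> a - y \<in> C"
proof -
 obtain r where r: "r > 0" "cball x r \<subseteq> V" using assms open_contains_cball by blast
 have "compact {a - y | a y. a \<in> cball x r & y \<in> K}" by (intro compact_differences compact_cball assms)
 moreover have "0 ~: {a - y | a y. a \<in> cball x r & y \<in> K}" using r assms(3) by auto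
 ultimately show ?thesis using that[OF r] by blast
qed

lemma potential_integrable:
 fixes G :: "'a::euclidean_space => real"
 assumes "compact C" "!!y. y \<in> K ==> x - y \<in> C" "integrable lborel G" "!!y. y ~: K ==> G y = 0"
  and f: "continuous_on C f" "f \<in> Borel"
 shows "integrable lborel (\<lambda>y. G y * f (x - y))"
proof -
 have "compact (f ` C)" using assms compact_continuous_image by blast
 then obtain M where M: "\<forall>v\<in>f ` C. norm v <= M" using compact_imp_bounded bounded_iff by metis
 show ?thesis
 proof (rule bochner_bound[of _ "\<lambda>y. M * G y"])
  show "AE y in lborel. norm (G y * f (x - y)) <= norm (M * G y)"
  proof (rule AE_I2)
   fix y
   show "norm (G y * f (x - y)) <= norm (M * G y)"
   proof (cases "y \<in> K")
    case True
    then have "\<bar>f (x - y)\<bar> <= \<bar>M\<bar>" using M assms(2) by fastforce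
    then show ?thesis by (simp add: abs_mult mult.commute[of "\<bar>M\<bar>"] mult_left_mono)
   qed (use assms(4) in simp)
  qed
  show "(\<lambda>y. G y * f (x - y)) \<in> borel_measurable lborel"
   using borel_measurable_integrable[OF assms(3)] f(2) by measurable
 qed (use assms(3) in auto)
qed

lemma potential_tendsto:
 fixes G :: "'a::euclidean_space => real"
 assumes KV: "compact K" "open V" "V \<inter> K = {}" and G: "integrable lborel G" "!!y. y ~: K ==> G y = 0"
  and f: "continuous_on (- {0}) f" "f \<in> Borel" and x: "x \<in> V" "X ----> x"
 shows "(\<lambda>n. LBINT y. G y * f (X n - y)) ----> (LBINT y. G y * f (x - y))"
proof -
 obtain r C where r: "r > 0" "cball x r \<subseteq> V" "compact C" "0 ~: C"
  "!!a y. a \<in> cball x r ==> y \<in> K ==> a - y \<in> C" using compact_differences_away_from_0[OF KV x(1)] by metis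
 have fC: "continuous_on C f" using continuous_on_subset[OF f(1)] r(4) by blast
 have "compact (f ` C)" using fC r(3) compact_continuous_image by blast
 then obtain M where M: "\<forall>v\<in>f ` C. norm v <= M" using compact_imp_bounded bounded_iff by metis
 obtain N where N: "!!n. n >= N ==> X n \<in> cball x r"
  using LIMSEQ_D[OF x(2) r(1)] by (auto simp: dist_norm norm_minus_commute intro: less_imp_le)
 have Gm [measurable]: "G \<in> Borel" using borel_measurable_integrable[OF G(1)] by simp
 note f(2)[measurable]
 have "(\<lambda>n. LBINT y. G y * f (X (n + N) - y)) ----> (LBINT y. G y * f (x - y))"
 proof (rule integral_dominated_convergence[where w = "\<lambda>y. M * norm (G y)"])
  show "integrable lborel (\<lambda>y. M * norm (G y))" using G(1) by auto
  show "AE y in lborel. (\<lambda>n. G y * f (X (n + N) - y)) ----> G y * f (x - y)"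
  proof (rule AE_I2)
   fix y
   show "(\<lambda>n. G y * f (X (n + N) - y)) ----> G y * f (x - y)"
   proof (cases "y \<in> K")
    case True
    have "(\<lambda>n. f (X (n + N) - y)) ----> f (x - y)"
    proof (rule continuous_on_tendsto_compose[OF fC])
     show "(\<lambda>n. X (n + N) - y) ----> x - y" by (intro tendsto_intros LIMSEQ_ignore_initial_segment x)
     show "x - y \<in> C" using r(5)[of x y] r(1) True by auto
     show "\<forall>\<^sub>F n in sequentially. X (n + N) - y \<in> C" using r(5)[OF N True] by (auto intro!: always_eventually)
    qed
    then show ?thesis by (intro tendsto_intros)
   qed (use G(2) in simp)
  qed
  show "AE y in lborel. norm (G y * f (X (n + N) - y)) <= M * norm (G y)" for n
  proof (rule AE_I2)
   fix y
   show "norm (G y * f (X (n + N) - y)) <= M * norm (G y)"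
   proof (cases "y \<in> K")
    case True
    then have "norm (f (X (n + N) - y)) <= M" using M r(5)[OF N True, of "n + N"] by auto
    then show ?thesis unfolding norm_mult by (subst mult.commute) (rule mult_right_mono, auto)
   qed (use G(2) in simp)
  qed
 qed measurable
 then show ?thesis by (rule LIMSEQ_offset)
qed

text \<open>Differentiation under the integral sign: \<open>K\<close> is at positive distance from \<open>x\<close>, so the difference
quotients of \<open>f\<close> are bounded uniformly on the support of \<open>G\<close>.\<close>

lemma potential_derivative_vanishes:
 fixes G :: "'a::euclidean_space => real"
 assumes KV: "compact K" "open V" "V \<inter> K = {}" and G: "integrable lborel G" "!!y. y ~: K ==> G y = 0"
  and f: "!!w. w ~= 0 ==> (f has_derivative (\<lambda>e. D e w)) (at w)" "f \<in> Borel"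
  and D: "continuous_on (- {0}) (D e)" "D e \<in> Borel"
  and z: "!!x. x \<in> V ==> (LBINT y. G y * f (x - y)) = 0" and x: "x \<in> V"
 shows "(LBINT y. G y * D e (x - y)) = 0"
proof -
 obtain r C where r: "r > 0" "cball x r \<subseteq> V" "compact C" "0 ~: C"
  "!!a y. a \<in> cball x r ==> y \<in> K ==> a - y \<in> C" using compact_differences_away_from_0[OF KV x] by metis
 have DC: "continuous_on C (D e)" using continuous_on_subset[OF D(1)] r(4) by blast
 have fcont: "continuous_on C f"
  using f(1) r(4) by (intro continuous_at_imp_continuous_on) (metis has_derivative_continuous)
 have "compact (D e ` C)" using DC r(3) compact_continuous_image by blast
 then obtain M where M: "\<forall>v\<in>D e ` C. norm v <= M" using compact_imp_bounded bounded_iff by metis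
 define \<tau> where "\<tau> n = r / ((norm e + 1) * real (Suc n))" for n
 have ne: "norm e + 1 > 0" using norm_ge_zero[of e] by linarith
 have \<tau>: "\<tau> n > 0" for n using r(1) ne by (simp add: \<tau>_def)
 have "\<tau> = (\<lambda>n. (r / (norm e + 1)) * inverse (real (Suc n)))" by (simp add: \<tau>_def fun_eq_iff field_simps)
 then have \<tau>0: "\<tau> ----> 0" using tendsto_mult_left[OF LIMSEQ_inverse_real_of_nat, of "r / (norm e + 1)"] by simp
 have in_ball: "x + \<sigma> *\<^sub>R e \<in> cball x r" if "0 <= \<sigma>" "\<sigma> <= \<tau> n" for \<sigma> n
 proof -
  have "\<sigma> * norm e <= \<tau> n * (norm e + 1)" using that by (intro mult_mono) auto
  also have "... = r / real (Suc n)" using ne by (simp add: \<tau>_def)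
  also have "... <= r" using r(1) by (simp add: divide_le_eq mult_le_cancel_left1)
  finally show ?thesis using that by (simp add: dist_norm)
 qed
 let ?q = "\<lambda>n y. (f (x + \<tau> n *\<^sub>R e - y) - f (x - y)) / \<tau> n"
 have Gm [measurable]: "G \<in> Borel" using borel_measurable_integrable[OF G(1)] by simp
 note f(2)[measurable] D(2)[measurable]
 have dir: "((\<lambda>\<sigma>. f (x + \<sigma> *\<^sub>R e - y)) has_derivative (\<lambda>h. h * D e (x + \<sigma> *\<^sub>R e - y))) (at \<sigma>)"
  if "x + \<sigma> *\<^sub>R e - y ~= 0" for \<sigma> y
 proof -
  have "((\<lambda>\<sigma>. x + \<sigma> *\<^sub>R e - y) has_derivative (\<lambda>h. h *\<^sub>R e)) (at \<sigma>)"
   by (auto intro!: derivative_eq_intros)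
  from has_derivative_compose[OF this f(1)[OF that]]
  have "((\<lambda>\<sigma>. f (x + \<sigma> *\<^sub>R e - y)) has_derivative (\<lambda>h. D (h *\<^sub>R e) (x + \<sigma> *\<^sub>R e - y))) (at \<sigma>)" .
  moreover have "D (h *\<^sub>R e) (x + \<sigma> *\<^sub>R e - y) = h * D e (x + \<sigma> *\<^sub>R e - y)" for h
   using has_derivative_linear[OF f(1)[OF that]] linear_scale by fastforce
  ultimately show ?thesis by simp
 qed
 have "(\<lambda>n. LBINT y. G y * ?q n y) ----> (LBINT y. G y * D e (x - y))"
 proof (rule integral_dominated_convergence[where w = "\<lambda>y. M * norm (G y)"])
  show "integrable lborel (\<lambda>y. M * norm (G y))" using G(1) by auto
  show "AE y in lborel. (\<lambda>n. G y * ?q n y) ----> G y * D e (x - y)"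
  proof (rule AE_I2)
   fix y
   show "(\<lambda>n. G y * ?q n y) ----> G y * D e (x - y)"
   proof (cases "y \<in> K")
    case True
    have w: "x - y ~= 0" using r(5)[of x y] r(1,4) True by auto
    have "((\<lambda>\<sigma>. f (x + \<sigma> *\<^sub>R e - y)) has_field_derivative D e (x - y)) (at 0)"
     using dir[of 0 y] w by (simp add: has_field_derivative_def mult_commute_abs)
    then have "((\<lambda>h. (f (x + h *\<^sub>R e - y) - f (x - y)) / h) \<longlongrightarrow> D e (x - y)) (at 0)"
     by (simp add: DERIV_def)
    then have "(\<lambda>n. ?q n y) ----> D e (x - y)"
    proof (rule filterlim_compose)
     show "filterlim \<tau> (at 0) sequentially"
      using \<tau>0 \<tau> by (auto simp: filterlim_at less_imp_neq[symmetric] intro!: always_eventually)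
    qed
    then show ?thesis by (intro tendsto_intros)
   qed (use G(2) in simp)
  qed
  show "AE y in lborel. norm (G y * ?q n y) <= M * norm (G y)" for n
  proof (rule AE_I2)
   fix y
   show "norm (G y * ?q n y) <= M * norm (G y)"
   proof (cases "y \<in> K")
    case True
    have inC: "x + \<sigma> *\<^sub>R e - y \<in> C" if "\<sigma> \<in> {0..\<tau> n}" for \<sigma>
     using r(5)[OF in_ball True] that by auto
    have "norm (f (x + \<tau> n *\<^sub>R e - y) - f (x + 0 *\<^sub>R e - y)) <= M * norm (\<tau> n - 0)"
    proof (rule differentiable_bound[of "{0..\<tau> n}" "\<lambda>\<sigma>. f (x + \<sigma> *\<^sub>R e - y)" "\<lambda>\<sigma> h. h * D e (x + \<sigma> *\<^sub>R e - y)"])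
     show "((\<lambda>\<sigma>. f (x + \<sigma> *\<^sub>R e - y)) has_derivative (\<lambda>h. h * D e (x + \<sigma> *\<^sub>R e - y))) (at \<sigma> within {0..\<tau> n})"
      if "\<sigma> \<in> {0..\<tau> n}" for \<sigma>
     proof (rule has_derivative_at_withinI, rule dir)
      show "x + \<sigma> *\<^sub>R e - y ~= 0" using inC[OF that] r(4) by metis
     qed
     show "onorm (\<lambda>h. h * D e (x + \<sigma> *\<^sub>R e - y)) <= M" if "\<sigma> \<in> {0..\<tau> n}" for \<sigma>
     proof (rule onorm_le)
      fix h :: real
      have "norm (D e (x + \<sigma> *\<^sub>R e - y)) <= M" using M inC[OF that] by auto
      then show "norm (h * D e (x + \<sigma> *\<^sub>R e - y)) <= M * norm h"
       unfolding norm_mult by (subst mult.commute) (rule mult_right_mono, auto)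
     qed
    qed (use \<tau>[of n] in auto)
    then have "norm (?q n y) <= M" using \<tau>[of n] by (simp add: divide_le_eq)
    then show ?thesis unfolding norm_mult by (subst mult.commute) (rule mult_right_mono, auto)
   qed (use G(2) in simp)
  qed
 qed measurable
 moreover have "(LBINT y. G y * ?q n y) = 0" for n
 proof -
  have b: "x + \<tau> n *\<^sub>R e \<in> cball x r" using in_ball[of "\<tau> n" n] \<tau>[of n] by simp
  have i1: "integrable lborel (\<lambda>y. G y * f (x + \<tau> n *\<^sub>R e - y))"
   by (rule potential_integrable[OF r(3) _ G fcont f(2)]) (use r(5) b in auto)
  have i2: "integrable lborel (\<lambda>y. G y * f (x - y))"
   by (rule potential_integrable[OF r(3) _ G fcont f(2)]) (use r(5)[of x] r(1) in auto)
  have "(LBINT y. G y * ?q n y) = (LBINT y. (G y * f (x + \<tau> n *\<^sub>R e - y) - G y * f (x - y)) / \<tau> n)"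
   by (simp add: algebra_simps)
  also have "... = ((LBINT y. G y * f (x + \<tau> n *\<^sub>R e - y)) - (LBINT y. G y * f (x - y))) / \<tau> n"
   using i1 i2 by (simp add: bochner_diff)
  also have "... = 0" using z[OF x] z[of "x + \<tau> n *\<^sub>R e"] b r(2) by auto
  finally show ?thesis .
 qed
 ultimately have "(\<lambda>n. 0) ----> (LBINT y. G y * D e (x - y))" by (simp only:)
 then show ?thesis by (simp add: LIMSEQ_const_iff)
qed

text \<open>Summing over the basis trades one derivative and one factor for a multiple of the original kernel,
by Euler's identity for homogeneous functions.\<close>

lemma riesz_kernel_trace:
 fixes w :: "'a::euclidean_space"
 assumes "w ~= 0"
 shows "(\<Sum>b\<in>Basis. riesz_kernel_deriv b q (b # as) w)
  = (real DIM('a) + real (length as) - q) * riesz_kernel q as w"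
proof -
 have sq: "(\<Sum>b\<in>Basis. (w \<bullet> b) * (w \<bullet> b)) = (norm w)^2"
  by (simp add: euclidean_inner[of w w] power2_norm_eq_inner)
 have pw: "norm w powr (- (q + 2)) * (norm w)^2 = norm w powr (- q)"
 proof -
  have "norm w powr (- (q + 2)) * norm w powr 2 = norm w powr (- q)"
   unfolding powr_add[symmetric] by simp
  then show ?thesis using assms by simp
 qed
 have "(\<Sum>b\<in>Basis. riesz_kernel_deriv b q (b # as) w)
  = (\<Sum>b\<in>Basis. - q * norm w powr (- (q + 2)) * inner_prod as w * ((w \<bullet> b) * (w \<bullet> b))
    + norm w powr (- q) * inner_prod as w + norm w powr (- q) * ((w \<bullet> b) * inner_prod_deriv b as w))"
  by (intro sum.cong) (auto simp: riesz_kernel_deriv_def algebra_simps)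
 also have "... = - q * norm w powr (- (q + 2)) * inner_prod as w * (norm w)^2
    + real DIM('a) * (norm w powr (- q) * inner_prod as w) + norm w powr (- q) * (real (length as) * inner_prod as w)"
  unfolding sum.distrib sum_distrib_left[symmetric] sq inner_prod_euler by simp
 also have "- q * norm w powr (- (q + 2)) * inner_prod as w * (norm w)^2
   = - q * (norm w powr (- (q + 2)) * (norm w)^2) * inner_prod as w" by simp
 finally show ?thesis unfolding pw riesz_kernel_def by (simp add: algebra_simps)
qed

text \<open>Differentiate the identity for \<open>m\<close> factors in direction \<open>a\<close>. One of the two terms is the kernel with
the additional factor \<open>a\<close>; the other has a lower degree numerator, and the trace identity shows that it
vanishes too. The coefficient met there is nonzero because \<open>p > n\<close>.\<close>

lemma riesz_moments_vanish:
 fixes G :: "'a::euclidean_space => real"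
 assumes KV: "compact K" "open V" "V \<inter> K = {}" and G: "integrable lborel G" "!!y. y ~: K ==> G y = 0"
  and p: "p > real DIM('a)" and z: "!!x. x \<in> V ==> (LBINT y. G y * norm (x - y) powr (- p)) = 0"
 shows "length as = m ==> x \<in> V ==> (LBINT y. G y * riesz_kernel (p + 2 * real m) as (x - y)) = 0"
proof (induction m arbitrary: as x)
 case 0
 then show ?case using z by (simp add: riesz_kernel_def)
next
 case (Suc m)
 then obtain e bs where as: "as = e # bs" "length bs = m" by (cases as) auto
 define q where "q = p + 2 * real m"
 have q0: "q > 0" unfolding q_def by (rule add_pos_nonneg) (use p order.strict_trans1[OF of_nat_0_le_iff p] in auto)
 have IH: "(LBINT y. G y * riesz_kernel q cs (x - y)) = 0" if "length cs = m" "x \<in> V" for cs x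
  unfolding q_def by (rule Suc.IH[OF that])
 have int: "integrable lborel (\<lambda>y. G y * f (x - y))"
  if f: "continuous_on (- {0}) f" "f \<in> Borel" for f :: "'a => real"
 proof -
  obtain r C where r: "r > 0" "cball x r \<subseteq> V" "compact C" "0 ~: C"
   "!!a y. a \<in> cball x r ==> y \<in> K ==> a - y \<in> C"
   using compact_differences_away_from_0[OF KV Suc.prems(2)] by metis
  have "continuous_on C f" using continuous_on_subset[OF f(1)] r(4) by blast
  from potential_integrable[OF r(3) _ G this f(2), where x = x] show ?thesis using r(1) r(5)[of x] by auto
 qed
 have deriv: "(LBINT y. G y * riesz_kernel_deriv b q cs (x - y)) = 0" if "length cs = m" for b cs
  by (rule potential_derivative_vanishes[OF KV G riesz_kernel_has_derivative riesz_kernel_measurable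
     riesz_kernel_deriv_continuous riesz_kernel_deriv_measurable IH[OF that] Suc.prems(2)]) auto
 have lower: "(LBINT y. G y * riesz_kernel q R (x - y)) = 0" if "Suc (length R) = m" for R
 proof -
  have "0 = (\<Sum>b\<in>Basis. LBINT y. G y * riesz_kernel_deriv b q (b # R) (x - y))"
   using deriv[of "b # R" for b] that by simp
  also have "... = (LBINT y. (\<Sum>b\<in>Basis. G y * riesz_kernel_deriv b q (b # R) (x - y)))"
   by (rule Bochner_Integration.integral_sum[symmetric])
     (intro int riesz_kernel_deriv_continuous riesz_kernel_deriv_measurable, simp)
  also have "... = (LBINT y. (real DIM('a) + real (length R) - q) * (G y * riesz_kernel q R (x - y)))"
  proof (intro bochner_cong refl)
   fix y
   show "(\<Sum>b\<in>Basis. G y * riesz_kernel_deriv b q (b # R) (x - y))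
     = (real DIM('a) + real (length R) - q) * (G y * riesz_kernel q R (x - y))"
   proof (cases "y \<in> K")
    case True
    then have "x - y ~= 0" using KV(3) Suc.prems(2) by auto
    from riesz_kernel_trace[OF this, of q R] show ?thesis by (simp add: sum_distrib_left[symmetric])
   qed (use G(2) in simp)
  qed
  also have "... = (real DIM('a) + real (length R) - q) * (LBINT y. G y * riesz_kernel q R (x - y))"
   by simp
  finally have "(real DIM('a) + real (length R) - q) * (LBINT y. G y * riesz_kernel q R (x - y)) = 0" by simp
  moreover have "real DIM('a) + real (length R) - q < 0"
   using p that unfolding q_def by simp
  ultimately show ?thesis by simp
 qed
 have pre: "(LBINT y. G y * (riesz_kernel q pre (x - y) * inner_prod_deriv e cs (x - y))) = 0"
  if "length pre + length cs = m" for pre cs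
  using that
 proof (induction cs arbitrary: pre)
  case (Cons a cs)
  have "(LBINT y. G y * (riesz_kernel q pre (x - y) * inner_prod_deriv e (a # cs) (x - y)))
   = (LBINT y. (e \<bullet> a) * (G y * riesz_kernel q (pre @ cs) (x - y))
     + G y * (riesz_kernel q (pre @ [a]) (x - y) * inner_prod_deriv e cs (x - y)))"
   by (intro bochner_cong) (auto simp: riesz_kernel_def inner_prod_append algebra_simps)
  also have "... = (LBINT y. (e \<bullet> a) * (G y * riesz_kernel q (pre @ cs) (x - y)))
     + (LBINT y. G y * (riesz_kernel q (pre @ [a]) (x - y) * inner_prod_deriv e cs (x - y)))"
  proof (rule bochner_add)
   show "integrable lborel (\<lambda>y. (e \<bullet> a) * (G y * riesz_kernel q (pre @ cs) (x - y)))"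
    by (intro integrable_mult_right int riesz_kernel_continuous riesz_kernel_measurable) auto
   show "integrable lborel (\<lambda>y. G y * (riesz_kernel q (pre @ [a]) (x - y) * inner_prod_deriv e cs (x - y)))"
    by (rule int[of "\<lambda>w. riesz_kernel q (pre @ [a]) w * inner_prod_deriv e cs w"])
      (auto intro!: continuous_intros riesz_kernel_continuous)
  qed
  also have "... = 0" using lower[of "pre @ cs"] Cons.IH[of "pre @ [a]"] Cons.prems by simp
  finally show ?case .
 qed simp
 have "0 = (LBINT y. G y * riesz_kernel_deriv e q bs (x - y))" using deriv[OF as(2)] by simp
 also have "... = (LBINT y. (- q) * (G y * riesz_kernel (q + 2) as (x - y))
   + G y * (riesz_kernel q [] (x - y) * inner_prod_deriv e bs (x - y)))"
  unfolding as(1) by (intro bochner_cong) (auto simp: riesz_kernel_def riesz_kernel_deriv_def algebra_simps)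
 also have "... = (LBINT y. (- q) * (G y * riesz_kernel (q + 2) as (x - y)))
   + (LBINT y. G y * (riesz_kernel q [] (x - y) * inner_prod_deriv e bs (x - y)))"
 proof (rule bochner_add)
  show "integrable lborel (\<lambda>y. (- q) * (G y * riesz_kernel (q + 2) as (x - y)))"
   by (intro integrable_mult_right int riesz_kernel_continuous riesz_kernel_measurable) auto
  show "integrable lborel (\<lambda>y. G y * (riesz_kernel q [] (x - y) * inner_prod_deriv e bs (x - y)))"
   by (rule int[of "\<lambda>w. riesz_kernel q [] w * inner_prod_deriv e bs w"])
     (auto intro!: continuous_intros riesz_kernel_continuous)
 qed
 also have "... = (- q) * (LBINT y. G y * riesz_kernel (q + 2) as (x - y))"
  using pre[of "[]" bs] as(2) by simp
 finally have "(LBINT y. G y * riesz_kernel (q + 2) as (x - y)) = 0" using q0 by simp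
 then show ?case by (simp add: q_def algebra_simps)
qed

text \<open>Fix \<open>x\<close> in \<open>V\<close> and put \<open>\<zeta>(y) = (x - y)/|x - y|\<^sup>2\<close>, an injective map on \<open>K\<close>. The vanishing moments say
that \<open>H(y) = G(y)|x - y|\<^sup>-\<^sup>p\<close> annihilates all polynomials in \<open>\<zeta>\<close>, hence by Stone--Weierstrass all of
\<open>C(K)\<close>. In the proof, \<open>R\<close> is the ring of multipliers that preserve the property \<open>P\<close> of annihilating
every moment; this avoids a description of the polynomials themselves.\<close>

lemma riesz_potential_unique_continuation:
 fixes G :: "'a::euclidean_space => real"
 assumes KV: "compact K" "open V" "V \<inter> K = {}" "V ~= {}" and G: "integrable lborel G" "!!y. y ~: K ==> G y = 0"
  and p: "p > real DIM('a)" and z: "!!x. x \<in> V ==> (LBINT y. G y * norm (x - y) powr (- p)) = 0"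
 shows "AE y in lebesgue. G y = 0"
proof -
 obtain x where x: "x \<in> V" using KV(4) by blast
 have nz: "x - y ~= 0" if "y \<in> K" for y using that x KV(3) by auto
 define \<zeta> where "\<zeta> y = (1 / (norm (x - y))^2) *\<^sub>R (x - y)" for y
 define H where "H y = G y * norm (x - y) powr (- p)" for y
 have Gm [measurable]: "G \<in> Borel" using borel_measurable_integrable[OF G(1)] by simp
 have Hm [measurable]: "H \<in> Borel" unfolding H_def by measurable
 have H0: "H y = 0" if "y ~: K" for y using G(2)[OF that] by (simp add: H_def)
 have \<zeta>c: "continuous_on K \<zeta>" unfolding \<zeta>_def by (intro continuous_intros) (use nz in auto)
 have Hi: "integrable lborel H"
 proof -
  obtain r C where r: "r > 0" "cball x r \<subseteq> V" "compact C" "0 ~: C"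
   "!!a y. a \<in> cball x r ==> y \<in> K ==> a - y \<in> C"
   using compact_differences_away_from_0[OF KV(1-3) x] by metis
  have "continuous_on C (riesz_kernel p [])" using r(4) by (rule riesz_kernel_continuous)
  from potential_integrable[OF r(3) _ G this riesz_kernel_measurable, where x = x]
  show ?thesis using r(1) r(5)[of x] by (auto simp: H_def[abs_def] riesz_kernel_def)
 qed
 have Hk: "integrable lborel (\<lambda>y. H y * k y)" if k: "continuous_on K k" for k
 proof -
  have "compact (k ` K)" using k KV(1) compact_continuous_image by blast
  then obtain M where M: "\<forall>v\<in>k ` K. norm v <= M" using compact_imp_bounded bounded_iff by metis
  have "(\<lambda>y. indicator K y *\<^sub>R k y) \<in> Borel"
   using KV(1) k by (intro borel_measurable_continuous_on_indicator borel_compact)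
  then have "(\<lambda>y. H y * (indicator K y *\<^sub>R k y)) \<in> borel_measurable lborel" by measurable
  moreover have "H y * (indicator K y *\<^sub>R k y) = H y * k y" for y using H0 by (cases "y \<in> K") auto
  ultimately have m: "(\<lambda>y. H y * k y) \<in> borel_measurable lborel" by (simp only:)
  show ?thesis
  proof (rule bochner_bound[of _ "\<lambda>y. M * H y"])
   show "AE y in lborel. norm (H y * k y) <= norm (M * H y)"
   proof (rule AE_I2)
    fix y show "norm (H y * k y) <= norm (M * H y)"
    proof (cases "y \<in> K")
     case True
     then have "\<bar>k y\<bar> <= \<bar>M\<bar>" using M by fastforce
     then show ?thesis by (simp add: abs_mult mult.commute[of "\<bar>M\<bar>"] mult_left_mono)
    qed (use H0 in simp)
   qed
  qed (use Hi m in auto)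
 qed
 have moments: "(LBINT y. H y * inner_prod as (\<zeta> y)) = 0" for as
 proof -
  have "H y * inner_prod as (\<zeta> y) = G y * riesz_kernel (p + 2 * real (length as)) as (x - y)" for y
  proof (cases "y \<in> K")
   case True
   have "norm (x - y) powr (- (p + 2 * real (length as))) = norm (x - y) powr (- p) * norm (x - y) powr (- real (2 * length as))"
    unfolding powr_add[symmetric] by simp
   also have "norm (x - y) powr (- real (2 * length as)) = inverse (norm (x - y) ^ (2 * length as))"
    using nz[OF True] by (subst powr_minus, subst powr_realpow) auto
   also have "... = (1 / (norm (x - y))^2) ^ length as"
    by (simp add: power_mult power_divide inverse_eq_divide)
   finally show ?thesis unfolding H_def \<zeta>_def inner_prod_scale riesz_kernel_def by simp
  qed (use H0 G(2) in simp)
  then show ?thesis using riesz_moments_vanish[OF KV(1-3) G p z, of as "length as" x] x by simp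
 qed
 define P where "P k \<longleftrightarrow> continuous_on K k & (\<forall>as. (LBINT y. H y * k y * inner_prod as (\<zeta> y)) = 0)" for k
 define R where "R = {g. continuous_on K g & (\<forall>k. P k --> P (\<lambda>y. k y * g y))}"
 have Pint: "integrable lborel (\<lambda>y. H y * k y * inner_prod as (\<zeta> y))" if "continuous_on K k" for k as
 proof -
  have "continuous_on K (\<lambda>y. k y * inner_prod as (\<zeta> y))"
   by (intro continuous_intros that continuous_on_compose2[OF inner_prod_continuous[of UNIV] \<zeta>c]) auto
  from Hk[OF this] show ?thesis by (simp add: mult.assoc)
 qed
 interpret function_ring_on R K
 proof
  show "compact K" by (rule KV)
  show "continuous_on K f" if "f \<in> R" for f using that by (simp add: R_def)
  show "(\<lambda>x. f x + g x) \<in> R" if fg: "f \<in> R" "g \<in> R" for f g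
   unfolding R_def
  proof (intro CollectI conjI allI impI)
   show "continuous_on K (\<lambda>x. f x + g x)" using fg by (auto simp: R_def intro: continuous_intros)
   fix k assume "P k"
   then have pf: "P (\<lambda>y. k y * f y)" "P (\<lambda>y. k y * g y)" using fg by (auto simp: R_def)
   show "P (\<lambda>y. k y * (f y + g y))"
    unfolding P_def
   proof (intro conjI allI)
    show "continuous_on K (\<lambda>y. k y * (f y + g y))"
     using pf continuous_on_add[of K "\<lambda>y. k y * f y" "\<lambda>y. k y * g y"] by (simp add: P_def distrib_left)
    fix as
    have "(LBINT y. H y * (k y * (f y + g y)) * inner_prod as (\<zeta> y))
     = (LBINT y. H y * (k y * f y) * inner_prod as (\<zeta> y) + H y * (k y * g y) * inner_prod as (\<zeta> y))"
     by (simp add: algebra_simps)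
    also have "... = 0" using pf by (subst bochner_add) (auto simp: P_def intro: Pint)
    finally show "(LBINT y. H y * (k y * (f y + g y)) * inner_prod as (\<zeta> y)) = 0" .
   qed
  qed
  show "(\<lambda>x. f x * g x) \<in> R" if fg: "f \<in> R" "g \<in> R" for f g
   using fg by (auto simp: R_def mult.assoc[symmetric] intro: continuous_intros)
  show "(\<lambda>_. c) \<in> R" for c
  proof -
   have "P (\<lambda>y. k y * c)" if "P k" for k
   proof -
    have "(LBINT y. H y * (k y * c) * inner_prod as (\<zeta> y)) = c * (LBINT y. H y * k y * inner_prod as (\<zeta> y))" for as
     by (subst integral_mult_right_zero[symmetric]) (simp add: mult_ac)
    then show ?thesis using that by (auto simp: P_def intro: continuous_intros)
   qed
   then show ?thesis by (auto simp: R_def)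
  qed
  have coord: "(\<lambda>y. \<zeta> y \<bullet> b) \<in> R" for b
  proof -
   have c: "continuous_on K (\<lambda>y. \<zeta> y \<bullet> b)" by (intro continuous_intros \<zeta>c)
   have "P (\<lambda>y. k y * (\<zeta> y \<bullet> b))" if "P k" for k
    unfolding P_def
   proof (intro conjI allI)
    show "continuous_on K (\<lambda>y. k y * (\<zeta> y \<bullet> b))" using that c by (auto simp: P_def intro: continuous_intros)
    fix as
    have "(LBINT y. H y * (k y * (\<zeta> y \<bullet> b)) * inner_prod as (\<zeta> y)) = (LBINT y. H y * k y * inner_prod (b # as) (\<zeta> y))"
     by (simp add: mult_ac)
    then show "(LBINT y. H y * (k y * (\<zeta> y \<bullet> b)) * inner_prod as (\<zeta> y)) = 0"
     using that by (simp only: P_def)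
   qed
   then show ?thesis using c by (auto simp: R_def)
  qed
  show "\<exists>f\<in>R. f y ~= f y'" if "y \<in> K" "y' \<in> K" "y ~= y'" for y y'
  proof (rule ccontr)
   assume "\<not> ?thesis"
   then have all: "\<forall>f\<in>R. f y = f y'" by blast
   have eq: "\<zeta> y = \<zeta> y'" by (rule euclidean_eqI) (rule bspec[OF all coord])
   have inv: "(1 / (norm (\<zeta> y))^2) *\<^sub>R \<zeta> y = x - y" if "y \<in> K" for y
   proof -
    have N: "norm (x - y) ~= 0" using nz[OF that] by simp
    have n: "norm (\<zeta> y) = 1 / norm (x - y)" unfolding \<zeta>_def norm_scaleR using N by (simp add: power2_eq_square)
    have "(1 / (1 / norm (x - y))^2) * (1 / (norm (x - y))^2) = 1" using N by (simp add: power_divide)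
    then show ?thesis unfolding n unfolding \<zeta>_def scaleR_scaleR by (simp only: scaleR_one)
   qed
   have "x - y = x - y'" 
    by (rule trans[OF inv[OF that(1), symmetric, unfolded eq] inv[OF that(2)]])
   then show False using that(3) by simp
  qed
 qed
 have P1: "P (\<lambda>_. 1)" using moments by (simp add: P_def)
 have test: "(LINT y|lebesgue. H y * \<psi> y) = 0" if \<psi>: "\<psi> \<in> test_functions UNIV" for \<psi>
 proof -
  have c: "continuous_on UNIV \<psi>" and [measurable]: "\<psi> \<in> Borel"
   using test_function_L2[OF \<psi>] by auto
  have cK: "continuous_on K \<psi>" using c continuous_on_subset by blast
  have "\<bar>LBINT y. H y * \<psi> y\<bar> <= e * (LBINT y. \<bar>H y\<bar>)" if e: "e > 0" for e
  proof -
   obtain g where g: "g \<in> R" "!!y. y \<in> K ==> \<bar>\<psi> y - g y\<bar> < e" using Stone_Weierstrass_basic[OF cK e] by blast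
   have gK: "continuous_on K g" using g by (simp add: R_def)
   have "(LBINT y. H y * g y) = 0"
   proof -
    have "P (\<lambda>y. 1 * g y)" using g(1) P1 unfolding R_def by blast
    then have "(LBINT y. H y * (1 * g y) * inner_prod [] (\<zeta> y)) = 0" unfolding P_def by blast
    then show ?thesis by simp
   qed
   then have "(LBINT y. H y * \<psi> y) = (LBINT y. H y * \<psi> y - H y * g y)"
    by (subst bochner_diff) (auto intro: Hk cK gK)
   also have "\<bar>\<dots>\<bar> <= (LBINT y. \<bar>H y * \<psi> y - H y * g y\<bar>)" by (rule integral_abs_bound)
   also have "... <= (LBINT y. e * \<bar>H y\<bar>)"
   proof (rule integral_mono)
    show "integrable lborel (\<lambda>y. \<bar>H y * \<psi> y - H y * g y\<bar>)"
     by (intro integrable_abs bochner_integrable_diff Hk cK gK)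
    show "integrable lborel (\<lambda>y. e * \<bar>H y\<bar>)" using Hi by auto
    show "\<bar>H y * \<psi> y - H y * g y\<bar> <= e * \<bar>H y\<bar>" for y
    proof (cases "y \<in> K")
     case True
     have "\<bar>H y * \<psi> y - H y * g y\<bar> = \<bar>\<psi> y - g y\<bar> * \<bar>H y\<bar>"
      by (simp add: abs_mult[symmetric] algebra_simps)
     also have "... <= e * \<bar>H y\<bar>" using g(2)[OF True] by (intro mult_right_mono) auto
     finally show ?thesis .
    qed (use H0 in simp)
   qed
   also have "... = e * (LBINT y. \<bar>H y\<bar>)" by simp
   finally show ?thesis .
  qed
  note small = this
  have "\<bar>LBINT y. H y * \<psi> y\<bar> <= 0"
  proof (rule field_le_epsilon)
   fix e :: real assume e: "e > 0"
   let ?I = "LBINT y. \<bar>H y\<bar>"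
   have I0: "?I >= 0" by simp
   have "e / (I + 1) * I <= e" if "I >= 0" for I :: real
   proof -
    have "e * I <= e * (I + 1)" using e by (intro mult_left_mono) auto
    then show ?thesis using that by (simp add: pos_divide_le_eq)
   qed
   from this[OF I0] have "e / (?I + 1) * ?I <= e" .
   moreover have "e / (?I + 1) > 0" by (rule divide_pos_pos[OF e]) (rule add_nonneg_pos[OF I0], simp)
   ultimately show "\<bar>LBINT y. H y * \<psi> y\<bar> <= 0 + e" using small[of "e / (?I + 1)"] by linarith
  qed
  then have "(LBINT y. H y * \<psi> y) = 0" by simp
  then show ?thesis by (subst integral_completion) auto
 qed
 have "AE y in lebesgue. y \<in> UNIV --> H y = 0"
 proof (rule test_functions_separate[OF open_UNIV _ test])
  fix a c :: 'a
  have "integrable lborel (\<lambda>y. indicator (cbox a c) y * H y)"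
   using integrable_real_mult_indicator[of "cbox a c" lborel H] Hi by (simp add: mult.commute)
  then show "integrable lebesgue (\<lambda>y. indicator (cbox a c) y * H y)" by (subst integrable_completion) auto
 qed
 then show ?thesis
 proof eventually_elim
  case (elim y)
  show ?case
  proof (cases "y \<in> K")
   case True
   then show ?thesis using elim nz[OF True] by (simp add: H_def)
  qed (rule G(2))
 qed
qed

text \<open>The potential is continuous off \<open>K\<close>, so vanishing against test functions means vanishing pointwise.\<close>

lemma riesz_potential_unique_continuation_weak:
 fixes G :: "'a::euclidean_space => real"
 assumes KV: "compact K" "open V" "V \<inter> K = {}" "V ~= {}" and G: "integrable lborel G" "!!y. y ~: K ==> G y = 0"
  and p: "p > real DIM('a)"
  and z: "!!\<psi>. \<psi> \<in> test_functions V ==> (LBINT x. (LBINT y. G y * norm (x - y) powr (- p)) * \<psi> x) = 0"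
 shows "AE y in lebesgue. G y = 0"
proof (rule riesz_potential_unique_continuation[OF KV G p])
 let ?U = "\<lambda>x. LBINT y. G y * norm (x - y) powr (- p)"
 have Gm [measurable]: "G \<in> Borel" using borel_measurable_integrable[OF G(1)] by simp
 have [measurable]: "?U \<in> Borel" by measurable
 have fc: "continuous_on (- {0}) (\<lambda>w::'a. norm w powr (- p))" by (intro continuous_intros) auto
 have lim: "(\<lambda>n. ?U (X n)) ----> ?U x" if "x \<in> V" "X ----> x" for X x
  by (rule potential_tendsto[OF KV(1-3) G fc _ that]) measurable
 have cont: "continuous_on V ?U"
  unfolding continuous_on_sequentially using lim by (auto simp: comp_def)
 have "AE x in lebesgue. x \<in> V --> ?U x = 0"
 proof (rule test_functions_separate[OF KV(2)])
  fix a c assume sub: "cbox a c \<subseteq> V"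
  have "(\<lambda>x. indicator (cbox a c) x *\<^sub>R ?U x) \<in> Borel" by measurable
  have "integrable lborel (\<lambda>x. indicator (cbox a c) x *\<^sub>R ?U x)"
   using borel_integrable_compact[of "cbox a c" ?U] continuous_on_subset[OF cont sub] by simp
  then show "integrable lebesgue (\<lambda>x. indicator (cbox a c) x * ?U x)" by (subst integrable_completion) auto
 next
  fix \<psi> assume \<psi>: "\<psi> \<in> test_functions V"
  note test_function_L2(1)[OF \<psi>, measurable]
  show "(LINT x|lebesgue. ?U x * \<psi> x) = 0" using z[OF \<psi>] by (subst integral_completion) auto
 qed
 then have ae: "AE x\<in>V in lebesgue. x \<in> closure {x \<in> V. ?U x = 0}"
 proof eventually_elim
  case (elim x)
  then show ?case using subsetD[OF closure_subset, of x "{x \<in> V. ?U x = 0}"] by simp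
 qed
 fix x assume x: "x \<in> V"
 have "x \<in> closure {x \<in> V. ?U x = 0}"
  by (rule mem_closed_if_AE_lebesgue_open[OF KV(2) closed_closure ae x])
 then obtain X where X: "!!n. X n \<in> {x \<in> V. ?U x = 0}" "X ----> x" unfolding closure_sequential by blast
 have "(\<lambda>n. ?U (X n)) ----> ?U x" by (rule lim[OF x X(2)])
 moreover have "?U (X n) = 0" for n using X(1)[of n] by simp
 ultimately show "?U x = 0" by (simp add: LIMSEQ_const_iff)
qed

section \<open>Plancherel identity for integrable functions\<close>

definition gauss :: "'a::euclidean_space => real" where
 "gauss w = exp (- ((norm w)^2 / 2))"

definition fint :: "('a::euclidean_space => complex) => 'a => complex" where
 "fint f \<xi> = (LBINT x. exp (- \<i> * of_real (x \<bullet> \<xi>)) * f x)"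

lemma gauss_measurable [measurable]: "gauss \<in> Borel"
 unfolding gauss_def[abs_def] by measurable

lemma gauss_pos: "gauss w > 0" and gauss_le_1: "gauss w <= 1" and gauss_abs_le_1: "\<bar>gauss w\<bar> <= 1"
 by (auto simp: gauss_def)

lemma cnj_measurable [measurable]: "cnj \<in> Borel"
 by (intro borel_measurable_continuous_onI continuous_intros)

text \<open>The characteristic function of the standard normal distribution, in the present normalisation.\<close>

lemma gaussian_fourier_real:
 "integrable lborel (\<lambda>x::real. exp (- \<i> * of_real (t * x)) * of_real (exp (- (x^2 / 2))))"
 "(LINT x::real|lborel. exp (- \<i> * of_real (t * x)) * of_real (exp (- (x^2 / 2)))) = of_real (sqrt (2 * pi) * exp (- (t^2 / 2)))"
proof -
 have e: "exp (- \<i> * of_real (t * x)) * of_real (exp (- (x^2 / 2)))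
   = of_real (sqrt (2 * pi)) * (std_normal_density x *\<^sub>R iexp ((- t) * x))" for x :: real
 proof -
  have "exp (- (x^2 / 2)) = sqrt (2 * pi) * std_normal_density x"
   unfolding std_normal_density_def by simp
  then show ?thesis by (simp add: scaleR_conv_of_real mult_ac)
 qed
 have n1: "integrable lborel (\<lambda>x. std_normal_density x *\<^sub>R iexp ((- t) * x))"
 proof (rule bochner_bound[of _ std_normal_density])
  show "integrable lborel std_normal_density" by simp
 qed (auto simp: norm_exp_i_times)
 show "integrable lborel (\<lambda>x::real. exp (- \<i> * of_real (t * x)) * of_real (exp (- (x^2 / 2))))"
  unfolding e using n1 by (rule integrable_mult_right)
 have "char std_normal_distribution (- t) = (LBINT x. std_normal_density x *\<^sub>R iexp ((- t) * x))"
  unfolding char_def by (rule integral_density) auto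
 then have I: "(LBINT x. std_normal_density x *\<^sub>R iexp ((- t) * x)) = complex_of_real (exp (- (t^2) / 2))"
  by (simp add: char_std_normal_distribution)
 show "(LINT x::real|lborel. exp (- \<i> * of_real (t * x)) * of_real (exp (- (x^2 / 2)))) = of_real (sqrt (2 * pi) * exp (- (t^2 / 2)))"
  unfolding e integral_mult_right_zero I by simp
qed

lemma lborel_integral_prod:
 fixes f :: "'a::euclidean_space => real => complex"
 assumes f: "!!b. b \<in> Basis ==> integrable lborel (f b)"
 shows "integrable lborel (\<lambda>x::'a. \<Prod>b\<in>Basis. f b (x \<bullet> b))"
  "(LBINT x. (\<Prod>b\<in>Basis. f b (x \<bullet> b))) = (\<Prod>b\<in>Basis. LBINT t. f b t)"
proof -
 interpret product_sigma_finite "\<lambda>_::'a. lborel :: real measure" ..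
 have [measurable]: "f b \<in> Borel" if "b \<in> Basis" for b
  using borel_measurable_integrable[OF f[OF that]] by simp
 have m [measurable]: "(\<lambda>x::'a. \<Prod>b\<in>Basis. f b (x \<bullet> b)) \<in> Borel" by measurable
 let ?T = "\<lambda>g. \<Sum>b\<in>Basis. g b *\<^sub>R (b::'a)"
 have T [measurable]: "?T \<in> (\<Pi>\<^sub>M b\<in>Basis. lborel) \<rightarrow>\<^sub>M borel" by measurable
 have e: "(\<Prod>b\<in>Basis. f b (?T g \<bullet> b)) = (\<Prod>b\<in>Basis. f b (g b))" for g
  by (intro prod.cong) auto
 have "integrable (\<Pi>\<^sub>M b\<in>Basis. lborel) (\<lambda>g. \<Prod>b\<in>Basis. f b (g b))"
  by (rule product_integrable_prod) (auto intro: f)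
 then show "integrable lborel (\<lambda>x::'a. \<Prod>b\<in>Basis. f b (x \<bullet> b))"
  by (subst lborel_eq, subst integrable_distr_eq[OF T m]) (simp only: e)
 have "(LBINT x. (\<Prod>b\<in>Basis. f b (x \<bullet> b))) = integral\<^sup>L (\<Pi>\<^sub>M b\<in>Basis. lborel) (\<lambda>g. \<Prod>b\<in>Basis. f b (g b))"
  by (subst lborel_eq, subst integral_distr[OF T m]) (simp only: e)
 also have "... = (\<Prod>b\<in>Basis. LBINT t. f b t)"
  by (rule product_integral_prod) (auto intro: f)
 finally show "(LBINT x. (\<Prod>b\<in>Basis. f b (x \<bullet> b))) = (\<Prod>b\<in>Basis. LBINT t. f b t)" .
qed

lemma gaussian_fourier:
 fixes z :: "'a::euclidean_space"
 shows "integrable lborel (\<lambda>\<xi>::'a. exp (- \<i> * of_real (\<xi> \<bullet> z)) * of_real (gauss \<xi>))"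
  "fint (\<lambda>\<xi>. of_real (gauss \<xi>)) z = of_real (sqrt (2 * pi) ^ DIM('a) * gauss z)"
proof -
 have sq: "(norm w)^2 / 2 = (\<Sum>b\<in>Basis. (w \<bullet> b)^2 / 2)" for w :: 'a
  unfolding power2_norm_eq_inner by (subst euclidean_inner) (simp add: power2_eq_square sum_divide_distrib)
 have e: "exp (- \<i> * of_real (\<xi> \<bullet> z)) * of_real (gauss \<xi>)
   = (\<Prod>b\<in>Basis. exp (- \<i> * of_real ((z \<bullet> b) * (\<xi> \<bullet> b))) * of_real (exp (- ((\<xi> \<bullet> b)^2 / 2))))" for \<xi> :: 'a
 proof -
  have "exp (- \<i> * of_real (\<xi> \<bullet> z)) = (\<Prod>b\<in>Basis. exp (- \<i> * of_real ((z \<bullet> b) * (\<xi> \<bullet> b))))"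
   by (subst euclidean_inner) (simp add: exp_sum[symmetric] sum_distrib_left sum_negf mult_ac)
  moreover have "gauss \<xi> = (\<Prod>b\<in>Basis. exp (- ((\<xi> \<bullet> b)^2 / 2)))"
   unfolding gauss_def sq by (simp add: exp_sum[symmetric] sum_negf)
  ultimately show ?thesis by (simp add: prod.distrib)
 qed
 show "integrable lborel (\<lambda>\<xi>::'a. exp (- \<i> * of_real (\<xi> \<bullet> z)) * of_real (gauss \<xi>))"
  unfolding e by (rule lborel_integral_prod(1)) (rule gaussian_fourier_real(1))
 have "fint (\<lambda>\<xi>. of_real (gauss \<xi>)) z = (\<Prod>b\<in>Basis. of_real (sqrt (2 * pi) * exp (- ((z \<bullet> b)^2 / 2))))"
  unfolding fint_def e by (subst lborel_integral_prod(2)) (simp_all only: gaussian_fourier_real)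
 also have "... = of_real (\<Prod>b\<in>(Basis::'a set). sqrt (2 * pi) * exp (- ((z \<bullet> b)^2 / 2)))"
  by (rule of_real_prod[symmetric])
 also have "(\<Prod>b\<in>(Basis::'a set). sqrt (2 * pi) * exp (- ((z \<bullet> b)^2 / 2))) = sqrt (2 * pi) ^ DIM('a) * gauss z"
  unfolding gauss_def sq by (simp add: prod.distrib exp_sum[symmetric] sum_negf)
 finally show "fint (\<lambda>\<xi>. of_real (gauss \<xi>)) z = of_real (sqrt (2 * pi) ^ DIM('a) * gauss z)" .
qed

lemma sqrt_2pi_power: "sqrt (2 * pi) ^ n * sqrt (2 * pi) ^ n = (2 * pi) ^ n"
 unfolding power_mult_distrib[symmetric] by simp

lemma gauss_integrable: "integrable lborel (gauss :: 'a::euclidean_space => real)"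
proof -
 have "integrable lborel (\<lambda>\<xi>::'a. complex_of_real (gauss \<xi>))" using gaussian_fourier(1)[of "0::'a"] by simp
 then show ?thesis by (simp add: complex_of_real_integrable_eq)
qed

lemma gauss_integral: "(LINT x::'a::euclidean_space|lborel. gauss x) = sqrt (2 * pi) ^ DIM('a)"
proof -
 have "complex_of_real (LINT x::'a|lborel. gauss x) = of_real (sqrt (2 * pi) ^ DIM('a))"
  using gaussian_fourier(2)[of "0::'a"] by (simp add: fint_def gauss_def[of 0] integral_complex_of_real)
 then show ?thesis by (simp only: of_real_eq_iff)
qed

lemma lborel_integral_affine:
 fixes f :: "'a::euclidean_space => 'b::{banach, second_countable_topology}"
 assumes [measurable]: "f \<in> Borel" and c: "c ~= 0"
 shows "(LBINT x. f x) = \<bar>c\<bar> ^ DIM('a) *\<^sub>R (LBINT x. f (t + c *\<^sub>R x))"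
 by (subst lborel_affine[OF c, of t]) (simp add: integral_density integral_distr)

lemma lborel_nn_integral_affine:
 fixes f :: "'a::euclidean_space => ennreal"
 assumes [measurable]: "f \<in> Borel" and c: "c ~= 0"
 shows "(\<integral>+x. f x) = ennreal (\<bar>c\<bar> ^ DIM('a)) * (\<integral>+x. f (t + c *\<^sub>R x))"
 by (subst lborel_affine[OF c, of t]) (simp add: nn_integral_density nn_integral_distr nn_integral_cmult)

lemma lborel_nn_integral_translation:
 fixes f :: "'a::euclidean_space => ennreal"
 assumes "f \<in> Borel"
 shows "(\<integral>+x. f (t + x)) = (\<integral>+x. f x)"
 using lborel_nn_integral_affine[OF assms, of 1 t] by simp

lemma lborel_nn_integral_reflect:
 fixes f :: "'a::euclidean_space => ennreal"
 assumes "f \<in> Borel"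
 shows "(\<integral>+x. f (t - x)) = (\<integral>+x. f x)"
 using lborel_nn_integral_affine[OF assms, of "-1" t] by simp

lemma lborel_integrable_affine:
 fixes f :: "'a::euclidean_space => 'b::{banach, second_countable_topology}"
 assumes f: "integrable lborel f" and c: "c ~= 0"
 shows "integrable lborel (\<lambda>x. f (t + c *\<^sub>R x))"
proof -
 have m [measurable]: "f \<in> Borel" using borel_measurable_integrable[OF f] by simp
 have "(\<integral>+x. ennreal (norm (f x))) = ennreal (\<bar>c\<bar> ^ DIM('a)) * (\<integral>+x. ennreal (norm (f (t + c *\<^sub>R x))))"
  by (rule lborel_nn_integral_affine[OF _ c]) measurable
 moreover have "(\<integral>+x. ennreal (norm (f x))) < \<infinity>" using f by (simp add: integrable_iff_bounded)
 ultimately have "(\<integral>+x. ennreal (norm (f (t + c *\<^sub>R x)))) < \<infinity>"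
  using c by (auto simp: ennreal_mult_less_top)
 then show ?thesis by (simp add: integrable_iff_bounded)
qed

lemma fourier_kernel_integrable:
 fixes f :: "'a::euclidean_space => complex"
 assumes "integrable lborel f"
 shows "integrable lborel (\<lambda>x. exp (- \<i> * of_real (x \<bullet> \<xi>)) * f x)"
proof (rule bochner_bound[OF assms])
 show "(\<lambda>x. exp (- \<i> * of_real (x \<bullet> \<xi>)) * f x) \<in> borel_measurable lborel"
  using borel_measurable_integrable[OF assms] by measurable
qed (simp add: norm_mult)

lemma fint_measurable [measurable]:
 assumes [measurable]: "f \<in> Borel"
 shows "fint f \<in> Borel"
 unfolding fint_def[abs_def] by measurable

lemma fint_bound:
 assumes "integrable lborel f" shows "norm (fint f \<xi>) <= (LBINT x. norm (f x))"
proof -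
 have "norm (fint f \<xi>) <= (LBINT x. norm (exp (- \<i> * of_real (x \<bullet> \<xi>)) * f x))"
  unfolding fint_def by (rule integral_norm_bound)
 then show ?thesis by (simp add: norm_mult)
qed

lemma integrable_product_kernel:
 fixes f g :: "'a::euclidean_space => complex" and k :: "'a => 'a => complex"
 assumes f: "integrable lborel f" and g: "integrable lborel g"
  and k: "(\<lambda>(x, y). k x y) \<in> borel_measurable (borel \<Otimes>\<^sub>M borel)" "!!x y. norm (k x y) <= 1"
 shows "integrable (lborel \<Otimes>\<^sub>M lborel) (\<lambda>(x, y). f x * (k x y * g y))"
proof (rule lborel_pair.Fubini_integrable)
 have [measurable]: "f \<in> Borel" "g \<in> Borel"
  using borel_measurable_integrable[OF f] borel_measurable_integrable[OF g] by simp_all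
 note k(1)[measurable]
 show m: "(\<lambda>(x, y). f x * (k x y * g y)) \<in> borel_measurable (lborel \<Otimes>\<^sub>M lborel)" by measurable
 have ki: "integrable lborel (\<lambda>y. k x y * g y)" for x
 proof (rule bochner_bound[OF g])
  show "AE y in lborel. norm (k x y * g y) <= norm (g y)"
   using k(2) by (intro AE_I2) (simp add: norm_mult mult_left_le_one_le)
 qed measurable
 then show "AE x in lborel. integrable lborel (\<lambda>y. case (x, y) of (x, y) => f x * (k x y * g y))"
  by (intro AE_I2) auto
 show "integrable lborel (\<lambda>x. LBINT y. norm (case (x, y) of (x, y) => f x * (k x y * g y)))"
 proof (rule bochner_bound[of _ "\<lambda>x. norm (f x) * (LBINT y. norm (g y))"])
  show "integrable lborel (\<lambda>x. norm (f x) * (LBINT y. norm (g y)))" using f by auto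
  show "AE x in lborel. norm (LBINT y. norm (case (x, y) of (x, y) => f x * (k x y * g y)))
    <= norm (norm (f x) * (LBINT y. norm (g y)))"
  proof (rule AE_I2)
   fix x
   have "(LBINT y. norm (k x y * g y)) <= (LBINT y. norm (g y))"
    by (intro integral_mono integrable_norm ki g) (use k(2) in \<open>simp add: norm_mult mult_left_le_one_le\<close>)
   moreover have "0 <= (LBINT y. norm (k x y * g y))" "0 <= (LBINT y. norm (g y))" by simp_all
   moreover have "(LBINT y. norm (case (x, y) of (x, y) => f x * (k x y * g y))) = norm (f x) * (LBINT y. norm (k x y * g y))"
    by (simp add: norm_mult)
   ultimately show "norm (LBINT y. norm (case (x, y) of (x, y) => f x * (k x y * g y)))
    <= norm (norm (f x) * (LBINT y. norm (g y)))"
    by (simp add: mult_left_mono)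
  qed
 qed measurable
qed

lemma kernel_swap:
 fixes f g :: "'a::euclidean_space => complex" and k :: "'a => 'a => complex"
 assumes f: "integrable lborel f" and g: "integrable lborel g"
  and k: "(\<lambda>(x, y). k x y) \<in> borel_measurable (borel \<Otimes>\<^sub>M borel)" "!!x y. norm (k x y) <= 1"
 shows "(LBINT x. f x * (LBINT y. k x y * g y)) = (LBINT y. (LBINT x. k x y * f x) * g y)"
proof -
 have "(LBINT y. LBINT x. f x * (k x y * g y)) = (LBINT x. LBINT y. f x * (k x y * g y))"
  by (rule lborel_pair.Fubini_integral[OF integrable_product_kernel[OF assms]])
 moreover have "(LBINT y. f x * (k x y * g y)) = f x * (LBINT y. k x y * g y)" for x
  by simp
 moreover have "(LBINT x. f x * (k x y * g y)) = (LBINT x. k x y * f x) * g y" for y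
 proof -
  have "(LBINT x. f x * (k x y * g y)) = (LBINT x. (k x y * f x) * g y)" by (simp add: mult_ac)
  then show ?thesis by simp
 qed
 ultimately show ?thesis by simp
qed

lemma fint_multiplication:
 assumes f: "integrable lborel f" and g: "integrable lborel g"
 shows "(LBINT x. fint f x * g x) = (LBINT x. f x * fint g x)"
proof -
 have "(LBINT x. f x * (LBINT y. exp (- \<i> * of_real (y \<bullet> x)) * g y))
   = (LBINT y. (LBINT x. exp (- \<i> * of_real (y \<bullet> x)) * f x) * g y)"
  by (rule kernel_swap[OF f g]) (auto simp del: mult_minus_left)
 moreover have "(LBINT x. exp (- \<i> * of_real (y \<bullet> x)) * f x) = fint f y" for y
  unfolding fint_def by (simp add: inner_commute)
 ultimately show ?thesis by (simp only: fint_def[of g])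
qed

lemma fint_gauss_scaled:
 fixes z :: "'a::euclidean_space"
 assumes "\<delta> > 0"
 shows "(LBINT \<xi>. exp (- \<i> * of_real (z \<bullet> \<xi>)) * of_real (gauss (\<delta> *\<^sub>R \<xi>)))
  = of_real (sqrt (2 * pi) ^ DIM('a) * gauss ((1 / \<delta>) *\<^sub>R z) / \<delta> ^ DIM('a))"
proof -
 let ?h = "\<lambda>\<xi>. exp (- \<i> * of_real (((1 / \<delta>) *\<^sub>R z) \<bullet> \<xi>)) * complex_of_real (gauss \<xi>)"
 have "(LBINT \<xi>. ?h \<xi>) = \<bar>\<delta>\<bar> ^ DIM('a) *\<^sub>R (LBINT \<xi>. ?h (0 + \<delta> *\<^sub>R \<xi>))"
  using assms by (intro lborel_integral_affine) measurable
 moreover have "?h (0 + \<delta> *\<^sub>R \<xi>) = exp (- \<i> * of_real (z \<bullet> \<xi>)) * of_real (gauss (\<delta> *\<^sub>R \<xi>))" for \<xi>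
  using assms by simp
 moreover have "(LBINT \<xi>. ?h \<xi>) = fint (\<lambda>\<xi>. of_real (gauss \<xi>)) ((1 / \<delta>) *\<^sub>R z)"
  unfolding fint_def by (simp add: inner_commute)
 ultimately show ?thesis using assms unfolding gaussian_fourier(2)
  by (simp add: scaleR_conv_of_real field_simps)
qed

text \<open>Integrating over \<open>w\<close> gives a Gaussian average of the autocorrelation of \<open>f\<close> at scale \<open>\<delta>\<close>, which tends to
\<open>(2\<pi>)\<^sup>n \<parallel>f\<parallel>\<^sup>2\<close> as \<open>\<delta>\<close> tends to 0.\<close>

definition autocorr :: "real => ('a::euclidean_space => complex) => 'a \<times> 'a => complex" where
 "autocorr \<delta> f = (\<lambda>(x, w). f x * cnj (f (x - \<delta> *\<^sub>R w)) * of_real (sqrt (2 * pi) ^ DIM('a) * gauss w))"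

lemma autocorr_measurable [measurable]:
 assumes [measurable]: "f \<in> Borel"
 shows "autocorr \<delta> f \<in> borel_measurable (borel \<Otimes>\<^sub>M borel)"
 unfolding autocorr_def split_beta by measurable

lemma autocorr_norm_bound:
 fixes f :: "'a::euclidean_space => complex"
 assumes [measurable]: "f \<in> Borel" and f2: "(\<integral>+x. ennreal ((norm (f x))^2)) = ennreal N" and N: "N >= 0"
 shows "(\<integral>\<^sup>+z. ennreal (norm (autocorr \<delta> f z)) \<partial>(lborel \<Otimes>\<^sub>M lborel)) <= ennreal ((2 * pi) ^ DIM('a) * N)"
proof -
 let ?c = "sqrt (2 * pi) ^ DIM('a)"
 have c0: "?c >= 0" by simp
 have "(\<integral>\<^sup>+z. ennreal (norm (autocorr \<delta> f z)) \<partial>(lborel \<Otimes>\<^sub>M lborel))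
   <= (\<integral>\<^sup>+z. (case z of (x, w) => ennreal ((1/2) * ?c * gauss w) * (ennreal ((norm (f x))^2) + ennreal ((norm (f (x - \<delta> *\<^sub>R w)))^2))) \<partial>(lborel \<Otimes>\<^sub>M lborel))"
 proof (rule nn_integral_mono, clarify)
  fix x w
  have "norm (autocorr \<delta> f (x, w)) = norm (f x) * norm (f (x - \<delta> *\<^sub>R w)) * (?c * gauss w)"
   using gauss_pos[of w] by (simp add: autocorr_def norm_mult norm_power)
  also have "... <= (1/2) * ((norm (f x))^2 + (norm (f (x - \<delta> *\<^sub>R w)))^2) * (?c * gauss w)"
   using sum_squares_bound[of "norm (f x)" "norm (f (x - \<delta> *\<^sub>R w))"] gauss_pos[of w]
   by (intro mult_right_mono) auto
  also have "... = (1/2) * ?c * gauss w * ((norm (f x))^2 + (norm (f (x - \<delta> *\<^sub>R w)))^2)" by simp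
  finally show "ennreal (norm (autocorr \<delta> f (x, w)))
   <= ennreal ((1/2) * ?c * gauss w) * (ennreal ((norm (f x))^2) + ennreal ((norm (f (x - \<delta> *\<^sub>R w)))^2))"
   using gauss_pos[of w] by (simp add: ennreal_mult[symmetric] ennreal_plus[symmetric] ennreal_leI del: ennreal_plus)
 qed
 also have "... = (\<integral>+w. \<integral>+x. ennreal ((1/2) * ?c * gauss w) * (ennreal ((norm (f x))^2) + ennreal ((norm (f (x - \<delta> *\<^sub>R w)))^2)))"
  by (subst lborel_pair.nn_integral_snd[symmetric]) auto
 also have "... = (\<integral>\<^sup>+w. ennreal ((1/2) * ?c * gauss w) * (ennreal N + ennreal N) \<partial>(lborel::'a measure))"
 proof (rule nn_integral_cong)
  fix w :: 'a
  have "(\<integral>+x. ennreal ((norm (f (x - \<delta> *\<^sub>R w)))^2)) = ennreal N"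
   using lborel_nn_integral_translation[of "\<lambda>x. ennreal ((norm (f x))^2)" "- \<delta> *\<^sub>R w"] f2 by simp
  then show "(\<integral>+x. ennreal ((1/2) * ?c * gauss w) * (ennreal ((norm (f x))^2) + ennreal ((norm (f (x - \<delta> *\<^sub>R w)))^2)))
    = ennreal ((1/2) * ?c * gauss w) * (ennreal N + ennreal N)"
   by (simp add: nn_integral_cmult nn_integral_add f2)
 qed
 also have "... = (\<integral>\<^sup>+w. ennreal (?c * N * gauss w) \<partial>(lborel::'a measure))"
 proof (rule nn_integral_cong)
  fix w :: 'a
  have g0: "0 <= (1/2) * ?c * gauss w" using gauss_pos[of w] by simp
  have "ennreal ((1/2) * ?c * gauss w) * (ennreal N + ennreal N) = ennreal (((1/2) * ?c * gauss w) * (N + N))"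
   unfolding ennreal_plus[OF N N, symmetric] by (rule ennreal_mult[symmetric]) (use g0 N in auto)
  also have "((1/2) * ?c * gauss w) * (N + N) = ?c * N * gauss w" by simp
  finally show "ennreal ((1/2) * ?c * gauss w) * (ennreal N + ennreal N) = ennreal (?c * N * gauss w)" .
 qed
 also have "... = ennreal (LINT w::'a|lborel. ?c * N * gauss w)"
  using N gauss_integrable gauss_pos[THEN less_imp_le]
  by (intro nn_integral_eq_integral) (auto intro!: AE_I2 mult_nonneg_nonneg)
 also have "(LINT w::'a|lborel. ?c * N * gauss w) = (2 * pi) ^ DIM('a) * N"
  unfolding integral_mult_right_zero gauss_integral sqrt_2pi_power[symmetric] by simp
 finally show ?thesis .
qed

text \<open>The Gaussian factor makes \<open>|F f|\<^sup>2\<close> integrable, so that the multiplication formula applies to \<open>f\<close> and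
the conjugate of \<open>F f\<close> times the Gaussian.\<close>

lemma regularised_plancherel:
 fixes f :: "'a::euclidean_space => complex"
 assumes f: "integrable lborel f" and fm [measurable]: "f \<in> Borel"
  and f2: "(\<integral>+x. ennreal ((norm (f x))^2)) = ennreal N" and N: "N >= 0" and \<delta>: "\<delta> > 0"
 shows "integrable lborel (\<lambda>\<xi>. (norm (fint f \<xi>))^2 * gauss (\<delta> *\<^sub>R \<xi>))"
  "complex_of_real (LBINT \<xi>. (norm (fint f \<xi>))^2 * gauss (\<delta> *\<^sub>R \<xi>)) = (LINT z|(lborel \<Otimes>\<^sub>M lborel). autocorr \<delta> f z)"
proof -
 let ?c = "sqrt (2 * pi) ^ DIM('a)"
 have gi: "integrable lborel (\<lambda>\<xi>::'a. complex_of_real (gauss (\<delta> *\<^sub>R \<xi>)))"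
  using lborel_integrable_affine[OF gauss_integrable, of \<delta> "0::'a"] \<delta> by simp
 let ?M = "LBINT x. norm (f x)"
 show i1: "integrable lborel (\<lambda>\<xi>. (norm (fint f \<xi>))^2 * gauss (\<delta> *\<^sub>R \<xi>))"
 proof (rule bochner_bound[of _ "\<lambda>\<xi>. ?M^2 * gauss (\<delta> *\<^sub>R \<xi>)"])
  show "integrable lborel (\<lambda>\<xi>::'a. ?M^2 * gauss (\<delta> *\<^sub>R \<xi>))"
   using lborel_integrable_affine[OF gauss_integrable, of \<delta> "0::'a"] \<delta> by simp
  show "AE \<xi> in lborel. norm ((norm (fint f \<xi>))^2 * gauss (\<delta> *\<^sub>R \<xi>)) <= norm (?M^2 * gauss (\<delta> *\<^sub>R \<xi>))"
   using fint_bound[OF f] gauss_pos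
   by (intro AE_I2) (auto simp: abs_mult intro!: mult_right_mono power_mono)
 qed measurable
 let ?h = "\<lambda>\<xi>. cnj (fint f \<xi>) * of_real (gauss (\<delta> *\<^sub>R \<xi>))"
 have hi: "integrable lborel ?h"
 proof (rule bochner_bound[of _ "\<lambda>\<xi>. ?M * gauss (\<delta> *\<^sub>R \<xi>)"])
  show "integrable lborel (\<lambda>\<xi>::'a. ?M * gauss (\<delta> *\<^sub>R \<xi>))"
   using lborel_integrable_affine[OF gauss_integrable, of \<delta> "0::'a"] \<delta> by simp
  show "AE \<xi> in lborel. norm (?h \<xi>) <= norm (?M * gauss (\<delta> *\<^sub>R \<xi>))"
   using fint_bound[OF f] gauss_pos
   by (intro AE_I2) (auto simp: abs_mult norm_mult intro!: mult_right_mono)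
 qed measurable
 have fh: "fint ?h x = (LBINT w. cnj (f (x - \<delta> *\<^sub>R w)) * of_real (?c * gauss w))" for x
 proof -
  have cf: "integrable lborel (\<lambda>y. cnj (f y))" using f by (rule integrable_cnj)
  have c1: "cnj (fint f \<xi>) = (LBINT y. exp (\<i> * of_real (y \<bullet> \<xi>)) * cnj (f y))" for \<xi>
   unfolding fint_def Bochner_Integration.integral_cnj[symmetric] by (simp add: exp_cnj)
  have "fint ?h x = (LBINT \<xi>. of_real (gauss (\<delta> *\<^sub>R \<xi>)) * (LBINT y. exp (- \<i> * of_real ((x - y) \<bullet> \<xi>)) * cnj (f y)))"
   unfolding fint_def[of ?h]
  proof (intro bochner_cong refl)
   fix \<xi>
   have "exp (- \<i> * of_real (\<xi> \<bullet> x)) * cnj (fint f \<xi>) = (LBINT y. exp (- \<i> * of_real (\<xi> \<bullet> x)) * (exp (\<i> * of_real (y \<bullet> \<xi>)) * cnj (f y)))"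
    unfolding c1 by simp
   also have "... = (LBINT y. exp (- \<i> * of_real ((x - y) \<bullet> \<xi>)) * cnj (f y))"
   proof (intro bochner_cong refl)
    fix y
    have "- \<i> * of_real (\<xi> \<bullet> x) + \<i> * of_real (y \<bullet> \<xi>) = - \<i> * of_real ((x - y) \<bullet> \<xi>)"
     by (simp add: inner_diff_left inner_commute[of \<xi> x] right_diff_distrib)
    then have "exp (- \<i> * of_real (\<xi> \<bullet> x)) * exp (\<i> * of_real (y \<bullet> \<xi>)) = exp (- \<i> * of_real ((x - y) \<bullet> \<xi>))"
     by (simp only: exp_add[symmetric])
    then show "exp (- \<i> * of_real (\<xi> \<bullet> x)) * (exp (\<i> * of_real (y \<bullet> \<xi>)) * cnj (f y))
      = exp (- \<i> * of_real ((x - y) \<bullet> \<xi>)) * cnj (f y)" by (simp only: mult.assoc[symmetric])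
   qed
   finally show "exp (- \<i> * of_real (\<xi> \<bullet> x)) * (cnj (fint f \<xi>) * of_real (gauss (\<delta> *\<^sub>R \<xi>)))
    = of_real (gauss (\<delta> *\<^sub>R \<xi>)) * (LBINT y. exp (- \<i> * of_real ((x - y) \<bullet> \<xi>)) * cnj (f y))"
    by (simp add: mult_ac)
  qed
  also have "... = (LBINT y. (LBINT \<xi>. exp (- \<i> * of_real ((x - y) \<bullet> \<xi>)) * of_real (gauss (\<delta> *\<^sub>R \<xi>))) * cnj (f y))"
   by (rule kernel_swap[OF gi cf]) (auto simp del: mult_minus_left)
  also have "... = (LBINT y. of_real (?c * gauss ((1 / \<delta>) *\<^sub>R (x - y)) / \<delta> ^ DIM('a)) * cnj (f y))"
   by (simp only: fint_gauss_scaled[OF \<delta>])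
  also have "... = \<bar>- \<delta>\<bar> ^ DIM('a) *\<^sub>R (LBINT w. of_real (?c * gauss ((1 / \<delta>) *\<^sub>R (x - (x + (- \<delta>) *\<^sub>R w))) / \<delta> ^ DIM('a)) * cnj (f (x + (- \<delta>) *\<^sub>R w)))"
   using \<delta> by (intro lborel_integral_affine) measurable
  also have "... = (LBINT w. \<bar>- \<delta>\<bar> ^ DIM('a) *\<^sub>R (of_real (?c * gauss ((1 / \<delta>) *\<^sub>R (x - (x + (- \<delta>) *\<^sub>R w))) / \<delta> ^ DIM('a)) * cnj (f (x + (- \<delta>) *\<^sub>R w))))"
   by simp
  also have "... = (LBINT w. cnj (f (x - \<delta> *\<^sub>R w)) * of_real (?c * gauss w))"
   using \<delta> by (intro bochner_cong refl) (simp add: scaleR_conv_of_real)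
  finally show ?thesis .
 qed
 have ai: "integrable (lborel \<Otimes>\<^sub>M lborel) (autocorr \<delta> f)"
  using autocorr_norm_bound[OF fm f2 N, of \<delta>] by (auto simp: integrable_iff_bounded intro: le_less_trans)
 have "(LINT z|(lborel \<Otimes>\<^sub>M lborel). autocorr \<delta> f z) = (LBINT x. LBINT w. autocorr \<delta> f (x, w))"
  by (rule lborel_pair.integral_fst'[OF ai, symmetric])
 also have "... = (LBINT x. f x * fint ?h x)"
  unfolding fh autocorr_def by (simp add: mult.assoc)
 also have "... = (LBINT x. fint f x * ?h x)" by (rule fint_multiplication[OF f hi, symmetric])
 also have "... = (LBINT \<xi>. complex_of_real ((norm (fint f \<xi>))^2 * gauss (\<delta> *\<^sub>R \<xi>)))"
  by (intro bochner_cong refl) (simp only: mult.assoc[symmetric] complex_norm_square[symmetric] of_real_mult)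
 also have "... = complex_of_real (LBINT \<xi>. (norm (fint f \<xi>))^2 * gauss (\<delta> *\<^sub>R \<xi>))"
  by (rule integral_complex_of_real)
 finally show "complex_of_real (LBINT \<xi>. (norm (fint f \<xi>))^2 * gauss (\<delta> *\<^sub>R \<xi>)) = (LINT z|(lborel \<Otimes>\<^sub>M lborel). autocorr \<delta> f z)"
  by simp
qed

lemma gauss_scaled_tendsto_1: "(\<lambda>k. gauss ((1 / real (Suc k)) *\<^sub>R \<xi>)) ----> 1"
proof -
 have "(\<lambda>k. gauss (inverse (real (Suc k)) *\<^sub>R \<xi>)) ----> exp (- ((norm (0 *\<^sub>R \<xi>))^2 / 2))"
  unfolding gauss_def by (intro tendsto_intros LIMSEQ_inverse_real_of_nat) auto
 then show ?thesis by (simp add: inverse_eq_divide)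
qed

text \<open>Cauchy--Schwarz bounds the averaged autocorrelation for every \<open>\<delta>\<close>; Fatou's lemma removes the Gaussian.\<close>

lemma plancherel_bound:
 fixes f :: "'a::euclidean_space => complex"
 assumes f: "integrable lborel f" and fm [measurable]: "f \<in> Borel"
  and f2: "(\<integral>+x. ennreal ((norm (f x))^2)) = ennreal N" and N: "N >= 0"
 shows "(\<integral>+\<xi>. ennreal ((norm (fint f \<xi>))^2)) <= ennreal ((2 * pi) ^ DIM('a) * N)"
proof -
 let ?I = "\<lambda>k \<xi>. (norm (fint f \<xi>))^2 * gauss ((1 / real (Suc k)) *\<^sub>R \<xi>)"
 have "(\<integral>+\<xi>. ennreal ((norm (fint f \<xi>))^2)) = (\<integral>+\<xi>. liminf (\<lambda>k. ennreal (?I k \<xi>)))"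
 proof (rule nn_integral_cong)
  fix \<xi> :: 'a
  have "(\<lambda>k. ennreal (?I k \<xi>)) ----> ennreal ((norm (fint f \<xi>))^2 * 1)"
   by (intro tendsto_ennrealI tendsto_intros gauss_scaled_tendsto_1)
  from lim_imp_Liminf[OF _ this] show "ennreal ((norm (fint f \<xi>))^2) = liminf (\<lambda>k. ennreal (?I k \<xi>))" by simp
 qed
 also have "... <= liminf (\<lambda>k. \<integral>+\<xi>. ennreal (?I k \<xi>))"
  by (rule nn_integral_liminf) measurable
 also have "... <= liminf (\<lambda>k. ennreal ((2 * pi) ^ DIM('a) * N))"
 proof (intro Liminf_mono always_eventually allI)
  fix k
  have d: "1 / real (Suc k) > 0" by simp
  note rp = regularised_plancherel[OF f fm f2 N d]
  have "(\<integral>+\<xi>. ennreal (?I k \<xi>)) = ennreal (LBINT \<xi>. ?I k \<xi>)"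
   using gauss_pos by (intro nn_integral_eq_integral rp(1) AE_I2 mult_nonneg_nonneg) (auto intro: less_imp_le)
  also have "... <= ennreal (norm (complex_of_real (LBINT \<xi>. ?I k \<xi>)))"
   by (intro ennreal_leI) simp
  also have "... = ennreal (norm (LINT z|(lborel \<Otimes>\<^sub>M lborel). autocorr (1 / real (Suc k)) f z))" by (simp only: rp(2))
  also have "... <= (\<integral>\<^sup>+z. ennreal (norm (autocorr (1 / real (Suc k)) f z)) \<partial>(lborel \<Otimes>\<^sub>M lborel))"
  proof (rule integral_norm_bound_ennreal)
   show "integrable (lborel \<Otimes>\<^sub>M lborel) (autocorr (1 / real (Suc k)) f)"
    using autocorr_norm_bound[OF fm f2 N, of "1 / real (Suc k)"] by (auto simp: integrable_iff_bounded intro: le_less_trans)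
  qed
  also have "... <= ennreal ((2 * pi) ^ DIM('a) * N)" by (rule autocorr_norm_bound[OF fm f2 N])
  finally show "(\<integral>+\<xi>. ennreal (?I k \<xi>)) <= ennreal ((2 * pi) ^ DIM('a) * N)" .
 qed
 also have "... = ennreal ((2 * pi) ^ DIM('a) * N)" by (simp add: Liminf_const)
 finally show ?thesis .
qed

text \<open>Now \<open>f (x - \<delta> w)\<close> tends to \<open>f x\<close> boundedly, so both sides of the regularised identity converge by
dominated convergence, the Fourier side because of the bound.\<close>

lemma plancherel_continuous_compact_support:
 fixes f :: "'a::euclidean_space => complex"
 assumes fc: "continuous_on UNIV f" and K: "compact K" "!!x. x ~: K ==> f x = 0"
  and f2: "(\<integral>+x. ennreal ((norm (f x))^2)) = ennreal N" and N: "N >= 0"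
 shows "(\<integral>+\<xi>. ennreal ((norm (fint f \<xi>))^2)) = ennreal ((2 * pi) ^ DIM('a) * N)"
proof -
 have fm [measurable]: "f \<in> Borel" and f: "integrable lborel f"
  using continuous_compact_support_L2[OF fc K] by auto
 obtain M where M: "M >= 0" "!!x. norm (f x) <= M" using continuous_compact_support_bounded[OF fc K] by metis
 let ?c = "sqrt (2 * pi) ^ DIM('a)"
 let ?I = "\<lambda>k \<xi>. (norm (fint f \<xi>))^2 * gauss ((1 / real (Suc k)) *\<^sub>R \<xi>)"
 have bd: "(\<integral>+\<xi>. ennreal ((norm (fint f \<xi>))^2)) <= ennreal ((2 * pi) ^ DIM('a) * N)"
  by (rule plancherel_bound[OF f fm f2 N])
 have fi: "integrable lborel (\<lambda>\<xi>. (norm (fint f \<xi>))^2)"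
  using bd by (auto simp: integrable_iff_bounded intro: le_less_trans)
 have l1: "(\<lambda>k. LBINT \<xi>. ?I k \<xi>) ----> (LBINT \<xi>. (norm (fint f \<xi>))^2)"
 proof (rule integral_dominated_convergence[OF _ _ fi])
  show "AE \<xi> in lborel. (\<lambda>k. ?I k \<xi>) ----> (norm (fint f \<xi>))^2"
   using tendsto_mult_left[OF gauss_scaled_tendsto_1] by (intro AE_I2) fastforce
  show "AE \<xi> in lborel. norm (?I k \<xi>) <= (norm (fint f \<xi>))^2" for k
   by (intro AE_I2) (simp add: abs_mult mult_left_le gauss_abs_le_1 del: of_nat_Suc)
 qed measurable
 let ?A = "\<lambda>z. case z of (x, w) => complex_of_real ((norm (f x))^2) * complex_of_real (?c * gauss (w::'a))"
 have l2: "(\<lambda>k. LINT z|(lborel \<Otimes>\<^sub>M lborel). autocorr (1 / real (Suc k)) f z) ----> (LINT z|(lborel \<Otimes>\<^sub>M lborel). ?A z)"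
 proof (rule integral_dominated_convergence[where w = "\<lambda>z. norm (case z of (x, w) => complex_of_real (M * norm (f x)) * (1 * complex_of_real (?c * gauss (w::'a))))"])
  show "integrable (lborel \<Otimes>\<^sub>M lborel) (\<lambda>z. norm (case z of (x, w) => complex_of_real (M * norm (f x)) * (1 * complex_of_real (?c * gauss (w::'a)))))"
   using f gauss_integrable
   by (intro integrable_norm integrable_product_kernel) (auto simp: complex_of_real_integrable_eq simp del: of_real_mult)
  show "AE z in (lborel \<Otimes>\<^sub>M lborel). (\<lambda>k. autocorr (1 / real (Suc k)) f z) ----> ?A z"
  proof (rule AE_I2)
   fix z :: "'a \<times> 'a"
   obtain x w where z: "z = (x, w)" by (cases z)
   have "(\<lambda>k. x - inverse (real (Suc k)) *\<^sub>R w) ----> x - 0 *\<^sub>R w"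
    by (intro tendsto_intros LIMSEQ_inverse_real_of_nat)
   then have "(\<lambda>k. f (x - inverse (real (Suc k)) *\<^sub>R w)) ----> f x"
    using continuous_on_tendsto_compose[OF fc] by simp
   then have "(\<lambda>k. f x * cnj (f (x - inverse (real (Suc k)) *\<^sub>R w)) * of_real (?c * gauss (w::'a))) ----> f x * cnj (f x) * of_real (?c * gauss (w::'a))"
    by (intro tendsto_intros)
   then show "(\<lambda>k. autocorr (1 / real (Suc k)) f z) ----> ?A z"
    unfolding z autocorr_def by (simp only: prod.case inverse_eq_divide complex_norm_square)
  qed
  show "AE z in (lborel \<Otimes>\<^sub>M lborel). norm (autocorr (1 / real (Suc k)) f z)
    <= norm (case z of (x, w) => complex_of_real (M * norm (f x)) * (1 * complex_of_real (?c * gauss (w::'a))))" for k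
  proof (rule AE_I2)
   fix z :: "'a \<times> 'a"
   obtain x w where z: "z = (x, w)" by (cases z)
   have eq: "norm (complex_of_real (M * norm (f x))) = norm (f x) * M" unfolding norm_of_real using M(1) by (simp add: abs_mult)
   have "norm (f x) * norm (f (x - (1 / real (Suc k)) *\<^sub>R w)) * norm (complex_of_real (?c * gauss (w::'a)))
    <= norm (f x) * M * norm (complex_of_real (?c * gauss (w::'a)))"
    by (intro mult_right_mono mult_left_mono M) auto
   then show "norm (autocorr (1 / real (Suc k)) f z)
    <= norm (case z of (x, w) => complex_of_real (M * norm (f x)) * (1 * complex_of_real (?c * gauss (w::'a))))"
    unfolding z autocorr_def prod.case norm_mult complex_mod_cnj mult_1 eq .
  qed
 qed measurable
 have Aint: "(LINT z|(lborel \<Otimes>\<^sub>M lborel). ?A z) = complex_of_real ((2 * pi) ^ DIM('a) * N)"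
 proof -
  have sqi: "integrable lborel (\<lambda>x. (norm (f x))^2)"
   using f2 by (auto simp: integrable_iff_bounded)
  have Nn: "(LBINT x. (norm (f x))^2) = N"
   using f2 N by (subst integral_eq_nn_integral) auto
  have ii: "integrable (lborel \<Otimes>\<^sub>M lborel) (\<lambda>(x, w). complex_of_real ((norm (f x))^2) * (1 * complex_of_real (?c * gauss (w::'a))))"
   using sqi gauss_integrable
   by (intro integrable_product_kernel) (auto simp: complex_of_real_integrable_eq simp del: of_real_mult of_real_power)
  have "(LINT z|(lborel \<Otimes>\<^sub>M lborel). ?A z) = (LBINT x. LBINT w. complex_of_real ((norm (f x))^2) * complex_of_real (?c * gauss (w::'a)))"
   using lborel_pair.integral_fst'[OF ii, symmetric] by simp
  also have "... = (LBINT x. complex_of_real ((norm (f x))^2) * complex_of_real (?c * ?c))"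
   by (simp only: integral_mult_right_zero integral_complex_of_real gauss_integral)
  also have "... = complex_of_real N * complex_of_real (?c * ?c)"
   by (simp only: integral_mult_left_zero integral_complex_of_real Nn)
  also have "?c * ?c = (2 * pi) ^ DIM('a)" by (rule sqrt_2pi_power)
  finally show ?thesis by (simp add: mult.commute)
 qed
 have "complex_of_real (LBINT \<xi>. ?I k \<xi>) = (LINT z|(lborel \<Otimes>\<^sub>M lborel). autocorr (1 / real (Suc k)) f z)" for k
  by (rule regularised_plancherel(2)[OF f fm f2 N]) simp
 with l2 Aint have "(\<lambda>k. complex_of_real (LBINT \<xi>. ?I k \<xi>)) ----> complex_of_real ((2 * pi) ^ DIM('a) * N)" by (simp only:)
 then have "(\<lambda>k. LBINT \<xi>. ?I k \<xi>) ----> (2 * pi) ^ DIM('a) * N" by (simp only: tendsto_of_real_iff)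
 with l1 have "(LBINT \<xi>. (norm (fint f \<xi>))^2) = (2 * pi) ^ DIM('a) * N" using LIMSEQ_unique by blast
 then show ?thesis using nn_integral_eq_integral[OF fi] by simp
qed

section \<open>The Fourier transform on square integrable functions\<close>

abbreviation fourier_const :: "'a::euclidean_space itself => real" where
 "fourier_const _ \<equiv> sqrt (2 * pi) ^ DIM('a)"

lemma fourier_const_sq: "(sqrt (2 * pi) ^ n * x)^2 = (2 * pi) ^ n * x^2"
proof -
 have "(sqrt (2 * pi) ^ n * x)^2 = (sqrt (2 * pi) ^ n * sqrt (2 * pi) ^ n) * x^2"
  by (simp only: power2_eq_square mult_ac)
 then show ?thesis unfolding sqrt_2pi_power .
qed

lemma L2_borel_iff:
 fixes f :: "'a::euclidean_space => 'b::euclidean_space"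
 assumes f: "f \<in> Borel"
 shows "f \<in> L2 UNIV \<longleftrightarrow> integrable lborel (\<lambda>x. (norm (f x))^2)"
proof -
 have "(\<lambda>x. (norm (f x))^2) \<in> borel_measurable lborel" using f by measurable
 from integrable_completion[OF this] show ?thesis
  using borel_measurable_lebesgueI[OF f] unfolding mem_L2_UNIV by simp
qed

lemma nn_integral_l2of_borel:
 assumes "f \<in> L2 UNIV"
 shows "(\<integral>+x. ennreal ((norm (f x))^2)) = ennreal ((norm (l2of f))^2)"
 using nn_integral_l2of[OF assms] unfolding nn_integral_completion .

lemma L2_borel_nn_integral:
 fixes f :: "'a::euclidean_space => 'b::euclidean_space"
 assumes f: "f \<in> Borel" and le: "(\<integral>+x. ennreal ((norm (f x))^2)) <= ennreal (C^2)" and C: "C >= 0"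
 shows "f \<in> L2 UNIV" "norm (l2of f) <= C"
proof -
 have "(\<lambda>x. (norm (f x))^2) \<in> borel_measurable lborel" using f by measurable
 then have "integrable lborel (\<lambda>x. (norm (f x))^2)"
  using le_less_trans[OF le ennreal_less_top] by (intro integrableI_nonneg) auto
 then show fL: "f \<in> L2 UNIV" using L2_borel_iff[OF f] by simp
 have "ennreal ((norm (l2of f))^2) <= ennreal (C^2)" using le nn_integral_l2of_borel[OF fL] by simp
 then have "(norm (l2of f))^2 <= C^2" by (subst (asm) ennreal_le_iff) auto
 then show "norm (l2of f) <= C" by (rule power2_le_imp_le[OF _ C])
qed

lemma fint_L2:
 fixes f :: "'a::euclidean_space => complex"
 assumes f: "integrable lborel f" "f \<in> Borel" "f \<in> L2 UNIV"
 shows "fint f \<in> L2 UNIV" "norm (l2of (fint f)) <= fourier_const TYPE('a) * norm (l2of f)"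
proof -
 have "(\<integral>+\<xi>. ennreal ((norm (fint f \<xi>))^2)) <= ennreal ((2 * pi) ^ DIM('a) * (norm (l2of f))^2)"
  by (rule plancherel_bound[OF f(1,2) nn_integral_l2of_borel[OF f(3)]]) simp
 also have "(2 * pi) ^ DIM('a) * (norm (l2of f))^2 = (fourier_const TYPE('a) * norm (l2of f))^2"
  by (rule fourier_const_sq[symmetric])
 finally have le: "(\<integral>+\<xi>. ennreal ((norm (fint f \<xi>))^2)) <= ennreal ((fourier_const TYPE('a) * norm (l2of f))^2)" .
 show "fint f \<in> L2 UNIV" "norm (l2of (fint f)) <= fourier_const TYPE('a) * norm (l2of f)"
  by (rule L2_borel_nn_integral[OF fint_measurable[OF f(2)] le], simp)+
qed

lemma fint_cong_AE:
 assumes "AE x in lebesgue. f x = g x" "f \<in> Borel" "g \<in> Borel"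
 shows "fint f = fint g"
proof
 fix \<xi>
 show "fint f \<xi> = fint g \<xi>"
  unfolding fint_def
 proof (rule integral_cong_AE)
  show "AE x in lborel. exp (- \<i> * of_real (x \<bullet> \<xi>)) * f x = exp (- \<i> * of_real (x \<bullet> \<xi>)) * g x"
   using assms(1) unfolding AE_lebesgue_iff_lborel by eventually_elim simp
 qed (use assms(2,3) in measurable)
qed

lemma fint_add:
 assumes "integrable lborel f" "integrable lborel g"
 shows "fint (\<lambda>x. f x + g x) \<xi> = fint f \<xi> + fint g \<xi>"
 unfolding fint_def distrib_left using assms by (intro bochner_add fourier_kernel_integrable)

lemma fint_diff:
 assumes "integrable lborel f" "integrable lborel g"
 shows "fint (\<lambda>x. f x - g x) \<xi> = fint f \<xi> - fint g \<xi>"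
 unfolding fint_def right_diff_distrib using assms by (intro bochner_diff fourier_kernel_integrable)

lemma fint_scaleR: "fint (\<lambda>x. c *\<^sub>R f x) \<xi> = c *\<^sub>R fint f \<xi>"
 unfolding fint_def mult_scaleR_right by simp

text \<open>Integrability makes the Fourier integral converge absolutely; square integrability makes the transform
square integrable.\<close>

definition good :: "('a::euclidean_space => complex) => bool" where
 "good f \<longleftrightarrow> f \<in> Borel & integrable lborel f & f \<in> L2 UNIV"

lemma goodD: assumes "good f" shows "f \<in> Borel" "integrable lborel f" "f \<in> L2 UNIV"
 using assms by (auto simp: good_def)

lemma good_diff: "good f ==> good g ==> good (\<lambda>x. f x - g x)"
 unfolding good_def by (auto intro!: borel_measurable_diff bochner_integrable_diff)

lemma good_fint: "good f ==> fint f \<in> L2 UNIV"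
 by (rule fint_L2(1)) (auto simp: good_def)

lemma fint_diff_bound:
 fixes f g :: "'a::euclidean_space => complex"
 assumes f: "good f" and g: "good g"
 shows "norm (l2of (fint f) - l2of (fint g)) <= fourier_const TYPE('a) * norm (l2of f - l2of g)"
proof -
 have "fint (\<lambda>x. f x - g x) = (\<lambda>\<xi>. fint f \<xi> - fint g \<xi>)"
  using fint_diff[OF goodD(2)[OF f] goodD(2)[OF g]] by auto
 then have 1: "l2of (fint (\<lambda>x. f x - g x)) = l2of (fint f) - l2of (fint g)"
  using l2of_diff[OF good_fint[OF f] good_fint[OF g]] by simp
 have 2: "l2of (\<lambda>x. f x - g x) = l2of f - l2of g" using l2of_diff[OF goodD(3)[OF f] goodD(3)[OF g]] .
 note d = goodD[OF good_diff[OF f g]]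
 from fint_L2(2)[OF d(2,1,3)] show ?thesis unfolding 1 2 .
qed

definition cut :: "real => ('a::euclidean_space, complex) l2 => 'a => complex" where
 "cut R U x = indicator (cball 0 R) x *\<^sub>R l2fun U x"

lemma good_cut: "good (cut R (U :: ('a::euclidean_space, complex) l2))"
proof -
 have m: "cut R U \<in> Borel"
  unfolding cut_def[abs_def] by (intro borel_measurable_scaleR borel_measurable_indicator l2fun_measurable) simp
 have L: "cut R U \<in> L2 UNIV"
  by (rule L2_dominated[OF l2fun_L2[of U] borel_measurable_lebesgueI[OF m], of 1]) (simp add: cut_def split: split_indicator)
 have sq: "integrable lborel (\<lambda>x. (norm (l2fun U x))^2)"
  using L2_borel_iff[OF l2fun_measurable] l2fun_L2 by blast
 have "integrable lborel (cut R U)"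
 proof (rule bochner_bound)
  show "integrable lborel (\<lambda>x. indicator (cball 0 R :: 'a set) x + (norm (l2fun U x))^2)"
   using sq emeasure_bounded_finite[OF bounded_cball[of "0::'a" R]]
   by (intro Bochner_Integration.integrable_add integrable_real_indicator) auto
  show "AE x in lborel. norm (cut R U x) <= norm (indicator (cball 0 R) x + (norm (l2fun U x))^2)"
  proof (rule AE_I2)
   fix x :: 'a
   have "a <= 1 + a^2" for a :: real using zero_le_power2[of "a - 1/2"] by (simp add: power2_eq_square algebra_simps)
   from this[of "norm (l2fun U x)"]
   show "norm (cut R U x) <= norm (indicator (cball 0 R) x + (norm (l2fun U x))^2)"
    by (simp add: cut_def split: split_indicator)
  qed
 qed (use m in simp)
 with m L show ?thesis by (simp add: good_def)
qed

lemma cut_tendsto: "((\<lambda>R. l2of (cut R U)) \<longlongrightarrow> (U :: ('a::euclidean_space, complex) l2)) at_top"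
proof -
 have n: "(norm (l2of (cut R U) - U))^2 = (LBINT x. (norm (cut R U x - l2fun U x))^2)" for R
 proof -
  have L: "(\<lambda>x. cut R U x - l2fun U x) \<in> L2 UNIV" using goodD(3)[OF good_cut] by (intro L2_diff) auto
  have [measurable]: "cut R U \<in> Borel" using goodD(1)[OF good_cut] .
  have "l2of (\<lambda>x. cut R U x - l2fun U x) = l2of (cut R U) - U"
   using l2of_diff[OF goodD(3)[OF good_cut] l2fun_L2] by simp
  then have "(norm (l2of (cut R U) - U))^2 = (LINT x|lebesgue. (norm (cut R U x - l2fun U x))^2)"
   using norm_l2of_sq[OF L] by simp
  then show ?thesis by (subst (asm) integral_completion) auto
 qed
 have "((\<lambda>R. LBINT x. (norm (cut R U x - l2fun U x))^2) \<longlongrightarrow> (LINT x|(lborel :: 'a measure). 0)) at_top"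
 proof (rule integral_dominated_convergence_at_top[where w = "\<lambda>x. (norm (l2fun U x))^2"])
  show "integrable lborel (\<lambda>x. (norm (l2fun U x))^2)" using L2_borel_iff[OF l2fun_measurable] l2fun_L2 by blast
  show "AE x in lborel. ((\<lambda>R. (norm (cut R U x - l2fun U x))^2) \<longlongrightarrow> 0) at_top"
  proof (rule AE_I2)
   fix x
   have "\<forall>\<^sub>F R in at_top. (norm (cut R U x - l2fun U x))^2 = 0"
    using eventually_ge_at_top[of "norm x"] by eventually_elim (simp add: cut_def)
   then show "((\<lambda>R. (norm (cut R U x - l2fun U x))^2) \<longlongrightarrow> 0) at_top"
    by (rule tendsto_eventually)
  qed
  show "\<forall>\<^sub>F R in at_top. AE x in lborel. norm ((norm (cut R U x - l2fun U x))^2) <= (norm (l2fun U x))^2"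
   by (intro always_eventually allI AE_I2) (simp add: cut_def split: split_indicator)
  show "(\<lambda>x. (norm (cut R U x - l2fun U x))^2) \<in> borel_measurable lborel" for R
   using goodD(1)[OF good_cut[of R U]] by measurable
 qed simp
 then have "((\<lambda>R. (norm (l2of (cut R U) - U))^2) \<longlongrightarrow> 0) at_top" unfolding n by simp
 then have "((\<lambda>R. sqrt ((norm (l2of (cut R U) - U))^2)) \<longlongrightarrow> sqrt 0) at_top" by (rule tendsto_real_sqrt)
 then have "((\<lambda>R. norm (l2of (cut R U) - U)) \<longlongrightarrow> 0) at_top" by simp
 then show ?thesis by (rule tendsto_norm_zero_cancel[THEN LIM_zero_cancel])
qed

lemma cut_tendsto_nat: "(\<lambda>n. l2of (cut (real n) U)) ----> U"
 by (rule filterlim_compose[OF cut_tendsto filterlim_real_sequentially])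

text \<open>The transform of \<open>U\<close> is the limit of the integrals over balls of integer radius; \<open>fint\<close> differs from a
unitary map by the factor \<open>(2\<pi>)\<^sup>n\<^sup>/\<^sup>2\<close>.\<close>

definition FT :: "('a::euclidean_space, complex) l2 => ('a, complex) l2" where
 "FT U = lim (\<lambda>n. l2of (fint (cut (real n) U)))"

lemma FT_tendsto: "(\<lambda>n. l2of (fint (cut (real n) U))) ----> FT (U :: ('a::euclidean_space, complex) l2)"
proof -
 let ?c = "fourier_const TYPE('a)"
 have c: "?c > 0" by simp
 have "Cauchy (\<lambda>n. l2of (fint (cut (real n) U)))"
 proof (rule CauchyI)
  fix e :: real assume e: "e > 0"
  have "Cauchy (\<lambda>n. l2of (cut (real n) U))" using cut_tendsto_nat by (rule LIMSEQ_imp_Cauchy)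
  from CauchyD[OF this, of "e / ?c"] obtain M where
   M: "!!m n. m >= M ==> n >= M ==> norm (l2of (cut (real m) U) - l2of (cut (real n) U)) < e / ?c"
   using e c by auto
  show "\<exists>M. \<forall>m\<ge>M. \<forall>n\<ge>M. norm (l2of (fint (cut (real m) U)) - l2of (fint (cut (real n) U))) < e"
  proof (intro exI[of _ M] allI impI)
   fix m n assume mn: "m >= M" "n >= M"
   have "norm (l2of (fint (cut (real m) U)) - l2of (fint (cut (real n) U))) <= ?c * norm (l2of (cut (real m) U) - l2of (cut (real n) U))"
    by (rule fint_diff_bound[OF good_cut good_cut])
   also have "... < ?c * (e / ?c)" using M[OF mn] c by (intro mult_strict_left_mono) auto
   also have "... = e" using c by simp
   finally show "norm (l2of (fint (cut (real m) U)) - l2of (fint (cut (real n) U))) < e" .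
  qed
 qed
 then show ?thesis unfolding FT_def using Cauchy_convergent convergent_LIMSEQ_iff by blast
qed

lemma FT_l2of:
 fixes f :: "'a::euclidean_space => complex"
 assumes f: "good f" shows "FT (l2of f) = l2of (fint f)"
proof -
 let ?c = "fourier_const TYPE('a)"
 have "(\<lambda>n. l2of (fint (cut (real n) (l2of f)))) ----> l2of (fint f)"
 proof (rule LIM_zero_cancel, rule Lim_null_comparison)
  show "\<forall>\<^sub>F n in sequentially. norm (l2of (fint (cut (real n) (l2of f))) - l2of (fint f)) <= ?c * norm (l2of (cut (real n) (l2of f)) - l2of f)"
   by (intro always_eventually allI fint_diff_bound good_cut f)
  have "(\<lambda>n. ?c * norm (l2of (cut (real n) (l2of f)) - l2of f)) ----> ?c * norm (l2of f - l2of f)"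
   by (intro tendsto_intros cut_tendsto_nat)
  then show "(\<lambda>n. ?c * norm (l2of (cut (real n) (l2of f)) - l2of f)) ----> 0" by simp
 qed
 then show ?thesis using FT_tendsto LIMSEQ_unique by blast
qed

lemma FT_bounded_linear: "bounded_linear (FT :: ('a::euclidean_space, complex) l2 => _)"
proof (rule bounded_linear_intro[where K = "fourier_const TYPE('a)"])
 fix U V :: "('a, complex) l2" and r :: real
 have "l2of (fint (cut (real n) (U + V))) = l2of (fint (cut (real n) U)) + l2of (fint (cut (real n) V))" for n
 proof -
  note gU = goodD[OF good_cut[of "real n" U]] and gV = goodD[OF good_cut[of "real n" V]]
  have "fint (cut (real n) (U + V)) = fint (\<lambda>x. cut (real n) U x + cut (real n) V x)"
  proof (rule fint_cong_AE)
   show "AE x in lebesgue. cut (real n) (U + V) x = cut (real n) U x + cut (real n) V x"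
    using l2fun_add[of U V] by eventually_elim (simp add: cut_def scaleR_add_right)
  qed (use gU(1) gV(1) goodD(1)[OF good_cut[of "real n" "U + V"]] in auto)
  also have "... = (\<lambda>\<xi>. fint (cut (real n) U) \<xi> + fint (cut (real n) V) \<xi>)"
   using fint_add[OF gU(2) gV(2)] by auto
  finally show ?thesis using l2of_add[OF good_fint[OF good_cut[of "real n" U]] good_fint[OF good_cut[of "real n" V]]] by simp
 qed
 then have "(\<lambda>n. l2of (fint (cut (real n) (U + V)))) ----> FT U + FT V"
  using tendsto_add[OF FT_tendsto[of U] FT_tendsto[of V]] by simp
 then show "FT (U + V) = FT U + FT V" using FT_tendsto LIMSEQ_unique by blast
 have "l2of (fint (cut (real n) (r *\<^sub>R U))) = r *\<^sub>R l2of (fint (cut (real n) U))" for n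
 proof -
  note gU = goodD[OF good_cut[of "real n" U]]
  have "fint (cut (real n) (r *\<^sub>R U)) = fint (\<lambda>x. r *\<^sub>R cut (real n) U x)"
  proof (rule fint_cong_AE)
   show "AE x in lebesgue. cut (real n) (r *\<^sub>R U) x = r *\<^sub>R cut (real n) U x"
    using l2fun_scaleR[of r U] by eventually_elim (simp add: cut_def)
  qed (use gU(1) goodD(1)[OF good_cut[of "real n" "r *\<^sub>R U"]] in auto)
  also have "... = (\<lambda>\<xi>. r *\<^sub>R fint (cut (real n) U) \<xi>)" using fint_scaleR by auto
  finally show ?thesis using l2of_scaleR[OF good_fint[OF good_cut[of "real n" U]]] by simp
 qed
 then have "(\<lambda>n. l2of (fint (cut (real n) (r *\<^sub>R U)))) ----> r *\<^sub>R FT U"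
  using tendsto_scaleR[OF tendsto_const FT_tendsto[of U]] by simp
 then show "FT (r *\<^sub>R U) = r *\<^sub>R FT U" using FT_tendsto LIMSEQ_unique by blast
 have "norm (FT U) <= fourier_const TYPE('a) * norm U"
 proof (rule LIMSEQ_le)
  show "(\<lambda>n. norm (l2of (fint (cut (real n) U)))) ----> norm (FT U)" by (intro tendsto_norm FT_tendsto)
  show "(\<lambda>n. fourier_const TYPE('a) * norm (l2of (cut (real n) U))) ----> fourier_const TYPE('a) * norm U"
   by (intro tendsto_intros cut_tendsto_nat)
  show "\<exists>N. \<forall>n\<ge>N. norm (l2of (fint (cut (real n) U))) <= fourier_const TYPE('a) * norm (l2of (cut (real n) U))"
   using fint_L2(2)[OF goodD(2,1,3)[OF good_cut]] by blast
 qed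
 then show "norm (FT U) <= norm U * fourier_const TYPE('a)" by (simp add: mult.commute)
qed

lemma truncated_fourier_eq:
 fixes u :: "'a::euclidean_space => complex"
 assumes u: "u \<in> L2 UNIV"
 shows "truncated_fourier R u = fint (cut R (l2of u))"
proof
 fix \<xi> :: 'a
 have [measurable]: "cut R (l2of u) \<in> Borel" using goodD(1)[OF good_cut] .
 have um: "u \<in> borel_measurable lebesgue" using u by (simp add: mem_L2_UNIV)
 have em: "(\<lambda>x. exp (- \<i> * of_real (x \<bullet> \<xi>))) \<in> borel_measurable lebesgue"
  by (rule borel_measurable_lebesgueI) measurable
 have "truncated_fourier R u \<xi> = (LINT x|lebesgue. exp (- \<i> * of_real (x \<bullet> \<xi>)) * cut R (l2of u) x)"
  unfolding truncated_fourier_def set_lebesgue_integral_def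
 proof (rule integral_cong_AE)
  show "(\<lambda>x. indicator (cball 0 R) x *\<^sub>R (exp (- \<i> * of_real (x \<bullet> \<xi>)) * u x)) \<in> borel_measurable lebesgue"
   by (intro borel_measurable_scaleR borel_measurable_indicator borel_measurable_times em um) auto
  show "(\<lambda>x. exp (- \<i> * of_real (x \<bullet> \<xi>)) * cut R (l2of u) x) \<in> borel_measurable lebesgue"
   by (intro borel_measurable_times em borel_measurable_lebesgueI) measurable
  show "AE x in lebesgue. indicator (cball 0 R) x *\<^sub>R (exp (- \<i> * of_real (x \<bullet> \<xi>)) * u x) = exp (- \<i> * of_real (x \<bullet> \<xi>)) * cut R (l2of u) x"
   using l2fun_l2of[OF u] by eventually_elim (simp add: cut_def)
 qed
 also have "... = fint (cut R (l2of u)) \<xi>"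
  unfolding fint_def by (rule integral_completion) measurable
 finally show "truncated_fourier R u \<xi> = fint (cut R (l2of u)) \<xi>" .
qed

text \<open>The truncated transforms converge in norm to \<open>FT U\<close>, so the limit in mean is unique; everything
about \<open>has_fourier\<close> can therefore be read off from the bounded operator \<open>FT\<close>.\<close>

lemma has_fourier_iff:
 fixes u v :: "'a::euclidean_space => complex"
 shows "has_fourier u v \<longleftrightarrow> u \<in> L2 UNIV & v \<in> L2 UNIV & FT (l2of u) = l2of v"
proof (cases "u \<in> L2 UNIV & v \<in> L2 UNIV")
 case True
 interpret FT: bounded_linear "FT :: ('a, complex) l2 => _" by (rule FT_bounded_linear)
 have n: "L2_norm UNIV (\<lambda>\<xi>. v \<xi> - truncated_fourier R u \<xi>) = norm (l2of v - FT (l2of (cut R (l2of u))))" for R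
 proof -
  have t: "truncated_fourier R u = fint (cut R (l2of u))" using True by (intro truncated_fourier_eq) simp
  have L: "fint (cut R (l2of u)) \<in> L2 UNIV" by (rule good_fint[OF good_cut])
  have "L2_norm UNIV (\<lambda>\<xi>. v \<xi> - fint (cut R (l2of u)) \<xi>) = norm (l2of v - l2of (fint (cut R (l2of u))))"
   using norm_l2of[OF L2_diff[OF _ L, of v]] l2of_diff[OF _ L, of v] True by simp
  then show ?thesis unfolding t FT_l2of[OF good_cut] .
 qed
 have lim: "((\<lambda>R. norm (l2of v - FT (l2of (cut R (l2of u))))) \<longlongrightarrow> norm (l2of v - FT (l2of u))) at_top"
  by (intro tendsto_intros FT.tendsto cut_tendsto)
 have "((\<lambda>R. norm (l2of v - FT (l2of (cut R (l2of u))))) \<longlongrightarrow> 0) at_top \<longleftrightarrow> norm (l2of v - FT (l2of u)) = 0"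
 proof
  assume "((\<lambda>R. norm (l2of v - FT (l2of (cut R (l2of u))))) \<longlongrightarrow> 0) at_top"
  from tendsto_unique[OF trivial_limit_at_top_linorder lim this]
  show "norm (l2of v - FT (l2of u)) = 0" .
 next
  assume "norm (l2of v - FT (l2of u)) = 0"
  then show "((\<lambda>R. norm (l2of v - FT (l2of (cut R (l2of u))))) \<longlongrightarrow> 0) at_top" using lim by (simp only:)
 qed
 then show ?thesis using True unfolding has_fourier_def n by auto
qed (auto simp: has_fourier_def)

lemma good_continuous_compact_support:
 assumes "continuous_on UNIV f" "compact K" "!!x. x ~: K ==> f x = 0"
 shows "good f"
 using continuous_compact_support_L2[OF assms] by (simp add: good_def)

lemma compact_support_dense:
 fixes U :: "('a::euclidean_space, complex) l2"
 shows "U \<in> closure {l2of f | f K. continuous_on UNIV f & compact K & (\<forall>x. x ~: K --> f x = 0)}"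
  (is "_ \<in> closure ?S")
proof (rule hilbert_dense_if_orthogonal_trivial)
 show "subspace ?S"
  unfolding subspace_def
 proof (intro conjI ballI allI)
  show "0 \<in> ?S" unfolding l2of_zero[symmetric] by (auto intro!: exI[of _ "\<lambda>x. 0"] exI[of _ "{}"])
 next
  fix x y assume "x \<in> ?S" "y \<in> ?S"
  then obtain f K g L where f: "x = l2of f" "continuous_on UNIV f" "compact K" "!!x. x ~: K ==> f x = 0"
   and g: "y = l2of g" "continuous_on UNIV g" "compact L" "!!x. x ~: L ==> g x = 0" by blast
  have "x + y = l2of (\<lambda>x. f x + g x)"
   using l2of_add[OF goodD(3) goodD(3), OF good_continuous_compact_support[OF f(2-4)] good_continuous_compact_support[OF g(2-4)]] f(1) g(1) by simp
  moreover have "continuous_on UNIV (\<lambda>x. f x + g x)" by (intro continuous_intros f g)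
  moreover have "compact (K \<union> L)" by (intro compact_Un f g)
  moreover have "\<forall>x. x ~: K \<union> L --> f x + g x = 0" using f(4) g(4) by simp
  ultimately show "x + y \<in> ?S" by blast
 next
  fix c :: real and x assume "x \<in> ?S"
  then obtain f K where f: "x = l2of f" "continuous_on UNIV f" "compact K" "!!x. x ~: K ==> f x = 0" by blast
  have "c *\<^sub>R x = l2of (\<lambda>x. c *\<^sub>R f x)"
   using l2of_scaleR[OF goodD(3)[OF good_continuous_compact_support[OF f(2-4)]]] f(1) by simp
  moreover have "continuous_on UNIV (\<lambda>x. c *\<^sub>R f x)" by (intro continuous_intros f)
  moreover have "\<forall>x. x ~: K --> c *\<^sub>R f x = 0" using f(4) by simp
  ultimately show "c *\<^sub>R x \<in> ?S" using f(3) by blast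
 qed
next
 fix Z :: "('a, complex) l2" assume Z: "!!y. y \<in> ?S ==> Z \<bullet> y = 0"
 have main: "AE x in lebesgue. x \<in> UNIV --> l2fun Z x \<bullet> w = 0" for w :: complex
 proof (rule L2_orthogonal_test_functions[OF open_UNIV])
  show "(\<lambda>x. l2fun Z x \<bullet> w) \<in> L2 UNIV"
   by (rule L2_dominated[OF l2fun_L2[of Z], of _ "norm w"])
     (auto intro!: borel_measurable_lebesgueI AE_I2 simp: mult.commute[of "norm w"] intro: Cauchy_Schwarz_ineq2)
  fix \<psi> :: "'a => real" assume p: "\<psi> \<in> test_functions UNIV"
  obtain K where K: "compact K" "!!x. x ~: K ==> \<psi> x = 0" using test_function_support[OF p] by metis
  let ?f = "\<lambda>x. \<psi> x *\<^sub>R w"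
  have c: "continuous_on UNIV ?f" by (intro continuous_intros test_function_L2(4)[OF p])
  have z: "!!x. x ~: K ==> ?f x = 0" using K(2) by simp
  have "l2of ?f \<in> ?S" using c K(1) z by blast
  then have "l2of (l2fun Z) \<bullet> l2of ?f = 0" using Z by simp
  then have "(LINT x|lebesgue. l2fun Z x \<bullet> ?f x) = 0"
   using inner_l2of[OF l2fun_L2 goodD(3)[OF good_continuous_compact_support[OF c K(1) z]]] by simp
  then show "(LINT x|lebesgue. (l2fun Z x \<bullet> w) * \<psi> x) = 0" by (simp add: mult.commute)
 qed
 have "AE x in lebesgue. l2fun Z x \<bullet> l2fun U x = 0"
  using main[of 1] main[of \<i>]
  by eventually_elim (simp add: inner_complex_def)
 then show "Z \<bullet> U = 0" unfolding inner_l2fun by (rule integral_eq_zero_AE)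
qed

text \<open>Equality holds on continuous functions of compact support, which are dense.\<close>

lemma FT_norm: "norm (FT U) = fourier_const TYPE('a) * norm (U :: ('a::euclidean_space, complex) l2)"
proof -
 interpret FT: bounded_linear "FT :: ('a, complex) l2 => _" by (rule FT_bounded_linear)
 let ?S = "{l2of f | f K. continuous_on UNIV f & compact K & (\<forall>x::'a. x ~: K --> f x = (0::complex))}"
 have "?S \<subseteq> {U. norm (FT U) = fourier_const TYPE('a) * norm U}"
 proof clarify
  fix f :: "'a => complex" and K assume f: "continuous_on UNIV f" "compact K" "\<forall>x. x ~: K --> f x = 0"
  then have g: "good f" by (intro good_continuous_compact_support) auto
  have "(\<integral>+\<xi>. ennreal ((norm (fint f \<xi>))^2)) = ennreal ((2 * pi) ^ DIM('a) * (norm (l2of f))^2)"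
   by (rule plancherel_continuous_compact_support[OF f(1,2) _ nn_integral_l2of_borel[OF goodD(3)[OF g]]]) (use f(3) in auto)
  then have "ennreal ((norm (l2of (fint f)))^2) = ennreal ((2 * pi) ^ DIM('a) * (norm (l2of f))^2)"
   unfolding nn_integral_l2of_borel[OF good_fint[OF g]] .
  then have "(norm (l2of (fint f)))^2 = (2 * pi) ^ DIM('a) * (norm (l2of f))^2"
   by (subst (asm) ennreal_inj) auto
  also have "... = (fourier_const TYPE('a) * norm (l2of f))^2"
   by (rule fourier_const_sq[symmetric])
  finally show "norm (FT (l2of f)) = fourier_const TYPE('a) * norm (l2of f)"
   unfolding FT_l2of[OF g] by (subst (asm) power2_eq_iff_nonneg) auto
 qed
 moreover have "closed {U :: ('a, complex) l2. norm (FT U) = fourier_const TYPE('a) * norm U}"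
  by (intro closed_Collect_eq continuous_intros FT.continuous_on)
 ultimately have "closure ?S \<subseteq> {U. norm (FT U) = fourier_const TYPE('a) * norm U}" by (rule closure_minimal)
 then show ?thesis using compact_support_dense[of U] by blast
qed

lemma FT_inner: "FT U \<bullet> FT V = (2 * pi) ^ DIM('a) * (U \<bullet> (V :: ('a::euclidean_space, complex) l2))"
proof -
 interpret FT: bounded_linear "FT :: ('a, complex) l2 => _" by (rule FT_bounded_linear)
 have sq: "(norm (FT W))^2 = (2 * pi) ^ DIM('a) * (norm W)^2" for W :: "('a, complex) l2"
  unfolding FT_norm by (rule fourier_const_sq)
 have "FT U \<bullet> FT V = ((norm (FT (U + V)))^2 - (norm (FT U))^2 - (norm (FT V))^2) / 2"
  unfolding FT.add by (rule dot_norm)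
 also have "... = (2 * pi) ^ DIM('a) * (((norm (U + V))^2 - (norm U)^2 - (norm V)^2) / 2)"
  unfolding sq by (simp add: algebra_simps)
 finally show ?thesis unfolding dot_norm[of U V, symmetric] .
qed

definition l2cnj :: "('a::euclidean_space, complex) l2 => ('a, complex) l2" where
 "l2cnj U = l2of (\<lambda>x. cnj (l2fun U x))"

definition l2refl :: "('a::euclidean_space, complex) l2 => ('a, complex) l2" where
 "l2refl U = l2of (\<lambda>x. l2fun U (- x))"

lemma L2_cnj: "f \<in> L2 UNIV ==> (\<lambda>x. cnj (f x)) \<in> L2 UNIV"
 by (rule L2_dominated[of f _ 1]) (auto simp: mem_L2_UNIV intro: measurable_compose[OF _ cnj_measurable])

lemma l2cnj_l2of: assumes "f \<in> L2 UNIV" shows "l2cnj (l2of f) = l2of (\<lambda>x. cnj (f x))"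
proof -
 have "AE x in lebesgue. cnj (l2fun (l2of f) x) = cnj (f x)" using l2fun_l2of[OF assms] by eventually_elim simp
 then show ?thesis unfolding l2cnj_def using l2of_eq_iff[OF L2_cnj[OF l2fun_L2] L2_cnj[OF assms]] by blast
qed

lemma l2cnj_bounded_linear: "bounded_linear l2cnj"
proof (rule bounded_linear_intro[where K = 1])
 fix U V :: "('a::euclidean_space, complex) l2" and r :: real
 have U: "U = l2of (l2fun U)" and V: "V = l2of (l2fun V)" by simp_all
 show "l2cnj (U + V) = l2cnj U + l2cnj V"
 proof -
  have "U + V = l2of (\<lambda>x. l2fun U x + l2fun V x)" using l2of_add[OF l2fun_L2 l2fun_L2, of U V] by simp
  then have "l2cnj (U + V) = l2of (\<lambda>x. cnj (l2fun U x) + cnj (l2fun V x))"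
   by (simp add: l2cnj_l2of[OF L2_add[OF l2fun_L2 l2fun_L2]])
  then show ?thesis unfolding l2cnj_def[of U] l2cnj_def[of V] using l2of_add[OF L2_cnj[OF l2fun_L2] L2_cnj[OF l2fun_L2]] by simp
 qed
 show "l2cnj (r *\<^sub>R U) = r *\<^sub>R l2cnj U"
 proof -
  have "r *\<^sub>R U = l2of (\<lambda>x. r *\<^sub>R l2fun U x)" using l2of_scaleR[OF l2fun_L2, of r U] by simp
  then have "l2cnj (r *\<^sub>R U) = l2of (\<lambda>x. r *\<^sub>R cnj (l2fun U x))"
   by (simp add: l2cnj_l2of[OF L2_scaleR[OF l2fun_L2]])
  then show ?thesis unfolding l2cnj_def[of U] using l2of_scaleR[OF L2_cnj[OF l2fun_L2]] by simp
 qed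
 have "norm (l2cnj U) = norm (l2of (l2fun U))"
  unfolding l2cnj_def norm_l2of[OF L2_cnj[OF l2fun_L2]] norm_l2of[OF l2fun_L2] L2_norm_def by simp
 then show "norm (l2cnj U) <= norm U * 1" by simp
qed

lemma AE_lborel_reflect:
 fixes P :: "'a::euclidean_space => bool"
 assumes "AE x in lebesgue. P x" shows "AE x in lebesgue. P (- x)"
proof -
 obtain N where N: "{x. \<not> P x} \<subseteq> N" "N \<in> null_sets (lborel :: 'a measure)"
  using iffD1[OF AE_lebesgue_iff_lborel assms] by (auto simp: eventually_ae_filter)
 have [measurable]: "N \<in> sets borel" using N(2) by (auto simp: null_sets_def)
 have "(\<integral>+x. indicator N (0 - x)) = (\<integral>+x. indicator N x)"
  by (rule lborel_nn_integral_reflect) simp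
 also have "... = 0" using N(2) by (simp add: null_sets_def)
 finally have "AE x in lborel. indicator N (- x) = (0::ennreal)"
  by (subst (asm) nn_integral_0_iff_AE) auto
 then show ?thesis unfolding AE_lebesgue_iff_lborel
  by eventually_elim (use N(1) in \<open>auto split: split_indicator_asm\<close>)
qed

lemma L2_reflect:
 fixes f :: "'a::euclidean_space => complex"
 assumes f: "f \<in> Borel" "f \<in> L2 UNIV"
 shows "(\<lambda>x. f (- x)) \<in> L2 UNIV" "norm (l2of (\<lambda>x. f (- x))) <= norm (l2of f)"
proof -
 have m: "(\<lambda>x. f (- x)) \<in> Borel" using f(1) by measurable
 have "(\<integral>+x. ennreal ((norm (f (0 - x)))^2)) = (\<integral>+x. ennreal ((norm (f x))^2))"
  by (rule lborel_nn_integral_reflect) (use f(1) in measurable)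
 then have le: "(\<integral>+x. ennreal ((norm (f (- x)))^2)) <= ennreal ((norm (l2of f))^2)"
  using nn_integral_l2of_borel[OF f(2)] by simp
 show "(\<lambda>x. f (- x)) \<in> L2 UNIV" "norm (l2of (\<lambda>x. f (- x))) <= norm (l2of f)"
  by (rule L2_borel_nn_integral[OF m le], simp)+
qed

lemma l2refl_l2of:
 fixes f :: "'a::euclidean_space => complex"
 assumes "f \<in> Borel" "f \<in> L2 UNIV" shows "l2refl (l2of f) = l2of (\<lambda>x. f (- x))"
proof -
 have "AE x in lebesgue. l2fun (l2of f) (- x) = f (- x)" by (rule AE_lborel_reflect[OF l2fun_l2of[OF assms(2)]])
 then show ?thesis unfolding l2refl_def
  using l2of_eq_iff[OF L2_reflect(1)[OF l2fun_measurable l2fun_L2] L2_reflect(1)[OF assms]] by blast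
qed

lemma l2refl_bounded_linear: "bounded_linear l2refl"
proof (rule bounded_linear_intro[where K = 1])
 fix U V :: "('a::euclidean_space, complex) l2" and r :: real
 note R = L2_reflect[OF l2fun_measurable l2fun_L2]
 show "l2refl (U + V) = l2refl U + l2refl V"
 proof -
  have "U + V = l2of (\<lambda>x. l2fun U x + l2fun V x)" using l2of_add[OF l2fun_L2 l2fun_L2, of U V] by simp
  moreover have "(\<lambda>x. l2fun U x + l2fun V x) \<in> Borel" by measurable
  ultimately have "l2refl (U + V) = l2of (\<lambda>x. l2fun U (- x) + l2fun V (- x))"
   by (simp add: l2refl_l2of[OF _ L2_add[OF l2fun_L2 l2fun_L2]])
  then show ?thesis unfolding l2refl_def[of U] l2refl_def[of V] using l2of_add[OF R(1) R(1)] by simp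
 qed
 show "l2refl (r *\<^sub>R U) = r *\<^sub>R l2refl U"
 proof -
  have "r *\<^sub>R U = l2of (\<lambda>x. r *\<^sub>R l2fun U x)" using l2of_scaleR[OF l2fun_L2, of r U] by simp
  moreover have "(\<lambda>x. r *\<^sub>R l2fun U x) \<in> Borel" by measurable
  ultimately have "l2refl (r *\<^sub>R U) = l2of (\<lambda>x. r *\<^sub>R l2fun U (- x))"
   by (simp add: l2refl_l2of[OF _ L2_scaleR[OF l2fun_L2]])
  then show ?thesis unfolding l2refl_def[of U] using l2of_scaleR[OF R(1)] by simp
 qed
 show "norm (l2refl U) <= norm U * 1" unfolding l2refl_def using R(2)[of U] by simp
qed

lemma FT_multiplication: "FT U \<bullet> l2cnj W = U \<bullet> l2cnj (FT (W :: ('a::euclidean_space, complex) l2))"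
proof -
 interpret FT: bounded_linear "FT :: ('a, complex) l2 => _" by (rule FT_bounded_linear)
 interpret C: bounded_linear "l2cnj :: ('a, complex) l2 => _" by (rule l2cnj_bounded_linear)
 have g: "FT (l2of f) \<bullet> l2cnj (l2of h) = l2of f \<bullet> l2cnj (FT (l2of h))" if f: "good f" and h: "good h" for f h :: "'a => complex"
 proof -
  have ic: "a \<bullet> cnj b = Re (a * b)" for a b by (simp add: inner_complex_def)
  note fm = goodD(1)[OF f, measurable] and hm = goodD(1)[OF h, measurable]
  have i1: "integrable lborel (\<lambda>x. fint f x * h x)"
  proof (rule bochner_bound)
   show "integrable lborel (\<lambda>x. (LBINT x. norm (f x)) * norm (h x))" using goodD(2)[OF h] by auto
   show "AE x in lborel. norm (fint f x * h x) <= norm ((LBINT x. norm (f x)) * norm (h x))"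
    using fint_bound[OF goodD(2)[OF f]] by (intro AE_I2) (auto simp: norm_mult intro!: mult_right_mono)
  qed measurable
  have i2: "integrable lborel (\<lambda>x. f x * fint h x)"
  proof (rule bochner_bound)
   show "integrable lborel (\<lambda>x. (LBINT x. norm (h x)) * norm (f x))" using goodD(2)[OF f] by auto
   show "AE x in lborel. norm (f x * fint h x) <= norm ((LBINT x. norm (h x)) * norm (f x))"
    using fint_bound[OF goodD(2)[OF h]]
    by (intro AE_I2) (auto simp: norm_mult mult.commute[of "norm (f _)"] intro!: mult_right_mono)
  qed measurable
  have "FT (l2of f) \<bullet> l2cnj (l2of h) = (LINT x|lebesgue. fint f x \<bullet> cnj (h x))"
   unfolding FT_l2of[OF f] l2cnj_l2of[OF goodD(3)[OF h]]
   by (rule inner_l2of[OF good_fint[OF f] L2_cnj[OF goodD(3)[OF h]]])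
  also have "... = (LBINT x. Re (fint f x * h x))"
   unfolding ic by (rule integral_completion) measurable
  also have "... = Re (LBINT x. fint f x * h x)" by (rule integral_Re[OF i1])
  also have "... = Re (LBINT x. f x * fint h x)" by (simp only: fint_multiplication[OF goodD(2)[OF f] goodD(2)[OF h]])
  also have "... = (LBINT x. Re (f x * fint h x))" by (rule integral_Re[OF i2, symmetric])
  also have "... = (LINT x|lebesgue. f x \<bullet> cnj (fint h x))"
   unfolding ic by (rule integral_completion[symmetric]) measurable
  also have "... = l2of f \<bullet> l2cnj (FT (l2of h))"
   unfolding FT_l2of[OF h] l2cnj_l2of[OF good_fint[OF h]]
   by (rule inner_l2of[OF goodD(3)[OF f] L2_cnj[OF good_fint[OF h]], symmetric])
  finally show ?thesis .
 qed
 have "(\<lambda>n. FT (l2of (cut (real n) U)) \<bullet> l2cnj (l2of (cut (real n) W))) ----> FT U \<bullet> l2cnj W"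
  by (intro tendsto_inner FT.tendsto C.tendsto cut_tendsto_nat)
 moreover have "(\<lambda>n. l2of (cut (real n) U) \<bullet> l2cnj (FT (l2of (cut (real n) W)))) ----> U \<bullet> l2cnj (FT W)"
  by (intro tendsto_inner FT.tendsto C.tendsto cut_tendsto_nat)
 ultimately show ?thesis unfolding g[OF good_cut good_cut] using LIMSEQ_unique by blast
qed

lemma l2cnj_l2cnj [simp]: "l2cnj (l2cnj U) = U"
 unfolding l2cnj_def[of U] l2cnj_l2of[OF L2_cnj[OF l2fun_L2]] by simp

lemma FT_inj: "FT U = FT V ==> U = (V :: ('a::euclidean_space, complex) l2)"
proof -
 interpret FT: bounded_linear "FT :: ('a, complex) l2 => _" by (rule FT_bounded_linear)
 assume "FT U = FT V"
 then have "norm (FT (U - V)) = 0" by (simp add: FT.diff)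
 then show "U = V" unfolding FT_norm by simp
qed

text \<open>The range is closed because \<open>FT\<close> is a multiple of an isometry, and dense because by the multiplication
formula its orthogonal complement is mapped into the kernel of \<open>FT\<close>. This replaces an inversion formula.\<close>

lemma FT_surj: "\<exists>U. FT U = (V :: ('a::euclidean_space, complex) l2)"
proof -
 interpret FT: bounded_linear "FT :: ('a, complex) l2 => _" by (rule FT_bounded_linear)
 let ?c = "fourier_const TYPE('a)"
 have sub: "subspace (range (FT :: ('a, complex) l2 => _))"
  using FT.linear linear_subspace_image subspace_UNIV by blast
 have "V \<in> closure (range FT)"
 proof (rule hilbert_dense_if_orthogonal_trivial[OF sub])
  fix Z :: "('a, complex) l2" assume Z: "!!y. y \<in> range FT ==> Z \<bullet> y = 0"
  have "U \<bullet> l2cnj (FT (l2cnj Z)) = 0" for U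
   using FT_multiplication[of U "l2cnj Z"] Z[of "FT U"] by (simp add: inner_commute)
  from this[of "l2cnj (FT (l2cnj Z))"] have "l2cnj (FT (l2cnj Z)) = 0" by simp
  then have "FT (l2cnj Z) = l2cnj 0" by (metis l2cnj_l2cnj)
  also have "l2cnj (0 :: ('a, complex) l2) = 0" by (rule linear_0[OF bounded_linear.linear[OF l2cnj_bounded_linear]])
  finally have "FT (l2cnj Z) = FT 0" by (simp add: FT.zero)
  then have "l2cnj Z = 0" by (rule FT_inj)
  then have "Z = l2cnj 0" by (metis l2cnj_l2cnj)
  then have "Z = 0" using linear_0[OF bounded_linear.linear[OF l2cnj_bounded_linear]] by simp
  then show "Z \<bullet> V = 0" by simp
 qed
 then obtain X where X: "!!n. X n \<in> range FT" "X ----> V" unfolding closure_sequential by blast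
 have "\<forall>n. \<exists>u. X n = FT u" using X(1) by blast
 then obtain u where u: "!!n. X n = FT (u n)" by metis
 have "Cauchy u"
 proof (rule CauchyI)
  fix e :: real assume e: "e > 0"
  have "Cauchy X" using X(2) by (rule LIMSEQ_imp_Cauchy)
  from CauchyD[OF this, of "?c * e"] e obtain M where
   M: "!!m n. m >= M ==> n >= M ==> norm (X m - X n) < ?c * e" by auto
  have "norm (u m - u n) < e" if "m >= M" "n >= M" for m n
  proof -
   have "?c * norm (u m - u n) < ?c * e" using M[OF that] unfolding u FT.diff[symmetric] FT_norm .
   then show ?thesis by (simp add: mult_less_cancel_left_pos)
  qed
  then show "\<exists>M. \<forall>m\<ge>M. \<forall>n\<ge>M. norm (u m - u n) < e" by blast
 qed
 then obtain U where "u ----> U" using Cauchy_convergent convergent_def by blast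
 then have "(\<lambda>n. FT (u n)) ----> FT U" by (rule FT.tendsto)
 moreover have "X = (\<lambda>n. FT (u n))" using u by auto
 then have "(\<lambda>n. FT (u n)) ----> V" using X(2) by simp
 ultimately have "FT U = V" using LIMSEQ_unique by blast
 then show ?thesis by blast
qed

lemma FT_l2cnj: "FT (l2cnj U) = l2cnj (l2refl (FT (U :: ('a::euclidean_space, complex) l2)))"
proof -
 interpret FT: bounded_linear "FT :: ('a, complex) l2 => _" by (rule FT_bounded_linear)
 interpret C: bounded_linear "l2cnj :: ('a, complex) l2 => _" by (rule l2cnj_bounded_linear)
 interpret N: bounded_linear "l2refl :: ('a, complex) l2 => _" by (rule l2refl_bounded_linear)
 have g: "FT (l2cnj (l2of f)) = l2cnj (l2refl (FT (l2of f)))" if f: "good f" for f :: "'a => complex"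
 proof -
  have gc: "good (\<lambda>x. cnj (f x))"
   using goodD[OF f] L2_cnj measurable_compose[OF goodD(1)[OF f] cnj_measurable]
   unfolding good_def by (auto intro: integrable_cnj)
  have e: "fint (\<lambda>x. cnj (f x)) \<xi> = cnj (fint f (- \<xi>))" for \<xi>
   unfolding fint_def Bochner_Integration.integral_cnj[symmetric] by (simp add: exp_cnj)
  have fm: "fint f \<in> Borel" using goodD(1)[OF f] by measurable
  have "FT (l2cnj (l2of f)) = l2of (\<lambda>\<xi>. cnj (fint f (- \<xi>)))"
   unfolding l2cnj_l2of[OF goodD(3)[OF f]] FT_l2of[OF gc] e[abs_def] ..
  also have "... = l2cnj (l2refl (l2of (fint f)))"
   unfolding l2refl_l2of[OF fm good_fint[OF f]] l2cnj_l2of[OF L2_reflect(1)[OF fm good_fint[OF f]]] ..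
  finally show ?thesis unfolding FT_l2of[OF f] .
 qed
 have "(\<lambda>n. FT (l2cnj (l2of (cut (real n) U)))) ----> FT (l2cnj U)"
  by (intro FT.tendsto C.tendsto cut_tendsto_nat)
 moreover have "(\<lambda>n. l2cnj (l2refl (FT (l2of (cut (real n) U))))) ----> l2cnj (l2refl (FT U))"
  by (intro FT.tendsto C.tendsto N.tendsto cut_tendsto_nat)
 ultimately show ?thesis unfolding g[OF good_cut] using LIMSEQ_unique by blast
qed

definition cplx :: "('a => real) => 'a => complex" where "cplx u x = complex_of_real (u x)"

lemma cplx_L2_iff: "cplx u \<in> L2 UNIV \<longleftrightarrow> u \<in> L2 UNIV"
proof
 assume "cplx u \<in> L2 UNIV"
 then show "u \<in> L2 UNIV"
  by (rule L2_dominated[of _ _ 1])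
    (use borel_measurable_Re \<open>cplx u \<in> L2 UNIV\<close> in \<open>auto simp: mem_L2_UNIV cplx_def[abs_def] borel_measurable_complex_iff\<close>)
next
 assume "u \<in> L2 UNIV"
 then show "cplx u \<in> L2 UNIV"
  by (rule L2_dominated[of _ _ 1]) (use \<open>u \<in> L2 UNIV\<close> in \<open>auto simp: mem_L2_UNIV cplx_def[abs_def] intro: borel_measurable_of_real\<close>)
qed

lemma inner_cplx: "u \<in> L2 UNIV ==> w \<in> L2 UNIV ==> l2of (cplx u) \<bullet> l2of (cplx w) = (LINT x|lebesgue. u x * w x)"
 by (simp add: inner_l2of cplx_L2_iff) (simp add: cplx_def inner_complex_def)

text \<open>A real function has a Hermitian transform; an even real multiplier preserves this, and the preimage
under \<open>FT\<close> of a Hermitian function is real.\<close>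

lemma multiplier_real:
 fixes u :: "'a::euclidean_space => real"
 assumes u: "u \<in> L2 UNIV" and v: "has_fourier (cplx u) v"
  and m: "!!\<xi>. m (- \<xi>) = m \<xi>" and mL: "(\<lambda>\<xi>. complex_of_real (m \<xi>) * v \<xi>) \<in> L2 UNIV"
 shows "\<exists>w. has_fourier (cplx w) (\<lambda>\<xi>. complex_of_real (m \<xi>) * v \<xi>)"
proof -
 let ?mv = "\<lambda>\<xi>. complex_of_real (m \<xi>) * v \<xi>"
 have vL: "v \<in> L2 UNIV" and FTu: "FT (l2of (cplx u)) = l2of v" using v by (auto simp: has_fourier_iff)
 have herm: "AE x in lebesgue. cnj (l2fun (l2of v) (- x)) = l2fun (l2of v) x"
 proof -
  have "l2cnj (l2of (cplx u)) = l2of (cplx u)"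
  proof -
   have "cplx u \<in> L2 UNIV" using u by (simp add: cplx_L2_iff)
   moreover have "(\<lambda>x. cnj (cplx u x)) = cplx u" by (simp add: cplx_def fun_eq_iff)
   ultimately show ?thesis using l2cnj_l2of[of "cplx u"] by simp
  qed
  then have "l2cnj (l2refl (l2of v)) = l2of v" using FT_l2cnj[of "l2of (cplx u)"] FTu by simp
  moreover have "l2cnj (l2refl (l2of v)) = l2of (\<lambda>x. cnj (l2fun (l2of v) (- x)))"
   unfolding l2refl_def by (rule l2cnj_l2of[OF L2_reflect(1)[OF l2fun_measurable l2fun_L2]])
  ultimately have "l2of (\<lambda>x. cnj (l2fun (l2of v) (- x))) = l2of (l2fun (l2of v))" by simp
  then show ?thesis
   using l2of_eq_iff[OF L2_cnj[OF L2_reflect(1)[OF l2fun_measurable l2fun_L2]] l2fun_L2] by blast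
 qed
 obtain U where U: "FT U = l2of ?mv" using FT_surj by blast
 have "l2cnj (l2refl (l2of ?mv)) = l2of ?mv"
 proof -
  have AEv: "AE x in lebesgue. l2fun (l2of v) x = v x" by (rule l2fun_l2of[OF vL])
  have AEm: "AE x in lebesgue. l2fun (l2of ?mv) x = ?mv x" by (rule l2fun_l2of[OF mL])
  have "AE x in lebesgue. cnj (l2fun (l2of ?mv) (- x)) = l2fun (l2of ?mv) x"
   using AE_lborel_reflect[OF AEm] AEm AE_lborel_reflect[OF AEv] AEv herm
   by eventually_elim (simp add: m)
  then have "l2of (\<lambda>x. cnj (l2fun (l2of ?mv) (- x))) = l2of (l2fun (l2of ?mv))"
   using l2of_eq_iff[OF L2_cnj[OF L2_reflect(1)[OF l2fun_measurable l2fun_L2]] l2fun_L2] by blast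
  then show ?thesis
   unfolding l2refl_def l2cnj_l2of[OF L2_reflect(1)[OF l2fun_measurable l2fun_L2]] by simp
 qed
 then have "FT (l2cnj U) = FT U" using FT_l2cnj[of U] U by simp
 then have "l2cnj U = l2of (l2fun U)" using FT_inj by simp
 then have re: "AE x in lebesgue. cnj (l2fun U x) = l2fun U x"
  unfolding l2cnj_def using l2of_eq_iff[OF L2_cnj[OF l2fun_L2] l2fun_L2] by blast
 let ?w = "\<lambda>x. Re (l2fun U x)"
 have wU: "AE x in lebesgue. l2fun U x = cplx ?w x"
  using re by eventually_elim (auto simp: cplx_def complex_eq_iff)
 have wL: "?w \<in> L2 UNIV"
  by (rule L2_dominated[OF l2fun_L2[of U], of _ 1])
    (auto intro!: borel_measurable_lebesgueI AE_I2 abs_Re_le_cmod)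
 have "l2of (cplx ?w) = U" using l2of_eq_iff[OF l2fun_L2, of "cplx ?w" U] wU wL by (simp add: cplx_L2_iff)
 then have "has_fourier (cplx ?w) ?mv" using U wL mL by (simp add: has_fourier_iff cplx_L2_iff)
 then show ?thesis by blast
qed

text \<open>A witness for the choice in the definition of the fractional Laplacian.\<close>

lemma frac_laplacian_has_fourier:
 fixes u :: "'a::euclidean_space => real"
 assumes u: "u \<in> L2 UNIV" and v: "has_fourier (cplx u) v"
  and mL: "(\<lambda>\<xi>. complex_of_real (norm \<xi> powr (2 * a)) * v \<xi>) \<in> L2 UNIV"
 shows "frac_laplacian a u \<in> L2 UNIV"
  "has_fourier (cplx (frac_laplacian a u)) (\<lambda>\<xi>. complex_of_real (norm \<xi> powr (2 * a)) * v \<xi>)"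
proof -
 let ?m = "\<lambda>v \<xi>. complex_of_real (norm \<xi> powr (2 * a)) * (v \<xi> :: complex)"
 have "\<exists>w. has_fourier (cplx w) (?m v)" by (rule multiplier_real[OF u v _ mL]) simp
 then have "\<exists>w v. has_fourier (\<lambda>x. of_real (u x)) v & has_fourier (\<lambda>x. of_real (w x)) (?m v)"
  using v unfolding cplx_def[abs_def] by blast
 from someI_ex[OF this] obtain v' where v': "has_fourier (cplx u) v'" "has_fourier (cplx (frac_laplacian a u)) (?m v')"
  unfolding frac_laplacian_def[symmetric] cplx_def[abs_def] by blast
 have vL: "v \<in> L2 UNIV" "v' \<in> L2 UNIV" "l2of v = l2of v'" using v v'(1) by (auto simp: has_fourier_iff)
 then have "AE \<xi> in lebesgue. v \<xi> = v' \<xi>" using l2of_eq_iff by blast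
 then have ae: "AE \<xi> in lebesgue. ?m v \<xi> = ?m v' \<xi>" by eventually_elim simp
 have m'L: "?m v' \<in> L2 UNIV" using v'(2) by (simp add: has_fourier_iff)
 have "l2of (?m v) = l2of (?m v')" using l2of_eq_iff[OF mL m'L] ae by blast
 then show "has_fourier (cplx (frac_laplacian a u)) (?m v)" using v'(2) mL by (simp add: has_fourier_iff)
 show "frac_laplacian a u \<in> L2 UNIV" using v'(2) cplx_L2_iff[of "frac_laplacian a u"] by (simp add: has_fourier_iff)
qed

section \<open>Gagliardo energy and the fractional Laplacian\<close>

text \<open>Smoothness gives the factor \<open>|h|\<^sup>c\<close> for small \<open>h\<close> and boundedness gives 1 for large \<open>h\<close>, against the
singular weight of order \<open>n + 2a\<close>.\<close>

definition trunc_kernel :: "real => real => 'a::euclidean_space => real" where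
 "trunc_kernel c a h = min 1 (norm h powr c) * norm h powr (- (real DIM('a) + 2 * a))"

lemma trunc_kernel_measurable [measurable]: "trunc_kernel c a \<in> Borel"
 unfolding trunc_kernel_def[abs_def] by measurable

lemma trunc_kernel_nonneg: "0 <= trunc_kernel c a h"
 unfolding trunc_kernel_def by simp

lemma trunc_kernel_integrable:
 assumes a: "0 < a" "2 * a < c"
 shows "integrable lborel (trunc_kernel c a :: 'a::euclidean_space => real)"
proof -
 have pos: "c - 2 * a > 0" "2 * a > 0" using a by auto
 obtain C where C: "C >= 0" "!!\<delta>. \<delta> > 0 ==>
  (\<integral>\<^sup>+z. indicator (ball 0 \<delta>) z * ennreal (norm z powr (c - 2 * a - real DIM('a))) \<partial>(lborel::'a measure)) <= ennreal (C * \<delta> powr (c - 2 * a))"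
  by (rule nn_integral_norm_powr_near_0[OF pos(1), where 'a = 'a]) (rule that)
 let ?N = "\<lambda>h::'a. indicator (ball 0 1) h * ennreal (norm h powr (c - 2 * a - real DIM('a)))"
 let ?F = "\<lambda>h::'a. indicator (- ball 0 1) h * ennreal (norm h powr (- (2 * a) - real DIM('a)))"
 have [measurable]: "(\<lambda>h::'a. indicator (ball 0 1) h :: ennreal) \<in> Borel"
   "(\<lambda>h::'a. indicator (- ball 0 1) h :: ennreal) \<in> Borel"
  by (rule borel_measurable_indicator, rule borel_open, simp)
    (rule borel_measurable_indicator, rule borel_closed, simp add: closed_Compl)
 have "(\<integral>+h. ennreal (trunc_kernel c a (h::'a))) <= (\<integral>+h. ?N h + ?F h)"
 proof (rule nn_integral_mono)
  fix h :: 'a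
  have e: "norm h powr c * norm h powr (- (real DIM('a) + 2 * a)) = norm h powr (c - 2 * a - real DIM('a))"
   "- (real DIM('a) + 2 * a) = - (2 * a) - real DIM('a)"
   unfolding powr_add[symmetric] by (rule arg_cong[where f = "(powr) (norm h)"]) simp_all
  have "trunc_kernel c a h <= norm h powr (c - 2 * a - real DIM('a))" "trunc_kernel c a h <= norm h powr (- (2 * a) - real DIM('a))"
   unfolding trunc_kernel_def e(1)[symmetric] e(2)[symmetric] by (simp_all add: mult_right_mono mult_left_le_one_le)
  then show "ennreal (trunc_kernel c a h) <= ?N h + ?F h" by (cases "h \<in> ball 0 1") (simp_all add: ennreal_leI)
 qed
 also have "... = (\<integral>+h. ?N h) + (\<integral>+h. ?F h)" by (rule nn_integral_add) measurable
 also have "... < \<infinity>"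
  using le_less_trans[OF C(2)[of 1] ennreal_less_top] nn_integral_norm_powr_far[OF pos(2), of 1, where 'a = 'a] by simp
 finally show ?thesis using trunc_kernel_nonneg by (intro integrableI_nonneg) (auto intro!: AE_I2)
qed

definition symbol_density :: "real => 'a::euclidean_space => 'a => real" where
 "symbol_density a h \<xi> = (2 - 2 * cos (h \<bullet> \<xi>)) * norm h powr (- (real DIM('a) + 2 * a))"

lemma symbol_density_nonneg: "0 <= symbol_density a h \<xi>"
 unfolding symbol_density_def by simp

lemma symbol_density_measurable [measurable]: "(\<lambda>h. symbol_density a h \<xi>) \<in> Borel"
 unfolding symbol_density_def by measurable

lemma symbol_density_measurable2 [measurable]: "(\<lambda>(h, \<xi>). symbol_density a h \<xi>) \<in> borel_measurable (borel \<Otimes>\<^sub>M borel)"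
 unfolding symbol_density_def by measurable

text \<open>The Fourier multiplier of the Gagliardo energy: the factor \<open>2 - 2 cos(h \<bullet> \<xi>)\<close> is
\<open>|exp(i h \<bullet> \<xi>) - 1|\<^sup>2\<close>, from the transform of a difference of translates.\<close>

definition symbol :: "real => 'a::euclidean_space => ennreal" where
 "symbol a \<xi> = (\<integral>+h. ennreal (symbol_density a h \<xi>))"

lemma two_minus_two_cos_le: "2 - 2 * cos t <= t^2" for t :: real
proof -
 have "2 - 2 * cos t = 4 * (sin (t / 2))^2" using cos_double_sin[of "t / 2"] by simp
 also have "... <= 4 * (t / 2)^2"
 proof -
  have "\<bar>sin (t / 2)\<bar>^2 <= \<bar>t / 2\<bar>^2" by (intro power_mono abs_sin_x_le_abs_x) auto
  then show ?thesis by (simp only: power2_abs)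
 qed
 also have "... = t^2" by (simp add: power2_eq_square)
 finally show ?thesis .
qed

lemma symbol_finite:
 fixes \<xi> :: "'a::euclidean_space"
 assumes a: "0 < a" "a < 1"
 shows "symbol a \<xi> < \<infinity>"
proof -
 let ?c = "4 + (norm \<xi>)^2"
 have le: "symbol_density a h \<xi> <= ?c * trunc_kernel 2 a h" for h
 proof -
  have "2 - 2 * cos (h \<bullet> \<xi>) <= ?c * min 1 (norm h powr 2)"
  proof (cases "1 <= norm h powr 2")
   case True
   have "2 - 2 * cos (h \<bullet> \<xi>) <= 4" using cos_ge_minus_one[of "h \<bullet> \<xi>"] by linarith
   also have "... <= ?c" by simp
   finally show ?thesis using True by (simp add: min_def)
  next
   case False
   have p: "norm h powr 2 = (norm h)^2" by (cases "h = 0") simp_all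
   have "2 - 2 * cos (h \<bullet> \<xi>) <= (h \<bullet> \<xi>)^2" by (rule two_minus_two_cos_le)
   also have "... <= (norm h * norm \<xi>)^2"
    using Cauchy_Schwarz_ineq2[of h \<xi>] by (metis abs_ge_zero power2_abs power_mono)
   also have "... <= ?c * (norm h)^2" by (simp add: power_mult_distrib algebra_simps)
   finally show ?thesis using False p by (simp add: min_def)
  qed
  then show ?thesis unfolding symbol_density_def trunc_kernel_def mult.assoc[symmetric] by (rule mult_right_mono) simp
 qed
 have "integrable lborel (\<lambda>h::'a. symbol_density a h \<xi>)"
 proof (rule bochner_bound)
  show "integrable lborel (\<lambda>h::'a. ?c * trunc_kernel 2 a h)" by (intro integrable_mult_right trunc_kernel_integrable) (use a in auto)
  show "AE h in lborel. norm (symbol_density a h \<xi>) <= norm (?c * trunc_kernel 2 a h)"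
   unfolding real_norm_def abs_of_nonneg[OF symbol_density_nonneg] by (intro AE_I2 order_trans[OF le abs_ge_self])
 qed measurable
 then show ?thesis unfolding symbol_def by (simp add: integrable_iff_bounded symbol_density_nonneg)
qed

lemma symbol_scale:
 fixes e :: "'a::euclidean_space"
 assumes r: "r > 0"
 shows "symbol a (r *\<^sub>R e) = ennreal (r powr (2 * a)) * symbol a e"
proof -
 have "symbol a (r *\<^sub>R e) = ennreal (\<bar>1 / r\<bar> ^ DIM('a)) * (\<integral>+h. ennreal (symbol_density a (0 + (1 / r) *\<^sub>R h) (r *\<^sub>R e)))"
  unfolding symbol_def using r by (intro lborel_nn_integral_affine) auto
 also have "(\<lambda>h. symbol_density a (0 + (1 / r) *\<^sub>R h) (r *\<^sub>R e)) = (\<lambda>h. r powr (real DIM('a) + 2 * a) * symbol_density a h e)"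
 proof
  fix h :: 'a
  have "(norm h / r) powr (- (real DIM('a) + 2 * a)) = norm h powr (- (real DIM('a) + 2 * a)) * r powr (real DIM('a) + 2 * a)"
  proof -
   have "(norm h / r) powr (- p) = norm h powr (- p) * r powr p" for p
    using r by (subst powr_divide) (auto simp: powr_minus divide_simps)
   then show ?thesis .
  qed
  then show "symbol_density a (0 + (1 / r) *\<^sub>R h) (r *\<^sub>R e) = r powr (real DIM('a) + 2 * a) * symbol_density a h e"
   using r by (simp add: symbol_density_def)
 qed
 also have "(\<integral>+h. ennreal (r powr (real DIM('a) + 2 * a) * symbol_density a h e)) = ennreal (r powr (real DIM('a) + 2 * a)) * symbol a e"
  unfolding symbol_def by (simp add: ennreal_mult symbol_density_nonneg nn_integral_cmult)
 also have "ennreal (\<bar>1 / r\<bar> ^ DIM('a)) * (ennreal (r powr (real DIM('a) + 2 * a)) * symbol a e)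
   = ennreal (\<bar>1 / r\<bar> ^ DIM('a) * r powr (real DIM('a) + 2 * a)) * symbol a e"
  by (simp add: ennreal_mult mult.assoc)
 also have "\<bar>1 / r\<bar> ^ DIM('a) * r powr (real DIM('a) + 2 * a) = r powr (2 * a)"
  using r by (simp add: powr_add powr_realpow power_divide)
 finally show ?thesis .
qed

text \<open>Uniqueness of Haar measure by hand: multiplying by the volume of the unit ball, which rotations leave
invariant, and shifting in both variables exchanges \<open>F (f x)\<close> for \<open>F x\<close>.\<close>

lemma nn_integral_orthogonal:
 fixes f :: "real ^ 'n => real ^ 'n" and F :: "real ^ 'n => ennreal"
 assumes f: "orthogonal_transformation f" and F [measurable]: "F \<in> Borel"
 shows "(\<integral>+x. F (f x)) = (\<integral>+x. F x)"
proof -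
 have lin: "linear f" using f by (rule orthogonal_transformation_linear)
 have n: "norm (f x) = norm x" for x using f by (rule orthogonal_transformation_norm)
 have fm [measurable]: "f \<in> Borel"
  using linear_continuous_on[OF linear_conv_bounded_linear[THEN iffD1, OF lin]] by (simp add: borel_measurable_continuous_onI)
 let ?B = "\<lambda>x::real ^ 'n. indicator (ball 0 1) x :: ennreal"
 have Bm [measurable]: "?B \<in> Borel" by (rule borel_measurable_indicator) (rule borel_open, simp)
 define b where "b = (\<integral>+x. ?B x)"
 have "b = emeasure lborel (ball (0::real ^ 'n) 1)" unfolding b_def by (rule nn_integral_indicator) (simp add: borel_open)
 moreover have "unit_ball_vol (real CARD('n)) ~= 0" by (rule unit_ball_vol_pos[THEN less_imp_neq, symmetric]) simp
 ultimately have b: "b ~= 0" "b ~= \<top>" by (auto simp: emeasure_ball)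
 have Bf: "?B (f x) = ?B x" for x using n by (simp add: indicator_def)
 have "b * (\<integral>+x. F (f x)) = (\<integral>+x. \<integral>+y. F (f x) * ?B y)"
  unfolding b_def by (simp add: nn_integral_cmult nn_integral_multc mult.commute)
 also have "... = (\<integral>+x. \<integral>+y. F (f x) * ?B (f x + y))"
  by (intro nn_integral_cong lborel_nn_integral_translation[symmetric]) measurable
 also have "... = (\<integral>+y. \<integral>+x. F (f x) * ?B (f x + y))"
  by (rule lborel_pair.Fubini'[symmetric]) measurable
 also have "... = (\<integral>+y. \<integral>+x. F (f x - y) * ?B x)"
 proof (rule nn_integral_cong)
  fix y
  obtain z where z: "f z = - y" using orthogonal_transformation_surj[OF f] by (metis surjD)
  have "(\<integral>+x. F (f x) * ?B (f x + y)) = (\<integral>+x. F (f (z + x)) * ?B (f (z + x) + y))"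
   by (rule lborel_nn_integral_translation[symmetric]) measurable
  also have "... = (\<integral>+x. F (f x - y) * ?B x)"
  proof (rule nn_integral_cong)
   fix x
   have "f (z + x) = f x - y" using linear_add[OF lin, of z x] z by simp
   then show "F (f (z + x)) * ?B (f (z + x) + y) = F (f x - y) * ?B x" using Bf[of x] by simp
  qed
  finally show "(\<integral>+x. F (f x) * ?B (f x + y)) = (\<integral>+x. F (f x - y) * ?B x)" .
 qed
 also have "... = (\<integral>+x. \<integral>+y. F (f x - y) * ?B x)"
  by (rule lborel_pair.Fubini') measurable
 also have "... = (\<integral>+x. (\<integral>+y. F y) * ?B x)"
 proof (rule nn_integral_cong)
  fix x
  have "(\<integral>+y. F (f x - y) * ?B x) = (\<integral>+y. F (f x - y)) * ?B x" by (rule nn_integral_multc) measurable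
  then show "(\<integral>+y. F (f x - y) * ?B x) = (\<integral>+y. F y) * ?B x"
   using lborel_nn_integral_reflect[OF F, of "f x"] by simp
 qed
 also have "... = b * (\<integral>+x. F x)"
  unfolding b_def by (subst nn_integral_cmult) (auto simp: mult.commute)
 finally show ?thesis using b by (simp add: ennreal_mult_cancel_left)
qed

lemma symbol_orthogonal:
 fixes f :: "real ^ 'n => real ^ 'n"
 assumes f: "orthogonal_transformation f"
 shows "symbol a (f \<xi>) = symbol a \<xi>"
proof -
 have m: "(\<lambda>h. ennreal (symbol_density a h (f \<xi>))) \<in> Borel" by measurable
 have "symbol a (f \<xi>) = (\<integral>+h. ennreal (symbol_density a (f h) (f \<xi>)))"
  unfolding symbol_def by (rule nn_integral_orthogonal[OF f m, symmetric])
 moreover have "symbol_density a (f h) (f \<xi>) = symbol_density a h \<xi>" for h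
  using f unfolding symbol_density_def orthogonal_transformation_def by (simp add: norm_eq_sqrt_inner)
 ultimately show ?thesis unfolding symbol_def by simp
qed

text \<open>The symbol at a unit vector; rotation invariance makes the choice of the vector immaterial.\<close>

definition symbol_const :: "'n::finite itself => real => real" where
 "symbol_const _ a = enn2real (symbol a (SOME b :: real ^ 'n. b \<in> Basis))"

text \<open>Scaling by the norm and rotation to a fixed unit vector determine the symbol up to a constant.\<close>

lemma symbol_formula:
 fixes \<xi> :: "real ^ 'n"
 assumes a: "0 < a" "a < 1"
 shows "symbol a \<xi> = ennreal (symbol_const TYPE('n) a * norm \<xi> powr (2 * a))"
proof -
 let ?e = "SOME b :: real ^ 'n. b \<in> Basis"
 have e: "norm ?e = 1" using SOME_Basis[where 'a = "real ^ 'n"] by (rule norm_Basis)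
 have c: "symbol a ?e = ennreal (symbol_const TYPE('n) a)"
  unfolding symbol_const_def using symbol_finite[OF a, of ?e] by (simp add: ennreal_enn2real)
 show ?thesis
 proof (cases "\<xi> = 0")
  case True
  then show ?thesis by (simp add: symbol_def symbol_density_def)
 next
  case False
  define e' where "e' = (1 / norm \<xi>) *\<^sub>R \<xi>"
  have n: "norm e' = 1" using False by (simp add: e'_def)
  then obtain f where f: "orthogonal_transformation f" "f ?e = e'"
   using orthogonal_transformation_exists[of ?e e'] e by metis
  have "\<xi> = norm \<xi> *\<^sub>R e'" using False by (simp add: e'_def)
  then have "symbol a \<xi> = ennreal (norm \<xi> powr (2 * a)) * symbol a e'"
   using symbol_scale[of "norm \<xi>" a e'] False by simp
  also have "symbol a e' = symbol a ?e" using symbol_orthogonal[OF f(1), of a ?e] f(2) by simp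
  finally show ?thesis unfolding c by (simp add: ennreal_mult[symmetric] symbol_const_def mult.commute)
 qed
qed

lemma symbol_const_pos:
 assumes a: "0 < a" "a < 1"
 shows "symbol_const TYPE('n::finite) a > 0"
proof (rule ccontr)
 let ?e = "SOME b :: real ^ 'n. b \<in> Basis"
 have e: "norm ?e = 1" using SOME_Basis[where 'a = "real ^ 'n"] by (rule norm_Basis)
 assume "\<not> symbol_const TYPE('n) a > 0"
 then have "symbol_const TYPE('n) a = 0" unfolding symbol_const_def by (simp add: less_le)
 then have "symbol a ?e = 0" using symbol_formula[OF a, of ?e] by simp
 then have "AE h in lborel. ennreal (symbol_density a h ?e) = 0"
  unfolding symbol_def by (subst (asm) nn_integral_0_iff_AE) auto
 then have ae: "AE h\<in>{h. 0 < h \<bullet> ?e & h \<bullet> ?e < 1} in lebesgue. h \<in> {}"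
  unfolding AE_lebesgue_iff_lborel
 proof eventually_elim
  case (elim h)
  show ?case
  proof
   assume h: "h \<in> {h. 0 < h \<bullet> ?e & h \<bullet> ?e < 1}"
   then have "h ~= 0" by auto
   have "cos (h \<bullet> ?e) < cos 0" using h pi_gt3 by (intro cos_monotone_0_pi) auto
   then have "symbol_density a h ?e > 0" unfolding symbol_density_def using \<open>h ~= 0\<close> by (intro mult_pos_pos) auto
   then show "h \<in> {}" using elim by simp
  qed
 qed
 have op: "open {h. 0 < h \<bullet> ?e & h \<bullet> ?e < 1}"
  by (intro open_Collect_conj open_Collect_less continuous_intros)
 have "(1/2) *\<^sub>R ?e \<in> {h. 0 < h \<bullet> ?e & h \<bullet> ?e < 1}" using e by (simp add: power2_norm_eq_inner[symmetric])
 from mem_closed_if_AE_lebesgue_open[OF op closed_empty ae this] show False by simp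
qed

text \<open>The square of this weighted difference quotient is the integrand of the Gagliardo seminorm of order \<open>a\<close>.\<close>

definition Dq :: "real => ('a::euclidean_space => real) => 'a \<times> 'a => real" where
 "Dq a u = (\<lambda>(x, y). (u x - u y) * norm (x - y) powr (- (real DIM('a) / 2 + a)))"

lemma Dq_measurable [measurable]:
 assumes [measurable]: "u \<in> Borel"
 shows "Dq a u \<in> Borel"
 unfolding Dq_def split_beta borel_prod[symmetric] by measurable

lemma Dq_sq: "(Dq a u (x, y))^2 = (u x - u y)^2 * norm (x - y) powr (- (real DIM('a) + 2 * a))"
 for x y :: "'a::euclidean_space"
proof -
 have "(norm (x - y) powr (- (real DIM('a) / 2 + a)))^2 = norm (x - y) powr (- (real DIM('a) + 2 * a))"
  unfolding power2_eq_square powr_add[symmetric] by (rule arg_cong[where f = "(powr) (norm (x - y))"]) simp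
 then show ?thesis by (simp add: Dq_def power_mult_distrib)
qed

lemma nn_integral_lborel_pair:
 fixes f :: "'a::euclidean_space \<times> 'a => ennreal"
 assumes f: "f \<in> Borel"
 shows "(\<integral>+z. f z) = (\<integral>+x. \<integral>+y. f (x, y))"
  "(\<integral>+z. f z) = (\<integral>+y. \<integral>+x. f (x, y))"
proof -
 have m: "f \<in> borel_measurable (lborel \<Otimes>\<^sub>M lborel)" using f by (simp add: lborel_prod)
 show "(\<integral>+z. f z) = (\<integral>+x. \<integral>+y. f (x, y))"
  using lborel.nn_integral_fst[OF m] by (simp add: lborel_prod)
 show "(\<integral>+z. f z) = (\<integral>+y. \<integral>+x. f (x, y))"
  using lborel_pair.nn_integral_snd[OF m] by (simp add: lborel_prod)
qed

text \<open>The coordinates \<open>(x, h)\<close> with \<open>y = x + h\<close> turn the kernel into a function of \<open>h\<close> alone.\<close>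

lemma nn_integral_pair_shift:
 fixes f :: "'a::euclidean_space \<times> 'a => ennreal"
 assumes f: "f \<in> Borel"
 shows "(\<integral>+z. f z) = (\<integral>+h. \<integral>+x. f (x, x + h))"
proof -
 have fm [measurable]: "f \<in> borel_measurable (borel \<Otimes>\<^sub>M borel)" using f by (simp add: borel_prod)
 have "(\<integral>+z. f z) = (\<integral>+x. \<integral>+y. f (x, y))" by (rule nn_integral_lborel_pair(1)[OF f])
 also have "... = (\<integral>+x. \<integral>+h. f (x, x + h))"
  by (intro nn_integral_cong lborel_nn_integral_translation[symmetric]) measurable
 also have "... = (\<integral>+h. \<integral>+x. f (x, x + h))"
  using nn_integral_lborel_pair[of "\<lambda>(x, h). f (x, x + h)"] by (simp add: borel_prod[symmetric])
 finally show ?thesis .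
qed

lemma good_translate:
 fixes f :: "'a::euclidean_space => complex"
 assumes "good f" shows "good (\<lambda>x. f (x + h))"
proof -
 note f = goodD[OF assms]
 have m: "(\<lambda>x. f (x + h)) \<in> Borel" using f(1) by measurable
 have i: "integrable lborel (\<lambda>x. f (x + h))" using lborel_integrable_affine[OF f(2), of 1 h] by (simp add: add.commute)
 have "integrable lborel (\<lambda>x. (norm (f (x + h)))^2)"
  using lborel_integrable_affine[of "\<lambda>x. (norm (f x))^2" 1 h] f L2_borel_iff[OF f(1)] by (simp add: add.commute)
 then have "(\<lambda>x. f (x + h)) \<in> L2 UNIV" using L2_borel_iff[OF m] by simp
 then show ?thesis using m i by (simp add: good_def)
qed

lemma fint_translate:
 fixes f :: "'a::euclidean_space => complex"
 assumes [measurable]: "f \<in> Borel"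
 shows "fint (\<lambda>x. f (x + h)) \<xi> = exp (\<i> * of_real (h \<bullet> \<xi>)) * fint f \<xi>"
proof -
 have "fint f \<xi> = (LBINT x. exp (- \<i> * of_real ((h + 1 *\<^sub>R x) \<bullet> \<xi>)) * f (h + 1 *\<^sub>R x))"
  unfolding fint_def by (subst lborel_integral_affine[where c = 1 and t = h]) auto
 also have "... = (LBINT x. exp (- \<i> * of_real (h \<bullet> \<xi>)) * (exp (- \<i> * of_real (x \<bullet> \<xi>)) * f (x + h)))"
 proof (intro bochner_cong refl)
  fix x
  have "- \<i> * of_real ((h + 1 *\<^sub>R x) \<bullet> \<xi>) = - \<i> * of_real (h \<bullet> \<xi>) + - \<i> * of_real (x \<bullet> \<xi>)"
   by (simp add: inner_add_left algebra_simps)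
  then have "exp (- \<i> * of_real ((h + 1 *\<^sub>R x) \<bullet> \<xi>)) = exp (- \<i> * of_real (h \<bullet> \<xi>)) * exp (- \<i> * of_real (x \<bullet> \<xi>))"
   by (simp only: exp_add)
  then show "exp (- \<i> * of_real ((h + 1 *\<^sub>R x) \<bullet> \<xi>)) * f (h + 1 *\<^sub>R x) = exp (- \<i> * of_real (h \<bullet> \<xi>)) * (exp (- \<i> * of_real (x \<bullet> \<xi>)) * f (x + h))"
   by (simp only: mult.assoc scaleR_one add.commute)
 qed
 also have "... = exp (- \<i> * of_real (h \<bullet> \<xi>)) * fint (\<lambda>x. f (x + h)) \<xi>" unfolding fint_def by simp
 finally have "exp (\<i> * of_real (h \<bullet> \<xi>)) * fint f \<xi> = (exp (\<i> * of_real (h \<bullet> \<xi>)) * exp (- \<i> * of_real (h \<bullet> \<xi>))) * fint (\<lambda>x. f (x + h)) \<xi>"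
  by (simp only: mult.assoc)
 moreover have "exp (\<i> * of_real (h \<bullet> \<xi>)) * exp (- \<i> * of_real (h \<bullet> \<xi>)) = 1"
  by (simp add: exp_add[symmetric])
 ultimately show ?thesis by simp
qed

lemma norm_exp_i_minus_1_sq: "(norm (exp (\<i> * of_real t) - 1))^2 = 2 - 2 * cos t"
proof -
 have "exp (\<i> * of_real t) = cis t" by (simp add: cis_conv_exp)
 then have "(norm (exp (\<i> * of_real t) - 1))^2 = (cos t - 1)^2 + (sin t)^2" by (simp add: cmod_power2)
 also have "... = 2 - 2 * cos t" using sin_cos_squared_add[of t] by (simp add: power2_eq_square algebra_simps)
 finally show ?thesis .
qed

lemma nn_integral_difference_sq:
 fixes u :: "'a::euclidean_space => real"
 assumes u: "good (cplx u)" and um [measurable]: "u \<in> Borel"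
 shows "ennreal ((2 * pi) ^ DIM('a)) * (\<integral>+x. ennreal ((u x - u (x + h))^2))
   = (\<integral>+\<xi>. ennreal ((2 - 2 * cos (h \<bullet> \<xi>)) * (norm (fint (cplx u) \<xi>))^2))"
proof -
 let ?g = "\<lambda>x. cplx u (x + h) - cplx u x"
 note gt = good_translate[OF u, of h]
 have g: "good ?g" by (rule good_diff[OF gt u])
 have fg: "fint ?g \<xi> = (exp (\<i> * of_real (h \<bullet> \<xi>)) - 1) * fint (cplx u) \<xi>" for \<xi>
  using fint_diff[OF goodD(2)[OF gt] goodD(2)[OF u]] fint_translate[OF goodD(1)[OF u]] by (simp add: algebra_simps)
 have "(\<integral>+\<xi>. ennreal ((2 - 2 * cos (h \<bullet> \<xi>)) * (norm (fint (cplx u) \<xi>))^2)) = (\<integral>+\<xi>. ennreal ((norm (fint ?g \<xi>))^2))"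
  unfolding fg norm_mult power_mult_distrib norm_exp_i_minus_1_sq ..
 also have "... = ennreal ((norm (l2of (fint ?g)))^2)" by (rule nn_integral_l2of_borel[OF good_fint[OF g]])
 also have "(norm (l2of (fint ?g)))^2 = (2 * pi) ^ DIM('a) * (norm (l2of ?g))^2"
  unfolding FT_l2of[OF g, symmetric] FT_norm by (rule fourier_const_sq)
 also have "ennreal ((2 * pi) ^ DIM('a) * (norm (l2of ?g))^2) = ennreal ((2 * pi) ^ DIM('a)) * ennreal ((norm (l2of ?g))^2)"
  by (rule ennreal_mult) auto
 also have "ennreal ((norm (l2of ?g))^2) = (\<integral>+x. ennreal ((norm (?g x))^2))"
  by (rule nn_integral_l2of_borel[OF goodD(3)[OF g], symmetric])
 also have "(\<lambda>x. (norm (?g x))^2) = (\<lambda>x. (u x - u (x + h))^2)"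
  by (auto simp: cplx_def simp flip: of_real_diff) (simp add: power2_commute)
 finally show ?thesis by simp
qed

text \<open>For fixed \<open>h\<close>, Plancherel turns \<open>\<integral>|u(x) - u(x + h)|\<^sup>2 dx\<close> into \<open>\<integral>|exp(i h \<bullet> \<xi>) - 1|\<^sup>2|F u|\<^sup>2\<close>. Tonelli and
integration in \<open>h\<close> against the kernel then leave the symbol.\<close>

lemma gagliardo_fourier:
 fixes u :: "real ^ 'n => real"
 assumes a: "0 < a" "a < 1" and u: "good (cplx u)" and um [measurable]: "u \<in> Borel"
 shows "ennreal ((2 * pi) ^ DIM(real ^ 'n)) * (\<integral>+z. ennreal ((Dq a u z)^2))
  = ennreal (symbol_const TYPE('n) a) * (\<integral>+\<xi>. ennreal ((norm (complex_of_real (norm \<xi> powr a) * fint (cplx u) \<xi>))^2))"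
proof -
 let ?k = "\<lambda>h::real ^ 'n. norm h powr (- (real DIM(real ^ 'n) + 2 * a))"
 let ?P = "ennreal ((2 * pi) ^ DIM(real ^ 'n))"
 note fm = fint_measurable[OF goodD(1)[OF u], measurable]
 have Dm: "(\<lambda>z. ennreal ((Dq a u z)^2)) \<in> Borel" by measurable
 have "?P * (\<integral>+z. ennreal ((Dq a u z)^2)) = ?P * (\<integral>+h. \<integral>+x. ennreal ((Dq a u (x, x + h))^2))"
  by (simp only: nn_integral_pair_shift[OF Dm])
 also have "... = ?P * (\<integral>+h. ennreal (?k h) * (\<integral>+x. ennreal ((u x - u (x + h))^2)))"
  unfolding Dq_sq by (simp add: ennreal_mult nn_integral_cmult mult.commute[of "ennreal (norm _ powr _)"] nn_integral_multc)
 also have "... = (\<integral>+h. ennreal (?k h) * (?P * (\<integral>+x. ennreal ((u x - u (x + h))^2))))"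
  by (subst nn_integral_cmult[symmetric]) (auto simp: mult.left_commute)
 also have "... = (\<integral>+h. \<integral>+\<xi>. ennreal (symbol_density a h \<xi>) * ennreal ((norm (fint (cplx u) \<xi>))^2))"
 proof (rule nn_integral_cong)
  fix h :: "real ^ 'n"
  have "ennreal (?k h) * (?P * (\<integral>+x. ennreal ((u x - u (x + h))^2)))
    = (\<integral>+\<xi>. ennreal (?k h) * ennreal ((2 - 2 * cos (h \<bullet> \<xi>)) * (norm (fint (cplx u) \<xi>))^2))"
   unfolding nn_integral_difference_sq[OF u um] by (rule nn_integral_cmult[symmetric]) measurable
  also have "... = (\<integral>+\<xi>. ennreal (symbol_density a h \<xi>) * ennreal ((norm (fint (cplx u) \<xi>))^2))"
   by (intro nn_integral_cong) (simp add: ennreal_mult[symmetric] symbol_density_nonneg, simp add: symbol_density_def mult_ac)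
  finally show "ennreal (?k h) * (?P * (\<integral>+x. ennreal ((u x - u (x + h))^2)))
    = (\<integral>+\<xi>. ennreal (symbol_density a h \<xi>) * ennreal ((norm (fint (cplx u) \<xi>))^2))" .
 qed
 also have "... = (\<integral>+\<xi>. \<integral>+h. ennreal (symbol_density a h \<xi>) * ennreal ((norm (fint (cplx u) \<xi>))^2))"
  by (rule lborel_pair.Fubini'[symmetric]) measurable
 also have "... = (\<integral>+\<xi>. symbol a \<xi> * ennreal ((norm (fint (cplx u) \<xi>))^2))"
  unfolding symbol_def by (intro nn_integral_cong nn_integral_multc) measurable
 also have "... = (\<integral>+\<xi>. ennreal (symbol_const TYPE('n) a) * ennreal ((norm (complex_of_real (norm \<xi> powr a) * fint (cplx u) \<xi>))^2))"
 proof (rule nn_integral_cong)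
  fix \<xi> :: "real ^ 'n"
  have "norm \<xi> powr (2 * a) = (norm \<xi> powr a)^2"
   unfolding power2_eq_square powr_add[symmetric] by simp
  then show "symbol a \<xi> * ennreal ((norm (fint (cplx u) \<xi>))^2)
    = ennreal (symbol_const TYPE('n) a) * ennreal ((norm (complex_of_real (norm \<xi> powr a) * fint (cplx u) \<xi>))^2)"
   unfolding symbol_formula[OF a] using symbol_const_pos[OF a, where 'n = 'n]
   by (simp add: ennreal_mult[symmetric] norm_mult power_mult_distrib mult.assoc)
 qed
 also have "... = ennreal (symbol_const TYPE('n) a) * (\<integral>+\<xi>. ennreal ((norm (complex_of_real (norm \<xi> powr a) * fint (cplx u) \<xi>))^2))"
  by (rule nn_integral_cmult) measurable
 finally show ?thesis .
qed

text \<open>A Gagliardo description of the Sobolev space of order \<open>a\<close>, with a Borel representative and with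
integrability added so that the Fourier integral converges absolutely.\<close>

definition gagl :: "real => ('a::euclidean_space => real) => bool" where
 "gagl a u \<longleftrightarrow> u \<in> Borel & integrable lborel u & u \<in> L2 UNIV & Dq a u \<in> L2 UNIV"

lemma gaglD: assumes "gagl a u"
 shows "u \<in> Borel" "integrable lborel u" "u \<in> L2 UNIV" "Dq a u \<in> L2 UNIV"
 using assms by (auto simp: gagl_def)

lemma good_cplx:
 assumes "u \<in> Borel" "integrable lborel u" "u \<in> L2 UNIV"
 shows "good (cplx u)"
proof -
 have "cplx u \<in> Borel" unfolding cplx_def[abs_def] using assms(1) by measurable
 moreover have "integrable lborel (cplx u)" unfolding cplx_def[abs_def] using assms(2) by (simp add: complex_of_real_integrable_eq)
 ultimately show ?thesis using assms(3) by (simp add: good_def cplx_L2_iff)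
qed

lemma gagl_good: "gagl a u ==> good (cplx u)"
 using good_cplx gaglD by blast

lemma Dq_add: "Dq a (\<lambda>x. u x + w x) = (\<lambda>z. Dq a u z + Dq a w z)"
 by (auto simp: Dq_def algebra_simps)

lemma Dq_scaleR: "Dq a (\<lambda>x. c *\<^sub>R u x) = (\<lambda>z. c *\<^sub>R Dq a u z)"
 by (auto simp: Dq_def algebra_simps)

lemma gagl_add: "gagl a u ==> gagl a w ==> gagl a (\<lambda>x. u x + w x)"
 unfolding gagl_def Dq_add by auto

definition mult_fint :: "real => ('a::euclidean_space => real) => 'a => complex" where
 "mult_fint a u \<xi> = complex_of_real (norm \<xi> powr a) * fint (cplx u) \<xi>"

lemma gagl_mult_fint:
 fixes u :: "real ^ 'n => real"
 assumes a: "0 < a" "a < 1" and u: "gagl a u"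
 shows "mult_fint a u \<in> L2 UNIV"
  "(2 * pi) ^ DIM(real ^ 'n) * (norm (l2of (Dq a u)))^2 = symbol_const TYPE('n) a * (norm (l2of (mult_fint a u)))^2"
proof -
 let ?M = "symbol_const TYPE('n) a" and ?P = "(2 * pi) ^ DIM(real ^ 'n)"
 have M: "?M > 0" by (rule symbol_const_pos[OF a])
 note g = gagl_good[OF u] and um = gaglD(1)[OF u]
 have mm: "mult_fint a u \<in> Borel"
  unfolding mult_fint_def[abs_def] using fint_measurable[OF goodD(1)[OF g]] by measurable
 have eq: "ennreal ?P * ennreal ((norm (l2of (Dq a u)))^2) = ennreal ?M * (\<integral>+\<xi>. ennreal ((norm (mult_fint a u \<xi>))^2))"
  using gagliardo_fourier[OF a g um] nn_integral_l2of_borel[OF gaglD(4)[OF u]] unfolding mult_fint_def by simp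
 have "ennreal ?M * (\<integral>+\<xi>. ennreal ((norm (mult_fint a u \<xi>))^2)) < \<infinity>"
  unfolding eq[symmetric] by (simp add: ennreal_mult[symmetric])
 then have fin: "(\<integral>+\<xi>. ennreal ((norm (mult_fint a u \<xi>))^2)) < \<infinity>"
  using M by (auto simp: ennreal_mult_less_top)
 then show L: "mult_fint a u \<in> L2 UNIV"
  using mm unfolding L2_borel_iff[OF mm] by (intro integrableI_nonneg) auto
 have "ennreal (?P * (norm (l2of (Dq a u)))^2) = ennreal (?M * (norm (l2of (mult_fint a u)))^2)"
  using eq M unfolding nn_integral_l2of_borel[OF L] by (simp add: ennreal_mult[symmetric])
 then show "?P * (norm (l2of (Dq a u)))^2 = ?M * (norm (l2of (mult_fint a u)))^2"
  using M by (subst (asm) ennreal_inj) auto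
qed

lemma has_fourier_fint: "good f ==> has_fourier f (fint f)"
 by (simp add: has_fourier_iff FT_l2of good_fint goodD)

text \<open>Both \<open>F u\<close> and \<open>|\<xi>|\<^sup>a F u\<close> are square integrable, and their sum dominates the Bessel weight.\<close>

lemma gagl_sobolev:
 fixes u :: "real ^ 'n => real"
 assumes a: "0 < a" "a < 1" and u: "gagl a u"
 shows "u \<in> sobolev a"
proof -
 let ?F = "fint (cplx u)"
 note g = gagl_good[OF u]
 have Fm [measurable]: "?F \<in> Borel" by (rule fint_measurable[OF goodD(1)[OF g]])
 have n1: "(\<lambda>\<xi>. norm (?F \<xi>)) \<in> L2 UNIV"
  by (rule L2_dominated[OF good_fint[OF g], of _ 1]) (auto intro!: borel_measurable_lebesgueI)
 have mm: "mult_fint a u \<in> Borel" unfolding mult_fint_def[abs_def] by measurable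
 have n2: "(\<lambda>\<xi>. norm (mult_fint a u \<xi>)) \<in> L2 UNIV"
  by (rule L2_dominated[OF gagl_mult_fint(1)[OF a u], of _ 1]) (use mm in \<open>auto intro!: borel_measurable_lebesgueI\<close>)
 have "(\<lambda>\<xi>. complex_of_real ((1 + (norm \<xi>)^2) powr (a / 2)) * ?F \<xi>) \<in> L2 UNIV"
 proof (rule L2_dominated[OF L2_add[OF n1 n2]])
  show "(\<lambda>\<xi>. complex_of_real ((1 + (norm \<xi>)^2) powr (a / 2)) * ?F \<xi>) \<in> borel_measurable lebesgue"
   by (rule borel_measurable_lebesgueI) measurable
  show "AE \<xi> in lebesgue. norm (complex_of_real ((1 + (norm \<xi>)^2) powr (a / 2)) * ?F \<xi>)
    <= 2 powr (a / 2) * norm (norm (?F \<xi>) + norm (mult_fint a u \<xi>))"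
  proof (rule AE_I2)
   fix \<xi> :: "real ^ 'n"
   have "(1 + (norm \<xi>)^2) powr (a / 2) <= 2 powr (a / 2) * (1 + norm \<xi> powr a)"
   proof (cases "norm \<xi> <= 1")
    case True
    then have "(norm \<xi>)^2 <= 1" by (simp add: power_le_one)
    then have "(1 + (norm \<xi>)^2) powr (a / 2) <= 2 powr (a / 2)" using a by (intro powr_mono2) auto
    also have "... <= 2 powr (a / 2) * (1 + norm \<xi> powr a)" by (simp add: mult_le_cancel_left1)
    finally show ?thesis .
   next
    case False
    then have "1 <= (norm \<xi>)^2" by simp
    then have "(1 + (norm \<xi>)^2) powr (a / 2) <= (2 * (norm \<xi>)^2) powr (a / 2)" using a by (intro powr_mono2) auto
    also have "... = 2 powr (a / 2) * ((norm \<xi>)^2) powr (a / 2)" by (simp add: powr_mult)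
    also have "((norm \<xi>)^2) powr (a / 2) = norm \<xi> powr a"
    proof -
     have "(norm \<xi>)^2 = norm \<xi> powr 2" using False by (subst powr_numeral) auto
     show ?thesis unfolding \<open>(norm \<xi>)^2 = norm \<xi> powr 2\<close> powr_powr by simp
    qed
    also have "2 powr (a / 2) * norm \<xi> powr a <= 2 powr (a / 2) * (1 + norm \<xi> powr a)" by (intro mult_left_mono) auto
    finally show ?thesis .
   qed
   then have "(1 + (norm \<xi>)^2) powr (a / 2) * norm (?F \<xi>) <= (2 powr (a / 2) * (1 + norm \<xi> powr a)) * norm (?F \<xi>)"
    by (rule mult_right_mono) simp
   then show "norm (complex_of_real ((1 + (norm \<xi>)^2) powr (a / 2)) * ?F \<xi>)
    <= 2 powr (a / 2) * norm (norm (?F \<xi>) + norm (mult_fint a u \<xi>))"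
    by (simp add: norm_mult mult_fint_def algebra_simps)
  qed
 qed
 then show ?thesis unfolding sobolev_def using has_fourier_fint[OF g] unfolding cplx_def[abs_def] by blast
qed

text \<open>Polarisation of the identity for squared norms.\<close>

lemma mult_fint_inner:
 fixes u w :: "real ^ 'n => real"
 assumes a: "0 < a" "a < 1" and u: "gagl a u" and w: "gagl a w"
 shows "l2of (mult_fint a u) \<bullet> l2of (mult_fint a w)
  = (2 * pi) ^ DIM(real ^ 'n) / symbol_const TYPE('n) a * (l2of (Dq a u) \<bullet> l2of (Dq a w))"
proof -
 let ?M = "symbol_const TYPE('n) a" and ?P = "(2 * pi) ^ DIM(real ^ 'n)"
 have M: "?M > 0" by (rule symbol_const_pos[OF a])
 have sq: "(norm (l2of (mult_fint a v)))^2 = ?P / ?M * (norm (l2of (Dq a v)))^2" if "gagl a v" for v :: "real ^ 'n => real"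
  using gagl_mult_fint(2)[OF a that] M by (simp add: field_simps)
 have add: "mult_fint a (\<lambda>x. u x + w x) = (\<lambda>\<xi>. mult_fint a u \<xi> + mult_fint a w \<xi>)"
 proof
  fix \<xi>
  have "cplx (\<lambda>x. u x + w x) = (\<lambda>x. cplx u x + cplx w x)" by (simp add: cplx_def fun_eq_iff)
  then show "mult_fint a (\<lambda>x. u x + w x) \<xi> = mult_fint a u \<xi> + mult_fint a w \<xi>"
   unfolding mult_fint_def using fint_add[OF goodD(2)[OF gagl_good[OF u]] goodD(2)[OF gagl_good[OF w]]]
   by (simp add: distrib_left)
 qed
 note Lu = gagl_mult_fint(1)[OF a u] and Lw = gagl_mult_fint(1)[OF a w]
 have "l2of (mult_fint a u) \<bullet> l2of (mult_fint a w) = ((norm (l2of (mult_fint a u) + l2of (mult_fint a w)))^2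
   - (norm (l2of (mult_fint a u)))^2 - (norm (l2of (mult_fint a w)))^2) / 2" by (rule dot_norm)
 also have "l2of (mult_fint a u) + l2of (mult_fint a w) = l2of (mult_fint a (\<lambda>x. u x + w x))"
  unfolding add by (rule l2of_add[OF Lu Lw, symmetric])
 also have "((norm (l2of (mult_fint a (\<lambda>x. u x + w x))))^2 - (norm (l2of (mult_fint a u)))^2 - (norm (l2of (mult_fint a w)))^2) / 2
   = ?P / ?M * (((norm (l2of (Dq a u) + l2of (Dq a w)))^2 - (norm (l2of (Dq a u)))^2 - (norm (l2of (Dq a w)))^2) / 2)"
  unfolding sq[OF gagl_add[OF u w]] sq[OF u] sq[OF w] Dq_add l2of_add[OF gaglD(4)[OF u] gaglD(4)[OF w]]
  by (simp add: algebra_simps diff_divide_distrib)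
 also have "((norm (l2of (Dq a u) + l2of (Dq a w)))^2 - (norm (l2of (Dq a u)))^2 - (norm (l2of (Dq a w)))^2) / 2 = l2of (Dq a u) \<bullet> l2of (Dq a w)"
  by (rule dot_norm[symmetric])
 finally show "l2of (mult_fint a u) \<bullet> l2of (mult_fint a w) = ?P / ?M * (l2of (Dq a u) \<bullet> l2of (Dq a w))" .
qed

text \<open>The leading term of the weak formulation, rewritten as an inner product of difference quotients.\<close>

lemma frac_laplacian_energy:
 fixes u w :: "real ^ 'n => real"
 assumes a: "0 < a" "a < 1" and u: "gagl a u" and w: "gagl a w"
 shows "(LINT x|lebesgue. frac_laplacian (a / 2) u x * frac_laplacian (a / 2) w x)
  = (l2of (Dq a u) \<bullet> l2of (Dq a w)) / symbol_const TYPE('n) a"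
proof -
 let ?M = "symbol_const TYPE('n) a" and ?P = "(2 * pi) ^ DIM(real ^ 'n)"
 have M: "?M > 0" by (rule symbol_const_pos[OF a])
 have P: "?P > 0" by simp
 have fl: "frac_laplacian (a / 2) v \<in> L2 UNIV" "FT (l2of (cplx (frac_laplacian (a / 2) v))) = l2of (mult_fint a v)"
  if v: "gagl a v" for v :: "real ^ 'n => real"
 proof -
  have L: "(\<lambda>\<xi>. complex_of_real (norm \<xi> powr (2 * (a / 2))) * fint (cplx v) \<xi>) \<in> L2 UNIV"
   using gagl_mult_fint(1)[OF a v] unfolding mult_fint_def[abs_def] by simp
  note h = frac_laplacian_has_fourier[OF gaglD(3)[OF v] has_fourier_fint[OF gagl_good[OF v]] L]
  show "frac_laplacian (a / 2) v \<in> L2 UNIV" by (rule h(1))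
  show "FT (l2of (cplx (frac_laplacian (a / 2) v))) = l2of (mult_fint a v)"
   using h(2) unfolding mult_fint_def[abs_def] by (simp add: has_fourier_iff)
 qed
 note mult_fint_inner[OF a u w]
 moreover have "l2of (mult_fint a u) \<bullet> l2of (mult_fint a w)
   = ?P * (LINT x|lebesgue. frac_laplacian (a / 2) u x * frac_laplacian (a / 2) w x)"
  unfolding fl(2)[OF u, symmetric] fl(2)[OF w, symmetric] FT_inner inner_cplx[OF fl(1)[OF u] fl(1)[OF w]] ..
 ultimately have "?P * (LINT x|lebesgue. frac_laplacian (a / 2) u x * frac_laplacian (a / 2) w x) = ?P * ((l2of (Dq a u) \<bullet> l2of (Dq a w)) / ?M)" by simp
 then show ?thesis using P by (simp only: mult_cancel_left) simp
qed

section \<open>The principal value formula and its constant\<close>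

lemma borel_measurable_AE_cong:
 fixes f g :: "'a::euclidean_space => real"
 assumes g: "g \<in> borel_measurable lebesgue" and ae: "AE x in lebesgue. f x = g x"
 shows "f \<in> borel_measurable lebesgue"
proof (rule measurableI)
 fix A :: "real set" assume A: "A \<in> sets borel"
 obtain N where N: "{x. f x ~= g x} \<subseteq> N" "N \<in> null_sets (lebesgue :: 'a measure)"
  using ae by (auto simp: eventually_ae_filter)
 have 1: "g -` A \<in> sets lebesgue" using measurable_sets[OF g A] by simp
 have 2: "f -` A \<inter> N \<in> sets lebesgue" using N(2) null_sets_completion_subset[of "f -` A \<inter> N" N lborel] by auto
 have "f -` A = (g -` A - N) \<union> (f -` A \<inter> N)" using N(1) by auto
 also have "... \<in> sets lebesgue" using 1 2 N(2) by (intro sets.Un sets.Diff) auto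
 finally show "f -` A \<inter> space lebesgue \<in> sets lebesgue" by simp
qed simp

lemma fst_snd_measurable [measurable]:
 "fst \<in> borel_measurable (borel :: ('a::euclidean_space \<times> 'b::euclidean_space) measure)"
 "snd \<in> borel_measurable (borel :: ('a::euclidean_space \<times> 'b::euclidean_space) measure)"
 by (intro borel_measurable_continuous_onI continuous_intros)+

lemma lborel_integral_swap:
 fixes f :: "'a::euclidean_space \<times> 'a => real"
 assumes f: "f \<in> Borel"
 shows "(LBINT z. f (snd z, fst z)) = (LBINT z. f z)"
proof -
 have "f \<in> borel_measurable (lborel \<Otimes>\<^sub>M lborel)" using f by (simp add: lborel_prod)
 from lborel_pair.integral_product_swap[OF this] show ?thesis by (simp add: lborel_prod case_prod_beta')
qed

lemma lebesgue_integral_eq_borel: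
 fixes f g :: "'a::euclidean_space => real"
 assumes ae: "AE x in lebesgue. f x = g x" and g: "g \<in> Borel"
 shows "(LINT x|lebesgue. f x) = (LBINT x. g x)"
proof -
 have gl: "g \<in> borel_measurable lebesgue" by (rule borel_measurable_lebesgueI[OF g])
 have "(LINT x|lebesgue. f x) = (LINT x|lebesgue. g x)"
  by (rule integral_cong_AE[OF borel_measurable_AE_cong[OF gl ae] gl ae])
 also have "... = (LBINT x. g x)" by (rule integral_completion) (use g in simp)
 finally show ?thesis .
qed

lemma lborel_iterated_integral:
 fixes f :: "'a::euclidean_space \<times> 'a => real"
 assumes "integrable lborel f"
 shows "(LBINT x. (LBINT y. f (x, y))) = (LBINT z. f z)"
 using lborel_pair.integral_fst'[of f] assms by (simp add: lborel_prod)

lemma lborel_integrable_swap: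
 fixes f :: "'a::euclidean_space \<times> 'a => real"
 assumes "integrable lborel f"
 shows "integrable lborel (\<lambda>z. f (snd z, fst z))"
 using lborel_pair.integrable_product_swap[of f] assms by (simp add: lborel_prod case_prod_beta')

text \<open>An integrable majorant that is comparable on balls of radius one.\<close>

definition decay :: "'a::euclidean_space => real" where
 "decay x = 1 / (1 + norm x) ^ Suc DIM('a)"

lemma decay_pos: "0 < decay x" and decay_le_1: "decay x <= 1"
proof -
 have "1 + norm x > 0" using norm_ge_zero[of x] by linarith
 then show "0 < decay x" unfolding decay_def by (intro divide_pos_pos zero_less_power) auto
 have "1 <= (1 + norm x) ^ Suc DIM('a)" by (rule one_le_power) simp
 then show "decay x <= 1" unfolding decay_def by (simp add: divide_le_eq)
qed

lemma decay_measurable [measurable]: "decay \<in> Borel"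
 unfolding decay_def[abs_def] by measurable

lemma decay_integrable: "integrable lborel (decay :: 'a::euclidean_space => real)"
proof (rule bochner_bound)
 show "integrable lborel (\<lambda>h::'a. trunc_kernel (real DIM('a) + 2) (1 / 2) h + indicator (ball 0 1) h)"
  by (intro Bochner_Integration.integrable_add trunc_kernel_integrable integrable_real_indicator)
    (use emeasure_bounded_finite[of "ball (0::'a) 1"] in simp_all)
 show "AE h in lborel. norm (decay h) <= norm (trunc_kernel (real DIM('a) + 2) (1 / 2) h + indicator (ball (0::'a) 1) h)"
 proof (rule AE_I2)
  fix h :: 'a
  have nn: "trunc_kernel (real DIM('a) + 2) (1 / 2) h >= 0" by (rule trunc_kernel_nonneg)
  have "decay h <= trunc_kernel (real DIM('a) + 2) (1 / 2) h + indicator (ball 0 1) h"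
  proof (cases "norm h < 1")
   case True
   then show ?thesis using decay_le_1[of h] nn by simp
  next
   case False
   have m: "min 1 (norm h powr (real DIM('a) + 2)) = 1" using False ge_one_powr_ge_zero[of "norm h" "real DIM('a) + 2"] by simp
   have "decay h <= 1 / norm h ^ Suc DIM('a)"
    unfolding decay_def using False by (intro divide_left_mono power_mono mult_pos_pos zero_less_power) auto
   also have "... = norm h powr (- real (Suc DIM('a)))" using False by (subst powr_minus, subst powr_realpow) (auto simp: divide_inverse)
   also have "... = trunc_kernel (real DIM('a) + 2) (1 / 2) h" unfolding trunc_kernel_def m by (simp add: add.commute)
   finally show ?thesis using False by simp
  qed
  then show "norm (decay h) <= norm (trunc_kernel (real DIM('a) + 2) (1 / 2) h + indicator (ball (0::'a) 1) h)"
   using decay_pos[of h] nn by simp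
 qed
qed measurable

lemma decay_pair_integral_finite:
 fixes K :: "'a::euclidean_space => real"
 assumes K: "integrable lborel K" "!!h. K h >= 0"
 shows "(\<integral>+h. \<integral>+x. ennreal (K h * (decay x + decay (x + h)))) < \<infinity>"
proof -
 note borel_measurable_integrable[OF K(1), measurable]
 let ?W = "\<integral>\<^sup>+x. ennreal (decay x) \<partial>(lborel :: 'a measure)"
 have W: "?W < \<infinity>" and Kf: "(\<integral>+h. ennreal (K h)) < \<infinity>"
  using decay_integrable[where 'a = 'a] K by (simp_all add: integrable_iff_bounded abs_of_nonneg[OF less_imp_le[OF decay_pos]])
 have "(\<integral>+x. ennreal (K h * (decay x + decay (x + h)))) = ennreal (K h) * (?W + ?W)" for h
 proof -
  have "(\<integral>+x. ennreal (K h * (decay x + decay (x + h)))) = (\<integral>+x. ennreal (K h) * (ennreal (decay x) + ennreal (decay (h + x))))"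
   using K(2) less_imp_le[OF decay_pos[where 'a = 'a]] by (intro nn_integral_cong) (simp add: ennreal_mult ennreal_plus add.commute)
  also have "... = ennreal (K h) * (\<integral>+x. ennreal (decay x) + ennreal (decay (h + x)))" by (rule nn_integral_cmult) measurable
  also have "(\<integral>+x. ennreal (decay x) + ennreal (decay (h + x))) = ?W + (\<integral>+x. ennreal (decay (h + x)))"
   by (rule nn_integral_add) measurable
  also have "(\<integral>+x. ennreal (decay (h + x))) = ?W" by (rule lborel_nn_integral_translation) measurable
  finally show ?thesis .
 qed
 then show ?thesis using W Kf by (simp add: nn_integral_multc ennreal_mult_less_top)
qed

lemma decay_shift:
 fixes x z :: "'a::euclidean_space"
 assumes "norm (z - x) <= 1" shows "decay z <= 2 ^ Suc DIM('a) * decay x"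
proof -
 have "norm x <= norm z + norm (z - x)" using norm_triangle_ineq4[of z "z - x"] by simp
 then have "1 + norm x <= 2 * (1 + norm z)" using assms norm_ge_zero[of z] by argo
 then have "(1 + norm x) ^ Suc DIM('a) <= (2 * (1 + norm z)) ^ Suc DIM('a)" by (intro power_mono) auto
 then have p: "(1 + norm x) ^ Suc DIM('a) <= 2 ^ Suc DIM('a) * (1 + norm z) ^ Suc DIM('a)" by (simp only: power_mult_distrib)
 have pos: "(1 + norm x) ^ Suc DIM('a) > 0" "(1 + norm z) ^ Suc DIM('a) > 0"
  using norm_ge_zero[of x] norm_ge_zero[of z] by (intro zero_less_power; linarith)+
 show ?thesis unfolding decay_def using p pos by (simp only: divide_simps) (simp add: mult.commute)
qed

lemma schwartz_decay:
 fixes u :: "'a::euclidean_space => real"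
 assumes u: "u \<in> schwartz" and es: "es \<in> lists Basis"
 shows "\<exists>B\<ge>0. \<forall>x. \<bar>iter_partial es u x\<bar> <= B * decay x"
proof -
 let ?N = "Suc DIM('a)" and ?v = "iter_partial es u"
 have bd: "bounded (range (\<lambda>x. norm x ^ k * ?v x))" for k using u es by (auto simp: schwartz_def)
 obtain B0 where B0: "!!x. \<bar>norm x ^ 0 * ?v x\<bar> <= B0" using bd[of 0] unfolding bounded_iff by auto
 obtain B1 where B1: "!!x. \<bar>norm x ^ ?N * ?v x\<bar> <= B1" using bd[of ?N] unfolding bounded_iff by (auto simp del: power_Suc)
 have nn: "B0 >= 0" "B1 >= 0" using B0[of 0] B1[of 0] by linarith+
 show ?thesis
 proof (intro exI[of _ "2 ^ ?N * (B0 + B1)"] conjI allI)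
  show "0 <= 2 ^ ?N * (B0 + B1)" using nn by simp
  fix x
  have p: "(1 + r) ^ ?N <= 2 ^ ?N * (1 + r ^ ?N)" if "r >= 0" for r :: real
  proof -
   have "1 + r <= 2 * max 1 r" by simp
   then have "(1 + r) ^ ?N <= (2 * max 1 r) ^ ?N" using that by (intro power_mono) auto
   also have "... = 2 ^ ?N * max 1 r ^ ?N" by (simp only: power_mult_distrib)
   also have "max 1 r ^ ?N <= 1 + r ^ ?N" using that by (auto simp: max_def simp del: power_Suc)
   finally show ?thesis by simp
  qed
  have "\<bar>?v x\<bar> * (1 + norm x) ^ ?N <= \<bar>?v x\<bar> * (2 ^ ?N * (1 + norm x ^ ?N))" by (intro mult_left_mono p) auto
  also have "... = 2 ^ ?N * (\<bar>norm x ^ 0 * ?v x\<bar> + \<bar>norm x ^ ?N * ?v x\<bar>)" by (simp add: abs_mult algebra_simps)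
  also have "... <= 2 ^ ?N * (B0 + B1)" by (intro mult_left_mono add_mono B0 B1) auto
  finally have le: "\<bar>?v x\<bar> * (1 + norm x) ^ ?N <= 2 ^ ?N * (B0 + B1)" .
  have "(1 + norm x) ^ ?N > 0" using norm_ge_zero[of x] by (intro zero_less_power) linarith
  then show "\<bar>?v x\<bar> <= 2 ^ ?N * (B0 + B1) * decay x"
   using le unfolding decay_def by (simp only: pos_le_divide_eq times_divide_eq_right mult_1_right)
 qed
qed

text \<open>Near \<open>x\<close> this is the mean value inequality, with the gradient controlled by the comparability of \<open>decay\<close>
on unit balls; far from \<open>x\<close> the two values are bounded separately.\<close>

lemma schwartz_difference:
 fixes u :: "'a::euclidean_space => real"
 assumes u: "u \<in> schwartz"
 obtains C where "C >= 0" "!!x h. \<bar>u x - u (x + h)\<bar> <= C * min 1 (norm h) * (decay x + decay (x + h))"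
proof -
 have sm: "smooth u" using u by (simp add: schwartz_def)
 obtain B where B: "B >= 0" "!!x. \<bar>u x\<bar> <= B * decay x" using schwartz_decay[OF u, of "[]"] by auto
 have "\<forall>b. \<exists>B. b \<in> Basis --> B >= 0 & (\<forall>x. \<bar>iter_partial [b] u x\<bar> <= B * decay x)"
  using schwartz_decay[OF u] by (meson lists.simps)
 then obtain D where D: "!!b. b \<in> Basis ==> D b >= 0" "!!b x. b \<in> Basis ==> \<bar>iter_partial [b] u x\<bar> <= D b * decay x" by metis
 define E where "E = (\<Sum>b\<in>(Basis::'a set). D b)"
 have E0: "E >= 0" unfolding E_def by (intro sum_nonneg D(1))
 have DE: "D b <= E" if "b \<in> Basis" for b unfolding E_def by (rule member_le_sum) (use that D(1) in auto)
 define G where "G = real DIM('a) * (E * 2 ^ Suc DIM('a))"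
 have G0: "G >= 0" unfolding G_def using E0 by simp
 show ?thesis
 proof (rule that[of "B + G"])
  show "B + G >= 0" using B G0 by simp
  fix x h :: 'a
  have dp: "decay x + decay (x + h) >= 0" using decay_pos[of x] decay_pos[of "x + h"] by linarith
  show "\<bar>u x - u (x + h)\<bar> <= (B + G) * min 1 (norm h) * (decay x + decay (x + h))"
  proof (cases "norm h <= 1")
   case True
   have "\<bar>u x - u (x + h)\<bar> <= real DIM('a) * (E * 2 ^ Suc DIM('a) * decay x) * norm (x - (x + h))"
   proof (rule smooth_lipschitz_on_convex[OF sm convex_cball[of x 1]])
    show "x \<in> cball x 1" "x + h \<in> cball x 1" using True by (auto simp: dist_norm)
    fix b z :: 'a assume b: "b \<in> Basis" and z: "z \<in> cball x 1"
    have "\<bar>iter_partial [b] u z\<bar> <= D b * decay z" by (rule D(2)[OF b])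
    also have "... <= E * (2 ^ Suc DIM('a) * decay x)"
     using DE[OF b] E0 decay_pos[of z] z by (intro mult_mono decay_shift) (auto simp: dist_norm norm_minus_commute)
    finally show "\<bar>iter_partial [b] u z\<bar> <= E * 2 ^ Suc DIM('a) * decay x" by (simp only: mult.assoc)
   qed
   also have "... = G * norm h * decay x" by (simp add: G_def mult_ac)
   also have "... <= (B + G) * norm h * (decay x + decay (x + h))"
    using B(1) G0 decay_pos[of x] decay_pos[of "x + h"] by (intro mult_mono) auto
   also have "norm h = min 1 (norm h)" using True by simp
   finally show ?thesis .
  next
   case False
   have "\<bar>u x - u (x + h)\<bar> <= \<bar>u x\<bar> + \<bar>u (x + h)\<bar>" by simp
   also have "... <= B * (decay x + decay (x + h))" using B(2)[of x] B(2)[of "x + h"] by (simp add: distrib_left)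
   also have "... <= (B + G) * (decay x + decay (x + h))" using G0 dp by (intro mult_right_mono) auto
   also have "... = (B + G) * min 1 (norm h) * (decay x + decay (x + h))" using False by simp
   finally show ?thesis .
  qed
 qed
qed

lemma schwartz_measurable: "u \<in> schwartz ==> u \<in> Borel"
 using smooth_continuous by (auto simp: schwartz_def intro: borel_measurable_continuous_onI)

lemma schwartz_gagl:
 fixes u :: "'a::euclidean_space => real"
 assumes a: "0 < a" "a < 1" and u: "u \<in> schwartz"
 shows "gagl a u"
proof -
 note um [measurable] = schwartz_measurable[OF u]
 obtain B where B: "B >= 0" "!!x. \<bar>u x\<bar> <= B * decay x" using schwartz_decay[OF u, of "[]"] by auto
 have i: "integrable lborel u"
  by (rule bochner_bound[OF integrable_mult_right[OF decay_integrable, of B]])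
    (use B(2) in \<open>auto intro!: AE_I2 intro: order_trans[OF _ abs_ge_self]\<close>)
 have "integrable lborel (\<lambda>x. (norm (u x))^2)"
 proof (rule bochner_bound[OF integrable_mult_right[OF decay_integrable, of "B^2"]])
  show "AE x in lborel. norm ((norm (u x))^2) <= norm (B^2 * decay x)"
  proof (rule AE_I2)
   fix x
   have "\<bar>u x\<bar>^2 <= (B * decay x)^2" using B(2)[of x] by (intro power_mono) auto
   also have "... = B^2 * (decay x * decay x)" by (simp only: power2_eq_square mult_ac)
   also have "... <= B^2 * decay x" using decay_pos[of x] decay_le_1[of x] by (intro mult_left_mono) (auto simp: mult_left_le)
   finally show "norm ((norm (u x))^2) <= norm (B^2 * decay x)" using decay_pos[of x] by simp
  qed
 qed measurable
 then have L: "u \<in> L2 UNIV" using L2_borel_iff[OF um] by simp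
 obtain C where C: "C >= 0" "!!x h. \<bar>u x - u (x + h)\<bar> <= C * min 1 (norm h) * (decay x + decay (x + h))"
  using schwartz_difference[OF u] by metis
 let ?K = "\<lambda>h::'a. 2 * C^2 * trunc_kernel 2 a h"
 have le: "(Dq a u (x, x + h))^2 <= ?K h * (decay x + decay (x + h))" for x h
 proof -
  let ?d = "decay x + decay (x + h)"
  have d: "0 <= ?d" "?d <= 2" using decay_pos[of x] decay_pos[of "x + h"] decay_le_1[of x] decay_le_1[of "x + h"] by linarith+
  have m: "(min 1 (norm h))^2 = min 1 (norm h powr 2)"
  proof -
   have p: "norm h powr 2 = (norm h)^2" by (cases "h = 0") simp_all
   show ?thesis using power_le_one[of "norm h" 2] one_le_power[of "norm h" 2]
    unfolding p by (cases "norm h <= 1") (simp_all add: min_absorb1 min_absorb2)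
  qed
  have "\<bar>u x - u (x + h)\<bar>^2 <= (C * min 1 (norm h) * ?d)^2" by (rule power_mono[OF C(2)]) simp
  also have "... = C^2 * (min 1 (norm h))^2 * (?d * ?d)" by (simp add: power_mult_distrib power2_eq_square)
  also have "... <= C^2 * (min 1 (norm h))^2 * (2 * ?d)" using d by (intro mult_left_mono mult_right_mono) auto
  finally have "(u x - u (x + h))^2 * norm h powr (- (real DIM('a) + 2 * a)) <= (C^2 * (min 1 (norm h))^2 * (2 * ?d)) * norm h powr (- (real DIM('a) + 2 * a))"
   by (intro mult_right_mono) simp_all
  also have "... = ?K h * ?d" unfolding trunc_kernel_def m by (simp only: mult_ac)
  finally show ?thesis unfolding Dq_sq by simp
 qed
 have Dm: "Dq a u \<in> Borel" by measurable
 have "(\<integral>+z. ennreal ((Dq a u z)^2)) = (\<integral>+h. \<integral>+x. ennreal ((Dq a u (x, x + h))^2))"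
  by (rule nn_integral_pair_shift) (use Dm in measurable)
 also have "... <= (\<integral>+h. \<integral>+x. ennreal (?K h * (decay x + decay (x + h))))"
  by (intro nn_integral_mono ennreal_leI le)
 also have "... < \<infinity>"
 proof (rule decay_pair_integral_finite)
  show "integrable lborel ?K" by (intro integrable_mult_right trunc_kernel_integrable) (use a in auto)
  show "0 <= ?K h" for h by (intro mult_nonneg_nonneg trunc_kernel_nonneg) auto
 qed
 finally have "integrable lborel (\<lambda>z. (norm (Dq a u z))^2)" using Dm by (intro integrableI_nonneg) auto
 then have "Dq a u \<in> L2 UNIV" using L2_borel_iff[OF Dm] by simp
 then show ?thesis using um i L by (simp add: gagl_def)
qed

definition diff_kernel :: "real => ('a::euclidean_space => real) => 'a => 'a => real" where
 "diff_kernel a u x h = (u x - u (x + h)) * norm h powr (- (real DIM('a) + 2 * a))"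

text \<open>For \<open>a < 1/2\<close> the principal value is an absolutely convergent integral on Schwartz functions.\<close>

definition singular_integral :: "real => ('a::euclidean_space => real) => 'a => real" where
 "singular_integral a u x = (LBINT h. diff_kernel a u x h)"

lemma diff_kernel_measurable [measurable]:
 assumes [measurable]: "u \<in> Borel"
 shows "(\<lambda>(x, h). diff_kernel a u x h) \<in> borel_measurable (borel \<Otimes>\<^sub>M borel)"
 unfolding diff_kernel_def by measurable

context
 fixes a :: real and u :: "real ^ 'n => real"
 assumes a: "0 < a" "a < 1/2" and u: "u \<in> schwartz"
begin

lemma trunc1: "integrable lborel (trunc_kernel 1 a :: real ^ 'n => real)"
 by (rule trunc_kernel_integrable) (use a in auto)

lemmas um [measurable] = schwartz_measurable[OF u]

lemma diff_kernel_bound: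
 obtains C where "C >= 0" "!!x h. \<bar>diff_kernel a u x h\<bar> <= C * trunc_kernel 1 a h * (decay x + decay (x + h))"
proof -
 obtain C where C: "C >= 0" "!!x h. \<bar>u x - u (x + h)\<bar> <= C * min 1 (norm h) * (decay x + decay (x + h))"
  using schwartz_difference[OF u] by metis
 show ?thesis
 proof (rule that[OF C(1)])
  fix x h :: "real ^ 'n"
  have "\<bar>diff_kernel a u x h\<bar> = \<bar>u x - u (x + h)\<bar> * norm h powr (- (real DIM(real ^ 'n) + 2 * a))"
   unfolding diff_kernel_def abs_mult by simp
  also have "... <= (C * min 1 (norm h) * (decay x + decay (x + h))) * norm h powr (- (real DIM(real ^ 'n) + 2 * a))"
   by (rule mult_right_mono[OF C(2)]) simp
  also have "... = C * trunc_kernel 1 a h * (decay x + decay (x + h))" by (simp add: trunc_kernel_def mult_ac)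
  finally show "\<bar>diff_kernel a u x h\<bar> <= C * trunc_kernel 1 a h * (decay x + decay (x + h))" .
 qed
qed

lemma diff_kernel_dominated:
 obtains C where "integrable lborel (\<lambda>h::real ^ 'n. C * trunc_kernel 1 a h)" "!!x h. \<bar>diff_kernel a u x h\<bar> <= C * trunc_kernel 1 a h"
proof -
 obtain C where C: "C >= 0" "!!x h. \<bar>diff_kernel a u x h\<bar> <= C * trunc_kernel 1 a h * (decay x + decay (x + h))"
  using diff_kernel_bound by metis
 show ?thesis
 proof (rule that[of "C * 2"])
  show "integrable lborel (\<lambda>h::real ^ 'n. C * 2 * trunc_kernel 1 a h)" using trunc1 by simp
  fix x h :: "real ^ 'n"
  have "C * trunc_kernel 1 a h * (decay x + decay (x + h)) <= C * trunc_kernel 1 a h * 2"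
   using C(1) trunc_kernel_nonneg[of 1 a h] decay_le_1[of x] decay_le_1[of "x + h"] by (intro mult_left_mono) auto
  then show "\<bar>diff_kernel a u x h\<bar> <= C * 2 * trunc_kernel 1 a h" using C(2)[of x h] by simp
 qed
qed

lemma singular_integral_bounded:
 obtains B where "B >= 0" "!!x. \<bar>singular_integral a u x\<bar> <= B"
proof -
 obtain C where C: "integrable lborel (\<lambda>h::real ^ 'n. C * trunc_kernel 1 a h)" "!!x h. \<bar>diff_kernel a u x h\<bar> <= C * trunc_kernel 1 a h"
  using diff_kernel_dominated by metis
 define B where "B = (LINT h|(lborel :: (real ^ 'n) measure). C * trunc_kernel 1 a h)"
 have ki: "integrable lborel (\<lambda>h. diff_kernel a u x h)" for x
 proof (rule bochner_bound[OF C(1)])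
  show "(\<lambda>h. diff_kernel a u x h) \<in> borel_measurable lborel" unfolding diff_kernel_def by measurable
  show "AE h in lborel. norm (diff_kernel a u x h) <= norm (C * trunc_kernel 1 a h)"
   unfolding real_norm_def by (intro AE_I2 order_trans[OF C(2) abs_ge_self])
 qed
 have bd: "\<bar>singular_integral a u x\<bar> <= B" for x
 proof -
  have "\<bar>singular_integral a u x\<bar> <= (LBINT h. \<bar>diff_kernel a u x h\<bar>)" unfolding singular_integral_def by (rule integral_abs_bound)
  also have "... <= B" unfolding B_def by (rule integral_mono[OF integrable_abs[OF ki] C(1) C(2)])
  finally show ?thesis .
 qed
 show ?thesis using that[OF order_trans[OF abs_ge_zero bd] bd] .
qed

lemma singular_integral_measurable: "singular_integral a u \<in> Borel"
 unfolding singular_integral_def[abs_def] using diff_kernel_measurable[OF um, of a] by measurable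

text \<open>Symmetrisation: expanding \<open>w(x) - w(y)\<close> in the energy gives two integrals that are exchanged by
swapping \<open>x\<close> and \<open>y\<close>.\<close>

lemma singular_integral_weak:
 assumes w: "w \<in> schwartz"
 shows "(LBINT x. singular_integral a u x * w x) = (l2of (Dq a u) \<bullet> l2of (Dq a w)) / 2"
proof -
 let ?p = "real DIM(real ^ 'n) + 2 * a"
 have a1: "a < 1" using a by simp
 note gu = gaglD[OF schwartz_gagl[OF a(1) a1 u]] and gw = gaglD[OF schwartz_gagl[OF a(1) a1 w]]
 note wm [measurable] = schwartz_measurable[OF w]
 define Q where "Q z = (u (fst z) - u (snd z)) * norm (fst z - snd z) powr (- ?p) * w (fst z)" for z :: "(real ^ 'n) \<times> (real ^ 'n)"
 have Qm: "Q \<in> Borel" unfolding Q_def[abs_def] by measurable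
 have Qd: "Q (x, x + h) = diff_kernel a u x h * w x" for x h by (simp add: Q_def diff_kernel_def)
 have Qi: "integrable lborel Q"
 proof -
  obtain C where C: "C >= 0" "!!x h. \<bar>diff_kernel a u x h\<bar> <= C * trunc_kernel 1 a h * (decay x + decay (x + h))"
   using diff_kernel_bound by metis
  obtain B where B: "B >= 0" "!!x. \<bar>w x\<bar> <= B * decay x" using schwartz_decay[OF w, of "[]"] by auto
  have wB: "\<bar>w x\<bar> <= B" for x using order_trans[OF B(2) mult_left_mono[OF decay_le_1 B(1)]] by simp
  let ?K = "\<lambda>h::real ^ 'n. B * C * trunc_kernel 1 a h"
  have "\<bar>Q (x, x + h)\<bar> <= ?K h * (decay x + decay (x + h))" for x h
   using mult_mono[OF C(2)[of x h] wB[of x] order_trans[OF abs_ge_zero C(2)] abs_ge_zero]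
   unfolding Qd abs_mult by (simp only: mult_ac)
  then have "(\<integral>+h. \<integral>+x. ennreal \<bar>Q (x, x + h)\<bar>) <= (\<integral>+h. \<integral>+x. ennreal (?K h * (decay x + decay (x + h))))"
   by (intro nn_integral_mono ennreal_leI)
  also have "... < \<infinity>"
   by (rule decay_pair_integral_finite[OF integrable_mult_right[OF trunc1] mult_nonneg_nonneg[OF mult_nonneg_nonneg[OF B(1) C(1)] trunc_kernel_nonneg]])
  finally have "(\<integral>+z. ennreal \<bar>Q z\<bar>) < \<infinity>"
   using nn_integral_pair_shift[of "\<lambda>z. ennreal \<bar>Q z\<bar>"] Qm by simp
  then show ?thesis using Qm by (simp add: integrable_iff_bounded)
 qed
 have Qi': "integrable lborel (\<lambda>z. Q (snd z, fst z))" by (rule lborel_integrable_swap[OF Qi])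
 have P: "Dq a u z * Dq a w z = Q z + Q (snd z, fst z)" for z
 proof -
  obtain x y where z: "z = (x, y)" by (cases z)
  have e: "norm (x - y) powr (- (real DIM(real ^ 'n) / 2 + a)) * norm (x - y) powr (- (real DIM(real ^ 'n) / 2 + a)) = norm (x - y) powr (- ?p)"
   unfolding powr_add[symmetric] by (rule arg_cong[where f = "(powr) (norm (x - y))"]) simp
  have "Dq a u z * Dq a w z = (u x - u y) * (w x - w y) * norm (x - y) powr (- ?p)" unfolding z Dq_def e[symmetric] by simp
  then show ?thesis unfolding z Q_def by (simp add: norm_minus_commute[of y x] algebra_simps)
 qed
 have "l2of (Dq a u) \<bullet> l2of (Dq a w) = (LBINT z. Q z + Q (snd z, fst z))"
  unfolding inner_l2of[OF gu(4) gw(4)] using Qm borel_measurable_integrable[OF Qi']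
  by (intro lebesgue_integral_eq_borel) (simp_all add: P)
 also have "... = 2 * (LBINT z. Q z)"
  unfolding bochner_add[OF Qi Qi'] lborel_integral_swap[OF Qm] by simp
 also have "(LBINT z. Q z) = (LBINT x. (LBINT y. Q (x, y)))" by (rule lborel_iterated_integral[OF Qi, symmetric])
 also have "... = (LBINT x. singular_integral a u x * w x)"
 proof (rule bochner_cong[OF refl])
  fix x
  have m: "(\<lambda>y. Q (x, y)) \<in> Borel" using Qm by measurable
  have "(LBINT y. Q (x, y)) = (LBINT h. Q (x, x + h))" using lborel_integral_affine[OF m, of 1 x] by simp
  then show "(LBINT y. Q (x, y)) = singular_integral a u x * w x" unfolding Qd singular_integral_def by simp
 qed
 finally show ?thesis by simp
qed

text \<open>The whole multiplier \<open>|\<xi>|\<^sup>2\<^sup>a\<close> is put on \<open>u\<close> instead of half of it on each factor.\<close>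

lemma frac_laplacian_weak:
 assumes w: "w \<in> schwartz"
 shows "frac_laplacian a u \<in> L2 UNIV"
  "(LINT x|lebesgue. frac_laplacian a u x * w x) = (l2of (Dq a u) \<bullet> l2of (Dq a w)) / symbol_const TYPE('n) a"
proof -
 let ?P = "(2 * pi) ^ DIM(real ^ 'n)"
 have a1: "a < 1" "0 < 2 * a" "2 * a < 1" using a by auto
 note gu = schwartz_gagl[OF a(1) a1(1) u] and gw = schwartz_gagl[OF a(1) a1(1) w]
 have L: "(\<lambda>\<xi>. complex_of_real (norm \<xi> powr (2 * a)) * fint (cplx u) \<xi>) \<in> L2 UNIV"
  using gagl_mult_fint(1)[OF a1(2,3) schwartz_gagl[OF a1(2,3) u]] unfolding mult_fint_def[abs_def] .
 note h = frac_laplacian_has_fourier[OF gaglD(3)[OF gu] has_fourier_fint[OF gagl_good[OF gu]] L]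
 show fL: "frac_laplacian a u \<in> L2 UNIV" by (rule h(1))
 note mu = gagl_mult_fint(1)[OF a(1) a1(1) gu] and mw = gagl_mult_fint(1)[OF a(1) a1(1) gw]
 have "?P * (LINT x|lebesgue. frac_laplacian a u x * w x) = FT (l2of (cplx (frac_laplacian a u))) \<bullet> FT (l2of (cplx w))"
  unfolding FT_inner inner_cplx[OF fL gaglD(3)[OF gw]] ..
 also have "... = (LINT \<xi>|lebesgue. (complex_of_real (norm \<xi> powr (2 * a)) * fint (cplx u) \<xi>) \<bullet> fint (cplx w) \<xi>)"
  using h(2) inner_l2of[OF L good_fint[OF gagl_good[OF gw]]] by (simp add: has_fourier_iff FT_l2of[OF gagl_good[OF gw]])
 also have "... = l2of (mult_fint a u) \<bullet> l2of (mult_fint a w)"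
  unfolding inner_l2of[OF mu mw]
 proof (intro bochner_cong refl)
  fix \<xi> :: "real ^ 'n"
  have "norm \<xi> powr (2 * a) = norm \<xi> powr a * norm \<xi> powr a" unfolding powr_add[symmetric] by simp
  then show "(complex_of_real (norm \<xi> powr (2 * a)) * fint (cplx u) \<xi>) \<bullet> fint (cplx w) \<xi> = mult_fint a u \<xi> \<bullet> mult_fint a w \<xi>"
   unfolding mult_fint_def by (simp add: scaleR_conv_of_real[symmetric] mult.assoc)
 qed
 also have "... = ?P * ((l2of (Dq a u) \<bullet> l2of (Dq a w)) / symbol_const TYPE('n) a)" unfolding mult_fint_inner[OF a(1) a1(1) gu gw] by simp
 finally show "(LINT x|lebesgue. frac_laplacian a u x * w x) = (l2of (Dq a u) \<bullet> l2of (Dq a w)) / symbol_const TYPE('n) a"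
  by (simp only: mult_cancel_left) simp
qed

lemma principal_value_limit:
 "((\<lambda>\<epsilon>. C * (LINT y:- ball x \<epsilon>|lebesgue. (u x - u y) / norm (x - y) powr (real DIM(real ^ 'n) + 2 * a)))
   \<longlongrightarrow> C * singular_integral a u x) (at_right 0)"
proof -
 have e: "(LINT y:- ball x \<epsilon>|lebesgue. (u x - u y) / norm (x - y) powr (real DIM(real ^ 'n) + 2 * a))
   = (LBINT h. indicator (- ball 0 \<epsilon>) h * diff_kernel a u x h)" for \<epsilon>
 proof -
  let ?g = "\<lambda>y. indicator (- ball x \<epsilon>) y *\<^sub>R ((u x - u y) / norm (x - y) powr (real DIM(real ^ 'n) + 2 * a))"
  have [measurable]: "(\<lambda>y. indicator (- ball x \<epsilon>) y :: real) \<in> Borel"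
   by (rule borel_measurable_indicator, rule borel_closed, simp add: closed_Compl)
  have gm: "?g \<in> Borel" by measurable
  have "(LINT y:- ball x \<epsilon>|lebesgue. (u x - u y) / norm (x - y) powr (real DIM(real ^ 'n) + 2 * a)) = (LBINT y. ?g y)"
   unfolding set_lebesgue_integral_def using gm by (intro integral_completion) simp
  also have "... = (LBINT h. ?g (x + 1 *\<^sub>R h))" using lborel_integral_affine[OF gm, of 1 x] by simp
  also have "... = (LBINT h. indicator (- ball 0 \<epsilon>) h * diff_kernel a u x h)"
  proof (intro bochner_cong refl)
   fix h
   have "indicator (- ball x \<epsilon>) (x + h) = (indicator (- ball 0 \<epsilon>) h :: real)" by (simp add: indicator_def dist_norm)
   then show "?g (x + 1 *\<^sub>R h) = indicator (- ball 0 \<epsilon>) h * diff_kernel a u x h"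
    unfolding diff_kernel_def powr_minus by (simp add: divide_inverse)
  qed
  finally show ?thesis .
 qed
 obtain D where D: "integrable lborel (\<lambda>h::real ^ 'n. D * trunc_kernel 1 a h)" "!!x h. \<bar>diff_kernel a u x h\<bar> <= D * trunc_kernel 1 a h"
  using diff_kernel_dominated by metis
 have km [measurable]: "(\<lambda>h. diff_kernel a u x h) \<in> Borel" unfolding diff_kernel_def by measurable
 have "((\<lambda>\<epsilon>. LBINT h. indicator (- ball 0 \<epsilon>) h * diff_kernel a u x h) \<longlongrightarrow> singular_integral a u x) (at_right 0)"
 proof (rule tendsto_at_right_sequentially[of 0 1])
  fix S :: "nat => real" assume S: "!!n. 0 < S n" "S ----> 0"
  show "(\<lambda>n. LBINT h. indicator (- ball 0 (S n)) h * diff_kernel a u x h) ----> singular_integral a u x"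
   unfolding singular_integral_def
  proof (rule integral_dominated_convergence[OF _ _ D(1)])
   show "AE h in lborel. (\<lambda>n. indicator (- ball 0 (S n)) h * diff_kernel a u x h) ----> diff_kernel a u x h"
   proof (rule AE_I2)
    fix h
    show "(\<lambda>n. indicator (- ball 0 (S n)) h * diff_kernel a u x h) ----> diff_kernel a u x h"
    proof (cases "h = 0")
     case True
     then show ?thesis by (simp add: diff_kernel_def)
    next
     case False
     then have "\<forall>\<^sub>F n in sequentially. S n < norm h" using order_tendstoD(2)[OF S(2), of "norm h"] by simp
     then have "\<forall>\<^sub>F n in sequentially. indicator (- ball 0 (S n)) h * diff_kernel a u x h = diff_kernel a u x h"
      by eventually_elim (simp add: indicator_def)
     then show ?thesis by (rule tendsto_eventually)
    qed
   qed
   show "AE h in lborel. norm (indicator (- ball 0 (S n)) h * diff_kernel a u x h) <= D * trunc_kernel 1 a h" for n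
   proof (rule AE_I2)
    fix h
    have "norm (indicator (- ball 0 (S n)) h * diff_kernel a u x h) <= \<bar>diff_kernel a u x h\<bar>" by (simp add: indicator_def)
    then show "norm (indicator (- ball 0 (S n)) h * diff_kernel a u x h) <= D * trunc_kernel 1 a h" using D(2)[of x h] by linarith
   qed
   show "(\<lambda>h. indicator (- ball 0 (S n)) h * diff_kernel a u x h) \<in> borel_measurable lborel" for n
   proof -
    have [measurable]: "(\<lambda>y::real ^ 'n. indicator (- ball 0 (S n)) y :: real) \<in> Borel"
     by (rule borel_measurable_indicator, rule borel_closed, simp add: closed_Compl)
    show ?thesis by measurable
   qed
  qed (use km in simp)
 qed simp
 then show ?thesis unfolding e by (rule tendsto_mult_left)
qed

end

lemma test_functions_subset_schwartz: "test_functions U \<subseteq> schwartz"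
proof
 fix u :: "'a::euclidean_space => real" assume u: "u \<in> test_functions U"
 have sm: "smooth u" using u by (simp add: test_functions_def)
 let ?K = "closure {x. u x ~= 0}"
 have K: "compact ?K" using u by (simp add: test_functions_def)
 have z: "iter_partial es u x = 0" if "x ~: ?K" for es x
  using that
 proof (induction es arbitrary: x)
  case Nil
  then show ?case using closure_subset[of "{x. u x ~= 0}"] by auto
 next
  case (Cons e es)
  have "((\<lambda>_. 0) has_derivative (\<lambda>h. 0)) (at x)" by simp
  then have "(iter_partial es u has_derivative (\<lambda>h. 0)) (at x)"
   by (rule has_derivative_transform_within_open[of _ _ _ _ "- ?K"]) (use Cons in \<open>auto simp: open_Compl\<close>)
  then show ?case using frechet_derivative_at by (metis iter_partial.simps(2))
 qed
 have "bounded (range (\<lambda>x. norm x ^ k * iter_partial es u x))" if "es \<in> lists Basis" for es k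
 proof -
  have "continuous_on UNIV (\<lambda>x. norm x ^ k * iter_partial es u x)"
   using sm that unfolding smooth_def by (intro continuous_intros differentiable_imp_continuous_on) blast
  then obtain M where "!!x. norm (norm x ^ k * iter_partial es u x) <= M"
   using continuous_compact_support_bounded[OF _ K, of "\<lambda>x. norm x ^ k * iter_partial es u x"] z by (metis mult_zero_right)
  then show ?thesis unfolding bounded_iff by blast
 qed
 then show "u \<in> schwartz" using sm by (simp add: schwartz_def)
qed

text \<open>Both sides have the same integral against every test function, by the two weak identities.\<close>

lemma frac_laplacian_schwartz:
 fixes u :: "real ^ 'n => real"
 assumes a: "0 < a" "a < 1/2" and u: "u \<in> schwartz"
 shows "AE x in lebesgue. frac_laplacian a u x = 2 / symbol_const TYPE('n) a * singular_integral a u x"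
proof -
 let ?c = "2 / symbol_const TYPE('n) a" and ?T = "singular_integral a u" and ?f = "frac_laplacian a u"
 obtain B where B: "B >= 0" "!!x. \<bar>?T x\<bar> <= B" using singular_integral_bounded[OF a u] by metis
 note Tm = singular_integral_measurable[OF a u]
 have fL: "?f \<in> L2 UNIV" by (rule frac_laplacian_weak(1)[OF a u u])
 have Ti: "integrable lebesgue (\<lambda>x. ?T x * g x)" if g: "g \<in> Borel" "integrable lborel g" for g :: "real ^ 'n => real"
 proof -
  have "integrable lborel (\<lambda>x. ?T x * g x)"
  proof (rule bochner_bound[OF integrable_mult_right[OF g(2), of B]])
   show "AE x in lborel. norm (?T x * g x) <= norm (B * g x)" using B by (intro AE_I2) (simp add: abs_mult mult_right_mono)
  qed (use Tm g(1) in measurable)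
  then show ?thesis using Tm g(1) by (subst integrable_completion) auto
 qed
 have "AE x in lebesgue. x \<in> UNIV --> ?f x - ?c * ?T x = 0"
 proof (rule test_functions_separate[OF open_UNIV])
  fix l r :: "real ^ 'n"
  let ?i = "\<lambda>x. indicator (cbox l r) x :: real"
  have 1: "integrable lebesgue (\<lambda>x. ?f x * ?i x)"
   using L2_inner_integrable[OF fL L2_indicator[of "cbox l r"]] by simp
  have 2: "integrable lebesgue (\<lambda>x. ?c * (?T x * ?i x))"
   using emeasure_bounded_finite[OF bounded_cbox[of l r]]
   by (intro integrable_mult_right Ti borel_measurable_indicator integrable_real_indicator) auto
  show "integrable lebesgue (\<lambda>x. ?i x * (?f x - ?c * ?T x))"
   using bochner_integrable_diff[OF 1 2] by (simp add: algebra_simps)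
 next
  fix \<psi> :: "real ^ 'n => real" assume p: "\<psi> \<in> test_functions UNIV"
  then have ps: "\<psi> \<in> schwartz" using test_functions_subset_schwartz by blast
  note tf = test_function_L2[OF p]
  have i1: "integrable lebesgue (\<lambda>x. ?f x * \<psi> x)" using L2_inner_integrable[OF fL tf(2)] by simp
  have i2: "integrable lebesgue (\<lambda>x. ?c * (?T x * \<psi> x))" by (intro integrable_mult_right Ti tf)
  have "(LINT x|lebesgue. (?f x - ?c * ?T x) * \<psi> x) = (LINT x|lebesgue. ?f x * \<psi> x) - (LINT x|lebesgue. ?c * (?T x * \<psi> x))"
   using bochner_diff[OF i1 i2] by (simp add: left_diff_distrib mult.assoc)
  also have "(LINT x|lebesgue. ?c * (?T x * \<psi> x)) = ?c * (LBINT x. ?T x * \<psi> x)"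
   unfolding integral_mult_right_zero using Tm tf(1) by (subst integral_completion) auto
  finally show "(LINT x|lebesgue. (?f x - ?c * ?T x) * \<psi> x) = 0"
   unfolding singular_integral_weak[OF a u ps] frac_laplacian_weak(2)[OF a u ps] by simp
 qed
 then show ?thesis by eventually_elim simp
qed

lemma test_function_gagl:
 assumes "0 < a" "a < 1" "\<phi> \<in> test_functions U"
 shows "gagl a \<phi>"
 using assms test_functions_subset_schwartz by (intro schwartz_gagl) auto

text \<open>Existence is the principal value formula. For uniqueness, two admissible constants would force the
singular integral of a bump to vanish, hence its energy, hence all its differences; but a bump takes
nonzero values on one box and zero on another.\<close>

lemma frac_const_eq:
 assumes a: "0 < a" "a < 1/2"
 shows "frac_const TYPE(real ^ 'n::finite) a = 2 / symbol_const TYPE('n) a"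
proof -
 let ?C = "2 / symbol_const TYPE('n) a"
 have a1: "a < 1" using a by simp
 have M: "symbol_const TYPE('n) a > 0" by (rule symbol_const_pos[OF a(1) a1])
 let ?P = "\<lambda>C. 0 < C & (\<forall>u \<in> (schwartz :: (real ^ 'n => real) set).
   AE x in lebesgue.
    ((\<lambda>\<epsilon>. C * (LINT y:- ball x \<epsilon>|lebesgue.
          (u x - u y) / norm (x - y) powr (real DIM(real ^ 'n) + 2 * a)))
     \<longlongrightarrow> frac_laplacian a u x) (at_right 0))"
 have ex: "?P ?C"
 proof (intro conjI ballI)
  show "0 < ?C" using M by simp
  fix u :: "real ^ 'n => real" assume u: "u \<in> schwartz"
  show "AE x in lebesgue. ((\<lambda>\<epsilon>. ?C * (LINT y:- ball x \<epsilon>|lebesgue.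
          (u x - u y) / norm (x - y) powr (real DIM(real ^ 'n) + 2 * a))) \<longlongrightarrow> frac_laplacian a u x) (at_right 0)"
   using frac_laplacian_schwartz[OF a u]
  proof eventually_elim
   case (elim x)
   show ?case unfolding elim by (rule principal_value_limit[OF a u])
  qed
 qed
 have unique: "C = ?C" if C: "?P C" for C
 proof (rule ccontr)
  assume ne: "C ~= ?C"
  let ?u = "bump 1 (0 :: real ^ 'n) One"
  have ut: "?u \<in> test_functions UNIV" by (rule bump_test_function) auto
  then have us: "?u \<in> schwartz" using test_functions_subset_schwartz by blast
  let ?T = "singular_integral a ?u"
  have "AE x in lborel. ?T x * ?u x = 0" unfolding AE_lebesgue_iff_lborel[symmetric]
   using frac_laplacian_schwartz[OF a us] bspec[OF conjunct2[OF C] us]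
  proof eventually_elim
   case (elim x)
   have "C * ?T x = frac_laplacian a ?u x"
    by (rule tendsto_unique[OF _ principal_value_limit[OF a us] elim(2)]) simp
   then have "(C - ?C) * ?T x = 0" unfolding elim(1) by (simp only: left_diff_distrib diff_self)
   then have "?T x = 0" using ne by (simp only: mult_eq_0_iff right_minus_eq simp_thms)
   then show ?case by simp
  qed
  from integral_eq_zero_AE[OF this] have "l2of (Dq a ?u) \<bullet> l2of (Dq a ?u) = 0" unfolding singular_integral_weak[OF a us us] by simp
  then have "l2of (Dq a ?u) = 0" by simp
  then have "AE z in lebesgue. Dq a ?u z = 0"
   using l2of_eq_iff[OF gaglD(4)[OF schwartz_gagl[OF a(1) a1 us]] L2_zero] by (simp add: l2of_zero)
  then have ae: "AE z\<in>box 0 One \<times> box One (2 *\<^sub>R One) in lebesgue. z \<in> ({} :: ((real ^ 'n) \<times> (real ^ 'n)) set)"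
  proof eventually_elim
   case (elim z)
   show ?case
   proof
    assume "z \<in> box 0 One \<times> box One (2 *\<^sub>R One)"
    then obtain x y :: "real ^ 'n" where z: "z = (x, y)" "x \<in> box 0 One" "y \<in> box One (2 *\<^sub>R One)" by (cases z) auto
    obtain k :: "real ^ 'n" where k: "k \<in> Basis" using nonempty_Basis by blast
    have y: "y ~: box 0 One" using z(3) k by (fastforce simp: mem_box)
    then have "?u x ~= 0" "?u y = 0" "x ~= y" using z(2) bump_pos_iff[of 1 "0 :: real ^ 'n" One] by auto
    then show "z \<in> {}" using elim by (simp add: z(1) Dq_def)
   qed
  qed
  have "box (0 :: real ^ 'n) One ~= {}" "box (One :: real ^ 'n) (2 *\<^sub>R One) ~= {}" by (simp_all add: box_ne_empty)
  then obtain x0 y0 :: "real ^ 'n" where "x0 \<in> box 0 One" "y0 \<in> box One (2 *\<^sub>R One)" by blast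
  then have z: "(x0, y0) \<in> box (0 :: real ^ 'n) One \<times> box One (2 *\<^sub>R One)" by simp
  from mem_closed_if_AE_lebesgue_open[OF open_Times[OF open_box open_box] closed_empty ae z] show False by simp
 qed
 show ?thesis unfolding frac_const_def by (rule the_equality[of ?P ?C, OF ex unique])
qed

section \<open>The regional Laplacian as an operator on difference quotients\<close>

lemma hilbert_adjoint:
 fixes S :: "'h::hilbert => 'k::hilbert"
 assumes S: "bounded_linear S"
 obtains R where "bounded_linear R" "!!g v. R g \<bullet> v = g \<bullet> S v"
proof -
 interpret S: bounded_linear S by fact
 have bl: "bounded_linear (\<lambda>v. g \<bullet> S v)" for g
  by (rule bounded_linear_compose[OF bounded_linear_inner_right S])
 have "\<forall>g. \<exists>r. \<forall>v. r \<bullet> v = g \<bullet> S v"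
 proof
  fix g
  obtain r where "!!v. v \<in> UNIV ==> r \<bullet> v = g \<bullet> S v"
   using hilbert_riesz[OF subspace_UNIV closed_UNIV bl[of g]] by blast
  then show "\<exists>r. \<forall>v. r \<bullet> v = g \<bullet> S v" by blast
 qed
 then obtain R where R: "!!g v. R g \<bullet> v = g \<bullet> S v" by metis
 obtain K where K: "K >= 0" "!!v. norm (S v) <= norm v * K" using S.nonneg_bounded by blast
 have eqI: "x = y" if "!!v. x \<bullet> v = y \<bullet> v" for x y :: 'h
 proof -
  have "(x - y) \<bullet> (x - y) = 0" using that[of "x - y"] by (simp add: inner_diff_left)
  then show ?thesis by simp
 qed
 have "bounded_linear R"
 proof (rule bounded_linear_intro[where K = K])
  show "R (g + h) = R g + R h" for g h by (rule eqI) (simp add: R inner_add_left)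
  show "R (r *\<^sub>R g) = r *\<^sub>R R g" for r g by (rule eqI) (simp add: R)
  show "norm (R g) <= norm g * K" for g
  proof (cases "R g = 0")
   case False
   have "norm (R g) * norm (R g) = g \<bullet> S (R g)" by (simp add: R[symmetric] power2_norm_eq_inner[symmetric] power2_eq_square)
   also have "... <= norm g * norm (S (R g))" by (rule norm_cauchy_schwarz)
   also have "... <= norm g * (norm (R g) * K)" by (intro mult_left_mono K) auto
   finally have "norm (R g) * norm (R g) <= (norm g * K) * norm (R g)" by (simp only: mult_ac)
   then show ?thesis by (rule mult_right_le_imp_le) (use False in simp)
  qed (use K in simp)
 qed
 then show ?thesis using that R by blast
qed

text \<open>A Schur type bound: square integrability of the kernel on fibres, uniformly, makes multiplication map
functions of \<open>x\<close> boundedly into functions of \<open>(x, y)\<close>.\<close>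

lemma fiber_mult:
 fixes m :: "'a::euclidean_space \<times> 'a => real" and v :: "'a => real"
 assumes m [measurable]: "m \<in> Borel" and v [measurable]: "v \<in> Borel" and vL: "v \<in> L2 UNIV"
  and bd: "!!x. (\<integral>+y. ennreal ((m (x, y))^2)) <= ennreal (A^2)" and A: "A >= 0"
 shows "(\<lambda>z. m z * v (fst z)) \<in> L2 UNIV" "norm (l2of (\<lambda>z. m z * v (fst z))) <= A * norm (l2of v)"
proof -
 let ?f = "\<lambda>z. m z * v (fst z)"
 have fm: "?f \<in> Borel" by measurable
 have "(\<integral>+z. ennreal ((norm (?f z))^2)) = (\<integral>+x. \<integral>+y. ennreal ((m (x, y) * v x)^2))"
  using nn_integral_lborel_pair(1)[of "\<lambda>z. ennreal ((norm (?f z))^2)"] fm by simp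
 also have "... <= (\<integral>+x. ennreal (A^2) * ennreal ((norm (v x))^2))"
 proof (rule nn_integral_mono)
  fix x
  have m': "(\<lambda>y. m (x, y)) \<in> Borel" by measurable
  have "(\<integral>+y. ennreal ((m (x, y) * v x)^2)) = (\<integral>+y. ennreal ((m (x, y))^2) * ennreal ((norm (v x))^2))"
   by (intro nn_integral_cong) (simp add: power_mult_distrib ennreal_mult)
  also have "... = (\<integral>+y. ennreal ((m (x, y))^2)) * ennreal ((norm (v x))^2)"
   by (rule nn_integral_multc) (use m' in measurable)
  also have "... <= ennreal (A^2) * ennreal ((norm (v x))^2)" by (rule mult_right_mono[OF bd]) simp
  finally show "(\<integral>+y. ennreal ((m (x, y) * v x)^2)) <= ennreal (A^2) * ennreal ((norm (v x))^2)" .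
 qed
 also have "... = ennreal (A^2) * ennreal ((norm (l2of v))^2)"
  unfolding nn_integral_l2of_borel[OF vL, symmetric] by (rule nn_integral_cmult) measurable
 also have "... = ennreal ((A * norm (l2of v))^2)" by (simp add: ennreal_mult power_mult_distrib)
 finally have le: "(\<integral>+z. ennreal ((norm (?f z))^2)) <= ennreal ((A * norm (l2of v))^2)" .
 show "?f \<in> L2 UNIV" "norm (l2of ?f) <= A * norm (l2of v)"
  by (rule L2_borel_nn_integral[OF fm le], simp add: A)+
qed

text \<open>By Tonelli, exchanging the two variables preserves the norm.\<close>

lemma L2_swap:
 fixes f :: "'a::euclidean_space \<times> 'a => real"
 assumes f: "f \<in> Borel" "f \<in> L2 UNIV"
 shows "(\<lambda>z. f (snd z, fst z)) \<in> L2 UNIV" "norm (l2of (\<lambda>z. f (snd z, fst z))) <= norm (l2of f)"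
proof -
 note f(1)[measurable]
 have m: "(\<lambda>z. f (snd z, fst z)) \<in> Borel" unfolding borel_prod[symmetric] by measurable
 have "(\<integral>+z. ennreal ((norm (f (snd z, fst z)))^2)) = (\<integral>+x. \<integral>+y. ennreal ((norm (f (y, x)))^2))"
  using nn_integral_lborel_pair(1)[of "\<lambda>z. ennreal ((norm (f (snd z, fst z)))^2)"] m by simp
 also have "... = (\<integral>+z. ennreal ((norm (f z))^2))"
  using nn_integral_lborel_pair(2)[of "\<lambda>z. ennreal ((norm (f z))^2)"] f(1) by simp
 finally have le: "(\<integral>+z. ennreal ((norm (f (snd z, fst z)))^2)) <= ennreal ((norm (l2of f))^2)"
  unfolding nn_integral_l2of_borel[OF f(2)] by simp
 show "(\<lambda>z. f (snd z, fst z)) \<in> L2 UNIV" "norm (l2of (\<lambda>z. f (snd z, fst z))) <= norm (l2of f)"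
  by (rule L2_borel_nn_integral[OF m le], simp)+
qed

text \<open>The regional energy of order \<open>s/2\<close> has weight \<open>|x - y|\<^sup>-\<^sup>n\<^sup>-\<^sup>s\<close>; dividing it by the weight
\<open>|x - y|\<^sup>-\<^sup>n\<^sup>/\<^sup>2\<^sup>-\<^sup>t\<close> of the difference quotient of order \<open>t\<close> leaves this kernel with \<open>\<beta> = t - s\<close>.\<close>

definition pair_kernel :: "'a::euclidean_space set => real => 'a \<times> 'a => real" where
 "pair_kernel \<Omega> \<beta> z = indicator \<Omega> (fst z) * indicator \<Omega> (snd z) * norm (fst z - snd z) powr (\<beta> - real DIM('a) / 2)"

lemma pair_kernel_measurable [measurable]:
 assumes "\<Omega> \<in> sets borel" shows "pair_kernel \<Omega> \<beta> \<in> Borel"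
proof -
 have [measurable]: "(\<lambda>x. indicator \<Omega> x :: real) \<in> Borel" using assms by (rule borel_measurable_indicator)
 show ?thesis unfolding pair_kernel_def[abs_def] by measurable
qed

lemma near_kernel_bound:
 assumes \<beta>: "\<beta> > 0"
 obtains C where "C >= 0" "!!\<delta> x. \<delta> > 0 ==>
  (\<integral>\<^sup>+y. indicator (ball 0 \<delta>) (x - y) * ennreal ((norm (x - y) powr (\<beta> - real DIM('a) / 2))^2) \<partial>(lborel :: 'a::euclidean_space measure)) <= ennreal ((C * \<delta> powr \<beta>)^2)"
proof -
 have b2: "2 * \<beta> > 0" using \<beta> by simp
 obtain C where C: "C >= 0" "!!\<delta>. \<delta> > 0 ==>
  (\<integral>\<^sup>+z. indicator (ball 0 \<delta>) z * ennreal (norm z powr (2 * \<beta> - real DIM('a))) \<partial>(lborel::'a measure)) <= ennreal (C * \<delta> powr (2 * \<beta>))"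
  by (rule nn_integral_norm_powr_near_0[OF b2, where 'a = 'a]) (rule that)
 show ?thesis
 proof (rule that[of "sqrt C"])
  show "0 <= sqrt C" using C by simp
  fix \<delta> :: real and x :: 'a assume \<delta>: "\<delta> > 0"
  have [measurable]: "(\<lambda>z::'a. indicator (ball 0 \<delta>) z :: ennreal) \<in> Borel" by (rule borel_measurable_indicator, rule borel_open, simp)
  have e: "(norm z powr (\<beta> - real DIM('a) / 2))^2 = norm z powr (2 * \<beta> - real DIM('a))" for z :: 'a
   unfolding power2_eq_square powr_add[symmetric] by (rule arg_cong[where f = "(powr) (norm z)"]) simp
  have "(\<integral>+y. indicator (ball 0 \<delta>) (x - y) * ennreal ((norm (x - y) powr (\<beta> - real DIM('a) / 2))^2))
   = (\<integral>\<^sup>+z. indicator (ball 0 \<delta>) z * ennreal (norm z powr (2 * \<beta> - real DIM('a))) \<partial>(lborel::'a measure))"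
   unfolding e by (rule lborel_nn_integral_reflect) measurable
  also have "... <= ennreal (C * \<delta> powr (2 * \<beta>))" by (rule C(2)[OF \<delta>])
  also have "C * \<delta> powr (2 * \<beta>) = (sqrt C * \<delta> powr \<beta>)^2"
  proof -
   have "(\<delta> powr \<beta>)^2 = \<delta> powr (2 * \<beta>)" unfolding power2_eq_square powr_add[symmetric] by simp
   then show ?thesis using C(1) by (simp add: power_mult_distrib)
  qed
  finally show "(\<integral>+y. indicator (ball 0 \<delta>) (x - y) * ennreal ((norm (x - y) powr (\<beta> - real DIM('a) / 2))^2)) <= ennreal ((sqrt C * \<delta> powr \<beta>)^2)" .
 qed
qed

lemma pair_kernel_fiber_bound:
 fixes \<Omega> :: "'a::euclidean_space set"
 assumes \<Omega>: "bounded \<Omega>" "\<Omega> \<in> sets borel" and \<beta>: "\<beta> > 0"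
 obtains A where "A >= 0" "!!x. (\<integral>+y. ennreal ((pair_kernel \<Omega> \<beta> (x, y))^2)) <= ennreal (A^2)"
proof -
 obtain R where R: "R > 0" "!!x. x \<in> \<Omega> ==> norm x <= R" using \<Omega>(1) bounded_pos by metis
 obtain C where C: "C >= 0" "!!\<delta> x. \<delta> > 0 ==>
  (\<integral>\<^sup>+y. indicator (ball 0 \<delta>) (x - y) * ennreal ((norm (x - y) powr (\<beta> - real DIM('a) / 2))^2) \<partial>(lborel :: 'a measure)) <= ennreal ((C * \<delta> powr \<beta>)^2)"
  by (rule near_kernel_bound[OF \<beta>, where 'a = 'a]) (rule that)
 show ?thesis
 proof (rule that[of "C * (3 * R) powr \<beta>"])
  show "C * (3 * R) powr \<beta> >= 0" using C by simp
  fix x :: 'a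
  have "(\<integral>+y. ennreal ((pair_kernel \<Omega> \<beta> (x, y))^2)) <=
   (\<integral>+y. indicator (ball 0 (3 * R)) (x - y) * ennreal ((norm (x - y) powr (\<beta> - real DIM('a) / 2))^2))"
  proof (rule nn_integral_mono)
   fix y :: 'a
   show "ennreal ((pair_kernel \<Omega> \<beta> (x, y))^2) <= indicator (ball 0 (3 * R)) (x - y) * ennreal ((norm (x - y) powr (\<beta> - real DIM('a) / 2))^2)"
   proof (cases "x \<in> \<Omega> & y \<in> \<Omega>")
    case True
    have "norm (x - y) <= norm x + norm y" by (rule norm_triangle_ineq4)
    also have "... < 3 * R" using R(2)[of x] R(2)[of y] R(1) True by argo
    finally show ?thesis using True by (simp add: pair_kernel_def)
   qed (auto simp: pair_kernel_def)
  qed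
  also have "... <= ennreal ((C * (3 * R) powr \<beta>)^2)" by (rule C(2)) (use R in simp)
  finally show "(\<integral>+y. ennreal ((pair_kernel \<Omega> \<beta> (x, y))^2)) <= ennreal ((C * (3 * R) powr \<beta>)^2)" .
 qed
qed

definition Sop :: "'a::euclidean_space set => real => ('a, real) l2 => ('a \<times> 'a, real) l2" where
 "Sop \<Omega> \<beta> v = l2of (\<lambda>z. pair_kernel \<Omega> \<beta> z * l2fun v (fst z))"

lemma AE_lebesgue_fst:
 fixes P :: "'a::euclidean_space => bool"
 assumes "AE x in lebesgue. P x"
 shows "AE z in (lebesgue :: ('a \<times> 'a) measure). P (fst z)" "AE z in (lebesgue :: ('a \<times> 'a) measure). P (snd z)"
proof -
 obtain N where N: "{x. \<not> P x} \<subseteq> N" "N \<in> null_sets (lborel :: 'a measure)"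
  using iffD1[OF AE_lebesgue_iff_lborel assms] by (auto simp: eventually_ae_filter)
 have Nb: "N \<in> sets borel" "emeasure lborel N = 0" using N(2) by (auto simp: null_sets_def)
 have [measurable]: "(\<lambda>x. indicator N x :: ennreal) \<in> Borel" using Nb(1) by (rule borel_measurable_indicator)
 have n0: "(\<integral>+x. indicator N x) = (0 :: ennreal)" using Nb by simp
 have "(\<integral>\<^sup>+z. indicator N (fst z) \<partial>(lborel :: ('a \<times> 'a) measure)) = (0 :: ennreal)"
  using nn_integral_lborel_pair(2)[of "\<lambda>z::'a \<times> 'a. indicator N (fst z)"] n0 by simp
 then have "AE z in (lborel :: ('a \<times> 'a) measure). indicator N (fst z) = (0::ennreal)"
  by (subst (asm) nn_integral_0_iff_AE) auto
 then show "AE z in (lebesgue :: ('a \<times> 'a) measure). P (fst z)" unfolding AE_lebesgue_iff_lborel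
  by eventually_elim (use N(1) in \<open>auto split: split_indicator_asm\<close>)
 have "(\<integral>\<^sup>+z. indicator N (snd z) \<partial>(lborel :: ('a \<times> 'a) measure)) = (0 :: ennreal)"
  using nn_integral_lborel_pair(1)[of "\<lambda>z::'a \<times> 'a. indicator N (snd z)"] n0 by simp
 then have "AE z in (lborel :: ('a \<times> 'a) measure). indicator N (snd z) = (0::ennreal)"
  by (subst (asm) nn_integral_0_iff_AE) auto
 then show "AE z in (lebesgue :: ('a \<times> 'a) measure). P (snd z)" unfolding AE_lebesgue_iff_lborel
  by eventually_elim (use N(1) in \<open>auto split: split_indicator_asm\<close>)
qed

context
 fixes \<Omega> :: "'a::euclidean_space set" and \<beta> :: real
 assumes \<Omega>: "bounded \<Omega>" "\<Omega> \<in> sets borel" and \<beta>: "\<beta> > 0"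
begin

lemma Sop_L2: "(\<lambda>z. pair_kernel \<Omega> \<beta> z * l2fun v (fst z)) \<in> L2 UNIV"
proof -
 obtain A where A: "A >= 0" "!!x. (\<integral>+y. ennreal ((pair_kernel \<Omega> \<beta> (x, y))^2)) <= ennreal (A^2)"
  using pair_kernel_fiber_bound[OF \<Omega> \<beta>] by metis
 show ?thesis by (rule fiber_mult(1)[OF pair_kernel_measurable[OF \<Omega>(2)] l2fun_measurable l2fun_L2 A(2,1)])
qed

lemma Sop_bounded_linear: "bounded_linear (Sop \<Omega> \<beta>)"
proof -
 obtain A where A: "A >= 0" "!!x. (\<integral>+y. ennreal ((pair_kernel \<Omega> \<beta> (x, y))^2)) <= ennreal (A^2)"
  using pair_kernel_fiber_bound[OF \<Omega> \<beta>] by metis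
 show ?thesis
 proof (rule bounded_linear_intro[where K = A])
  fix v w :: "('a, real) l2" and r :: real
  let ?p = "\<lambda>v z. pair_kernel \<Omega> \<beta> z * l2fun v (fst z)"
  have "AE z in lebesgue. ?p (v + w) z = ?p v z + ?p w z"
   using AE_lebesgue_fst(1)[OF l2fun_add[of v w]] by eventually_elim (simp add: distrib_left)
  then have "Sop \<Omega> \<beta> (v + w) = l2of (\<lambda>z. ?p v z + ?p w z)"
   unfolding Sop_def using l2of_eq_iff[OF Sop_L2 L2_add[OF Sop_L2 Sop_L2]] by blast
  then show "Sop \<Omega> \<beta> (v + w) = Sop \<Omega> \<beta> v + Sop \<Omega> \<beta> w"
   unfolding Sop_def l2of_add[OF Sop_L2 Sop_L2, symmetric] .
  have "AE z in lebesgue. ?p (r *\<^sub>R v) z = r *\<^sub>R ?p v z"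
   using AE_lebesgue_fst(1)[OF l2fun_scaleR[of r v]] by eventually_elim simp
  then have "Sop \<Omega> \<beta> (r *\<^sub>R v) = l2of (\<lambda>z. r *\<^sub>R ?p v z)"
   unfolding Sop_def using l2of_eq_iff[OF Sop_L2 L2_scaleR[OF Sop_L2]] by blast
  then show "Sop \<Omega> \<beta> (r *\<^sub>R v) = r *\<^sub>R Sop \<Omega> \<beta> v"
   unfolding Sop_def l2of_scaleR[OF Sop_L2, symmetric] .
  show "norm (Sop \<Omega> \<beta> v) <= norm v * A"
   using fiber_mult(2)[OF pair_kernel_measurable[OF \<Omega>(2)] l2fun_measurable l2fun_L2 A(2,1), of v]
   unfolding Sop_def by (simp add: mult.commute)
 qed
qed

text \<open>The adjoint of \<open>Sop\<close>. Applied to the difference quotient of \<open>u\<close> it is the regional fractional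
Laplacian of \<open>u\<close> up to the normalising constant.\<close>

definition Rop :: "('a \<times> 'a, real) l2 => ('a, real) l2" where
 "Rop = (SOME R. bounded_linear R & (\<forall>g v. R g \<bullet> v = g \<bullet> Sop \<Omega> \<beta> v))"

lemma Rop: "bounded_linear Rop" "Rop g \<bullet> v = g \<bullet> Sop \<Omega> \<beta> v"
proof -
 have "\<exists>R. bounded_linear R & (\<forall>g v. R g \<bullet> v = g \<bullet> Sop \<Omega> \<beta> v)"
  by (rule hilbert_adjoint[OF Sop_bounded_linear]) (intro exI conjI allI)
 from someI_ex[OF this, folded Rop_def] have R: "bounded_linear Rop & (\<forall>g v. Rop g \<bullet> v = g \<bullet> Sop \<Omega> \<beta> v)" .
 show "bounded_linear Rop" by (rule conjunct1[OF R])
 show "Rop g \<bullet> v = g \<bullet> Sop \<Omega> \<beta> v" using conjunct2[OF R] by (elim allE)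
qed

lemma inner_Sop:
 assumes g: "g \<in> L2 UNIV"
 shows "l2of g \<bullet> Sop \<Omega> \<beta> v = (LINT z|lebesgue. g z * (pair_kernel \<Omega> \<beta> z * l2fun v (fst z)))"
 unfolding Sop_def using inner_l2of[OF g Sop_L2] by simp

end

text \<open>The regional Laplacian has order \<open>s < t\<close>. Pairs at distance less than \<open>\<delta>\<close> contribute a small multiple
of the energy; for the other pairs the kernel is bounded, so the \<open>L\<^sup>2\<close> norm suffices.\<close>

lemma Rop_interpolation:
 fixes \<Omega> :: "'a::euclidean_space set"
 assumes \<Omega>: "bounded \<Omega>" "\<Omega> \<in> sets borel" and s: "0 < s" "s < t" and e: "e > 0"
 obtains K where "K >= 0" "!!u. gagl t u ==> norm (Rop \<Omega> (t - s) (l2of (Dq t u))) <= e * norm (l2of (Dq t u)) + K * norm (l2of u)"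
proof -
 let ?n = "real DIM('a)"
 have \<beta>: "t - s > 0" using s by simp
 obtain C where C: "C >= 0" "!!\<delta> x. \<delta> > 0 ==>
  (\<integral>\<^sup>+y. indicator (ball 0 \<delta>) (x - y) * ennreal ((norm (x - y) powr ((t - s) - ?n / 2))^2) \<partial>(lborel :: 'a measure)) <= ennreal ((C * \<delta> powr (t - s))^2)"
  by (rule near_kernel_bound[OF \<beta>, where 'a = 'a]) (rule that)
 \<comment> \<open>the solution of \<open>(C + 1) \<delta>\<^sup>t\<^sup>-\<^sup>s = e\<close>, so that near pairs contribute at most \<open>e\<close>\<close>
 define \<delta> where "\<delta> = (e / (C + 1)) powr (1 / (t - s))"
 have \<delta>: "\<delta> > 0" unfolding \<delta>_def using e C by simp
 have "\<delta> powr (t - s) = e / (C + 1)" unfolding \<delta>_def powr_powr using \<beta> e C(1) by simp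
 then have Ce: "C * \<delta> powr (t - s) <= e" using C(1) e by (simp add: pos_divide_le_eq mult.commute mult_left_mono)
 have [measurable]: "(\<lambda>x. indicator \<Omega> x :: real) \<in> Borel" using \<Omega>(2) by (rule borel_measurable_indicator)
 have [measurable]: "(\<lambda>z::'a. indicator (ball 0 \<delta>) z :: real) \<in> Borel" by (rule borel_measurable_indicator, rule borel_open, simp)
 define near where "near z = indicator (ball 0 \<delta>) (fst z - snd z) * pair_kernel \<Omega> (t - s) z" for z :: "'a \<times> 'a"
 define far where "far z = (1 - indicator (ball 0 \<delta>) (fst z - snd z)) * (indicator \<Omega> (snd z) * norm (fst z - snd z) powr (- (?n + s)))" for z :: "'a \<times> 'a"
 define ind where "ind z = (indicator \<Omega> (fst z) * indicator \<Omega> (snd z) :: real)" for z :: "'a \<times> 'a"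
 have nm: "near \<in> Borel" unfolding near_def[abs_def] using pair_kernel_measurable[OF \<Omega>(2), of "t - s"] by measurable
 have farm: "far \<in> Borel" unfolding far_def[abs_def] by measurable
 have im: "ind \<in> Borel" unfolding ind_def[abs_def] by measurable
 define V where "V = measure lborel \<Omega>"
 have V: "emeasure lborel \<Omega> = ennreal V" "V >= 0"
  unfolding V_def using emeasure_bounded_finite[OF \<Omega>(1)] by (auto simp: emeasure_eq_ennreal_measure less_top)
 define M where "M = \<delta> powr (- (?n + s))"
 have near_bd: "(\<integral>+y. ennreal ((near (x, y))^2)) <= ennreal (e^2)" for x
 proof -
  have "(\<integral>+y. ennreal ((near (x, y))^2)) <=
   (\<integral>+y. indicator (ball 0 \<delta>) (x - y) * ennreal ((norm (x - y) powr ((t - s) - ?n / 2))^2))"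
   by (rule nn_integral_mono) (simp add: near_def pair_kernel_def indicator_def)
  also have "... <= ennreal ((C * \<delta> powr (t - s))^2)" by (rule C(2)[OF \<delta>])
  also have "... <= ennreal (e^2)" using Ce C(1) by (intro ennreal_leI power_mono) auto
  finally show ?thesis .
 qed
 have ind_int: "(\<integral>+y. ennreal (c * indicator \<Omega> y)) = ennreal (c * V)" if "c >= 0" for c
 proof -
  have "(\<integral>+y. ennreal (c * indicator \<Omega> y)) = (\<integral>+y. ennreal c * indicator \<Omega> y)"
   using that by (intro nn_integral_cong) (simp add: indicator_def)
  also have "... = ennreal c * ennreal V" unfolding V(1)[symmetric] using \<Omega>(2) by (intro nn_integral_cmult_indicator) simp
  finally show ?thesis using that V(2) by (simp add: ennreal_mult)
 qed
 have far_le: "\<bar>far (x, y)\<bar> <= M * indicator \<Omega> y" for x y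
 proof (cases "norm (x - y) < \<delta>")
  case False
  then have "norm (x - y) powr (- (?n + s)) <= M" unfolding M_def using \<delta> s by (intro powr_mono2') auto
  then show ?thesis using False by (simp add: far_def indicator_def)
 qed (simp add: far_def M_def indicator_def)
 have far_bd: "(\<integral>+y. ennreal ((far (x, y))^2)) <= ennreal ((M * sqrt V)^2)" for x
 proof -
  have "(\<integral>+y. ennreal ((far (x, y))^2)) <= (\<integral>+y. ennreal (M^2 * indicator \<Omega> y))"
  proof (intro nn_integral_mono ennreal_leI)
   fix y
   have "\<bar>far (x, y)\<bar>^2 <= (M * indicator \<Omega> y)^2" by (intro power_mono far_le) simp
   then show "(far (x, y))^2 <= M^2 * indicator \<Omega> y" by (cases "y \<in> \<Omega>") simp_all
  qed
  also have "... = ennreal (M^2 * V)" by (rule ind_int) simp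
  also have "M^2 * V = (M * sqrt V)^2" using V(2) by (simp add: power_mult_distrib)
  finally show ?thesis .
 qed
 have ind_bd: "(\<integral>+y. ennreal ((ind (x, y))^2)) <= ennreal ((sqrt V)^2)" for x
 proof -
  have "(\<integral>+y. ennreal ((ind (x, y))^2)) <= (\<integral>+y. ennreal (1 * indicator \<Omega> y))"
   by (intro nn_integral_mono ennreal_leI) (simp add: ind_def indicator_def)
  also have "... = ennreal (1 * V)" by (rule ind_int) simp
  finally show ?thesis using V(2) by simp
 qed
 have sV: "sqrt V >= 0" using V(2) by simp
 have M0: "M * sqrt V >= 0" using V(2) by (simp add: M_def)
 have eps: "e >= 0" using e by simp
 show ?thesis
 proof (rule that[of "2 * sqrt V * (M * sqrt V)"])
  show "0 <= 2 * sqrt V * (M * sqrt V)" using sV M0 by simp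
  fix u :: "'a => real" assume u: "gagl t u"
  note ug = gaglD[OF u]
  let ?D = "Dq t u" and ?R = "Rop \<Omega> (t - s) (l2of (Dq t u))"
  define v where "v = l2fun ?R"
  have vm: "v \<in> Borel" and vL: "v \<in> L2 UNIV" unfolding v_def by auto
  have lv: "l2of v = ?R" unfolding v_def by simp
  note N = fiber_mult[OF nm vm vL near_bd eps] and F = fiber_mult[OF farm vm vL far_bd M0]
  define W where "W z = ind z * u (fst z) - ind z * u (snd z)" for z
  note W1 = fiber_mult[OF im ug(1) ug(3) ind_bd sV]
  have W1m: "(\<lambda>z. ind z * u (fst z)) \<in> Borel" using im ug(1) by measurable
  have sw: "(\<lambda>z. ind (snd z, fst z) * u (snd z)) = (\<lambda>z. ind z * u (snd z))" by (auto simp: ind_def mult.commute)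
  note W2 = L2_swap[OF W1m W1(1), simplified fst_conv, unfolded sw]
  have WL: "W \<in> L2 UNIV" unfolding W_def[abs_def] by (rule L2_diff[OF W1(1) W2(1)])
  have Wn: "norm (l2of W) <= 2 * sqrt V * norm (l2of u)"
  proof -
   have "l2of W = l2of (\<lambda>z. ind z * u (fst z)) - l2of (\<lambda>z. ind z * u (snd z))"
    unfolding W_def[abs_def] by (rule l2of_diff[OF W1(1) W2(1)])
   then have "norm (l2of W) <= norm (l2of (\<lambda>z. ind z * u (fst z))) + norm (l2of (\<lambda>z. ind z * u (snd z)))"
    by (simp add: norm_triangle_ineq4)
   also have "... <= sqrt V * norm (l2of u) + sqrt V * norm (l2of u)"
    by (intro add_mono W1(2) order_trans[OF W2(2) W1(2)])
   finally show ?thesis by simp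
  qed
  have split: "?D z * (pair_kernel \<Omega> (t - s) z * v (fst z)) = ?D z * (near z * v (fst z)) + W z * (far z * v (fst z))" for z
  proof -
   obtain x y where z: "z = (x, y)" by (cases z)
   have "norm (x - y) powr (- (?n / 2 + t)) * norm (x - y) powr ((t - s) - ?n / 2) = norm (x - y) powr (- (?n + s))"
    unfolding powr_add[symmetric] by (rule arg_cong[where f = "(powr) (norm (x - y))"]) simp
   then have "?D z * pair_kernel \<Omega> (t - s) z = (u x - u y) * (indicator \<Omega> x * indicator \<Omega> y) * norm (x - y) powr (- (?n + s))"
    unfolding z Dq_def pair_kernel_def by simp
   moreover have "W z = (u x - u y) * (indicator \<Omega> x * indicator \<Omega> y)" unfolding z W_def ind_def by (simp add: algebra_simps)
   ultimately have "?D z * pair_kernel \<Omega> (t - s) z = W z * norm (x - y) powr (- (?n + s))" by simp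
   then have "(1 - indicator (ball 0 \<delta>) (x - y)) * (?D z * pair_kernel \<Omega> (t - s) z) = W z * far z"
    unfolding z far_def W_def ind_def by (simp add: indicator_def)
   then have "?D z * pair_kernel \<Omega> (t - s) z = ?D z * near z + W z * far z"
    unfolding near_def z by (simp add: algebra_simps)
   then show ?thesis by (simp add: algebra_simps)
  qed
  have "norm ?R * norm ?R = l2of ?D \<bullet> Sop \<Omega> (t - s) ?R"
   using Rop(2)[OF \<Omega> \<beta>, of "l2of ?D" ?R] by (simp add: power2_norm_eq_inner[symmetric] power2_eq_square)
  also have "... = (LINT z|lebesgue. ?D z * (near z * v (fst z)) + W z * (far z * v (fst z)))"
   unfolding inner_Sop[OF \<Omega> \<beta> ug(4)] v_def[symmetric] split ..
  also have "... = (LINT z|lebesgue. ?D z * (near z * v (fst z))) + (LINT z|lebesgue. W z * (far z * v (fst z)))"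
   using L2_inner_integrable[OF ug(4) N(1)] L2_inner_integrable[OF WL F(1)] by (intro bochner_add) auto
  also have "... = l2of ?D \<bullet> l2of (\<lambda>z. near z * v (fst z)) + l2of W \<bullet> l2of (\<lambda>z. far z * v (fst z))"
   unfolding inner_l2of[OF ug(4) N(1)] inner_l2of[OF WL F(1)] by simp
  also have "... <= norm (l2of ?D) * (e * norm ?R) + (2 * sqrt V * norm (l2of u)) * ((M * sqrt V) * norm ?R)"
  proof (rule add_mono)
   show "l2of ?D \<bullet> l2of (\<lambda>z. near z * v (fst z)) <= norm (l2of ?D) * (e * norm ?R)"
    by (rule order_trans[OF norm_cauchy_schwarz mult_left_mono[OF N(2)[unfolded lv]]]) simp
   show "l2of W \<bullet> l2of (\<lambda>z. far z * v (fst z)) <= (2 * sqrt V * norm (l2of u)) * ((M * sqrt V) * norm ?R)"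
    by (rule order_trans[OF norm_cauchy_schwarz mult_mono[OF Wn F(2)[unfolded lv]]]) (use sV in auto)
  qed
  also have "... = (e * norm (l2of ?D) + 2 * sqrt V * (M * sqrt V) * norm (l2of u)) * norm ?R"
   by (simp add: algebra_simps)
  finally have *: "norm ?R * norm ?R <= (e * norm (l2of ?D) + 2 * sqrt V * (M * sqrt V) * norm (l2of u)) * norm ?R" .
  show "norm ?R <= e * norm (l2of ?D) + 2 * sqrt V * (M * sqrt V) * norm (l2of u)"
  proof (cases "?R = 0")
   case True
   then show ?thesis using eps sV M0 by (simp add: add_nonneg_nonneg)
  next
   case False
   show ?thesis by (rule mult_right_le_imp_le[OF *]) (use False in simp)
  qed
 qed
qed

lemma L2_indicator_iff:
 fixes u :: "'a::euclidean_space => real"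
 shows "u \<in> L2 A \<longleftrightarrow> (\<lambda>x. indicator A x * u x) \<in> L2 UNIV"
proof -
 have "(\<lambda>x. indicator A x *\<^sub>R (norm (u x))^2) = (\<lambda>x. (norm (indicator A x * u x))^2)"
  by (auto simp: indicator_def)
 then show ?thesis
  unfolding L2_def[of A] mem_L2_UNIV by (simp add: set_borel_measurable_def set_integrable_def)
qed

lemma L2_norm_indicator:
 fixes u :: "'a::euclidean_space => real"
 assumes "u \<in> L2 A"
 shows "L2_norm A u = norm (l2of (\<lambda>x. indicator A x * u x))"
proof -
 have "(\<lambda>x. indicator A x *\<^sub>R (norm (u x))^2) = (\<lambda>x. (norm (indicator A x * u x))^2)"
  by (auto simp: indicator_def)
 then show ?thesis
  using norm_l2of[OF iffD1[OF L2_indicator_iff assms]]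
  by (simp add: L2_norm_def set_lebesgue_integral_def)
qed

lemma L2_UNIV_restrict:
 fixes u :: "'a::euclidean_space => real"
 assumes u: "u \<in> L2 UNIV" and A: "A \<in> sets borel"
 shows "(\<lambda>x. indicator A x * u x) \<in> L2 UNIV"
proof (rule L2_dominated[OF u, where C = 1])
 have [measurable]: "u \<in> borel_measurable lebesgue" using u by (simp add: mem_L2_UNIV)
 have [measurable]: "(\<lambda>x. indicator A x :: real) \<in> borel_measurable lebesgue"
  by (rule borel_measurable_lebesgueI, rule borel_measurable_indicator) (rule A)
 show "(\<lambda>x. indicator A x * u x) \<in> borel_measurable lebesgue" by measurable
 show "AE x in lebesgue. norm (indicator A x * u x) <= 1 * norm (u x)" by (rule AE_I2) (simp add: indicator_def)
qed

lemma integrable_lebesgue_borel: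
 fixes g :: "'a::euclidean_space => real"
 assumes "integrable lebesgue g" "g \<in> Borel"
 shows "integrable lborel g"
 using assms integrable_completion[of g lborel] by simp

lemma Dq_swap: "Dq a u (y, x) = - Dq a u (x, y)"
 by (simp add: Dq_def norm_minus_commute[of y x] algebra_simps)

text \<open>The kernel times the difference quotient is antisymmetric, so the term with \<open>v(y)\<close> equals the one with
\<open>v(x)\<close>, and the factor \<open>1/2\<close> in the form disappears.\<close>

lemma regional_form_eq:
 fixes \<Omega> :: "'a::euclidean_space set"
 assumes \<Omega>: "bounded \<Omega>" "\<Omega> \<in> sets borel" and s: "0 < s" "s < t" and u: "gagl t u"
  and v: "(\<lambda>x. indicator \<Omega> x * v x) \<in> L2 UNIV"
 shows "regional_form (s / 2) \<Omega> u v =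
  frac_const TYPE('a) (s / 2) * (l2of (Dq t u) \<bullet> Sop \<Omega> (t - s) (l2of (\<lambda>x. indicator \<Omega> x * v x)))"
proof -
 let ?n = "real DIM('a)"
 note ug = gaglD[OF u]
 have \<beta>: "t - s > 0" using s by simp
 define V where "V = l2of (\<lambda>x. indicator \<Omega> x * v x)"
 have Vv: "AE x in lebesgue. l2fun V x = indicator \<Omega> x * v x" unfolding V_def by (rule l2fun_l2of[OF v])
 define k where "k z = Dq t u z * pair_kernel \<Omega> (t - s) z" for z
 define F where "F z = Dq t u z * (pair_kernel \<Omega> (t - s) z * l2fun V (fst z))" for z
 have [measurable]: "k \<in> Borel" "F \<in> Borel"
  unfolding k_def[abs_def] F_def[abs_def] using Dq_measurable[OF ug(1)] pair_kernel_measurable[OF \<Omega>(2)] by measurable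
 have Fi: "integrable lborel F"
  unfolding F_def[abs_def]
  using L2_inner_integrable[OF ug(4) Sop_L2[OF \<Omega> \<beta>, of V]] \<open>F \<in> Borel\<close>[unfolded F_def[abs_def]]
  by (intro integrable_lebesgue_borel) simp_all
 have sw: "F (y, x) = - (k (x, y) * l2fun V y)" for x y
  unfolding F_def k_def by (simp add: Dq_swap[of t u y x] pair_kernel_def norm_minus_commute[of y x])
 define H where "H z = F z + F (snd z, fst z)" for z
 have Hm [measurable]: "H \<in> Borel"
  unfolding H_def[abs_def] by (intro borel_measurable_add \<open>F \<in> _\<close> measurable_compose[OF _ \<open>F \<in> _\<close>] borel_measurable_Pair fst_snd_measurable)
 have Hi: "integrable lborel H" unfolding H_def[abs_def] by (intro Bochner_Integration.integrable_add Fi lborel_integrable_swap)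
 have k_eq: "k (x, y) = indicator \<Omega> x * (indicator \<Omega> y * ((u x - u y) / norm (x - y) powr (?n + 2 * (s / 2))))" for x y
 proof -
  have "norm (x - y) powr (- (?n / 2 + t)) * norm (x - y) powr ((t - s) - ?n / 2) = norm (x - y) powr (- (?n + 2 * (s / 2)))"
   unfolding powr_add[symmetric] by (rule arg_cong[where f = "(powr) (norm (x - y))"]) simp
  moreover have "k (x, y) = indicator \<Omega> x * (indicator \<Omega> y * ((u x - u y) *
    (norm (x - y) powr (- (?n / 2 + t)) * norm (x - y) powr ((t - s) - ?n / 2))))"
   unfolding k_def Dq_def pair_kernel_def by simp
  ultimately show ?thesis by (simp only: powr_minus_divide times_divide_eq_right mult_1_right)
 qed
 have inner: "AE x in lebesgue. indicator \<Omega> x * (LINT y:\<Omega>|lebesgue. (u x - u y) * (v x - v y) / norm (x - y) powr (?n + 2 * (s / 2)))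
   = (LBINT y. H (x, y))"
  using Vv
 proof eventually_elim
  case (elim x)
  have "indicator \<Omega> x * (LINT y:\<Omega>|lebesgue. (u x - u y) * (v x - v y) / norm (x - y) powr (?n + 2 * (s / 2)))
   = (LINT y|lebesgue. indicator \<Omega> x * (indicator \<Omega> y * ((u x - u y) * (v x - v y) / norm (x - y) powr (?n + 2 * (s / 2)))))"
   unfolding set_lebesgue_integral_def real_scaleR_def by (rule integral_mult_right_zero[symmetric])
  also have "... = (LBINT y. H (x, y))"
  proof (rule lebesgue_integral_eq_borel)
   show "(\<lambda>y. H (x, y)) \<in> Borel" by measurable
   show "AE y in lebesgue. indicator \<Omega> x * (indicator \<Omega> y * ((u x - u y) * (v x - v y) / norm (x - y) powr (?n + 2 * (s / 2)))) = H (x, y)"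
    using Vv
   proof eventually_elim
    case (elim y)
    have "F (x, y) = k (x, y) * l2fun V x" by (simp add: F_def k_def)
    then have "H (x, y) = k (x, y) * (l2fun V x - l2fun V y)" unfolding H_def by (simp add: sw algebra_simps)
    also have "... = k (x, y) * (v x - v y)"
     unfolding elim \<open>l2fun V x = indicator \<Omega> x * v x\<close> k_eq by (simp add: indicator_def)
    finally show ?case unfolding k_eq by simp
   qed
  qed
  finally show ?case .
 qed
 have "(LINT x:\<Omega>|lebesgue. (LINT y:\<Omega>|lebesgue. (u x - u y) * (v x - v y) / norm (x - y) powr (?n + 2 * (s / 2))))
  = (LBINT x. (LBINT y. H (x, y)))"
  unfolding set_lebesgue_integral_def[of lebesgue \<Omega> "\<lambda>x. LINT y:\<Omega>|lebesgue. _ x y"] real_scaleR_def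
  by (rule lebesgue_integral_eq_borel[OF inner]) (use Hm in measurable)
 also have "... = (LBINT z. H z)" by (rule lborel_iterated_integral[OF Hi])
 also have "... = (LBINT z. F z) + (LBINT z. F (snd z, fst z))"
  unfolding H_def by (rule bochner_add[OF Fi lborel_integrable_swap[OF Fi]])
 also have "... = 2 * (LBINT z. F z)" by (simp add: lborel_integral_swap)
 also have "(LBINT z. F z) = l2of (Dq t u) \<bullet> Sop \<Omega> (t - s) V"
  unfolding inner_Sop[OF \<Omega> \<beta> ug(4)] F_def[symmetric] by (rule lebesgue_integral_eq_borel[symmetric]) simp_all
 finally show ?thesis unfolding regional_form_def V_def[symmetric] by simp
qed

text \<open>\<open>Rop\<close> supplies a function representing the weak regional Laplacian; test functions are admissible in
the definition and determine it almost everywhere.\<close>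

lemma regional_frac_laplacian_eq:
 fixes \<Omega> :: "(real ^ 'n) set"
 assumes \<Omega>: "bounded \<Omega>" "open \<Omega>" and s: "0 < s" "s < t" "t < 1" and u: "gagl t u"
 shows "regional_frac_laplacian (s / 2) \<Omega> u \<in> L2 \<Omega>"
  and "AE x in lebesgue. x \<in> \<Omega> --> regional_frac_laplacian (s / 2) \<Omega> u x =
   frac_const TYPE(real ^ 'n) (s / 2) * l2fun (Rop \<Omega> (t - s) (l2of (Dq t u))) x"
proof -
 have \<Omega>b: "\<Omega> \<in> sets borel" using \<Omega>(2) by simp
 have \<beta>: "t - s > 0" using s by simp
 let ?C = "frac_const TYPE(real ^ 'n) (s / 2)"
 let ?R = "Rop \<Omega> (t - s) (l2of (Dq t u))"
 define r where "r = (\<lambda>x. ?C *\<^sub>R l2fun ?R x)"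
 have rL: "r \<in> L2 UNIV" unfolding r_def by (rule L2_scaleR) simp
 have lr: "l2of r = ?C *\<^sub>R ?R" unfolding r_def using l2of_scaleR[OF l2fun_L2[of ?R], of ?C] by simp
 have pair: "(LINT x:\<Omega>|lebesgue. w x * v x) = l2of (\<lambda>x. indicator \<Omega> x * w x) \<bullet> l2of (\<lambda>x. indicator \<Omega> x * v x)"
  if "(\<lambda>x. indicator \<Omega> x * w x) \<in> L2 UNIV" "(\<lambda>x. indicator \<Omega> x * v x) \<in> L2 UNIV" for w v :: "real ^ 'n => real"
  unfolding inner_l2of[OF that] set_lebesgue_integral_def
  by (intro bochner_cong) (simp_all add: indicator_def)
 have pair2: "l2of (\<lambda>x. indicator \<Omega> x * w x) \<bullet> l2of (\<lambda>x. indicator \<Omega> x * v x) = l2of w \<bullet> l2of (\<lambda>x. indicator \<Omega> x * v x)"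
  if w: "w \<in> L2 UNIV" and v: "(\<lambda>x. indicator \<Omega> x * v x) \<in> L2 UNIV" for w v :: "real ^ 'n => real"
  unfolding inner_l2of[OF L2_UNIV_restrict[OF w \<Omega>b] v] inner_l2of[OF w v]
  by (intro bochner_cong) (simp_all add: indicator_def)
 have form: "(LINT x:\<Omega>|lebesgue. r x * v x) = regional_form (s / 2) \<Omega> u v" if v: "v \<in> sobolev_on (s / 2) \<Omega>" for v
 proof -
  obtain v0 where v0: "v0 \<in> sobolev (s / 2)" "!!x. x \<in> \<Omega> ==> v x = v0 x" using v unfolding sobolev_on_def by blast
  have "cplx v0 \<in> L2 UNIV" using v0(1) unfolding sobolev_def has_fourier_def cplx_def[abs_def] by blast
  then have "v0 \<in> L2 UNIV" by (simp add: cplx_L2_iff)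
  then have "(\<lambda>x. indicator \<Omega> x * v0 x) \<in> L2 UNIV" by (rule L2_UNIV_restrict[OF _ \<Omega>b])
  also have "(\<lambda>x. indicator \<Omega> x * v0 x) = (\<lambda>x. indicator \<Omega> x * v x)" using v0(2) by (auto simp: indicator_def)
  finally have vL: "(\<lambda>x. indicator \<Omega> x * v x) \<in> L2 UNIV" .
  show ?thesis
   unfolding pair[OF L2_UNIV_restrict[OF rL \<Omega>b] vL] pair2[OF rL vL] lr regional_form_eq[OF \<Omega>(1) \<Omega>b s(1,2) u vL]
   by (simp add: Rop(2)[OF \<Omega>(1) \<Omega>b \<beta>])
 qed
 have "\<exists>w. w \<in> L2 \<Omega> & (\<forall>v \<in> sobolev_on (s / 2) \<Omega>. (LINT x:\<Omega>|lebesgue. w x * v x) = regional_form (s / 2) \<Omega> u v)"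
  by (rule exI[of _ r], rule conjI[OF iffD2[OF L2_indicator_iff L2_UNIV_restrict[OF rL \<Omega>b]]]) (rule ballI, rule form)
 note spec = someI_ex[OF this, folded regional_frac_laplacian_def]
 have w: "regional_frac_laplacian (s / 2) \<Omega> u \<in> L2 \<Omega>"
  "!!v. v \<in> sobolev_on (s / 2) \<Omega> ==> (LINT x:\<Omega>|lebesgue. regional_frac_laplacian (s / 2) \<Omega> u x * v x) = regional_form (s / 2) \<Omega> u v"
  by (rule conjunct1[OF spec], rule bspec[OF conjunct2[OF spec]])
 show "regional_frac_laplacian (s / 2) \<Omega> u \<in> L2 \<Omega>" by (rule w(1))
 let ?w = "regional_frac_laplacian (s / 2) \<Omega> u"
 have wL: "(\<lambda>x. indicator \<Omega> x * ?w x) \<in> L2 UNIV" by (rule iffD1[OF L2_indicator_iff w(1)])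
 note rO = L2_UNIV_restrict[OF rL \<Omega>b]
 have "AE x in lebesgue. x \<in> \<Omega> --> indicator \<Omega> x * ?w x - indicator \<Omega> x * r x = 0"
 proof (rule L2_orthogonal_test_functions[OF \<Omega>(2) L2_diff[OF wL rO]])
  fix \<psi> assume p: "\<psi> \<in> test_functions \<Omega>"
  have "\<psi> \<in> sobolev (s / 2)" using s by (intro gagl_sobolev test_function_gagl[OF _ _ p]) auto
  then have ps: "\<psi> \<in> sobolev_on (s / 2) \<Omega>" unfolding sobolev_on_def by blast
  note pL = test_function_L2(2)[OF p]
  have pO: "(\<lambda>x. indicator \<Omega> x * \<psi> x) = \<psi>"
  proof -
   obtain K where "K \<subseteq> \<Omega>" "!!x. x ~: K ==> \<psi> x = 0" using test_function_support[OF p] by metis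
   then show ?thesis by (auto simp: indicator_def fun_eq_iff)
  qed
  have pL': "(\<lambda>x. indicator \<Omega> x * \<psi> x) \<in> L2 UNIV" unfolding pO by (rule pL)
  have "(LINT x|lebesgue. (indicator \<Omega> x * ?w x - indicator \<Omega> x * r x) * \<psi> x)
   = l2of (\<lambda>x. indicator \<Omega> x * ?w x - indicator \<Omega> x * r x) \<bullet> l2of \<psi>"
   by (simp add: inner_l2of[OF L2_diff[OF wL rO] pL])
  also have "... = l2of (\<lambda>x. indicator \<Omega> x * ?w x) \<bullet> l2of \<psi> - l2of (\<lambda>x. indicator \<Omega> x * r x) \<bullet> l2of \<psi>"
   by (simp add: l2of_diff[OF wL rO] inner_diff_left)
  also have "... = 0"
   using pair[OF wL pL'] pair[OF rO pL'] w(2)[OF ps] form[OF ps] unfolding pO by simp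
  finally show "(LINT x|lebesgue. (indicator \<Omega> x * ?w x - indicator \<Omega> x * r x) * \<psi> x) = 0" .
 qed
 then show "AE x in lebesgue. x \<in> \<Omega> --> ?w x = ?C * l2fun ?R x"
  by eventually_elim (simp add: r_def)
qed

section \<open>A Poincare inequality modulo finite rank\<close>

text \<open>The variance identity, expanding the square in the double integral.\<close>

lemma mean_square_eq:
 fixes u :: "'a::euclidean_space => real"
 assumes u: "integrable lborel (\<lambda>x. indicator Q x * u x)" "integrable lborel (\<lambda>x. indicator Q x * (u x)^2)"
  and Q: "integrable lborel (\<lambda>x. indicator Q x :: real)"
 shows "(LBINT x. (LBINT y. indicator Q x * indicator Q y * (u x - u y)^2))
  = 2 * (LBINT x. indicator Q x) * (LBINT x. indicator Q x * (u x)^2) - 2 * (LBINT x. indicator Q x * u x)^2"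
proof -
 define \<mu> M S where "\<mu> = (LBINT x. indicator Q x :: real)" "M = (LBINT x. indicator Q x * u x)"
  "S = (LBINT x. indicator Q x * (u x)^2)"
 have inner: "(LBINT y. indicator Q x * indicator Q y * (u x - u y)^2)
   = indicator Q x * (u x)^2 * \<mu> - 2 * (indicator Q x * u x) * M + indicator Q x * S" for x
 proof -
  have "(LBINT y. indicator Q x * indicator Q y * (u x - u y)^2)
   = (LBINT y. indicator Q x * (u x)^2 * indicator Q y - 2 * (indicator Q x * u x) * (indicator Q y * u y) + indicator Q x * (indicator Q y * (u y)^2))"
   by (rule bochner_cong) (simp_all add: power2_eq_square algebra_simps)
  also have "... = (LBINT y. indicator Q x * (u x)^2 * indicator Q y) - (LBINT y. 2 * (indicator Q x * u x) * (indicator Q y * u y))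
    + (LBINT y. indicator Q x * (indicator Q y * (u y)^2))"
   by (subst bochner_add, intro bochner_integrable_diff integrable_mult_right u Q,
     intro integrable_mult_right u Q, subst bochner_diff)
     (intro integrable_mult_right u Q refl)+
  finally show ?thesis unfolding \<mu>_M_S_def by (simp only: integral_mult_right_zero)
 qed
 have "(LBINT x. (LBINT y. indicator Q x * indicator Q y * (u x - u y)^2))
  = (LBINT x. indicator Q x * (u x)^2 * \<mu>) - (LBINT x. 2 * (indicator Q x * u x) * M) + (LBINT x. indicator Q x * S)"
  unfolding inner
  by (subst bochner_add, intro bochner_integrable_diff integrable_mult_left integrable_mult_right u Q,
    intro integrable_mult_left u Q, subst bochner_diff)
    (intro integrable_mult_left integrable_mult_right u Q refl)+
 also have "... = S * \<mu> - 2 * M * M + \<mu> * S" unfolding \<mu>_M_S_def by simp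
 finally show ?thesis unfolding \<mu>_M_S_def by (simp add: power2_eq_square algebra_simps)
qed

definition grid_cell :: "real => real ^ 'n => 'n => int" where
 "grid_cell d x = (\<lambda>i. \<lfloor>x $ i / d\<rfloor>)"

definition grid_cube :: "real => ('n => int) => (real ^ 'n) set" where
 "grid_cube d m = {x. grid_cell d x = m}"

lemma grid_cell_facts:
 fixes d :: real assumes d: "d > 0"
 defines "Q \<equiv> grid_cube d :: ('n => int) => (real ^ 'n) set"
 shows "Q m \<in> sets borel" "bounded (Q m)" "x \<in> Q m ==> y \<in> Q m ==> norm (x - y) <= real CARD('n) * d"
  and "d ^ CARD('n) <= measure lborel (Q m)"
  and "bounded \<Omega> ==> finite (grid_cell d ` (\<Omega> :: (real ^ 'n) set))"
proof -
 have Qe: "x \<in> Q m \<longleftrightarrow> (\<forall>i. of_int (m i) * d <= x $ i & x $ i < of_int (m i) * d + d)" for x m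
 proof -
  have "\<lfloor>x $ i / d\<rfloor> = m i \<longleftrightarrow> of_int (m i) * d <= x $ i & x $ i < of_int (m i) * d + d" for i
   using d by (simp add: floor_eq_iff pos_le_divide_eq pos_divide_less_eq algebra_simps)
  then show ?thesis by (simp add: Q_def grid_cube_def grid_cell_def fun_eq_iff)
 qed
 let ?a = "(\<chi> i. of_int (m i) * d) :: real ^ 'n" and ?b = "(\<chi> i. of_int (m i) * d + d) :: real ^ 'n"
 have Q_sub: "Q m \<subseteq> cbox ?a ?b" and sub_Q: "box ?a ?b \<subseteq> Q m"
  by (auto simp: Qe mem_box_cart less_imp_le)
 have "Q m = (\<Inter>i. {x. of_int (m i) * d <= x $ i} \<inter> {x. x $ i < of_int (m i) * d + d})" by (auto simp: Qe)
 also have "... \<in> sets borel"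
  by (intro sets.countable_INT'' sets.Int borel_closed borel_open closed_Collect_le open_Collect_less continuous_intros) auto
 finally show Qb: "Q m \<in> sets borel" .
 show bQ: "bounded (Q m)" by (rule bounded_subset[OF bounded_cbox Q_sub])
 show "norm (x - y) <= real CARD('n) * d" if "x \<in> Q m" "y \<in> Q m"
 proof -
  have "norm (x - y) <= (\<Sum>i\<in>UNIV. \<bar>(x - y) $ i\<bar>)" by (rule norm_le_l1_cart)
  also have "... <= (\<Sum>i\<in>(UNIV :: 'n set). d)"
  proof (rule sum_mono)
   fix i
   have "of_int (m i) * d <= x $ i" "x $ i < of_int (m i) * d + d" "of_int (m i) * d <= y $ i" "y $ i < of_int (m i) * d + d"
    using that unfolding Qe by auto
   then show "\<bar>(x - y) $ i\<bar> <= d" by simp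
  qed
  finally show ?thesis by simp
 qed
 have "d ^ CARD('n) = measure lborel (box ?a ?b)"
 proof -
  have "measure lborel (box ?a ?b) = (\<Prod>k\<in>Basis. (?b - ?a) \<bullet> k)"
  proof (rule measure_lborel_box)
   fix k :: "real ^ 'n" assume "k \<in> Basis"
   then obtain i where k: "k = axis i 1" by (auto simp: Basis_vec_def)
   show "?a \<bullet> k <= ?b \<bullet> k" unfolding k inner_axis using d by simp
  qed
  also have "... = (\<Prod>k\<in>(Basis :: (real ^ 'n) set). d)"
  proof (rule prod.cong[OF refl])
   fix k :: "real ^ 'n" assume "k \<in> Basis"
   then obtain i where k: "k = axis i 1" by (auto simp: Basis_vec_def)
   show "(?b - ?a) \<bullet> k = d" unfolding k inner_axis by simp
  qed
  finally show ?thesis by simp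
 qed
 also have "... <= measure lborel (Q m)"
  using Qb emeasure_bounded_finite[OF bQ] by (intro measure_mono_fmeasurable[OF sub_Q]) (auto simp: fmeasurable_def)
 finally show "d ^ CARD('n) <= measure lborel (Q m)" .
 show "finite (grid_cell d ` \<Omega>)" if "bounded \<Omega>"
 proof -
  obtain R where R: "!!x. x \<in> \<Omega> ==> norm x <= R" using \<open>bounded \<Omega>\<close> bounded_iff by metis
  have "grid_cell d ` \<Omega> \<subseteq> PiE UNIV (\<lambda>_. {\<lfloor>- R / d\<rfloor>..\<lfloor>R / d\<rfloor>})"
  proof (rule image_subsetI)
   fix x assume "x \<in> \<Omega>"
   have "\<bar>x $ i\<bar> <= R" for i using component_le_norm_cart[of x i] R[OF \<open>x \<in> \<Omega>\<close>] by simp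
   then have "\<lfloor>- R / d\<rfloor> <= \<lfloor>x $ i / d\<rfloor> & \<lfloor>x $ i / d\<rfloor> <= \<lfloor>R / d\<rfloor>" for i
    using d by (intro conjI floor_mono divide_right_mono) (auto simp: abs_le_iff minus_le_iff)
   then show "grid_cell d x \<in> PiE UNIV (\<lambda>_. {\<lfloor>- R / d\<rfloor>..\<lfloor>R / d\<rfloor>})" by (auto simp: grid_cell_def)
  qed
  then show ?thesis by (rule finite_subset) (intro finite_PiE, auto)
 qed
qed

text \<open>On a cube of side \<open>d\<close>, \<open>\<integral>u\<^sup>2\<close> is the square of the normalised mean plus a variance, and the variance is at most
\<open>d\<^sup>2\<^sup>t\<close> times the energy up to a constant. Half-open cubes are disjoint, so the energies add up; finitely
many meet \<open>\<Omega>\<close>. The side is chosen at the start so that the resulting constant is exactly \<open>e\<close>.\<close>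

lemma fractional_poincare_modulo_finite_rank:
 fixes \<Omega> :: "(real ^ 'n) set"
 assumes \<Omega>: "bounded \<Omega>" and t: "0 < t" and e: "e > 0"
 obtains J :: "('n => int) set" and g :: "('n => int) => (real ^ 'n, real) l2"
 where "finite J" "!!u. gagl t u ==> (!!x. x ~: \<Omega> ==> u x = 0) ==>
  (norm (l2of u))^2 <= e * (norm (l2of (Dq t u)))^2 + (\<Sum>j\<in>J. (l2of u \<bullet> g j)^2)"
proof -
 let ?n = "real CARD('n)"
 define d where "d = (2 * e / ?n powr (?n + 2 * t)) powr (1 / (2 * t))"
 have d: "d > 0" unfolding d_def using e by simp
 have "d powr (2 * t) = 2 * e / ?n powr (?n + 2 * t)" unfolding d_def powr_powr using e t by simp
 then have de: "?n powr (?n + 2 * t) * d powr (2 * t) = 2 * e" by simp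
 define c where "c = (?n * d) powr (?n + 2 * t)"
 have c: "c > 0" using d by (simp add: c_def)
 have dn: "d ^ CARD('n) = d powr ?n" using d by (simp add: powr_realpow)
 have ce: "c = 2 * d ^ CARD('n) * e"
 proof -
  have "c = ?n powr (?n + 2 * t) * (d powr ?n * d powr (2 * t))" using d by (simp add: c_def powr_mult powr_add)
  also have "... = d powr ?n * (?n powr (?n + 2 * t) * d powr (2 * t))" by simp
  finally show ?thesis unfolding de dn by simp
 qed
 define Q where "Q = (grid_cube d :: ('n => int) => (real ^ 'n) set)"
 note Q = grid_cell_facts[OF d, where 'n = 'n, folded Q_def]
 define J where "J = grid_cell d ` \<Omega>"
 have J: "finite J" unfolding J_def by (rule Q(5)[OF \<Omega>])
 define \<mu> where "\<mu> j = measure lborel (Q j)" for j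
 have \<mu>: "\<mu> j >= d ^ CARD('n)" "\<mu> j > 0" for j
  using Q(4)[of j] less_le_trans[OF zero_less_power[OF d] Q(4)[of j]] by (auto simp: \<mu>_def)
 have Qi: "integrable lborel (\<lambda>x. indicator (Q j) x :: real)" and Q\<mu>: "(LBINT x. indicator (Q j) x :: real) = \<mu> j" for j
  using Q(1)[of j] emeasure_bounded_finite[OF Q(2)[of j]] by (auto simp: \<mu>_def)
 have iL: "(\<lambda>x. indicator (Q j) x :: real) \<in> L2 UNIV" for j by (rule L2_indicator[OF Q(1,2)])
 define g where "g j = (1 / sqrt (\<mu> j)) *\<^sub>R l2of (\<lambda>x. indicator (Q j) x :: real)" for j
 show ?thesis
 proof (rule that[OF J, of g])
  fix u :: "real ^ 'n => real" assume u: "gagl t u" and u0: "!!x. x ~: \<Omega> ==> u x = 0"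
  note ug = gaglD[OF u]
  have [measurable]: "Q j \<in> sets borel" for j by (rule Q(1))
  have im [measurable]: "(\<lambda>x. indicator (Q j) x :: real) \<in> Borel" for j by (rule borel_measurable_indicator[OF Q(1)])
  have u2: "integrable lborel (\<lambda>x. (u x)^2)" using ug(3) L2_borel_iff[OF ug(1)] by simp
  have ui: "integrable lborel (\<lambda>x. indicator (Q j) x * u x)" for j
   by (rule bochner_bound[OF ug(2)]) (use ug(1) in \<open>auto simp: indicator_def\<close>)
  have u2i: "integrable lborel (\<lambda>x. indicator (Q j) x * (u x)^2)" for j
   by (rule bochner_bound[OF u2]) (use ug(1) in \<open>auto simp: indicator_def\<close>)
  define K where "K j z = indicator (Q j) (fst z) * indicator (Q j) (snd z) * (u (fst z) - u (snd z))^2" for j and z :: "(real ^ 'n) \<times> (real ^ 'n)"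
  have Dm: "Dq t u \<in> Borel" by (rule Dq_measurable[OF ug(1)])
  have D2: "integrable lborel (\<lambda>z. (Dq t u z)^2)" using ug(4) L2_borel_iff[OF Dm] by simp
  have Km: "K j \<in> Borel" for j
   unfolding K_def[abs_def] using ug(1) im[of j] by measurable
  have K0: "K j z >= 0" for j z by (simp add: K_def)
  have Kle: "K j z <= indicator (Q j) (fst z) * (c * (Dq t u z)^2)" for j z
  proof -
   obtain x y where z: "z = (x, y)" by (cases z)
   show ?thesis
   proof (cases "x \<in> Q j & y \<in> Q j & x ~= y")
    case True
    have "norm (x - y) powr (?n + 2 * t) <= c" unfolding c_def using Q(3)[of x j y] True t by (intro powr_mono2) auto
    moreover have "norm (x - y) powr (?n + 2 * t) > 0" using True by simp
    moreover have "(Dq t u z)^2 = (u x - u y)^2 / norm (x - y) powr (?n + 2 * t)"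
     unfolding z Dq_sq powr_minus_divide by simp
    ultimately have "(u x - u y)^2 <= c * (Dq t u z)^2"
     using mult_right_mono[of "norm (x - y) powr (?n + 2 * t)" c "(Dq t u z)^2"] by simp
    then show ?thesis using True z by (simp add: K_def)
   next
    case False
    then have "K j z = 0" unfolding z K_def by (auto simp: indicator_def)
    then show ?thesis using c by simp
   qed
  qed
  have Ki: "integrable lborel (K j)" for j
  proof (rule bochner_bound[OF integrable_mult_right[OF D2, of c]])
   have "K j z <= c * (Dq t u z)^2" for z
    by (rule order_trans[OF Kle]) (use c in \<open>simp add: indicator_def\<close>)
   then show "AE z in lborel. norm (K j z) <= norm (c * (Dq t u z)^2)" using K0 c by (intro AE_I2) simp
  qed (use Km in simp)
  have Kint: "(LBINT z. K j z) = 2 * \<mu> j * (LBINT x. indicator (Q j) x * (u x)^2) - 2 * (LBINT x. indicator (Q j) x * u x)^2" for j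
   unfolding lborel_iterated_integral[OF Ki, symmetric] using mean_square_eq[OF ui u2i Qi, of j] unfolding Q\<mu> by (simp add: K_def)
  have gj: "(l2of u \<bullet> g j)^2 = (LBINT x. indicator (Q j) x * u x)^2 / \<mu> j" for j
  proof -
   have "l2of u \<bullet> l2of (\<lambda>x. indicator (Q j) x) = (LBINT x. indicator (Q j) x * u x)"
    unfolding inner_l2of[OF ug(3) iL] by (rule lebesgue_integral_eq_borel) (use ug(1) in \<open>simp_all add: mult.commute\<close>)
   then show ?thesis unfolding g_def using \<mu>(2)[of j] by (simp add: power_mult_distrib power_divide)
  qed
  have cell: "(LBINT x. indicator (Q j) x * (u x)^2) <= (l2of u \<bullet> g j)^2 + (1 / (2 * d ^ CARD('n))) * (LBINT z. K j z)" for j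
  proof -
   have "(LBINT x. indicator (Q j) x * (u x)^2) = (l2of u \<bullet> g j)^2 + (1 / (2 * \<mu> j)) * (LBINT z. K j z)"
    unfolding gj Kint using \<mu>(2)[of j] by (simp add: field_simps)
   also have "... <= (l2of u \<bullet> g j)^2 + (1 / (2 * d ^ CARD('n))) * (LBINT z. K j z)"
    using \<mu>[of j] d K0 by (intro add_left_mono mult_right_mono divide_left_mono integral_nonneg_AE) auto
   finally show ?thesis .
  qed
  have part: "(\<Sum>j\<in>J. indicator (Q j) x * r) = (if grid_cell d x \<in> J then r else 0)" for x and r :: real
  proof -
   have "(\<Sum>j\<in>J. indicator (Q j) x * r) = (\<Sum>j\<in>J. if grid_cell d x = j then r else 0)"
    by (rule sum.cong) (auto simp: Q_def grid_cube_def)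
   then show ?thesis using J by simp
  qed
  have "(norm (l2of u))^2 = (LBINT x. (u x)^2)"
   unfolding norm_l2of_sq[OF ug(3)] by (rule lebesgue_integral_eq_borel) (use ug(1) in simp_all)
  also have "... = (LBINT x. (\<Sum>j\<in>J. indicator (Q j) x * (u x)^2))"
  proof (rule bochner_cong[OF refl])
   fix x show "(u x)^2 = (\<Sum>j\<in>J. indicator (Q j) x * (u x)^2)"
    unfolding part using u0[of x] by (auto simp: J_def)
  qed
  also have "... = (\<Sum>j\<in>J. (LBINT x. indicator (Q j) x * (u x)^2))" by (rule Bochner_Integration.integral_sum[OF u2i])
  also have "... <= (\<Sum>j\<in>J. (l2of u \<bullet> g j)^2 + (1 / (2 * d ^ CARD('n))) * (LBINT z. K j z))" by (rule sum_mono[OF cell])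
  also have "... = (\<Sum>j\<in>J. (l2of u \<bullet> g j)^2) + (1 / (2 * d ^ CARD('n))) * (LBINT z. (\<Sum>j\<in>J. K j z))"
   by (simp add: sum.distrib sum_distrib_left Bochner_Integration.integral_sum[OF Ki])
  also have "(LBINT z. (\<Sum>j\<in>J. K j z)) <= (LBINT z. c * (Dq t u z)^2)"
  proof (rule integral_mono)
   show "integrable lborel (\<lambda>z. \<Sum>j\<in>J. K j z)" by (rule Bochner_Integration.integrable_sum[OF Ki])
   show "integrable lborel (\<lambda>z. c * (Dq t u z)^2)" by (rule integrable_mult_right[OF D2])
   fix z
   have "(\<Sum>j\<in>J. K j z) <= (\<Sum>j\<in>J. indicator (Q j) (fst z) * (c * (Dq t u z)^2))" by (rule sum_mono[OF Kle])
   also have "... <= c * (Dq t u z)^2" unfolding part using c by simp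
   finally show "(\<Sum>j\<in>J. K j z) <= c * (Dq t u z)^2" .
  qed
  also have "(LBINT z. c * (Dq t u z)^2) = c * (norm (l2of (Dq t u)))^2"
  proof -
   have "(norm (l2of (Dq t u)))^2 = (LBINT z. (Dq t u z)^2)"
    unfolding norm_l2of_sq[OF ug(4)] by (rule lebesgue_integral_eq_borel) (use Dm in simp_all)
   then show ?thesis by simp
  qed
  also have "(1 / (2 * d ^ CARD('n))) * (c * (norm (l2of (Dq t u)))^2) = e * (norm (l2of (Dq t u)))^2"
   unfolding ce using d by simp
  finally show "(norm (l2of u))^2 <= e * (norm (l2of (Dq t u)))^2 + (\<Sum>j\<in>J. (l2of u \<bullet> g j)^2)"
   using d by (simp add: mult_left_mono divide_right_mono add.commute)
 qed
qed

section \<open>Energies of functions with disjoint supports\<close>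

text \<open>If \<open>f\<phi> = 0\<close>, the product of differences is \<open>- f(x)\<phi>(y) - f(y)\<phi>(x)\<close>; the energy becomes the pairing of
\<open>f\<close> with a Riesz potential of \<open>\<phi>\<close>.\<close>

lemma Dq_inner_disjoint:
 fixes f \<phi> :: "'a::euclidean_space => real"
 assumes f: "gagl t f" and \<phi>: "gagl t \<phi>" and disj: "!!x. f x = 0 \<or> \<phi> x = 0"
 shows "l2of (Dq t f) \<bullet> l2of (Dq t \<phi>) = - 2 * (LBINT x. (LBINT y. \<phi> y * norm (x - y) powr (- (real DIM('a) + 2 * t))) * f x)"
proof -
 note fg = gaglD[OF f] and pg = gaglD[OF \<phi>]
 note Df = Dq_measurable[OF fg(1), of t] and Dp = Dq_measurable[OF pg(1), of t]
 define P where "P z = Dq t f z * Dq t \<phi> z" for z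
 have Pm: "P \<in> Borel" unfolding P_def[abs_def] using Df Dp by measurable
 have "integrable lebesgue P" using L2_inner_integrable[OF fg(4) pg(4)] by (simp add: P_def[abs_def])
 then have Pi: "integrable lborel P" by (rule integrable_lebesgue_borel[OF _ Pm])
 define J where "J z = f (fst z) * \<phi> (snd z) * norm (fst z - snd z) powr (- (real DIM('a) + 2 * t))" for z :: "'a \<times> 'a"
 have Jm: "J \<in> Borel" unfolding J_def[abs_def] using fg(1) pg(1) by measurable
 have P_eq: "P z = - (J z + J (snd z, fst z))" for z
 proof -
  obtain x y where z: "z = (x, y)" by (cases z)
  have w: "norm (x - y) powr (- (real DIM('a) / 2 + t)) * norm (x - y) powr (- (real DIM('a) / 2 + t)) = norm (x - y) powr (- (real DIM('a) + 2 * t))"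
   unfolding powr_add[symmetric] by (rule arg_cong[where f = "(powr) (norm (x - y))"]) simp
  have "P z = (f x - f y) * (\<phi> x - \<phi> y) * norm (x - y) powr (- (real DIM('a) + 2 * t))"
   unfolding z P_def Dq_def w[symmetric] by simp
  also have "(f x - f y) * (\<phi> x - \<phi> y) = - (f x * \<phi> y) - f y * \<phi> x"
   using disj[of x] disj[of y] by (auto simp: algebra_simps)
  finally show ?thesis unfolding z J_def by (simp add: norm_minus_commute[of y x] algebra_simps)
 qed
 have Ji: "integrable lborel J"
 proof (rule bochner_bound[OF Pi])
  show "J \<in> borel_measurable lborel" using Jm by simp
  have "J z = 0 \<or> J (snd z, fst z) = 0" for z
   using disj[of "fst z"] disj[of "snd z"] by (auto simp: J_def)
  then have "\<bar>J z\<bar> <= \<bar>P z\<bar>" for z unfolding P_eq by (metis abs_ge_zero abs_minus_cancel abs_zero add.right_neutral order_refl)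
  then show "AE z in lborel. norm (J z) <= norm (P z)" by simp
 qed
 have "l2of (Dq t f) \<bullet> l2of (Dq t \<phi>) = (LBINT z. P z)"
  unfolding inner_l2of[OF fg(4) pg(4)] by (rule lebesgue_integral_eq_borel[OF _ Pm]) (simp add: P_def)
 also have "... = - ((LBINT z. J z) + (LBINT z. J (snd z, fst z)))"
  unfolding P_eq using Ji lborel_integrable_swap[OF Ji] by (simp add: bochner_add)
 also have "... = - 2 * (LBINT z. J z)" unfolding lborel_integral_swap[OF Jm] by simp
 also have "(LBINT z. J z) = (LBINT x. (LBINT y. J (x, y)))" by (rule lborel_iterated_integral[OF Ji, symmetric])
 also have "... = (LBINT x. (LBINT y. \<phi> y * norm (x - y) powr (- (real DIM('a) + 2 * t))) * f x)"
  unfolding integral_mult_left_zero[symmetric] by (simp add: J_def mult_ac)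
 finally show ?thesis .
qed

lemma Dq_inner_Sop_disjoint:
 fixes \<Omega> :: "'a::euclidean_space set" and G \<psi> :: "'a => real"
 assumes \<Omega>: "bounded \<Omega>" "\<Omega> \<in> sets borel" and s: "0 < s" "s < t" and \<psi>: "gagl t \<psi>"
  and G: "G \<in> Borel" "G \<in> L2 UNIV" and disj: "!!x. \<psi> x = 0 \<or> G x = 0"
  and sup: "!!x. x ~: \<Omega> ==> \<psi> x = 0" "!!x. x ~: \<Omega> ==> G x = 0"
 shows "l2of (Dq t \<psi>) \<bullet> Sop \<Omega> (t - s) (l2of G) = - (LBINT x. (LBINT y. G y * norm (x - y) powr (- (real DIM('a) + s))) * \<psi> x)"
proof -
 let ?n = "real DIM('a)"
 note pg = gaglD[OF \<psi>]
 have \<beta>: "t - s > 0" using s by simp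
 define P where "P z = Dq t \<psi> z * (pair_kernel \<Omega> (t - s) z * G (fst z))" for z
 have Pm: "P \<in> Borel"
  unfolding P_def[abs_def] using Dq_measurable[OF pg(1)] pair_kernel_measurable[OF \<Omega>(2)] G(1) by measurable
 have ae: "AE z in lebesgue. Dq t \<psi> z * (pair_kernel \<Omega> (t - s) z * l2fun (l2of G) (fst z)) = P z"
  using AE_lebesgue_fst(1)[OF l2fun_l2of[OF G(2)]] by eventually_elim (simp add: P_def)
 have "integrable lebesgue P"
  using L2_inner_integrable[OF pg(4) Sop_L2[OF \<Omega> \<beta>, of "l2of G"]] ae
   integrable_cong_AE[THEN iffD1, OF _ _ ae] borel_measurable_AE_cong[OF borel_measurable_lebesgueI[OF Pm] ae] borel_measurable_lebesgueI[OF Pm]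
  by simp
 then have Pi: "integrable lborel P" by (rule integrable_lebesgue_borel[OF _ Pm])
 have P_eq: "P (x, y) = - (G x * norm (y - x) powr (- (?n + s)) * \<psi> y)" for x y
 proof -
  have "norm (x - y) powr (- (?n / 2 + t)) * norm (x - y) powr ((t - s) - ?n / 2) = norm (x - y) powr (- (?n + s))"
   unfolding powr_add[symmetric] by (rule arg_cong[where f = "(powr) (norm (x - y))"]) simp
  then have "P (x, y) = (\<psi> x - \<psi> y) * (indicator \<Omega> x * indicator \<Omega> y) * norm (x - y) powr (- (?n + s)) * G x"
   unfolding P_def Dq_def pair_kernel_def by simp
  also have "(\<psi> x - \<psi> y) * (indicator \<Omega> x * indicator \<Omega> y) * norm (x - y) powr (- (?n + s)) * G x = - (G x * norm (y - x) powr (- (?n + s)) * \<psi> y)"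
   using disj[of x] sup(1)[of y] sup(2)[of x] by (auto simp: indicator_def norm_minus_commute)
  finally show ?thesis .
 qed
 have "l2of (Dq t \<psi>) \<bullet> Sop \<Omega> (t - s) (l2of G) = (LBINT z. P z)"
  unfolding inner_Sop[OF \<Omega> \<beta> pg(4)] by (rule lebesgue_integral_eq_borel[OF ae Pm])
 also have "... = (LBINT z. P (snd z, fst z))" by (rule lborel_integral_swap[OF Pm, symmetric])
 also have "... = (LBINT x. (LBINT y. P (y, x)))"
  using lborel_iterated_integral[OF lborel_integrable_swap[OF Pi]] by simp
 also have "... = - (LBINT x. (LBINT y. G y * norm (x - y) powr (- (?n + s))) * \<psi> x)"
  unfolding P_eq by simp
 finally show ?thesis .
qed

type_synonym 'a energy_pair = "('a, real) l2 \<times> ('a \<times> 'a, real) l2"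

section \<open>The energy space and multiplication operators\<close>

definition sob :: "real => ('a::euclidean_space => real) => 'a energy_pair" where
 "sob t u = (l2of u, l2of (Dq t u))"

definition energy_space :: "real => 'a::euclidean_space set => ('a energy_pair) set" where
 "energy_space t \<Omega> = {sob t u | u. gagl t u & (\<forall>x. x ~: \<Omega> --> u x = 0)}"

lemma sobolev_L2: "u \<in> sobolev a ==> u \<in> L2 UNIV"
proof -
 assume "u \<in> sobolev a"
 then have "cplx u \<in> L2 UNIV" unfolding sobolev_def has_fourier_def cplx_def[abs_def] by blast
 then show "u \<in> L2 UNIV" by (simp add: cplx_L2_iff)
qed

lemma L2_restrict:
 fixes w :: "'a::euclidean_space => real"
 assumes A: "A \<in> sets borel" "A \<subseteq> \<Omega>" and w: "w \<in> L2 \<Omega>"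
 shows "restrict w A \<in> L2 A"
proof (rule iffD2[OF L2_indicator_iff])
 have "(\<lambda>x. indicator A x * (indicator \<Omega> x * w x)) \<in> L2 UNIV"
  by (rule L2_UNIV_restrict[OF iffD1[OF L2_indicator_iff w] A(1)])
 also have "(\<lambda>x. indicator A x * (indicator \<Omega> x * w x)) = (\<lambda>x. indicator A x * restrict w A x)"
  using A(2) by (auto simp: indicator_def fun_eq_iff)
 finally show "(\<lambda>x. indicator A x * restrict w A x) \<in> L2 UNIV" .
qed

lemma Dq_scale: "Dq a (\<lambda>x. c * u x) = (\<lambda>z. c * Dq a u z)"
 using Dq_scaleR[of a c u] by simp

lemma L2_scale: "u \<in> L2 UNIV ==> (\<lambda>x. c * u x :: real) \<in> L2 UNIV"
 using L2_scaleR[of u c] by simp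

lemma l2of_scale: "u \<in> L2 UNIV ==> l2of (\<lambda>x. c * u x :: real) = c *\<^sub>R l2of u"
 using l2of_scaleR[of u c] by simp

lemma gagl_scale: "gagl a u ==> gagl a (\<lambda>x. c * u x)"
 unfolding gagl_def Dq_scale by (auto intro: L2_scale)

lemma sob_add: "gagl t u ==> gagl t w ==> sob t (\<lambda>x. u x + w x) = sob t u + sob t w"
 unfolding sob_def Dq_add by (simp add: l2of_add gaglD plus_prod_def)

lemma sob_scale: "gagl t u ==> sob t (\<lambda>x. c * u x) = c *\<^sub>R sob t u"
 unfolding sob_def Dq_scale by (simp add: l2of_scale gaglD scaleR_prod_def)

text \<open>Almost every pair \<open>(x, y)\<close> avoids a null set in both coordinates.\<close>

lemma sob_cong_AE:
 fixes u w :: "'a::euclidean_space => real"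
 assumes "gagl t u" "gagl t w" "AE x in lebesgue. u x = w x"
 shows "sob t u = sob t w"
proof -
 have "AE z in lebesgue. Dq t u z = Dq t w z"
  using AE_lebesgue_fst(1)[OF assms(3)] AE_lebesgue_fst(2)[OF assms(3)]
  by eventually_elim (simp add: Dq_def case_prod_beta')
 then show ?thesis
  unfolding sob_def using assms gaglD[OF assms(1)] gaglD[OF assms(2)] by (simp add: l2of_eq_iff)
qed

lemma gagl_zero: "gagl t (\<lambda>x. 0)" and sob_zero: "sob t (\<lambda>x. 0) = 0"
proof -
 have D: "Dq t (\<lambda>x. 0) = (\<lambda>z. 0)" by (simp add: Dq_def fun_eq_iff)
 have "(\<lambda>x. 0 :: real) \<in> L2 UNIV" by (simp add: mem_L2_UNIV)
 then show "gagl t (\<lambda>x. 0)" by (simp add: gagl_def D mem_L2_UNIV)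
 show "sob t (\<lambda>x. 0) = 0" by (simp add: sob_def D l2of_zero zero_prod_def)
qed

lemma energy_spaceI: "gagl t u ==> (!!x. x ~: \<Omega> ==> u x = 0) ==> sob t u \<in> energy_space t \<Omega>"
 unfolding energy_space_def by blast

lemma energy_spaceE:
 assumes "p \<in> energy_space t \<Omega>"
 obtains u where "gagl t u" "!!x. x ~: \<Omega> ==> u x = 0" "p = sob t u"
 using assms unfolding energy_space_def by blast

lemma subspace_energy_space: "subspace (energy_space t \<Omega>)"
proof (rule subspaceI)
 show "0 \<in> energy_space t \<Omega>" using energy_spaceI[OF gagl_zero, of \<Omega>] by (simp add: sob_zero)
next
 fix p p' assume "p \<in> energy_space t \<Omega>" "p' \<in> energy_space t \<Omega>"
 then obtain u w where u: "gagl t u" "!!x. x ~: \<Omega> ==> u x = 0" "p = sob t u"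
  and w: "gagl t w" "!!x. x ~: \<Omega> ==> w x = 0" "p' = sob t w" by (auto elim!: energy_spaceE)
 show "p + p' \<in> energy_space t \<Omega>"
  unfolding u(3) w(3) sob_add[OF u(1) w(1), symmetric] by (rule energy_spaceI[OF gagl_add[OF u(1) w(1)]]) (simp add: u w)
next
 fix c p assume "p \<in> energy_space t \<Omega>"
 then obtain u where u: "gagl t u" "!!x. x ~: \<Omega> ==> u x = 0" "p = sob t u" by (auto elim!: energy_spaceE)
 show "c *\<^sub>R p \<in> energy_space t \<Omega>"
  unfolding u(3) sob_scale[OF u(1), symmetric] by (rule energy_spaceI[OF gagl_scale[OF u(1)]]) (simp add: u)
qed

lemma integrable_bounded_support:
 fixes w :: "'a::euclidean_space => real"
 assumes w: "w \<in> Borel" "w \<in> L2 UNIV" and \<Omega>: "bounded \<Omega>" "\<Omega> \<in> sets borel"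
  and sup: "!!x. x ~: \<Omega> ==> w x = 0"
 shows "integrable lborel w"
proof (rule integrable_lebesgue_borel[OF _ w(1)])
 have "integrable lebesgue (\<lambda>x. w x \<bullet> indicator \<Omega> x)" by (rule L2_inner_integrable[OF w(2) L2_indicator[OF \<Omega>(2,1)]])
 also have "(\<lambda>x. w x \<bullet> indicator \<Omega> x) = w" using sup by (auto simp: indicator_def fun_eq_iff)
 finally show "integrable lebesgue w" .
qed

text \<open>Along a subsequence the functions and their difference quotients converge almost everywhere, so the
second component of the limit is the difference quotient of the first.\<close>

lemma closed_energy_space:
 fixes \<Omega> :: "'a::euclidean_space set"
 assumes \<Omega>: "bounded \<Omega>" "\<Omega> \<in> sets borel"
 shows "closed (energy_space t \<Omega>)"
 unfolding closed_sequential_limits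
proof (intro allI impI, elim conjE)
 fix P :: "nat => 'a energy_pair" and L
 assume P: "\<forall>n. P n \<in> energy_space t \<Omega>" and lim: "P ----> L"
 have "\<forall>n. \<exists>u. gagl t u & (\<forall>x. x ~: \<Omega> --> u x = 0) & P n = sob t u" using P unfolding energy_space_def by blast
 then obtain u where u: "!!n. gagl t (u n)" "!!n x. x ~: \<Omega> ==> u n x = 0" "!!n. P n = sob t (u n)" by metis
 obtain U G where L: "L = (U, G)" by (cases L)
 have "(\<lambda>n. l2of (u n)) ----> U" using tendsto_fst[OF lim] by (simp add: L u(3) sob_def)
 then obtain r where r: "strict_mono r" "AE x in lebesgue. (\<lambda>k. l2fun (l2of (u (r k))) x) ----> l2fun U x"
  by (rule l2_tendsto_AE_subsequence)
 have "(\<lambda>n. l2of (Dq t (u n))) ----> G" using tendsto_snd[OF lim] by (simp add: L u(3) sob_def)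
 then have "(\<lambda>n. l2of (Dq t (u (r n)))) ----> G" using LIMSEQ_subseq_LIMSEQ[OF _ r(1)] by (simp add: comp_def)
 then obtain r' where r': "strict_mono r'" "AE z in lebesgue. (\<lambda>k. l2fun (l2of (Dq t (u (r (r' k))))) z) ----> l2fun G z"
  by (rule l2_tendsto_AE_subsequence)
 have "AE x in lebesgue. \<forall>n. l2fun (l2of (u n)) x = u n x"
  unfolding AE_all_countable using l2fun_l2of gaglD(3)[OF u(1)] by blast
 with r(2) have ulim: "AE x in lebesgue. (\<lambda>k. u (r k) x) ----> l2fun U x" by eventually_elim simp
 have "AE z in lebesgue. \<forall>n. l2fun (l2of (Dq t (u n))) z = Dq t (u n) z"
  unfolding AE_all_countable using l2fun_l2of gaglD(4)[OF u(1)] by blast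
 with r'(2) have Dlim: "AE z in lebesgue. (\<lambda>k. Dq t (u (r (r' k))) z) ----> l2fun G z" by eventually_elim simp
 define w where "w = (\<lambda>x. indicator \<Omega> x * l2fun U x)"
 have wm: "w \<in> Borel"
  unfolding w_def by (intro borel_measurable_times borel_measurable_indicator \<Omega> l2fun_measurable)
 have wL: "w \<in> L2 UNIV" unfolding w_def by (rule L2_UNIV_restrict[OF l2fun_L2 \<Omega>(2)])
 have wU: "AE x in lebesgue. l2fun U x = w x" using ulim
 proof eventually_elim
  case (elim x)
  then have "x ~: \<Omega> ==> l2fun U x = 0" using u(2) by (simp add: LIMSEQ_const_iff)
  then show ?case by (cases "x \<in> \<Omega>") (simp_all add: w_def)
 qed
 have wlim: "AE x in lebesgue. (\<lambda>k. u (r k) x) ----> w x" using ulim wU by eventually_elim simp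
 have wG: "AE z in lebesgue. l2fun G z = Dq t w z" using AE_lebesgue_fst(1)[OF wlim] AE_lebesgue_fst(2)[OF wlim] Dlim
 proof eventually_elim
  case (elim z)
  have "(\<lambda>k. u (r (r' k)) (fst z)) ----> w (fst z)" "(\<lambda>k. u (r (r' k)) (snd z)) ----> w (snd z)"
   using LIMSEQ_subseq_LIMSEQ[OF elim(1) r'(1)] LIMSEQ_subseq_LIMSEQ[OF elim(2) r'(1)] by (simp_all add: comp_def)
  then have "(\<lambda>k. Dq t (u (r (r' k))) z) ----> Dq t w z"
   unfolding Dq_def case_prod_beta' by (intro tendsto_intros)
  then show ?case by (rule LIMSEQ_unique[OF elim(3)])
 qed
 have "Dq t w \<in> L2 UNIV"
  by (rule L2_cong_AE[OF l2fun_L2 wG borel_measurable_lebesgueI[OF Dq_measurable[OF wm]]])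
 then have g: "gagl t w"
  unfolding gagl_def using wm wL integrable_bounded_support[OF wm wL \<Omega>] by (simp add: w_def)
 have "l2of w = U" using l2of_eq_iff[OF l2fun_L2 wL, of U] wU by simp
 moreover have "l2of (Dq t w) = G" using l2of_eq_iff[OF l2fun_L2 gaglD(4)[OF g], of G] wG by simp
 ultimately have "L = sob t w" by (simp add: L sob_def)
 then show "L \<in> energy_space t \<Omega>" using energy_spaceI[OF g, of \<Omega>] by (simp add: w_def)
qed

definition mult_l2 :: "('a::euclidean_space => real) => ('a, real) l2 => ('a, real) l2" where
 "mult_l2 m U = l2of (\<lambda>x. m x * l2fun U x)"

context
 fixes m :: "'a::euclidean_space => real" and M :: real
 assumes m: "m \<in> Borel" and bd: "!!x. \<bar>m x\<bar> <= M"
begin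

lemma mult_L2: "u \<in> L2 UNIV ==> (\<lambda>x. m x * u x) \<in> L2 UNIV"
proof (rule L2_dominated[where C = M])
 assume u: "u \<in> L2 UNIV"
 have [measurable]: "u \<in> borel_measurable lebesgue" using u by (simp add: mem_L2_UNIV)
 have [measurable]: "m \<in> borel_measurable lebesgue" by (rule borel_measurable_lebesgueI[OF m])
 show "(\<lambda>x. m x * u x) \<in> borel_measurable lebesgue" by measurable
 show "AE x in lebesgue. norm (m x * u x) <= M * norm (u x)" by (rule AE_I2) (simp add: abs_mult mult_right_mono bd)
qed

lemma mult_l2of: "u \<in> L2 UNIV ==> mult_l2 m (l2of u) = l2of (\<lambda>x. m x * u x)"
proof -
 assume u: "u \<in> L2 UNIV"
 have "AE x in lebesgue. m x * l2fun (l2of u) x = m x * u x" using l2fun_l2of[OF u] by eventually_elim simp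
 then show ?thesis unfolding mult_l2_def using l2of_eq_iff[OF mult_L2[OF l2fun_L2] mult_L2[OF u]] by blast
qed

lemma inner_mult_l2: "mult_l2 m U \<bullet> V = (LINT x|lebesgue. m x * l2fun U x * l2fun V x)"
 using inner_l2of[OF mult_L2[OF l2fun_L2, of U] l2fun_L2[of V]] by (simp add: mult_l2_def)

lemma mult_l2_sym: "mult_l2 m U \<bullet> V = mult_l2 m V \<bullet> U"
 unfolding inner_mult_l2 by (simp add: mult_ac)

lemma norm_mult_l2: "norm (mult_l2 m U) <= M * norm U"
proof -
 have M0: "M >= 0" using order_trans[OF abs_ge_zero bd] .
 have "(norm (mult_l2 m U))^2 = (LINT x|lebesgue. (norm (m x * l2fun U x))^2)"
  unfolding mult_l2_def by (rule norm_l2of_sq[OF mult_L2[OF l2fun_L2]])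
 also have "... <= (LINT x|lebesgue. M^2 * (norm (l2fun U x))^2)"
 proof (rule integral_mono)
  show "integrable lebesgue (\<lambda>x. (norm (m x * l2fun U x))^2)" using mult_L2[OF l2fun_L2, of U] by (simp add: mem_L2_UNIV)
  show "integrable lebesgue (\<lambda>x. M^2 * (norm (l2fun U x))^2)"
   by (rule integrable_mult_right) (use l2fun_L2[of U] in \<open>simp add: mem_L2_UNIV\<close>)
  fix x
  have "(m x)^2 <= M^2" using power_mono[OF bd[of x], of 2] by simp
  then show "(norm (m x * l2fun U x))^2 <= M^2 * (norm (l2fun U x))^2" by (simp add: power_mult_distrib mult_right_mono)
 qed
 also have "... = M^2 * (norm U)^2" using norm_l2of_sq[OF l2fun_L2[of U]] by simp
 also have "... = (M * norm U)^2" by (simp add: power_mult_distrib)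
 finally show ?thesis by (rule power2_le_imp_le) (use M0 in simp)
qed

lemma bounded_linear_mult_l2: "bounded_linear (mult_l2 m)"
proof (rule bounded_linear_intro[where K = M])
 have eqI: "x = y" if "!!v. x \<bullet> v = y \<bullet> v" for x y :: "('a, real) l2"
 proof -
  have "(x - y) \<bullet> (x - y) = 0" using that[of "x - y"] by (simp add: inner_diff_left)
  then show ?thesis by simp
 qed
 have sym: "mult_l2 m U \<bullet> V = U \<bullet> mult_l2 m V" for U V
  using mult_l2_sym[of U V] by (simp add: inner_commute)
 show "mult_l2 m (U + V) = mult_l2 m U + mult_l2 m V" for U V by (rule eqI) (simp add: sym inner_add_left)
 show "mult_l2 m (r *\<^sub>R U) = r *\<^sub>R mult_l2 m U" for r U by (rule eqI) (simp add: sym)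
 show "norm (mult_l2 m U) <= norm U * M" for U using norm_mult_l2[of U] by (simp add: mult.commute)
qed

lemma mult_l2_form_bound: "- (M * (norm U)^2) <= mult_l2 m U \<bullet> U"
proof -
 have "\<bar>mult_l2 m U \<bullet> U\<bar> <= norm (mult_l2 m U) * norm U" by (rule Cauchy_Schwarz_ineq2)
 also have "... <= M * norm U * norm U" by (rule mult_right_mono[OF norm_mult_l2]) simp
 finally show ?thesis by (simp add: power2_eq_square abs_le_iff)
qed

end

text \<open>Truncation and extension by zero make the coefficient bounded everywhere and insensitive to values off \<open>\<Omega>\<close>.\<close>

lemma Linfty_bounded_borel:
 fixes b :: "'a::euclidean_space => real"
 assumes b: "b \<in> Linfty \<Omega>" and \<Omega>: "\<Omega> \<in> sets borel"
 obtains b' M where "b' \<in> Borel" "!!x. \<bar>b' x\<bar> <= M" "!!x. x ~: \<Omega> ==> b' x = 0"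
  "AE x in lebesgue. x \<in> \<Omega> --> b x = b' x"
proof -
 obtain M where M: "AE x in lebesgue. x \<in> \<Omega> --> \<bar>b x\<bar> <= M"
  and m: "(\<lambda>x. indicator \<Omega> x *\<^sub>R b x) \<in> borel_measurable lebesgue"
  using b by (auto simp: Linfty_def set_borel_measurable_def)
 obtain g where g: "g \<in> Borel" "AE x in lebesgue. indicator \<Omega> x *\<^sub>R b x = g x"
  by (rule lebesgue_measurable_ex_borel[OF m])
 \<comment> \<open>\<open>|M|\<close>, because an essential bound on a null set may be negative\<close>
 define b' where "b' x = indicator \<Omega> x * max (- \<bar>M\<bar>) (min \<bar>M\<bar> (g x))" for x
 show ?thesis
 proof (rule that)
  show "b' \<in> Borel"
   unfolding b'_def[abs_def] by (intro borel_measurable_times borel_measurable_indicator \<Omega> borel_measurable_max borel_measurable_min g borel_measurable_const)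
  show "\<bar>b' x\<bar> <= \<bar>M\<bar>" for x by (cases "x \<in> \<Omega>") (auto simp: b'_def abs_le_iff)
  show "x ~: \<Omega> ==> b' x = 0" for x by (simp add: b'_def)
  show "AE x in lebesgue. x \<in> \<Omega> --> b x = b' x" using g(2) M
   by eventually_elim (auto simp: b'_def)
 qed
qed

text \<open>\<open>Rop\<close> sees only pairs in \<open>\<Omega> \<times> \<Omega>\<close>.\<close>

lemma Rop_vanishing:
 fixes \<Omega> :: "'a::euclidean_space set"
 assumes \<Omega>: "bounded \<Omega>" "\<Omega> \<in> sets borel" and \<beta>: "\<beta> > 0" and f: "gagl t f" "!!x. x \<in> \<Omega> ==> f x = 0"
 shows "Rop \<Omega> \<beta> (l2of (Dq t f)) = 0"
proof -
 let ?R = "Rop \<Omega> \<beta> (l2of (Dq t f))"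
 have z: "Dq t f z * (pair_kernel \<Omega> \<beta> z * l2fun ?R (fst z)) = 0" for z
  using f(2)[of "fst z"] f(2)[of "snd z"] by (auto simp: Dq_def pair_kernel_def case_prod_beta' indicator_def)
 have "?R \<bullet> ?R = 0" unfolding Rop(2)[OF \<Omega> \<beta>] inner_Sop[OF \<Omega> \<beta> gaglD(4)[OF f(1)]] z by simp
 then show ?thesis by simp
qed

section \<open>The exterior value problem\<close>

text \<open>\<open>b'\<close> and \<open>q'\<close> are bounded Borel representatives of the coefficients.\<close>

locale exterior_problem =
 fixes s t :: real and \<Omega> :: "(real ^ 'n) set" and b q b' q' :: "real ^ 'n => real" and Mb Mq C \<sigma> :: real
 assumes s: "0 < s" "s < t" "t < 1" and \<Omega>: "bounded \<Omega>" "open \<Omega>"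
  and b': "b' \<in> Borel" "!!x. \<bar>b' x\<bar> <= Mb" "!!x. x ~: \<Omega> ==> b' x = 0" "AE x in lebesgue. x \<in> \<Omega> --> b x = b' x"
  and q': "q' \<in> Borel" "!!x. \<bar>q' x\<bar> <= Mq" "!!x. x ~: \<Omega> ==> q' x = 0" "AE x in lebesgue. x \<in> \<Omega> --> q x = q' x"
  and C_eq: "C = frac_const TYPE(real ^ 'n) (s / 2)" and \<sigma>_eq: "\<sigma> = symbol_const TYPE('n) t"
  and eigen: "eigenvalue_condition s t \<Omega> b q"
begin

lemma \<Omega>b: "\<Omega> \<in> sets borel" using \<Omega>(2) by simp

lemma ts: "t - s > 0" "0 < t" using s by auto

abbreviation "R \<equiv> Rop \<Omega> (t - s)"
abbreviation "V \<equiv> energy_space t \<Omega>"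

text \<open>The operator whose inner product with \<open>p'\<close> is the bilinear form of the equation.\<close>

definition opL :: "(real ^ 'n) energy_pair => (real ^ 'n) energy_pair" where
 "opL p = (mult_l2 q' (fst p), (1 / \<sigma>) *\<^sub>R snd p + C^2 *\<^sub>R Sop \<Omega> (t - s) (mult_l2 b' (R (snd p))))"

lemma regional_eq:
 assumes "gagl t u"
 shows "regional_frac_laplacian (s / 2) \<Omega> u \<in> L2 \<Omega>"
  and "AE x in lebesgue. x \<in> \<Omega> --> regional_frac_laplacian (s / 2) \<Omega> u x = C * l2fun (R (l2of (Dq t u))) x"
 unfolding C_eq by (rule regional_frac_laplacian_eq[OF \<Omega> s assms])+

lemma opL_inner: "opL p \<bullet> p' = mult_l2 q' (fst p) \<bullet> fst p' + (snd p \<bullet> snd p') / \<sigma> + C^2 * (mult_l2 b' (R (snd p)) \<bullet> R (snd p'))"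
proof -
 have "Sop \<Omega> (t - s) v \<bullet> g = v \<bullet> R g" for v g
  using Rop(2)[OF \<Omega>(1) \<Omega>b ts(1), of g v] by (simp add: inner_commute)
 then show ?thesis unfolding opL_def inner_prod_def by (simp add: inner_add_left)
qed

lemma opL_sym: "opL p \<bullet> p' = opL p' \<bullet> p"
 unfolding opL_inner mult_l2_sym[OF b'(1,2), of "R (snd p)"] mult_l2_sym[OF q'(1,2), of "fst p"]
 by (simp add: inner_commute)

lemma opL_bounded_linear: "bounded_linear opL"
 unfolding opL_def[abs_def]
 by (intro bounded_linear_Pair bounded_linear_add bounded_linear_compose[OF bounded_linear_scaleR_right]
   bounded_linear_compose[OF bounded_linear_mult_l2[OF q'(1,2)]] bounded_linear_compose[OF bounded_linear_mult_l2[OF b'(1,2)]]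
   bounded_linear_compose[OF Sop_bounded_linear[OF \<Omega>(1) \<Omega>b ts(1)]] bounded_linear_compose[OF Rop(1)[OF \<Omega>(1) \<Omega>b ts(1)]]
   bounded_linear_fst bounded_linear_snd)

lemma opL_bilinear: "bounded_bilinear (\<lambda>p p'. opL p \<bullet> p')"
 by (rule bounded_bilinear.comp[OF bounded_bilinear_inner opL_bounded_linear bounded_linear_ident])

lemma test_function_energy: "\<phi> \<in> test_functions U ==> gagl t \<phi>"
 by (rule test_function_gagl[OF ts(2) s(3)])

lemma weak_form:
 assumes u: "gagl t u" and \<phi>: "\<phi> \<in> test_functions \<Omega>"
 shows "(LINT x|lebesgue. frac_laplacian (t / 2) u x * frac_laplacian (t / 2) \<phi> x)
   + (LINT x:\<Omega>|lebesgue. b x * regional_frac_laplacian (s / 2) \<Omega> u x * regional_frac_laplacian (s / 2) \<Omega> \<phi> x)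
   + (LINT x:\<Omega>|lebesgue. q x * u x * \<phi> x) = opL (sob t u) \<bullet> sob t \<phi>"
proof -
 note p = test_function_energy[OF \<phi>]
 have 1: "(LINT x|lebesgue. frac_laplacian (t / 2) u x * frac_laplacian (t / 2) \<phi> x) = (l2of (Dq t u) \<bullet> l2of (Dq t \<phi>)) / \<sigma>"
  unfolding \<sigma>_eq by (rule frac_laplacian_energy[OF ts(2) s(3) u p])
 have 2: "(LINT x:\<Omega>|lebesgue. b x * regional_frac_laplacian (s / 2) \<Omega> u x * regional_frac_laplacian (s / 2) \<Omega> \<phi> x)
  = C^2 * (mult_l2 b' (R (l2of (Dq t u))) \<bullet> R (l2of (Dq t \<phi>)))"
 proof -
  let ?r = "l2fun (R (l2of (Dq t u)))" and ?r' = "l2fun (R (l2of (Dq t \<phi>)))"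
  have m: "(\<lambda>x. b' x * ?r x * ?r' x) \<in> Borel" using b'(1) by measurable
  have ae: "AE x in lebesgue. indicator \<Omega> x *\<^sub>R (b x * regional_frac_laplacian (s / 2) \<Omega> u x * regional_frac_laplacian (s / 2) \<Omega> \<phi> x)
    = C^2 * (b' x * ?r x * ?r' x)"
   using regional_eq(2)[OF u] regional_eq(2)[OF p] b'(4)
  proof eventually_elim
   case (elim x)
   then show ?case using b'(3)[of x] by (cases "x \<in> \<Omega>") (simp_all add: power2_eq_square mult_ac)
  qed
  have "(LINT x:\<Omega>|lebesgue. b x * regional_frac_laplacian (s / 2) \<Omega> u x * regional_frac_laplacian (s / 2) \<Omega> \<phi> x)
   = (LBINT x. C^2 * (b' x * ?r x * ?r' x))"
   unfolding set_lebesgue_integral_def by (rule lebesgue_integral_eq_borel[OF ae]) (use m in measurable)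
  also have "... = C^2 * (LBINT x. b' x * ?r x * ?r' x)" by simp
  also have "(LBINT x. b' x * ?r x * ?r' x) = (LINT x|lebesgue. b' x * ?r x * ?r' x)"
   by (rule lebesgue_integral_eq_borel[OF _ m, symmetric]) simp
  finally show ?thesis unfolding inner_mult_l2[OF b'(1,2)] .
 qed
 have 3: "(LINT x:\<Omega>|lebesgue. q x * u x * \<phi> x) = mult_l2 q' (l2of u) \<bullet> l2of \<phi>"
 proof -
  note ug = gaglD[OF u] and pg = gaglD[OF p]
  have m: "(\<lambda>x. q' x * u x * \<phi> x) \<in> Borel" using q'(1) ug(1) pg(1) by measurable
  have ae: "AE x in lebesgue. indicator \<Omega> x *\<^sub>R (q x * u x * \<phi> x) = q' x * u x * \<phi> x"
   using q'(4)
  proof eventually_elim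
   case (elim x)
   then show ?case using q'(3)[of x] by (cases "x \<in> \<Omega>") simp_all
  qed
  have "(LINT x:\<Omega>|lebesgue. q x * u x * \<phi> x) = (LBINT x. q' x * u x * \<phi> x)"
   unfolding set_lebesgue_integral_def by (rule lebesgue_integral_eq_borel[OF ae m])
  also have "... = (LINT x|lebesgue. q' x * u x * \<phi> x)"
   by (rule lebesgue_integral_eq_borel[OF _ m, symmetric]) simp
  finally show ?thesis unfolding mult_l2of[OF q'(1,2) ug(3)] inner_l2of[OF mult_L2[OF q'(1,2) ug(3)] pg(3)] by simp
 qed
 show ?thesis unfolding 1 2 3 opL_inner by (simp add: sob_def)
qed

lemma test_function_in_V: "\<phi> \<in> test_functions U ==> U \<subseteq> \<Omega> ==> sob t \<phi> \<in> V"
proof (rule energy_spaceI[OF test_function_energy])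
 fix x assume "\<phi> \<in> test_functions U" "U \<subseteq> \<Omega>" "x ~: \<Omega>"
 then show "\<phi> x = 0" using test_function_support[of \<phi> U] by (metis subsetD)
qed

lemma weak_solutionI:
 assumes u: "gagl t u" "!!x. x ~: \<Omega> ==> u x = f x" "!!\<psi>. \<psi> \<in> V ==> opL (sob t u) \<bullet> \<psi> = 0"
 shows "weak_solution s t \<Omega> b q f u"
 unfolding weak_solution_def
proof (intro conjI ballI)
 show "u \<in> sobolev t" by (rule gagl_sobolev[OF ts(2) s(3) u(1)])
 show "AE x in lebesgue. x \<in> - closure \<Omega> --> u x = f x" using u(2) closure_subset by (intro AE_I2) blast
 fix \<phi> assume p: "\<phi> \<in> test_functions \<Omega>"
 show "(LINT x|lebesgue. frac_laplacian (t / 2) u x * frac_laplacian (t / 2) \<phi> x)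
   + (LINT x:\<Omega>|lebesgue. b x * regional_frac_laplacian (s / 2) \<Omega> u x * regional_frac_laplacian (s / 2) \<Omega> \<phi> x)
   + (LINT x:\<Omega>|lebesgue. q x * u x * \<phi> x) = 0"
  unfolding weak_form[OF u(1) p] by (rule u(3)[OF test_function_in_V[OF p order_refl]])
qed

lemma opL_injective:
 assumes p: "p \<in> V" and z: "!!\<psi>. \<psi> \<in> V ==> opL p \<bullet> \<psi> = 0"
 shows "p = 0"
proof -
 obtain u where u: "gagl t u" "!!x. x ~: \<Omega> ==> u x = 0" "p = sob t u" using p unfolding energy_space_def by blast
 have "weak_solution s t \<Omega> b q (\<lambda>_. 0) u" by (rule weak_solutionI[OF u(1,2)]) (use z u(3) in simp_all)
 then have "AE x in lebesgue. u x = 0" using eigen unfolding eigenvalue_condition_def by blast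
 then show "p = 0" using sob_cong_AE[OF u(1) gagl_zero] by (simp add: u(3) sob_zero)
qed

text \<open>The potential and the regional term are bounded below by \<open>- L \<parallel>u\<parallel>\<^sup>2\<close> minus a quarter of the leading term,
and the Poincare inequality with constant \<open>c / L\<close> absorbs \<open>L \<parallel>u\<parallel>\<^sup>2\<close> up to finite rank.\<close>

lemma garding:
 obtains c K J and g :: "('n => int) => (real ^ 'n, real) l2"
 where "c > 0" "finite J" "!!p. p \<in> V ==> c * (norm p)^2 <= opL p \<bullet> p + K * (\<Sum>j\<in>J. (fst p \<bullet> g j)^2)"
proof -
 have \<sigma>: "\<sigma> > 0" unfolding \<sigma>_eq by (rule symbol_const_pos[OF ts(2) s(3)])
 have Mb: "Mb >= 0" and Mq: "Mq >= 0" using order_trans[OF abs_ge_zero b'(2)] order_trans[OF abs_ge_zero q'(2)] by auto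
 \<comment> \<open>a quarter of the leading coefficient; the regional term and the Poincare inequality use up one quarter each\<close>
 define c where "c = 1 / (4 * \<sigma>)"
 have c: "c > 0" using \<sigma> by (simp add: c_def)
 define A where "A = C^2 * Mb"
 have A: "A >= 0" using Mb by (simp add: A_def)
 \<comment> \<open>small enough that the energy part of the regional term is at most \<open>c\<close> times the energy\<close>
 define e where "e = sqrt (c / (2 * A + 1))"
 have e: "e > 0" using c A by (simp add: e_def)
 have e2: "A * (2 * e^2) <= c"
 proof -
  have "e^2 = c / (2 * A + 1)" using c A by (simp add: e_def)
  then have "A * (2 * e^2) = c * (2 * A / (2 * A + 1))" by simp
  also have "... <= c * 1" using c A by (intro mult_left_mono) (auto simp: pos_divide_le_eq)
  finally show ?thesis by simp
 qed
 obtain K where K: "K >= 0" "!!u. gagl t u ==> norm (R (l2of (Dq t u))) <= e * norm (l2of (Dq t u)) + K * norm (l2of u)"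
  by (rule Rop_interpolation[OF \<Omega>(1) \<Omega>b s(1,2) e]) (rule that)
 define L where "L = A * (2 * K^2) + Mq + c"
 have L: "L > 0" using A Mq c by (simp add: L_def add_nonneg_pos)
 have cL: "c / L > 0" using c L by simp
 obtain J and g :: "('n => int) => (real ^ 'n, real) l2" where J: "finite J"
  "!!u. gagl t u ==> (!!x. x ~: \<Omega> ==> u x = 0) ==> (norm (l2of u))^2 <= c / L * (norm (l2of (Dq t u)))^2 + (\<Sum>j\<in>J. (l2of u \<bullet> g j)^2)"
 proof (rule fractional_poincare_modulo_finite_rank[OF \<Omega>(1) ts(2) cL])
  fix J :: "('n => int) set" and g :: "('n => int) => (real ^ 'n, real) l2"
  assume "finite J" "!!u. gagl t u ==> (!!x. x ~: \<Omega> ==> u x = 0) ==> (norm (l2of u))^2 <= c / L * (norm (l2of (Dq t u)))^2 + (\<Sum>j\<in>J. (l2of u \<bullet> g j)^2)"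
  then show thesis by (rule that)
 qed
 show ?thesis
 proof (rule that[OF c J(1)])
  fix p assume "p \<in> V"
  then obtain u where u: "gagl t u" "!!x. x ~: \<Omega> ==> u x = 0" "p = sob t u" unfolding energy_space_def by blast
  define U D r S where defs: "U = norm (l2of u)" "D = norm (l2of (Dq t u))" "r = norm (R (l2of (Dq t u)))" "S = (\<Sum>j\<in>J. (l2of u \<bullet> g j)^2)"
  have np: "(norm p)^2 = U^2 + D^2" unfolding u(3) sob_def norm_prod_def defs by simp
  have "r <= e * D + K * U" unfolding defs by (rule K(2)[OF u(1)])
  then have "r^2 <= (e * D + K * U)^2" unfolding defs(3) by (rule power_mono) simp
  also have "... <= 2 * (e * D)^2 + 2 * (K * U)^2"
   using sum_squares_bound[of "e * D" "K * U"] by (simp add: power2_sum)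
  finally have "A * r^2 <= A * (2 * (e * D)^2 + 2 * (K * U)^2)" by (rule mult_left_mono[OF _ A])
  also have "... = (A * (2 * e^2)) * D^2 + (A * (2 * K^2)) * U^2" by (simp add: power_mult_distrib algebra_simps)
  also have "... <= c * D^2 + (A * (2 * K^2)) * U^2" by (intro add_right_mono mult_right_mono e2) simp
  finally have Ar: "A * r^2 <= c * D^2 + (A * (2 * K^2)) * U^2" .
  have B: "opL p \<bullet> p >= - (Mq * U^2) + 4 * c * D^2 - A * r^2"
  proof -
   have 1: "- (Mq * U^2) <= mult_l2 q' (l2of u) \<bullet> l2of u" unfolding defs by (rule mult_l2_form_bound[OF q'(1,2)])
   have "C^2 * - (Mb * r^2) <= C^2 * (mult_l2 b' (R (l2of (Dq t u))) \<bullet> R (l2of (Dq t u)))"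
    unfolding defs by (rule mult_left_mono[OF mult_l2_form_bound[OF b'(1,2)]]) simp
   then have 2: "- (A * r^2) <= C^2 * (mult_l2 b' (R (l2of (Dq t u))) \<bullet> R (l2of (Dq t u)))" by (simp add: A_def)
   have 3: "(l2of (Dq t u) \<bullet> l2of (Dq t u)) / \<sigma> = 4 * c * D^2" unfolding defs c_def power2_norm_eq_inner by simp
   show ?thesis unfolding opL_inner u(3) sob_def fst_conv snd_conv 3 using 1 2 by argo
  qed
  have P: "L * U^2 <= c * D^2 + L * S"
  proof -
   have "U^2 <= c / L * D^2 + S" unfolding defs by (rule J(2)[OF u(1,2)])
   then have "L * U^2 <= L * (c / L * D^2 + S)" by (rule mult_left_mono) (use L in simp)
   then show ?thesis using L by (simp add: distrib_left)
  qed
  have "L * U^2 = (A * (2 * K^2)) * U^2 + Mq * U^2 + c * U^2" unfolding L_def by (simp only: distrib_right)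
  moreover have "c * (U^2 + D^2) = c * U^2 + c * D^2" by (rule distrib_left)
  moreover have "c * D^2 >= 0" using c by simp
  ultimately have "c * (U^2 + D^2) <= opL p \<bullet> p + L * S" using Ar B P by argo
  then show "c * (norm p)^2 <= opL p \<bullet> p + L * (\<Sum>j\<in>J. (fst p \<bullet> g j)^2)"
   unfolding np defs(4) by (simp add: u(3) sob_def)
 qed
qed

lemma opL_solvable:
 fixes l :: "(real ^ 'n) energy_pair => real"
 assumes l: "bounded_linear l"
 obtains p where "p \<in> V" "!!\<psi>. \<psi> \<in> V ==> opL p \<bullet> \<psi> = l \<psi>"
proof -
 obtain c K J and g :: "('n => int) => (real ^ 'n, real) l2"
  where G: "c > 0" "finite J" "!!p. p \<in> V ==> c * (norm p)^2 <= opL p \<bullet> p + K * (\<Sum>j\<in>J. (fst p \<bullet> g j)^2)"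
  by (rule garding) (rule that)
 have ev: "bounded_linear (\<lambda>p. fst p \<bullet> g j)" for j :: "'n => int"
  by (rule bounded_linear_compose[OF bounded_linear_inner_left bounded_linear_fst])
 show ?thesis
  by (rule coercive_modulo_finite_rank_solvable[OF subspace_energy_space closed_energy_space[OF \<Omega>(1) \<Omega>b] opL_bilinear
    opL_sym G(2) ev G(1) G(3) opL_injective l]) (assumption | rule that)+
qed

end

section \<open>Density of solutions\<close>

locale exterior_control = exterior_problem s t \<Omega> b q b' q' Mb Mq C \<sigma>
 for s t :: real and \<Omega> :: "(real ^ 'n) set" and b q b' q' :: "real ^ 'n => real" and Mb Mq C \<sigma> :: real +
 fixes W :: "(real ^ 'n) set"
 assumes W: "open W" "W ~= {}" "W \<subseteq> - closure \<Omega>"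
begin

text \<open>A solution with a representative that agrees with the datum everywhere off \<open>\<Omega>\<close>, and with test functions
enlarged to the energy space.\<close>

definition solves :: "(real ^ 'n => real) => (real ^ 'n => real) => bool" where
 "solves f v \<longleftrightarrow> f \<in> test_functions W & gagl t v & (\<forall>x. x ~: \<Omega> --> v x = f x) & (\<forall>\<psi>\<in>V. opL (sob t v) \<bullet> \<psi> = 0)"

definition solutions :: "((real ^ 'n) energy_pair) set" where
 "solutions = {sob t v | f v. solves f v}"

lemma solves_weak_solution: "solves f v ==> weak_solution s t \<Omega> b q f v"
 unfolding solves_def by (blast intro: weak_solutionI)

lemma exterior_datum_zero: "f \<in> test_functions W ==> x \<in> closure \<Omega> ==> f x = 0"
 using test_function_support[of f W] W(3) by (metis ComplD subsetD)

lemma exterior_datum_zero': "f \<in> test_functions W ==> x \<in> \<Omega> ==> f x = 0"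
 using exterior_datum_zero closure_subset by blast

lemma subspace_solutions: "subspace solutions"
proof (rule subspaceI)
 have "solves (\<lambda>x. 0) (\<lambda>x. 0)"
  unfolding solves_def sob_zero using opL_bounded_linear by (simp add: test_functions_zero gagl_zero linear_simps)
 then show "0 \<in> solutions" unfolding solutions_def using sob_zero[of t] by (metis (mono_tags, lifting) mem_Collect_eq)
next
 interpret L: bounded_linear opL by (rule opL_bounded_linear)
 fix p p' assume "p \<in> solutions" "p' \<in> solutions"
 then obtain f v f' v' where v: "solves f v" "p = sob t v" and v': "solves f' v'" "p' = sob t v'"
  unfolding solutions_def by blast
 note g = v(1)[unfolded solves_def] and g' = v'(1)[unfolded solves_def]
 have e: "sob t (\<lambda>x. v x + v' x) = p + p'" unfolding v v' by (rule sob_add) (use g g' in auto)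
 have "solves (\<lambda>x. f x + f' x) (\<lambda>x. v x + v' x)"
  unfolding solves_def e using g g' unfolding v(2) v'(2) by (simp add: test_functions_add gagl_add L.add inner_add_left)
 then show "p + p' \<in> solutions" unfolding solutions_def e[symmetric] by blast
next
 interpret L: bounded_linear opL by (rule opL_bounded_linear)
 fix r :: real and p assume "p \<in> solutions"
 then obtain f v where v: "solves f v" "p = sob t v" unfolding solutions_def by blast
 note g = v(1)[unfolded solves_def]
 have e: "sob t (\<lambda>x. r * v x) = r *\<^sub>R p" unfolding v by (rule sob_scale) (use g in auto)
 have "solves (\<lambda>x. r * f x) (\<lambda>x. r * v x)"
  unfolding solves_def e using g unfolding v(2) by (simp add: test_functions_scale gagl_scale L.scaleR)
 then show "r *\<^sub>R p \<in> solutions" unfolding solutions_def e[symmetric] by blast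
qed

lemma solution_exists:
 assumes f: "f \<in> test_functions W"
 obtains w where "gagl t w" "sob t w \<in> V" "solves f (\<lambda>x. f x + w x)"
proof -
 interpret L: bounded_linear opL by (rule opL_bounded_linear)
 note fg = test_function_energy[OF f]
 have "bounded_linear (\<lambda>\<psi>. - (opL (sob t f) \<bullet> \<psi>))" by (intro bounded_linear_minus bounded_linear_inner_right)
 then obtain p where p: "p \<in> V" "!!\<psi>. \<psi> \<in> V ==> opL p \<bullet> \<psi> = - (opL (sob t f) \<bullet> \<psi>)" using opL_solvable by blast
 obtain w where w: "gagl t w" "!!x. x ~: \<Omega> ==> w x = 0" "p = sob t w" using p(1) unfolding energy_space_def by blast
 have "solves f (\<lambda>x. f x + w x)"
  unfolding solves_def sob_add[OF fg w(1)] using f gagl_add[OF fg w(1)] w(2) p(2) w(3) by (simp add: L.add inner_add_left)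
 then show ?thesis using that[OF w(1)] p(1) w(3) by simp
qed

text \<open>Runge type argument. Let \<open>p\<close> solve the adjoint problem with right hand side \<open>l\<close>. Testing with the
interior part of a solution and using symmetry shows that \<open>p\<close> has zero energy with every exterior datum.
As the supports are disjoint, a Riesz potential of \<open>p\<close> vanishes on \<open>W\<close>, so \<open>p = 0\<close>.\<close>

lemma functional_vanishes:
 fixes l :: "(real ^ 'n) energy_pair => real"
 assumes l: "bounded_linear l" and lf: "!!f. f \<in> test_functions W ==> l (sob t f) = 0"
  and ls: "!!p. p \<in> solutions ==> l p = 0" and \<psi>: "\<psi> \<in> V"
 shows "l \<psi> = 0"
proof -
 interpret L: bounded_linear opL by (rule opL_bounded_linear)
 interpret l: bounded_linear l by (rule l)
 obtain p where p: "p \<in> V" "!!\<psi>. \<psi> \<in> V ==> opL p \<bullet> \<psi> = l \<psi>" using opL_solvable[OF l] by blast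
 obtain u where u: "gagl t u" "!!x. x ~: \<Omega> ==> u x = 0" "p = sob t u" using p(1) unfolding energy_space_def by blast
 have \<sigma>: "\<sigma> > 0" unfolding \<sigma>_eq by (rule symbol_const_pos[OF ts(2) s(3)])
 have orth: "l2of (Dq t f) \<bullet> l2of (Dq t u) = 0" if f: "f \<in> test_functions W" for f
 proof -
  note fg = test_function_energy[OF f]
  obtain w where w: "gagl t w" "sob t w \<in> V" "solves f (\<lambda>x. f x + w x)" by (rule solution_exists[OF f])
  have e: "sob t (\<lambda>x. f x + w x) = sob t f + sob t w" by (rule sob_add[OF fg w(1)])
  have "l (sob t f + sob t w) = 0" unfolding e[symmetric] by (rule ls) (use w(3) in \<open>unfold solutions_def, blast\<close>)
  then have "l (sob t w) = 0" using lf[OF f] by (simp add: l.add)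
  then have "opL (sob t w) \<bullet> p = 0" using p(2)[OF w(2)] by (simp add: opL_sym)
  moreover have "opL (sob t f + sob t w) \<bullet> p = 0" using w(3) p(1) e unfolding solves_def by simp
  ultimately have *: "opL (sob t f) \<bullet> sob t u = 0" by (simp add: L.add inner_add_left u(3))
  have "R (l2of (Dq t f)) = 0" by (rule Rop_vanishing[OF \<Omega>(1) \<Omega>b ts(1) fg exterior_datum_zero'[OF f]])
  moreover have "mult_l2 q' (l2of f) = 0"
  proof -
   have "(\<lambda>x. q' x * f x) = (\<lambda>x. 0)" using q'(3) exterior_datum_zero'[OF f] by (metis mult_eq_0_iff)
   then show ?thesis by (simp add: mult_l2of[OF q'(1,2) gaglD(3)[OF fg]] l2of_zero)
  qed
  moreover have "mult_l2 b' 0 = 0" by (rule linear_simps(3)[OF bounded_linear_mult_l2[OF b'(1,2)]])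
  ultimately show ?thesis using * \<sigma> unfolding opL_inner by (simp add: sob_def)
 qed
 have "AE x in lebesgue. u x = 0"
 proof (rule riesz_potential_unique_continuation_weak[where K = "closure \<Omega>" and V = W and p = "real DIM(real ^ 'n) + 2 * t"])
  show "compact (closure \<Omega>)" using \<Omega>(1) by (simp add: compact_closure)
  show "W \<inter> closure \<Omega> = {}" using W(3) by blast
  show "u y = 0" if "y ~: closure \<Omega>" for y using u(2) that closure_subset by blast
  fix f assume f: "f \<in> test_functions W"
  have "f x = 0 \<or> u x = 0" for x using exterior_datum_zero'[OF f] u(2) by blast
  from Dq_inner_disjoint[OF test_function_energy[OF f] u(1) this] orth[OF f]
  show "(LBINT x. (LBINT y. u y * norm (x - y) powr (- (real DIM(real ^ 'n) + 2 * t))) * f x) = 0" by simp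
 next
  show "real DIM(real ^ 'n) + 2 * t > real DIM(real ^ 'n)" using ts by simp
 qed (fact W(1) W(2) gaglD(2)[OF u(1)])+
 then have "p = 0" using sob_cong_AE[OF u(1) gagl_zero] by (simp add: u(3) sob_zero)
 then show ?thesis using p(2)[OF \<psi>] by (simp add: L.zero)
qed

lemma solutions_dense:
 fixes T :: "(real ^ 'n) energy_pair => (real ^ 'n, real) l2"
 assumes T: "bounded_linear T" and Tf: "!!f. f \<in> test_functions W ==> T (sob t f) = 0"
  and x: "!!z. (!!\<psi>. \<psi> \<in> V ==> z \<bullet> T \<psi> = 0) ==> z \<bullet> x = 0" and e: "e > 0"
 obtains f v where "solves f v" "norm (x - T (sob t v)) < e"
proof -
 have lT: "linear T" using T by (rule bounded_linear.linear)
 have "x \<in> closure (T ` solutions)"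
 proof (rule hilbert_dense_if_orthogonal_trivial)
  show "subspace (T ` solutions)" by (rule linear_subspace_image[OF lT subspace_solutions])
  fix z assume z: "!!y. y \<in> T ` solutions ==> z \<bullet> y = 0"
  have bl: "bounded_linear (\<lambda>p. z \<bullet> T p)" by (rule bounded_linear_compose[OF bounded_linear_inner_right T])
  show "z \<bullet> x = 0"
  proof (rule x)
   fix \<psi> assume \<psi>: "\<psi> \<in> V"
   show "z \<bullet> T \<psi> = 0"
   proof (rule functional_vanishes[OF bl _ _ \<psi>])
    show "z \<bullet> T (sob t f) = 0" if "f \<in> test_functions W" for f by (simp only: Tf[OF that] inner_zero_right)
    show "z \<bullet> T p = 0" if "p \<in> solutions" for p by (rule z[OF imageI[OF that]])
   qed
  qed
 qed
 then obtain y where "y \<in> T ` solutions" "dist y x < e" using e unfolding closure_approachable by blast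
 then show ?thesis using that unfolding solutions_def by (auto simp: dist_norm norm_minus_commute)
qed

lemma solutions_dense_in_domain:
 assumes F: "F \<in> L2 \<Omega>" and e: "e > 0"
 obtains f v where "solves f v" "L2_norm \<Omega> (\<lambda>x. F x - restrict v \<Omega> x) < e"
proof -
 let ?i = "\<lambda>x. indicator \<Omega> x :: real"
 have im: "?i \<in> Borel" "!!x. \<bar>?i x\<bar> <= 1" using \<Omega>b by (auto intro: borel_measurable_indicator simp: indicator_def)
 define T where "T p = mult_l2 ?i (fst p)" for p :: "(real ^ 'n) energy_pair"
 have T: "bounded_linear T"
  unfolding T_def[abs_def] by (rule bounded_linear_compose[OF bounded_linear_mult_l2[OF im] bounded_linear_fst])
 have Tu: "T (sob t u) = l2of (\<lambda>x. ?i x * u x)" if "u \<in> L2 UNIV" for u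
  unfolding T_def sob_def fst_conv by (rule mult_l2of[OF im that])
 have FL: "(\<lambda>x. ?i x * F x) \<in> L2 UNIV" by (rule iffD1[OF L2_indicator_iff F])
 obtain f v where v: "solves f v" "norm (l2of (\<lambda>x. ?i x * F x) - T (sob t v)) < e"
 proof (rule solutions_dense[OF T _ _ e])
  fix f assume f: "f \<in> test_functions W"
  have "(\<lambda>x. ?i x * f x) = (\<lambda>x. 0)" using exterior_datum_zero'[OF f] by (auto simp: indicator_def)
  then show "T (sob t f) = 0" using Tu[OF test_function_L2(2)[OF f]] by (simp add: l2of_zero)
 next
  fix z assume z: "!!\<psi>. \<psi> \<in> V ==> z \<bullet> T \<psi> = 0"
  have "AE x in lebesgue. x \<in> \<Omega> --> l2fun z x = 0"
  proof (rule L2_orthogonal_test_functions[OF \<Omega>(2) l2fun_L2])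
   fix \<psi> assume p: "\<psi> \<in> test_functions \<Omega>"
   have "\<psi> x = 0" if "x ~: \<Omega>" for x using test_function_support[OF p] that by (metis subsetD)
   then have "(\<lambda>x. ?i x * \<psi> x) = \<psi>" by (auto simp: indicator_def fun_eq_iff)
   then have "z \<bullet> l2of \<psi> = 0" using z[OF test_function_in_V[OF p order_refl]] Tu[OF test_function_L2(2)[OF p]] by simp
   then show "(LINT x|lebesgue. l2fun z x * \<psi> x) = 0" using inner_l2of[OF l2fun_L2[of z] test_function_L2(2)[OF p]] by simp
  qed
  then have "AE x in lebesgue. l2fun z x * (?i x * F x) = 0" by eventually_elim (simp add: indicator_def)
  then have "(LINT x|lebesgue. l2fun z x * (?i x * F x)) = 0" by (rule integral_eq_zero_AE)
  then show "z \<bullet> l2of (\<lambda>x. ?i x * F x) = 0" using inner_l2of[OF l2fun_L2[of z] FL] by simp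
 qed (rule that)
 have vL: "v \<in> L2 UNIV" using v(1) gaglD(3) unfolding solves_def by blast
 have dL: "(\<lambda>x. ?i x * F x - ?i x * v x) \<in> L2 UNIV" by (rule L2_diff[OF FL mult_L2[OF im vL]])
 have eq: "(\<lambda>x. ?i x * F x - ?i x * v x) = (\<lambda>x. ?i x * (F x - restrict v \<Omega> x))" by (auto simp: indicator_def)
 have dO: "(\<lambda>x. F x - restrict v \<Omega> x) \<in> L2 \<Omega>" by (rule iffD2[OF L2_indicator_iff dL[unfolded eq]])
 show ?thesis
 proof (rule that[OF v(1)])
  show "L2_norm \<Omega> (\<lambda>x. F x - restrict v \<Omega> x) < e"
   using v(2) unfolding L2_norm_indicator[OF dO] Tu[OF vL] l2of_diff[OF FL mult_L2[OF im vL], symmetric] eq .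
 qed
qed

text \<open>Orthogonality to the regional Laplacians of functions supported in \<open>\<Omega> - closure A\<close> makes a Riesz
potential of \<open>G\<close> vanish there, which is the situation of the unique continuation lemma.\<close>

lemma regional_solutions_dense:
 assumes A: "open A" "compact (closure A)" "closure A \<subseteq> \<Omega>" and ne: "\<Omega> - closure A ~= {}"
  and F: "F \<in> L2 A" and e: "e > 0"
 obtains f v where "solves f v" "restrict (regional_frac_laplacian (s / 2) \<Omega> v) A \<in> L2 A"
  "L2_norm A (\<lambda>x. F x - restrict (regional_frac_laplacian (s / 2) \<Omega> v) A x) < e"
proof -
 let ?i = "\<lambda>x. indicator A x :: real"
 have Ab: "A \<in> sets borel" and AO: "A \<subseteq> \<Omega>" and Abd: "bounded A" using A closure_subset bounded_subset[OF \<Omega>(1)] by auto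
 have im: "?i \<in> Borel" "!!x. \<bar>?i x\<bar> <= 1" using Ab by (auto intro: borel_measurable_indicator simp: indicator_def)
 have a2: "0 < s / 2" "s / 2 < 1 / 2" "s / 2 < 1" using s by auto
 have C: "C ~= 0" using frac_const_eq[OF a2(1,2), where 'n = 'n] symbol_const_pos[OF a2(1,3), where 'n = 'n] by (simp add: C_eq)
 define T where "T p = C *\<^sub>R mult_l2 ?i (R (snd p))" for p :: "(real ^ 'n) energy_pair"
 have T: "bounded_linear T"
  unfolding T_def[abs_def]
  by (intro bounded_linear_compose[OF bounded_linear_scaleR_right] bounded_linear_compose[OF bounded_linear_mult_l2[OF im]]
    bounded_linear_compose[OF Rop(1)[OF \<Omega>(1) \<Omega>b ts(1)]] bounded_linear_snd)
 have FL: "(\<lambda>x. ?i x * F x) \<in> L2 UNIV" by (rule iffD1[OF L2_indicator_iff F])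
 obtain f v where v: "solves f v" "norm (l2of (\<lambda>x. ?i x * F x) - T (sob t v)) < e"
 proof (rule solutions_dense[OF T _ _ e])
  fix f assume f: "f \<in> test_functions W"
  have "R (l2of (Dq t f)) = 0" by (rule Rop_vanishing[OF \<Omega>(1) \<Omega>b ts(1) test_function_energy[OF f] exterior_datum_zero'[OF f]])
  then show "T (sob t f) = 0" using linear_simps(3)[OF bounded_linear_mult_l2[OF im]] by (simp add: T_def sob_def)
 next
  fix z assume z: "!!\<psi>. \<psi> \<in> V ==> z \<bullet> T \<psi> = 0"
  define G where "G x = ?i x * l2fun z x" for x
  have Gm: "G \<in> Borel" unfolding G_def[abs_def] using im(1) by measurable
  have GL: "G \<in> L2 UNIV" unfolding G_def[abs_def] by (rule mult_L2[OF im l2fun_L2])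
  have G0: "G x = 0" if "x ~: A" for x using that by (simp add: G_def)
  have Gz: "mult_l2 ?i z = l2of G" unfolding G_def[abs_def] mult_l2_def ..
  have "AE x in lebesgue. G x = 0"
  proof (rule riesz_potential_unique_continuation_weak[where K = "closure A" and V = "\<Omega> - closure A" and p = "real DIM(real ^ 'n) + s"])
   show "open (\<Omega> - closure A)" using \<Omega>(2) by auto
   show "integrable lborel G" by (rule integrable_bounded_support[OF Gm GL Abd Ab G0])
   show "G y = 0" if "y ~: closure A" for y using G0 that closure_subset by blast
   fix \<psi> assume p: "\<psi> \<in> test_functions (\<Omega> - closure A)"
   have sup: "\<psi> x = 0" if "x ~: \<Omega> - closure A" for x using test_function_support[OF p] that by (metis subsetD)
   have "z \<bullet> T (sob t \<psi>) = 0" by (rule z[OF test_function_in_V[OF p]]) blast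
   then have "mult_l2 ?i (R (l2of (Dq t \<psi>))) \<bullet> z = 0" using C by (simp add: T_def sob_def inner_commute)
   then have "R (l2of (Dq t \<psi>)) \<bullet> l2of G = 0"
    unfolding mult_l2_sym[OF im, of "R (l2of (Dq t \<psi>))"] Gz by (simp add: inner_commute)
   then have "l2of (Dq t \<psi>) \<bullet> Sop \<Omega> (t - s) (l2of G) = 0" unfolding Rop(2)[OF \<Omega>(1) \<Omega>b ts(1)] .
   moreover have "\<psi> x = 0 \<or> G x = 0" for x using sup[of x] G0[of x] closure_subset by blast
   ultimately show "(LBINT x. (LBINT y. G y * norm (x - y) powr (- (real DIM(real ^ 'n) + s))) * \<psi> x) = 0"
    using Dq_inner_Sop_disjoint[OF \<Omega>(1) \<Omega>b s(1,2) test_function_energy[OF p] Gm GL] sup G0 AO by auto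
  next
   show "real DIM(real ^ 'n) + s > real DIM(real ^ 'n)" using s by simp
   show "(\<Omega> - closure A) \<inter> closure A = {}" by blast
  qed (fact A(2) ne)+
  then have "AE x in lebesgue. l2fun z x * (?i x * F x) = 0" by eventually_elim (auto simp: G_def)
  then have "(LINT x|lebesgue. l2fun z x * (?i x * F x)) = 0" by (rule integral_eq_zero_AE)
  then show "z \<bullet> l2of (\<lambda>x. ?i x * F x) = 0" using inner_l2of[OF l2fun_L2[of z] FL] by simp
 qed (rule that)
 let ?w = "regional_frac_laplacian (s / 2) \<Omega> v"
 have vg: "gagl t v" using v(1) unfolding solves_def by blast
 note w = regional_eq[OF vg]
 have rA: "restrict ?w A \<in> L2 A" by (rule L2_restrict[OF Ab AO w(1)])
 note rL = iffD1[OF L2_indicator_iff rA]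
 have Tv: "T (sob t v) = l2of (\<lambda>x. ?i x * restrict ?w A x)"
 proof -
  let ?r = "l2fun (R (l2of (Dq t v)))"
  have rr: "(\<lambda>x. ?i x * ?r x) \<in> L2 UNIV" by (rule mult_L2[OF im l2fun_L2])
  have "AE x in lebesgue. C * (?i x * ?r x) = ?i x * restrict ?w A x"
   using w(2) by eventually_elim (use AO in \<open>auto simp: indicator_def\<close>)
  then have "l2of (\<lambda>x. C * (?i x * ?r x)) = l2of (\<lambda>x. ?i x * restrict ?w A x)"
   using l2of_eq_iff[OF L2_scale[OF rr] rL] by blast
  then show ?thesis unfolding T_def sob_def snd_conv mult_l2_def l2of_scale[OF rr, symmetric] .
 qed
 have dL: "(\<lambda>x. ?i x * F x - ?i x * restrict ?w A x) \<in> L2 UNIV" by (rule L2_diff[OF FL rL])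
 have eq: "(\<lambda>x. ?i x * F x - ?i x * restrict ?w A x) = (\<lambda>x. ?i x * (F x - restrict ?w A x))" by (simp add: right_diff_distrib)
 have dA: "(\<lambda>x. F x - restrict ?w A x) \<in> L2 A" by (rule iffD2[OF L2_indicator_iff dL[unfolded eq]])
 show ?thesis
 proof (rule that[OF v(1) rA])
  show "L2_norm A (\<lambda>x. F x - restrict ?w A x) < e"
   using v(2) unfolding L2_norm_indicator[OF dA] Tv l2of_diff[OF FL rL, symmetric] eq .
 qed
qed

end

theorem lemma3p6:
  fixes s t :: real
    and \<Omega> \<O> W :: "(real ^ 'n) set"
    and b q :: "real ^ 'n \<Rightarrow> real"
    and X Y :: "(real ^ 'n \<Rightarrow> real) set"
  assumes "0 < s" and "s < t" and "t < 1"
    and "bounded_lipschitz_domain \<Omega>"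
    and "b \<in> Linfty \<Omega>" and "q \<in> Linfty \<Omega>"
    and "eigenvalue_condition s t \<Omega> b q"
    and "open \<O>" and "\<O> \<noteq> {}" and "lipschitz_boundary \<O>"
    and "compact (closure \<O>)" and "closure \<O> \<subseteq> \<Omega>"
    and "open W" and "W \<noteq> {}" and "bounded W" and "W \<subseteq> - closure \<Omega>"
  defines "X \<equiv> {restrict (regional_frac_laplacian (s / 2) \<Omega> v) \<O> | f v.
                  f \<in> test_functions W \<and> weak_solution s t \<Omega> b q f v}"
    and "Y \<equiv> {restrict v \<Omega> | f v. f \<in> test_functions W \<and> weak_solution s t \<Omega> b q f v}"
  shows "(\<forall>F \<in> L2 \<O>. \<forall>\<epsilon>>0. \<exists>u\<in>X. u \<in> L2 \<O> \<and> L2_norm \<O> (\<lambda>x. F x - u x) < \<epsilon>)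
       \<and> L2_dense \<Omega> Y"
proof -
 have dom: "open \<Omega>" "\<Omega> ~= {}" "bounded \<Omega>" using assms(4) by (auto simp: bounded_lipschitz_domain_def)
 have \<Omega>b: "\<Omega> \<in> sets borel" using dom(1) by simp
 obtain b' Mb where b': "b' \<in> borel_measurable borel" "!!x. \<bar>b' x\<bar> <= Mb" "!!x. x ~: \<Omega> ==> b' x = 0"
  "AE x in lebesgue. x \<in> \<Omega> --> b x = b' x" using Linfty_bounded_borel[OF assms(5) \<Omega>b] by blast
 obtain q' Mq where q': "q' \<in> borel_measurable borel" "!!x. \<bar>q' x\<bar> <= Mq" "!!x. x ~: \<Omega> ==> q' x = 0"
  "AE x in lebesgue. x \<in> \<Omega> --> q x = q' x" using Linfty_bounded_borel[OF assms(6) \<Omega>b] by blast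
 interpret exterior_control s t \<Omega> b q b' q' Mb Mq
   "frac_const TYPE(real ^ 'n) (s / 2)" "symbol_const TYPE('n) t" W
  by unfold_locales (fact assms dom b' q' refl)+
 have X: "restrict (regional_frac_laplacian (s / 2) \<Omega> v) \<O> \<in> X" and Y: "restrict v \<Omega> \<in> Y" if "solves f v" for f v
  using solves_weak_solution[OF that] that unfolding X_def Y_def solves_def by blast+
 \<comment> \<open>a bounded nonempty open set is not closed, by connectedness of the whole space\<close>
 have ne: "\<Omega> - closure \<O> ~= {}"
 proof
  assume "\<Omega> - closure \<O> = {}"
  then have "\<Omega> = closure \<O>" using assms(12) by blast
  then have "closed \<Omega>" by simp
  then have "\<Omega> = UNIV" using clopen[of \<Omega>] dom by blast
  then show False using dom(3) not_bounded_UNIV by blast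
 qed
 show ?thesis
 proof (rule conjI)
  show "\<forall>F \<in> L2 \<O>. \<forall>\<epsilon>>0. \<exists>u\<in>X. u \<in> L2 \<O> & L2_norm \<O> (\<lambda>x. F x - u x) < \<epsilon>"
  proof (intro ballI allI impI)
   fix F :: "real ^ 'n => real" and \<epsilon> :: real assume F: "F \<in> L2 \<O>" and e: "\<epsilon> > 0"
   obtain f v where "solves f v" "restrict (regional_frac_laplacian (s / 2) \<Omega> v) \<O> \<in> L2 \<O>"
    "L2_norm \<O> (\<lambda>x. F x - restrict (regional_frac_laplacian (s / 2) \<Omega> v) \<O> x) < \<epsilon>"
    by (rule regional_solutions_dense[OF assms(8,11,12) ne F e])
   then show "\<exists>u\<in>X. u \<in> L2 \<O> & L2_norm \<O> (\<lambda>x. F x - u x) < \<epsilon>" using X by blast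
  qed
  show "L2_dense \<Omega> Y"
   unfolding L2_dense_def
  proof (intro conjI ballI allI impI subsetI)
   fix y assume "y \<in> Y"
   then obtain f v where y: "y = restrict v \<Omega>" and v: "v \<in> sobolev t" unfolding Y_def weak_solution_def by blast
   have "(\<lambda>x. indicator \<Omega> x * v x) \<in> L2 UNIV" by (rule L2_UNIV_restrict[OF sobolev_L2[OF v] \<Omega>b])
   also have "(\<lambda>x. indicator \<Omega> x * v x) = (\<lambda>x. indicator \<Omega> x * y x)" unfolding y by (auto simp: indicator_def)
   finally show "y \<in> L2 \<Omega>" by (rule iffD2[OF L2_indicator_iff])
  next
   fix F :: "real ^ 'n => real" and \<epsilon> :: real assume F: "F \<in> L2 \<Omega>" and e: "\<epsilon> > 0"
   obtain f v where "solves f v" "L2_norm \<Omega> (\<lambda>x. F x - restrict v \<Omega> x) < \<epsilon>"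
    by (rule solutions_dense_in_domain[OF F e])
   then show "\<exists>u\<in>Y. L2_norm \<Omega> (\<lambda>x. F x - u x) < \<epsilon>" using Y by blast
  qed
 qed
qed

end
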